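(* Assume there are $0<\delta\le1$, $\rho>\max\{(\delta^2+4\delta)/(2+2\delta),\,1\}$ and a constant $C$ such that $\mathbb{E}(|Y_1|^{4+2\delta})<\infty$ and $\alpha_Y(k)\le Ck^{-\rho(2+\delta)(1+\delta)/\delta^2}$ for all $k\in\mathbb{N}$. For $\ell_n=n^s$ and $\tilde\ell_n=n^q$, let $$s>\max\left\{\frac1{1+\delta\frac{\rho-1}{\rho+1}},\ \frac{1+\frac{\delta^2}{\rho(2+\delta)(1+\delta)}}{2+\frac{\delta^2}{\rho(2+\delta)(1+\delta)}}\right\},\qquad s>q,\qquad q>(1-s)\cdot\max\left\{\delta^{-1}\frac{\rho+1}{\rho-1},\ 1+\frac{\delta^2}{\rho(1+\delta)(2+\delta)}\right\}.$$ Then, under the hypothesis that $\mu$ is constant (there is $\mu_H\in\mathbb{R}$ with $\mu(x)=\mu_H$ for almost all $x\in[0,1]$), as $n\to\infty$, $$\sqrt{b_n}\,\frac1{\hat\psi_n}\left(\frac{\sqrt{\ell_n}}{\hat\kappa(n)}U(n)-\frac1{b_n(b_n-1)}\sum_{1\le j\ne k\le b_n}\sqrt{\hat\sigma_{j,n}^2+\hat\sigma_{k,n}^2}\,\sqrt{\frac2\pi}\right)\xrightarrow{\ \mathcal{D}\ }\mathcal{N}(0,1).$$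
   Context: $(Y_i)_{i\in\mathbb{N}}$ is a strictly stationary real-valued process with $\mathbb{E}(Y_1)=0$, $\mathrm{Var}(Y_1)=1$. For $\sigma$-fields $\mathcal{A},\mathcal{B}$ let $\alpha(\mathcal{A},\mathcal{B})=\sup\{|\mathbb{P}(A)\mathbb{P}(B)-\mathbb{P}(A\cap B)|:A\in\mathcal{A},B\in\mathcal{B}\}$ and $\alpha_Y(k)=\sup_{m\in\mathbb{N}}\alpha(\sigma(Y_1,\dots,Y_m),\sigma(Y_{k+m},Y_{k+m+1},\dots))$; $(Y_i)$ is $\alpha$-mixing, i.e. $\alpha_Y(k)\to0$. The long run variance $\kappa_Y^2=\mathrm{Var}(Y_1)+2\sum_{k=1}^\infty\mathrm{Cov}(Y_1,Y_{k+1})$ (finite under the moment and mixing assumptions made) satisfies $\kappa_Y^2>0$. Observations: $X_i=X_{i,n}=\mu(i/n)+\sigma(i/n)Y_i$, $i=1,\dots,n$, where $\mu:[0,1]\to\mathbb{R}$ is càdlàg and $\sigma:[0,1]\to(0,\infty)$ is càdlàg and piecewise Lipschitz-continuous (the sum of a Lipschitz-continuous function and a piecewise constant function with a fixed finite number of jumps), with $\sigma(x)\ge\sigma_0$ for all $x\in[0,1]$ and some $\sigma_0>0$. Blocks: $\ell_n=n^s$, $b_n=n^{1-s}$ with $s\in(0.5,1)$, both assumed to be integers; local means $\hat\mu_j=\frac1{\ell_n}\sum_{i=(j-1)\ell_n+1}^{j\ell_n}X_i$, local variances $\hat\sigma_{j,n}^2=\frac1{\ell_n}\sum_{i=(j-1)\ell_n+1}^{j\ell_n}(X_i-\hat\mu_j)^2$,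 $1\le j\le b_n$, and $U(n)=\frac1{b_n(b_n-1)}\sum_{1\le j\ne k\le b_n}|\hat\mu_j-\hat\mu_k|$. Long run variance estimator: let $\tilde\ell_n=n^q$, $\tilde b_n=n^{1-q}$ with $q\in(0,1)$, both assumed to be integers, let $c_0\in[1,\tilde b_n)$ be a fixed constant and $$\hat\kappa_{\tilde X}(n)=\sqrt{\tfrac{2c_0}{1+2c_0}}\,\frac1{\tilde b_n}\sqrt{\tfrac\pi2}\sum_{j=1}^{\tilde b_n}\frac1{\sqrt{\tilde\ell_n}}\left|\sum_{i=(j-1)\tilde\ell_n+1}^{j\tilde\ell_n}X_i-\frac1{2c_0}\left(\sum_{i=(j-1-c_0)\tilde\ell_n+1}^{(j-1)\tilde\ell_n}X_i+\sum_{i=j\tilde\ell_n+1}^{(j+c_0)\tilde\ell_n}X_i\right)\right|,$$ where $X_i:=0$ for $i\notin\{1,\dots,n\}$ and in the affected (boundary) blocks the weight $\frac1{2c_0}$ is adjusted accordingly (replaced by $\tilde\ell_n$ divided by the number of indices $i\in\{1,\dots,n\}$ in the two surrounding sums); $\hat\kappa(n)=\hat\kappa_{\tilde X}(n)\big/\big(\frac1{b_n}\sum_{j=1}^{b_n}\hat\sigma_{j,n}\big)$. Limit variance estimator: for independent standard normal $Z,Z'$ define $f_n:\mathbb{R}_{\ge0}^{b_n}\to\mathbb{R}_{\ge0}$ by $$f_n(x_1,\dots,x_{b_n})=\frac1{b_n}\sum_{j=1}^{b_n}\mathbb{E}\left(\left|\frac1{b_n-1}\sum_{1\le k\le b_n,\,k\ne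 j}\Big(\mathbb{E}\big(|x_jZ-x_kZ'|\,\big|\,Z\big)-\mathbb{E}\big(|x_jZ-x_kZ'|\big)\Big)\right|^2\right)$$ and $\hat\psi_n\ge0$ by $\hat\psi_n^2=4f_n(\hat\sigma_{1,n},\dots,\hat\sigma_{b_n,n})$ (the deterministic function $f_n$ evaluated at the random point). *)

theory Defs
  imports "HOL-Probability.Probability"
begin

section \<open>Stationary and mixing processes\<close>

text \<open>Processes are indexed by the positive integers; the value at index 0 is never used.\<close>

definition strictly_stationary :: "'a measure \<Rightarrow> (nat \<Rightarrow> 'a \<Rightarrow> real) \<Rightarrow> bool" where
  "strictly_stationary M Y \<longleftrightarrow>
     (\<forall>J h. finite J \<and> J \<subseteq> {1..} \<longrightarrow>
        distr M (Pi\<^sub>M J (\<lambda>_. borel)) (\<lambda>\<omega>. \<lambda>i\<in>J. Y (i + h) \<omega>) =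
        distr M (Pi\<^sub>M J (\<lambda>_. borel)) (\<lambda>\<omega>. \<lambda>i\<in>J. Y i \<omega>))"

definition sigma_gen :: "'a measure \<Rightarrow> (nat \<Rightarrow> 'a \<Rightarrow> real) \<Rightarrow> nat set \<Rightarrow> 'a set set" where
  "sigma_gen M Y I =
     sigma_sets (space M) (\<Union>i\<in>I. {Y i -` B \<inter> space M | B. B \<in> sets borel})"

definition alpha_coeff :: "'a measure \<Rightarrow> 'a set set \<Rightarrow> 'a set set \<Rightarrow> real" where
  "alpha_coeff M \<A> \<B> =
     Sup {\<bar>measure M A * measure M B - measure M (A \<inter> B)\<bar> | A B. A \<in> \<A> \<and> B \<in> \<B>}"

definition alpha_mix :: "'a measure \<Rightarrow> (nat \<Rightarrow> 'a \<Rightarrow> real) \<Rightarrow> nat \<Rightarrow> real" where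
  "alpha_mix M Y k =
     (SUP m\<in>{1..}. alpha_coeff M (sigma_gen M Y {1..m}) (sigma_gen M Y {k + m..}))"

definition covariance :: "'a measure \<Rightarrow> ('a \<Rightarrow> real) \<Rightarrow> ('a \<Rightarrow> real) \<Rightarrow> real" where
  "covariance M X X' =
     (LINT \<omega>|M. (X \<omega> - integral\<^sup>L M X) * (X' \<omega> - integral\<^sup>L M X'))"

text \<open>The series index is shifted by one: the summand for \<open>k\<close> is the covariance at lag \<open>k + 1\<close>.\<close>

definition long_run_variance :: "'a measure \<Rightarrow> (nat \<Rightarrow> 'a \<Rightarrow> real) \<Rightarrow> real" where
  "long_run_variance M Y =
     prob_space.variance M (Y 1) + 2 * (\<Sum>k. covariance M (Y 1) (Y (Suc k + 1)))"

section \<open>Regularity of the mean and scale functions\<close>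

definition cadlag_unit :: "(real \<Rightarrow> real) \<Rightarrow> bool" where
  "cadlag_unit f \<longleftrightarrow>
     (\<forall>x\<in>{0..<1}. (f \<longlongrightarrow> f x) (at_right x)) \<and>
     (\<forall>x\<in>{0<..1}. \<exists>l. (f \<longlongrightarrow> l) (at_left x))"

text \<open>The finite set \<open>D\<close> contains the jump locations; the values of \<open>f\<close> on \<open>D\<close> are arbitrary.\<close>

definition piecewise_constant_unit :: "(real \<Rightarrow> real) \<Rightarrow> bool" where
  "piecewise_constant_unit f \<longleftrightarrow>
     (\<exists>D. finite D \<and>
        (\<forall>x\<in>{0..1}. \<forall>y\<in>{0..1}. x \<le> y \<and> {x..y} \<inter> D = {} \<longrightarrow> f x = f y))"

definition piecewise_lipschitz_unit :: "(real \<Rightarrow> real) \<Rightarrow> bool" where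
  "piecewise_lipschitz_unit f \<longleftrightarrow>
     (\<exists>g h L. L-lipschitz_on {0..1} g \<and> piecewise_constant_unit h \<and>
        (\<forall>x\<in>{0..1}. f x = g x + h x))"

section \<open>Observations and block statistics\<close>

text \<open>
  A sample is a function on the integers that vanishes outside \<open>{1..n}\<close>, so that sums over blocks
  reaching beyond the observation window need no truncation.
\<close>

definition observation ::
  "(real \<Rightarrow> real) \<Rightarrow> (real \<Rightarrow> real) \<Rightarrow> (nat \<Rightarrow> 'a \<Rightarrow> real) \<Rightarrow> nat \<Rightarrow> 'a \<Rightarrow> int \<Rightarrow> real" where
  "observation \<mu> \<sigma> Y n \<omega> i =
     (if 1 \<le> i \<and> i \<le> int n
      then \<mu> (real_of_int i / real n) + \<sigma> (real_of_int i / real n) * Y (nat i) \<omega>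
      else 0)"

definition block :: "nat \<Rightarrow> nat \<Rightarrow> int set" where
  "block l j = {(int j - 1) * int l + 1 .. int j * int l}"

definition local_mean :: "nat \<Rightarrow> (int \<Rightarrow> real) \<Rightarrow> nat \<Rightarrow> real" where
  "local_mean l x j = (1 / real l) * (\<Sum>i\<in>block l j. x i)"

definition local_variance :: "nat \<Rightarrow> (int \<Rightarrow> real) \<Rightarrow> nat \<Rightarrow> real" where
  "local_variance l x j = (1 / real l) * (\<Sum>i\<in>block l j. (x i - local_mean l x j)\<^sup>2)"

definition local_sd :: "nat \<Rightarrow> (int \<Rightarrow> real) \<Rightarrow> nat \<Rightarrow> real" where
  "local_sd l x j = sqrt (local_variance l x j)"

definition U_stat :: "nat \<Rightarrow> nat \<Rightarrow> (int \<Rightarrow> real) \<Rightarrow> real" where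
  "U_stat b l x =
     1 / (real b * (real b - 1)) *
     (\<Sum>j\<in>{1..b}. \<Sum>k\<in>{1..b} - {j}. \<bar>local_mean l x j - local_mean l x k\<bar>)"

section \<open>Long run variance estimator\<close>

definition left_blocks :: "nat \<Rightarrow> nat \<Rightarrow> nat \<Rightarrow> int set" where
  "left_blocks c l j = {(int j - 1 - int c) * int l + 1 .. (int j - 1) * int l}"

definition right_blocks :: "nat \<Rightarrow> nat \<Rightarrow> nat \<Rightarrow> int set" where
  "right_blocks c l j = {int j * int l + 1 .. (int j + int c) * int l}"

definition neighbour_weight :: "nat \<Rightarrow> nat \<Rightarrow> nat \<Rightarrow> nat \<Rightarrow> real" where
  "neighbour_weight n c l j =
     (if left_blocks c l j \<union> right_blocks c l j \<subseteq> {1..int n}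
      then 1 / (2 * real c)
      else real l / real (card ((left_blocks c l j \<union> right_blocks c l j) \<inter> {1..int n})))"

definition kappa_raw :: "nat \<Rightarrow> nat \<Rightarrow> nat \<Rightarrow> nat \<Rightarrow> (int \<Rightarrow> real) \<Rightarrow> real" where
  "kappa_raw n c b l x =
     sqrt (2 * real c / (1 + 2 * real c)) * (1 / real b) * sqrt (pi / 2) *
     (\<Sum>j\<in>{1..b}. 1 / sqrt (real l) *
        \<bar>(\<Sum>i\<in>block l j. x i) -
         neighbour_weight n c l j *
           ((\<Sum>i\<in>left_blocks c l j. x i) + (\<Sum>i\<in>right_blocks c l j. x i))\<bar>)"

text \<open>
  Here \<open>b\<close>, \<open>l\<close> are the number and length of the blocks used for the local variances and
  \<open>b'\<close>, \<open>l'\<close> those used for the long run variance.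
\<close>

definition kappa_hat ::
  "nat \<Rightarrow> nat \<Rightarrow> nat \<Rightarrow> nat \<Rightarrow> nat \<Rightarrow> nat \<Rightarrow> (int \<Rightarrow> real) \<Rightarrow> real" where
  "kappa_hat n c b l b' l' x =
     kappa_raw n c b' l' x / ((1 / real b) * (\<Sum>j\<in>{1..b}. local_sd l x j))"

section \<open>Limit variance estimator\<close>

text \<open>
  Two independent standard normal variables \<open>Z\<close>, \<open>Z'\<close> are realised as the coordinate projections on
  the product space; conditioning on \<open>Z\<close> is conditioning on the \<open>\<sigma>\<close>-algebra generated by \<open>fst\<close>.
\<close>

definition normal_pair :: "(real \<times> real) measure" where
  "normal_pair = std_normal_distribution \<Otimes>\<^sub>M std_normal_distribution"

definition sigma_Z :: "(real \<times> real) measure" where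
  "sigma_Z = vimage_algebra (space normal_pair) fst borel"

definition abs_diff :: "real \<Rightarrow> real \<Rightarrow> real \<times> real \<Rightarrow> real" where
  "abs_diff u v = (\<lambda>(z, z'). \<bar>u * z - v * z'\<bar>)"

definition f_var :: "nat \<Rightarrow> (nat \<Rightarrow> real) \<Rightarrow> real" where
  "f_var b x =
     1 / real b *
     (\<Sum>j\<in>{1..b}. LINT \<zeta>|normal_pair.
        \<bar>1 / (real b - 1) *
          (\<Sum>k\<in>{1..b} - {j}.
             real_cond_exp normal_pair sigma_Z (abs_diff (x j) (x k)) \<zeta> -
             integral\<^sup>L normal_pair (abs_diff (x j) (x k)))\<bar>\<^sup>2)"

definition psi_hat :: "nat \<Rightarrow> nat \<Rightarrow> (int \<Rightarrow> real) \<Rightarrow> real" where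
  "psi_hat b l x = sqrt (4 * f_var b (local_sd l x))"

end

theory Submission
 imports Defs "HOL-Real_Asymp.Real_Asymp"
begin

text \<open>Stein's method (the characteristic function of a weighted block sum nearly solves
\<open>\<phi>' u = - v u \<phi> u\<close>) gives normal approximation with a rate, which
\<open>|x| = 2 / \<pi> \<integral> (1 - cos (u x)) / u^2 du\<close> turns into rates for first absolute moments.
As \<open>|x - y|\<close> is of negative type, the Hoeffding remainder of \<open>U\<close> has a sign, so its L1 norm is
its mean, which these rates bound. The projection is a sum over blocks, decoupled by removing gaps between
them, and the estimators of \<open>\<kappa>\<close> and \<open>\<psi>\<close> are replaced by their limits at a cost \<open>o (1 / sqrt b)\<close>.\<close>

text \<open>Every centring and scaling error is multiplied by \<open>sqrt b\<close> with b =
  n^(1-s), so block moments are needed up to o(1 / sqrt b), not just in the limit. Dependence is cut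
  at distance l^\<beta>, which costs l^(2 \<beta> - 1/2) in the characteristic function and one more
  logarithm in the absolute moment. The main proof takes 1 - 4 \<beta> = \<delta> (\<rho> - 1) /
  (\<rho> + 1); then \<open>sqrt b\<close> times this rate vanishes exactly when 1 - s < s (1 - 4
  \<beta>), which is the first lower bound on \<open>s\<close>, and with \<open>q\<close> in place
  of the second s it is the first lower bound on \<open>q\<close>.

  The mixing exponent is written lam * p with p = 4 + 2 \<delta>: clipping at height k^lam balances
  what is lost in the tails against what mixing gives for bounded variables.

  Two features shape the setting. The scale function may jump, so neighbouring weights are compared
  through total variation, and jumps cost O(1/b) on average over blocks. The mean is known only
  almost everywhere; right continuity fixes it on [0,1) but not at 1, so the last observation
  carries a spike \<open>e\<close> through all estimates.\<close>

lemmas int_bound = Bochner_Integration.integrable_bound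
lemmas int_sum = Bochner_Integration.integrable_sum
lemmas int_diff = Bochner_Integration.integrable_diff
lemmas int_add = Bochner_Integration.integrable_add
lemmas LINT_sum = Bochner_Integration.integral_sum
lemmas LINT_diff = Bochner_Integration.integral_diff
lemmas LINT_cong = Bochner_Integration.integral_cong
abbreviation "cpx \<equiv> complex_of_real"
notation LIMSEQ (infixr "---->" 60)

section \<open>Covariance inequalities under strong mixing\<close>

definition separated :: "nat => nat set => nat set => bool" where
 "separated k I J \<longleftrightarrow> k >= 1 \<and> I \<subseteq> {1..} \<and> J \<subseteq> {1..} \<and> (\<forall>i\<in>I. \<forall>j\<in>J. i + k <= j)"

text \<open>Only the \<sigma>-algebra matters. Packaging \<open>sigma_gen\<close> as a measure makes
  \<open>borel_measurable (gen_measure M Y I)\<close> the statement that a variable depends on the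
  indices in \<open>I\<close> only.\<close>

definition gen_measure :: "'a measure => (nat => 'a => real) => nat set => 'a measure" where
 "gen_measure M Y I = sigma (space M) (\<Union>i\<in>I. {Y i -` B \<inter> space M | B. B \<in> sets borel})"

lemma abs_divide_pos: "(y::real) > 0 ==> abs (x / y) = abs x / y" by (simp add: abs_divide)

lemma abs_mult_le: "abs a <= A ==> abs b <= B ==> abs (a * b) <= A * (B::real)"
 unfolding abs_mult by (intro mult_mono) auto

lemma norm_mult_bound: "cmod a <= A ==> cmod b <= B ==> cmod (a * b) <= A * B"
 unfolding norm_mult by (intro mult_mono) (auto intro: order_trans[OF norm_ge_zero])

lemma norm_triangle3: "cmod (a + b - c) <= cmod a + cmod b + cmod c"
 using norm_triangle_ineq4[of "a + b" c] norm_triangle_ineq[of a b] by linarith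

lemma space_gen_measure [simp]: "space (gen_measure M Y I) = space M"
 unfolding gen_measure_def by (intro space_measure_of) auto

lemma sets_gen_measure: "sets (gen_measure M Y I) = sigma_gen M Y I"
 unfolding gen_measure_def sigma_gen_def by (intro sets_measure_of) auto

lemma measurable_gen_measure: "i \<in> I ==> Y i \<in> borel_measurable (gen_measure M Y I)"
 by (rule measurableI) (auto simp: sets_gen_measure sigma_gen_def intro!: sigma_sets.Basic)

lemma gen_measure_mono:
 assumes "f \<in> measurable (gen_measure M Y I) N" "I \<subseteq> J"
 shows "f \<in> measurable (gen_measure M Y J) N"
proof -
 have "sets (gen_measure M Y I) \<subseteq> sets (gen_measure M Y J)"
  unfolding sets_gen_measure sigma_gen_def using assms(2) by (intro sigma_sets_mono') auto
 thus ?thesis using assms(1) measurable_mono[of N N "gen_measure M Y I" "gen_measure M Y J"] by auto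
qed

context prob_space
begin

lemma integrable_bounded:
 fixes u :: "'a => 'b::{banach, second_countable_topology}"
 shows "u \<in> borel_measurable M ==> (!!x. x \<in> space M ==> norm (u x) <= c) ==> integrable M u"
 by (rule integrable_const_bound[of _ c]) auto

lemma norm_expectation_le:
 fixes u :: "'a => 'b::{banach, second_countable_topology}"
 assumes "u \<in> borel_measurable M" "!!x. x \<in> space M ==> norm (u x) <= c"
 shows "norm (expectation u) <= c"
proof -
 have i: "integrable M u" using assms by (rule integrable_bounded)
 have "norm (expectation u) <= (LINT x|M. norm (u x))" by (rule integral_norm_bound)
 also have "... <= c" using assms i by (intro integral_le_const) auto
 finally show ?thesis .
qed

lemma abs_expectation_le:
 fixes u :: "'a => real"
 shows "u \<in> borel_measurable M ==> (!!x. x \<in> space M ==> abs (u x) <= c) ==> abs (expectation u) <= c"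
 using norm_expectation_le[of u c] by simp

end

text \<open>A rate \<open>al\<close> replaces the coefficients, and the index sets may have any
  shape: later arguments remove windows and gaps, so the sets that occur are rarely initial segments
  and tails. Measurability is asked at index 0 too; the main proof applies the locale to a copy of
  the process that is 0 there.\<close>

locale mixing_process = prob_space M for M :: "'a measure" +
 fixes Y :: "nat => 'a => real" and al :: "nat => real"
 assumes Y_measurable [measurable]: "!!i. Y i \<in> borel_measurable M"
  and mixing: "!!k I J A B. separated k I J ==> A \<in> sigma_gen M Y I ==> B \<in> sigma_gen M Y J ==>
   abs (prob A * prob B - prob (A \<inter> B)) <= al k"
begin

abbreviation "G \<equiv> gen_measure M Y"

lemma gen_measurable_M: "f \<in> measurable (G I) N ==> f \<in> measurable M N"
proof -
 assume f: "f \<in> measurable (G I) N"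
 have "sets (G I) \<subseteq> sets M"
  unfolding sets_gen_measure sigma_gen_def by (intro sets.sigma_sets_subset) auto
 thus ?thesis using f measurable_mono[of N N "G I" M] by auto
qed

lemma al_nonneg: "k >= 1 ==> 0 <= al k"
 using mixing[of k "{}" "{}" "{}" "{}"] by (auto simp: separated_def sigma_gen_def sigma_sets.Empty)

text \<open>Layer-cake argument: a function with values in [0,1] is within 1/n of the average of the
  indicators of its level sets at heights i/n. The covariance of two such averages is an average of
  n^2 covariances of indicators, each bounded by the mixing rate, so the constant 1 survives as n
  grows.\<close>

lemma covariance_unit_interval:
 fixes f g :: "'a => real"
 assumes sep: "separated k I J" and f: "f \<in> borel_measurable (G I)" and g: "g \<in> borel_measurable (G J)"
  and f01: "!!x. 0 <= f x \<and> f x <= 1" and g01: "!!x. 0 <= g x \<and> g x <= 1"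
 shows "abs ((LINT x|M. f x * g x) - expectation f * expectation g) <= al k"
proof -
 have [measurable]: "f \<in> borel_measurable M" "g \<in> borel_measurable M"
  using f g gen_measurable_M by auto
 \<comment> \<open>\<open>st n h\<close> rounds \<open>h\<close> down to the grid of mesh
   1/n.\<close>
 define st where "st n h x = (1 / real n) * (\<Sum>i=1..n. indicator {x\<in>space M. h x >= real i / real n} x)"
  for n and h :: "'a => real" and x
 have st_bd: "abs (st n h x - h x) <= 1 / n \<and> 0 <= st n h x \<and> st n h x <= 1"
  if "n >= 1" "x \<in> space M" "0 <= h x \<and> h x <= 1" for n h x
 proof -
  define N where "N = nat \<lfloor>real n * h x\<rfloor>"
  have N: "real N <= real n * h x" "real n * h x < real N + 1" using that by (auto simp: N_def)
  have "N <= n" using that N(1) by (smt (verit) mult_left_le of_nat_0_le_iff of_nat_le_iff)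
  have "(\<Sum>i=1..n. indicator {x\<in>space M. h x >= real i / real n} x) = (\<Sum>i=1..n. if i <= N then 1 else (0::real))"
  proof (intro sum.cong refl)
   fix i
   have "h x >= real i / real n \<longleftrightarrow> real i <= real n * h x"
    using that by (simp add: field_simps)
   also have "... \<longleftrightarrow> i <= N"
    using N by (smt (verit) of_nat_le_iff of_nat_1 of_nat_add nat_less_real_le not_le)
   finally show "indicator {x\<in>space M. h x >= real i / real n} x = (if i <= N then 1 else (0::real))"
    using that by (auto simp: indicator_def)
  qed
  also have "... = card ({1..n} \<inter> {i. i <= N})" by (simp add: sum.If_cases)
  also have "{1..n} \<inter> {i. i <= N} = {1..N}" using \<open>N <= n\<close> by auto
  finally have eq: "st n h x = real N / real n" by (simp add: st_def)
  have "abs (real N / real n - h x) = abs (real N - real n * h x) / n"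
   using that by (subst abs_divide_pos[symmetric]) (auto simp: diff_divide_distrib)
  also have "... <= 1 / n" using N that by (intro divide_right_mono) auto
  finally show ?thesis unfolding eq using \<open>N <= n\<close> that by auto
 qed
 have st_meas [measurable]: "st n f \<in> borel_measurable M" "st n g \<in> borel_measurable M" for n
  unfolding st_def by measurable
 have bdd: "integrable M h" if "h \<in> borel_measurable M" "!!x. x \<in> space M ==> abs (h x) <= 1" for h :: "'a => real"
  using that by (intro integrable_const_bound[of _ 1]) auto
 have main: "abs ((LINT x|M. f x * g x) - expectation f * expectation g) <= al k + 4 / real n" if n: "n >= 1" for n
 proof -
  define A where "A i = {x\<in>space M. f x >= real i / real n}" for i
  define B where "B i = {x\<in>space M. g x >= real i / real n}" for i
  have AG: "A i \<in> sigma_gen M Y I" for i using f measurable_sets[OF f, of "{real i / real n ..}"]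
   by (auto simp: A_def sets_gen_measure[symmetric] vimage_def Int_def conj_commute)
  have BG: "B i \<in> sigma_gen M Y J" for i using measurable_sets[OF g, of "{real i / real n ..}"]
   by (auto simp: B_def sets_gen_measure[symmetric] vimage_def Int_def conj_commute)
  have [measurable]: "A i \<in> sets M" "B i \<in> sets M" for i by (auto simp: A_def B_def)
  have ef: "expectation (st n f) = (1/n) * (\<Sum>i=1..n. prob (A i))"
   unfolding st_def A_def[symmetric] by (simp add: less_top[symmetric])
  have eg: "expectation (st n g) = (1/n) * (\<Sum>i=1..n. prob (B i))"
   unfolding st_def B_def[symmetric] by (simp add: less_top[symmetric])
  let ?b = "\<Sum>i=1..n. \<Sum>j=1..n. prob (A i \<inter> B j)"
  have "(LINT x|M. st n f x * st n g x) =
   (LINT x|M. (1/n^2) * (\<Sum>i=1..n. \<Sum>j=1..n. indicator (A i \<inter> B j) x))"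
   unfolding st_def A_def[symmetric] B_def[symmetric]
   by (simp add: sum_product power2_eq_square indicator_inter_arith)
  also have "... = (1/n^2) * ?b" by (simp add: less_top[symmetric])
  finally have efg: "(LINT x|M. st n f x * st n g x) = (1/n^2) * ?b" .
  let ?a = "\<Sum>i=1..n. \<Sum>j=1..n. prob (A i \<inter> B j) - prob (A i) * prob (B j)"
  have "(LINT x|M. st n f x * st n g x) - expectation (st n f) * expectation (st n g)
   = (1/n^2) * ?a" unfolding efg ef eg by (simp add: sum_product power2_eq_square sum_subtractf algebra_simps)
  also have "abs ... <= (1/n^2) * (\<Sum>i=1..n. \<Sum>j=1..n. al k)"
  proof -
   have "abs (prob (A i \<inter> B j) - prob (A i) * prob (B j)) <= al k" for i j
    using mixing[OF sep AG BG, of i j] by (simp add: abs_minus_commute)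
   hence "abs ?a <= (\<Sum>i=1..n. \<Sum>j=1..n. al k)" by (intro order_trans[OF sum_abs] sum_mono)
   thus ?thesis by (simp add: abs_mult divide_right_mono)
  qed
  also have "... = al k" using n by (simp add: power2_eq_square)
  finally have 1: "abs ((LINT x|M. st n f x * st n g x) - expectation (st n f) * expectation (st n g)) <= al k" .
  have If: "integrable M f" "integrable M g" "integrable M (st n f)" "integrable M (st n g)"
   using f01 g01 st_bd[OF n, of _ f] st_bd[OF n, of _ g] by (auto intro!: bdd)
  have 2: "abs (expectation f - expectation (st n f)) <= 1/n" "abs (expectation g - expectation (st n g)) <= 1/n"
   using f01 g01 st_bd[OF n, of _ f] st_bd[OF n, of _ g] If
   by (auto simp flip: LINT_diff simp: abs_minus_commute intro!: abs_expectation_le)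
  have 3: "abs ((LINT x|M. f x * g x) - (LINT x|M. st n f x * st n g x)) <= 2/n"
  proof -
   have i: "integrable M (%x. f x * g x)" "integrable M (%x. st n f x * st n g x)"
    using f01 g01 st_bd[OF n, of _ f] st_bd[OF n, of _ g] by (auto intro!: bdd simp: abs_mult mult_le_one)
   have "abs (f x * g x - st n f x * st n g x) <= 2/n" if "x \<in> space M" for x
   proof -
    have "f x * g x - st n f x * st n g x = (f x - st n f x) * g x + st n f x * (g x - st n g x)"
     by (simp add: algebra_simps)
    also have "abs ... <= (1/n) * 1 + 1 * (1/n)"
     by (intro order_trans[OF abs_triangle_ineq] add_mono abs_mult_le)
      (use st_bd[OF n that, of f] st_bd[OF n that, of g] f01[of x] g01[of x] in \<open>auto simp: abs_minus_commute\<close>)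
    finally show ?thesis by simp
   qed
   thus ?thesis using i by (auto simp flip: LINT_diff intro!: abs_expectation_le)
  qed
  have 4: "abs (expectation f) <= 1" "abs (expectation (st n g)) <= 1"
   using f01 st_bd[OF n, of _ g] g01 by (intro abs_expectation_le; auto)+
  have "expectation f * expectation g - expectation (st n f) * expectation (st n g) =
   expectation f * (expectation g - expectation (st n g)) + (expectation f - expectation (st n f)) * expectation (st n g)"
   by (simp add: algebra_simps)
  also have "abs ... <= 1 * (1/n) + (1/n) * 1"
   using 2 4 by (intro order_trans[OF abs_triangle_ineq] add_mono abs_mult_le)
  finally have 5: "abs (expectation f * expectation g - expectation (st n f) * expectation (st n g)) <= 2/n" by simp
  show ?thesis using 1 3 5 by simp
 qed
 show ?thesis
 proof (rule LIMSEQ_le_const)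
  show "(%n. al k + 4 / real n) ----> al k" by real_asymp
 qed (use main in blast)
qed

text \<open>The affine map (y / P + 1) / 2 brings [-P, P] to [0,1]; carried out for both variables
  it divides the covariance by 4 P Q, whence the factor 4.\<close>

lemma covariance_real:
 fixes f g :: "'a => real"
 assumes sep: "separated k I J" and f: "f \<in> borel_measurable (G I)" and g: "g \<in> borel_measurable (G J)"
  and P: "P > 0" "!!x. abs (f x) <= P" and Q: "Q > 0" "!!x. abs (g x) <= Q"
 shows "abs ((LINT x|M. f x * g x) - expectation f * expectation g) <= 4 * al k * P * Q"
proof -
 define f' where "f' x = (f x / P + 1) / 2" for x
 define g' where "g' x = (g x / Q + 1) / 2" for x
 have [measurable]: "f \<in> borel_measurable M" "g \<in> borel_measurable M"
  using f g gen_measurable_M by auto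
 have i: "integrable M f" "integrable M g" "integrable M (%x. f x * g x)"
  using integrable_bounded[of f P] integrable_bounded[of g Q] integrable_bounded[of "%x. f x * g x" "P * Q"] P Q
   abs_mult_le[OF P(2) Q(2)] by auto
 have f01: "0 <= f' x \<and> f' x <= 1" for x
  using P(1) P(2)[of x] unfolding f'_def by (auto simp: field_simps abs_le_iff)
 have g01: "0 <= g' x \<and> g' x <= 1" for x
  using Q(1) Q(2)[of x] unfolding g'_def by (auto simp: field_simps abs_le_iff)
 have b: "abs ((LINT x|M. f' x * g' x) - expectation f' * expectation g') <= al k"
  using f g f01 g01 unfolding f'_def g'_def by (intro covariance_unit_interval[OF sep]) auto
 let ?a = "(LINT x|M. f x * g x) - expectation f * expectation g"
 have "(LINT x|M. f' x * g' x) = (LINT x|M. (f x * g x / (P * Q) + f x / P + g x / Q + 1) / 4)"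
  unfolding f'_def g'_def using P Q by (intro LINT_cong) (auto simp: field_simps)
 also have "... = ((LINT x|M. f x * g x) / (P * Q) + expectation f / P + expectation g / Q + 1) / 4"
  using i by (simp add: prob_space)
 finally have "(LINT x|M. f' x * g' x) - expectation f' * expectation g' = ?a / (4 * P * Q)"
  unfolding f'_def g'_def using i P Q by (simp add: prob_space field_simps)
 hence "abs ?a / (4 * P * Q) <= al k" using b P Q by (simp add: abs_divide abs_mult)
 thus ?thesis using P Q by (simp add: field_simps)
qed

text \<open>Real and imaginary parts give four real covariances with constant 4 each, and
  \<open>cmod_le\<close> adds them up to 16.\<close>

lemma covariance_complex:
 fixes f g :: "'a => complex"
 assumes sep: "separated k I J" and f: "f \<in> borel_measurable (G I)" and g: "g \<in> borel_measurable (G J)"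
  and P: "P > 0" "!!x. cmod (f x) <= P" and Q: "Q > 0" "!!x. cmod (g x) <= Q"
 shows "cmod ((LINT x|M. f x * g x) - expectation f * expectation g) <= 16 * al k * P * Q"
proof -
 have [measurable]: "f \<in> borel_measurable M" "g \<in> borel_measurable M"
  using f g gen_measurable_M by auto
 have i: "integrable M f" "integrable M g"
  using P Q integrable_bounded[of f P] integrable_bounded[of g Q] by auto
 have ifg: "integrable M (%x. f x * g x)"
  using P(1) mult_mono[OF P(2) Q(2)] by (intro integrable_bounded[of _ "P * Q"]) (auto simp: norm_mult)
 have ir: "integrable M (%x. Re (f x) * Re (g x))" "integrable M (%x. Im (f x) * Im (g x))"
  "integrable M (%x. Re (f x) * Im (g x))" "integrable M (%x. Im (f x) * Re (g x))"
  using order_trans[OF abs_Re_le_cmod P(2)] order_trans[OF abs_Im_le_cmod P(2)]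
   order_trans[OF abs_Re_le_cmod Q(2)] order_trans[OF abs_Im_le_cmod Q(2)]
  by (auto intro!: integrable_bounded[of _ "P * Q"] abs_mult_le)
 have c: "abs ((LINT x|M. u (f x) * v (g x)) - (LINT x|M. u (f x)) * (LINT x|M. v (g x))) <= 4 * al k * P * Q"
  if "u \<in> {Re, Im}" "v \<in> {Re, Im}" for u v
  using that f g P Q order_trans[OF abs_Re_le_cmod P(2)] order_trans[OF abs_Im_le_cmod P(2)]
   order_trans[OF abs_Re_le_cmod Q(2)] order_trans[OF abs_Im_le_cmod Q(2)]
  by (intro covariance_real[OF sep]) auto
 define Z where "Z = (LINT x|M. f x * g x) - expectation f * expectation g"
 define d where "d u v = (LINT x|M. u (f x) * v (g x)) - (LINT x|M. u (f x)) * (LINT x|M. v (g x))"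
  for u v :: "complex => real"
 have "Re Z = d Re Re - d Im Im" unfolding Z_def d_def using i ifg ir by (simp flip: integral_Re integral_Im)
 moreover have "Im Z = d Re Im + d Im Re"
  unfolding Z_def d_def using i ifg ir by (simp flip: integral_Re integral_Im)
 moreover have "abs (d Re Re) <= 4 * al k * P * Q" "abs (d Re Im) <= 4 * al k * P * Q"
  "abs (d Im Re) <= 4 * al k * P * Q" "abs (d Im Im) <= 4 * al k * P * Q" using c unfolding d_def by auto
 ultimately have "abs (Re Z) + abs (Im Z) <= 16 * al k * P * Q" by linarith
 thus ?thesis unfolding Z_def[symmetric] using cmod_le[of Z] by linarith
qed

text \<open>In time \<open>f\<close> sits between \<open>g\<close> and \<open>h\<close>, so it
  cannot be split off by one application of mixing. First \<open>h\<close> is split from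
  \<open>f * g\<close>, then \<open>g\<close> from \<open>f\<close>, and finally \<open>g\<close>
  and \<open>h\<close> are joined again: three exchanges of cost 16 each.\<close>

lemma covariance_complex_3:
 fixes f g h :: "'a => complex"
 assumes sep: "separated k B A" "separated k A D" "separated k B D"
  and f: "f \<in> borel_measurable (G A)" and g: "g \<in> borel_measurable (G B)" and h: "h \<in> borel_measurable (G D)"
  and P: "P > 0" "!!x. cmod (f x) <= P" and Q: "!!x. cmod (g x) <= 1" "!!x. cmod (h x) <= 1"
 shows "cmod ((LINT x|M. f x * (g x * h x)) - expectation f * (LINT x|M. g x * h x)) <= 48 * al k * P"
proof -
 have [measurable]: "f \<in> borel_measurable M" "g \<in> borel_measurable M" "h \<in> borel_measurable M"
  using f g h gen_measurable_M by auto
 have s: "separated k (A \<union> B) D" using sep by (auto simp: separated_def)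
 let ?a = "(LINT x|M. (f x * g x) * h x) - (LINT x|M. f x * g x) * expectation h"
 have c1: "cmod ?a <= 16 * al k * P * 1"
  using f g h P Q gen_measure_mono[OF f, of "A \<union> B"] gen_measure_mono[OF g, of "A \<union> B"]
   mult_mono[OF P(2) Q(1)] by (intro covariance_complex[OF s]) (auto simp: norm_mult)
 let ?b = "(LINT x|M. g x * f x) - expectation g * expectation f"
 have c2: "cmod ?b <= 16 * al k * 1 * P" using f g P Q by (intro covariance_complex[OF sep(1)]) auto
 let ?c = "(LINT x|M. g x * h x) - expectation g * expectation h"
 have c3: "cmod ?c <= 16 * al k * 1 * 1" using h g P Q by (intro covariance_complex[OF sep(3)]) auto
 have "(LINT x|M. f x * (g x * h x)) - expectation f * (LINT x|M. g x * h x) = ?a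
   + ?b * expectation h - expectation f * ?c" by (simp add: algebra_simps)
 also have "cmod ... <= 16 * al k * P * 1 + (16 * al k * 1 * P) * 1 + P * (16 * al k * 1 * 1)"
  using norm_mult_bound[OF c2 norm_expectation_le[of h 1]] norm_mult_bound[OF norm_expectation_le[of f P] c3] c1 P Q
  by (intro order_trans[OF norm_triangle3] add_mono) auto
 finally show ?thesis by argo
qed

end

section \<open>Truncation and moment bounds at a polynomial mixing rate\<close>

definition clip :: "real => real => real" where
 "clip T y = max (- T) (min T y)"

lemma clip_measurable [measurable]: "clip T \<in> borel_measurable borel" unfolding clip_def by measurable

lemma abs_clip_le: "T >= 0 ==> abs (clip T y) <= T" "T >= 0 ==> abs (clip T y) <= abs y"
 unfolding clip_def by auto

lemma abs_diff_clip_le: "T >= 0 ==> abs (y - clip T y) <= abs y * of_bool (T < abs y)"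
 unfolding clip_def by (auto simp: of_bool_def)

text \<open>Markov's inequality in pointwise form: above \<open>T\<close> the missing powers of
  \<open>abs y\<close> are bought at the price \<open>T powr (r - p)\<close>.\<close>

lemma power_tail_le:
 assumes "T > 0" "real r <= p" "r >= 1"
 shows "abs y ^ r * of_bool (T < abs y) <= abs y powr p * T powr (r - p)"
proof (cases "T < abs y")
 case True
 have "abs y ^ r = abs y powr p * abs y powr (r - p)"
  using True assms by (simp add: powr_add[symmetric] powr_realpow)
 also have "... <= abs y powr p * T powr (r - p)" using True assms by (intro mult_left_mono powr_mono2') auto
 finally show ?thesis using True by simp
qed auto

text \<open>On the tail event the larger factor exceeds \<open>T\<close> and its square dominates
  the product. This reduces tails of products to second moments of single variables.\<close>

lemma mult_tail_le:
 "abs (x * y) * of_bool (T < abs x \<or> T < abs y) <= x^2 * of_bool (T < abs x) + y^2 * of_bool (T < abs y)" for x y T :: real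
proof -
 have "abs (x * y) <= x^2" if "abs y <= abs x"
  using mult_left_mono[OF that, of "abs x"] by (simp add: abs_mult power2_eq_square)
 moreover have "abs (x * y) <= y^2" if "abs x <= abs y"
  using mult_right_mono[OF that, of "abs y"] by (simp add: abs_mult power2_eq_square)
 ultimately show ?thesis
  by (cases "abs x <= abs y") (auto simp: of_bool_def intro: add_increasing add_increasing2)
qed

lemma abs_mult_le_squares: "abs (x * y) <= x^2 + y^2" for x y :: real
proof -
 have "2 * abs (x * y) <= x^2 + y^2" using sum_squares_bound[of "abs x" "abs y"] by (simp add: abs_mult)
 thus ?thesis using abs_ge_zero[of "x * y"] by linarith
qed

lemma rearrange4: "x * y = d ==> C * a * d = C * e ==> 4 * (C * a) * x * y = 4 * C * e" for a :: real
proof -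
 assume "x * y = d" "C * a * d = C * e"
 moreover have "4 * (C * a) * x * y = 4 * (C * a * (x * y))" by (simp only: mult.assoc)
 ultimately show ?thesis by (simp only: mult.assoc)
qed

lemma clip_mult_diff_le:
 assumes "T >= 0"
 shows "abs (x * y - clip T x * clip T y) <= 2 * (x^2 * of_bool (T < abs x) + y^2 * of_bool (T < abs y))"
proof (cases "T < abs x \<or> T < abs y")
 case True
 let ?a = "abs (x * y) * of_bool (T < abs x \<or> T < abs y)"
 have "abs (clip T x * clip T y) <= abs (x * y)"
  using abs_clip_le(2)[OF assms, of x] abs_clip_le(2)[OF assms, of y] by (simp add: abs_mult mult_mono)
 hence "abs (x * y - clip T x * clip T y) <= 2 * abs (x * y)" by linarith
 also have "... = 2 * ?a" using True by simp
 finally have "abs (x * y - clip T x * clip T y) <= 2 * ?a" .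
 also have "... <= 2 * (x^2 * of_bool (T < abs x) + y^2 * of_bool (T < abs y))"
  by (rule mult_left_mono[OF mult_tail_le]) simp
 finally show ?thesis .
next
 case False
 hence "clip T x = x" "clip T y = y" by (auto simp: clip_def)
 thus ?thesis by auto
qed

text \<open>The mixing exponent is the product \<open>lam * p\<close>, with \<open>p\<close> the
  order of the finite moments, because variables at distance k are clipped at height k^lam. The
  condition 2 <= lam (p - 4) makes the covariances of the squares decay like k^(-2); together with 1
  <= lam it makes those of the variables decay like k^(-4). Stationarity enters only through a
  common moment bound \<open>K\<close> and covariances \<open>c k\<close> that depend on the lag
  alone.\<close>

locale poly_mixing = mixing_process M Y "%k. C * real k powr (- (lam * p))" for M :: "'a measure" and Y C lam p +
 fixes K :: real and c :: "nat => real"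
 assumes p: "4 < p" and lam: "1 <= lam" "2 <= lam * (p - 4)" and C: "0 <= C" and K: "1 <= K"
  and moment_integrable: "!!i. 1 <= i ==> integrable M (%x. abs (Y i x) powr p)"
  and moment: "!!i. 1 <= i ==> (LINT x|M. abs (Y i x) powr p) <= K"
  and mean: "!!i. 1 <= i ==> expectation (Y i) = 0"
  and cov: "!!i k. 1 <= i ==> (LINT x|M. Y i x * Y (i + k) x) = c k"
  and c0: "c 0 = 1"
begin

lemma integrable_power:
 assumes "1 <= i" "r <= 4"
 shows "integrable M (%x. abs (Y i x) ^ r)"
  and "(LINT x|M. abs (Y i x) ^ r) <= 2 * K"
proof -
 have b: "abs y ^ r <= 1 + abs y powr p" for y :: real
 proof (cases "abs y <= 1")
  case True
  thus ?thesis using power_le_one[of "abs y" r] by (simp add: add_increasing2)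
 next
  case False
  hence "abs y ^ r = abs y powr r" by (simp add: powr_realpow)
  also have "... <= abs y powr p" using False p assms by (intro powr_mono) auto
  finally show ?thesis by simp
 qed
 have i: "integrable M (%x. 1 + abs (Y i x) powr p)" using moment_integrable[OF assms(1)] by simp
 show int: "integrable M (%x. abs (Y i x) ^ r)"
  by (rule int_bound[OF i]) (use b in \<open>auto intro!: AE_I2 order_trans[OF b]\<close>)
 have "(LINT x|M. abs (Y i x) ^ r) <= (LINT x|M. 1 + abs (Y i x) powr p)"
  using int i b by (intro integral_mono) auto
 also have "... <= 1 + K" using moment[OF assms(1)] moment_integrable[OF assms(1)] by (simp add: prob_space)
 finally show "(LINT x|M. abs (Y i x) ^ r) <= 2 * K" using K by simp
qed

lemma integrable_Y: "1 <= i ==> integrable M (Y i)"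
 using integrable_power(1)[of i 1] integrable_abs_cancel[of M "Y i"] by auto

lemma integrable_sq: "1 <= i ==> integrable M (%x. (Y i x)^2)" using integrable_power(1)[of i 2] by auto

lemma expectation_sq: "1 <= i ==> (LINT x|M. (Y i x)^2) = 1"
 using cov[of i 0] by (simp add: c0 power2_eq_square)

lemma integrable_mult: "1 <= i ==> 1 <= j ==> integrable M (%x. Y i x * Y j x)"
 by (rule int_bound[OF int_add[OF integrable_sq[of i] integrable_sq[of j]]])
   (auto intro!: AE_I2 abs_mult_le_squares)

lemma tail:
 assumes "1 <= i" "T > 0" "1 <= r" "r <= 4"
 shows "integrable M (%x. abs (Y i x) ^ r * of_bool (T < abs (Y i x)))"
  and "(LINT x|M. abs (Y i x) ^ r * of_bool (T < abs (Y i x))) <= K * T powr (r - p)"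
proof -
 show i: "integrable M (%x. abs (Y i x) ^ r * of_bool (T < abs (Y i x)))"
  by (rule int_bound[OF integrable_power(1)[OF assms(1,4)]]) auto
 let ?a = "LINT x|M. abs (Y i x) ^ r * of_bool (T < abs (Y i x))"
 have "?a <= (LINT x|M. abs (Y i x) powr p * T powr (r - p))"
  using i moment_integrable[OF assms(1)] power_tail_le[of T r p] assms p by (intro integral_mono) auto
 also have "... <= K * T powr (r - p)" using moment[OF assms(1)] by (simp add: mult_right_mono)
 finally show "?a <= K * T powr (r - p)" .
qed

lemma tail2:
 assumes "1 <= i" "1 <= j" "T > 0"
 shows "integrable M (%x. (Y i x)^2 * of_bool (T < abs (Y i x)) + (Y j x)^2 * of_bool (T < abs (Y j x)))"
  and "(LINT x|M. (Y i x)^2 * of_bool (T < abs (Y i x)) + (Y j x)^2 * of_bool (T < abs (Y j x))) <= 2 * K * T powr (2 - p)"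
 using tail[of i T 2] tail[of j T 2] assms by auto

lemma integrable_clip: "T > 0 ==> f \<in> borel_measurable M ==> integrable M (%x. clip T (f x))"
 using abs_clip_le[of T] by (intro integrable_bounded[of _ T]) auto

text \<open>Mixing handles the clipped \<open>f\<close>. What clipping removes is paired with
  factors of modulus at most 1, so it costs \<open>e\<close> once in the joint expectation and once
  in the product.\<close>

lemma decorrelation:
 fixes f :: "'a => real" and g h :: "'a => complex"
 assumes sep: "separated k B A" "separated k A D" "separated k B D"
  and f: "f \<in> borel_measurable (G A)" and g: "g \<in> borel_measurable (G B)" and h: "h \<in> borel_measurable (G D)"
  and Q: "!!x. cmod (g x) <= 1" "!!x. cmod (h x) <= 1" and i: "integrable M f" and T: "T > 0"
  and tail: "(LINT x|M. abs (f x - clip T (f x))) <= e"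
 shows "cmod ((LINT x|M. f x * (g x * h x)) - expectation f * (LINT x|M. g x * h x))
  <= 48 * (C * real k powr (- (lam * p))) * T + 2 * e"
proof -
 have [measurable]: "f \<in> borel_measurable M" "g \<in> borel_measurable M" "h \<in> borel_measurable M"
  using f g h gen_measurable_M by auto
 let ?f = "%x. clip T (f x)" and ?u = "%x. g x * h x"
 have u1: "cmod (?u x) <= 1" for x using norm_mult_bound[OF Q] by simp
 have ic: "integrable M ?f" using T by (intro integrable_clip) auto
 have "(%x. cpx (?f x)) \<in> borel_measurable (G A)" using f by measurable
 hence c: "cmod ((LINT x|M. cpx (?f x) * ?u x) - (LINT x|M. cpx (?f x)) * expectation ?u)
   <= 48 * (C * real k powr (- (lam * p))) * T"
  using g h Q T abs_clip_le[of T] by (intro covariance_complex_3[OF sep]) auto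
 have iu: "integrable M (%x. cpx (v x) * ?u x)" if v: "integrable M v" for v
 proof -
  have [measurable]: "v \<in> borel_measurable M" using v by auto
  show ?thesis by (rule int_bound[OF v])
     (use u1 in \<open>auto intro!: AE_I2 mult_left_le simp: norm_mult\<close>)
 qed
 have d1: "cmod ((LINT x|M. cpx (f x) * ?u x) - (LINT x|M. cpx (?f x) * ?u x)) <= e"
 proof -
  have "(LINT x|M. cpx (f x) * ?u x) - (LINT x|M. cpx (?f x) * ?u x)
   = (LINT x|M. cpx (f x - ?f x) * ?u x)"
   using iu[OF i] iu[OF ic] by (simp flip: LINT_diff add: algebra_simps)
  also have "cmod ... <= (LINT x|M. cmod (cpx (f x - ?f x) * ?u x))" by (rule integral_norm_bound)
  also have "... <= (LINT x|M. abs (f x - ?f x))"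
   using i ic u1 by (intro integral_mono integrable_norm iu) (auto simp: norm_mult simp del: of_real_diff intro: mult_left_le)
  finally show ?thesis using tail by linarith
 qed
 have d2: "cmod (cpx (expectation f) * expectation ?u - cpx (expectation ?f) * expectation ?u) <= e"
 proof -
  have "abs (expectation f - expectation ?f) <= (LINT x|M. abs (f x - ?f x))"
   using integral_abs_bound[of M "%x. f x - ?f x"] i ic by simp
  hence "abs (expectation f - expectation ?f) <= e" using tail by linarith
  hence "cmod (cpx (expectation f - expectation ?f) * expectation ?u) <= e * 1"
   using u1 by (intro norm_mult_bound norm_expectation_le) (auto simp del: of_real_diff)
  thus ?thesis by (simp add: algebra_simps)
 qed
 have "(LINT x|M. f x * ?u x) - expectation f * expectation ?u =
  ((LINT x|M. cpx (f x) * ?u x) - (LINT x|M. cpx (?f x) * ?u x))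
  + ((LINT x|M. cpx (?f x) * ?u x) - (LINT x|M. cpx (?f x)) * expectation ?u)
  - (cpx (expectation f) * expectation ?u - cpx (expectation ?f) * expectation ?u)" by simp
 also have "cmod ... <= e + 48 * (C * real k powr (- (lam * p))) * T + e"
  using c d1 d2 by (intro order_trans[OF norm_triangle3] add_mono)
 finally show ?thesis by simp
qed

text \<open>At clipping height T = k^lam the mixing error, rate times T^r, and the tail error T^(r -
  p) have the same order.\<close>

lemma mixing_powr:
 assumes "k >= 1"
 shows "C * real k powr (- (lam * p)) * real k powr (lam * r) = C * real k powr (- (lam * (p - r)))"
  "(real k powr lam) powr (r - p) = real k powr (- (lam * (p - r)))"
 using assms by (auto simp: powr_add[symmetric] powr_powr algebra_simps)

text \<open>A centred variable leaves nothing of the product of expectations, so the bound is on the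
  joint expectation itself.\<close>

lemma decorrelation_single:
 fixes g h :: "'a => complex"
 assumes sep: "separated k B {i}" "separated k {i} D" "separated k B D"
  and g: "g \<in> borel_measurable (G B)" and h: "h \<in> borel_measurable (G D)"
  and Q: "!!x. cmod (g x) <= 1" "!!x. cmod (h x) <= 1"
 shows "cmod ((LINT x|M. Y i x * (g x * h x))) <= (48 * C + 2 * K) * real k powr (- (lam * (p - 1)))"
proof -
 have k: "k >= 1" and i: "i >= 1" using sep by (auto simp: separated_def)
 define T where "T = real k powr lam"
 have T: "T > 0" using k by (simp add: T_def)
 have "(LINT x|M. abs (Y i x - clip T (Y i x))) <= (LINT y|M. abs (Y i y) ^ 1 * of_bool (T < abs (Y i y)))"
  using tail(1)[OF i T, of 1] T abs_diff_clip_le[of T] integrable_Y[OF i] integrable_clip[OF T, of "Y i"]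
  by (intro integral_mono) auto
 also have "... <= K * T powr (1 - p)" using tail(2)[OF i T, of 1] by simp
 finally have "cmod ((LINT x|M. Y i x * (g x * h x)) - expectation (Y i) * (LINT x|M. g x * h x))
  <= 48 * (C * real k powr (- (lam * p))) * T + 2 * (K * T powr (1 - p))"
  using T g h Q integrable_Y[OF i] measurable_gen_measure[of i "{i}" Y M] by (intro decorrelation[OF sep]) auto
 moreover have "48 * (C * real k powr (- (lam * p))) * T + 2 * (K * T powr (1 - p)) = (48 * C + 2 * K) * real k powr (- (lam * (p - 1)))"
  using mixing_powr[OF k, of 1] unfolding T_def mult_1_right by algebra
 ultimately show ?thesis using mean[OF i] by simp
qed

lemma decorrelation_pair:
 fixes g h :: "'a => complex"
 assumes sep: "separated k B A" "separated k A D" "separated k B D" and ij: "i \<in> A" "j \<in> A"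
  and g: "g \<in> borel_measurable (G B)" and h: "h \<in> borel_measurable (G D)"
  and Q: "!!x. cmod (g x) <= 1" "!!x. cmod (h x) <= 1"
 shows "cmod ((LINT x|M. cpx (Y i x * Y j x) * (g x * h x)) -
  (LINT x|M. Y i x * Y j x) * (LINT x|M. g x * h x)) <= (48 * C + 4 * K) * real k powr (- (lam * (p - 2)))"
proof -
 have k: "k >= 1" and i: "i >= 1" and j: "j >= 1" using sep ij by (auto simp: separated_def)
 define T where "T = real k powr lam"
 have T: "T > 0" using k by (simp add: T_def)
 \<comment> \<open>The product is clipped at T^2: if it exceeds T^2, then one of its factors exceeds
   T.\<close>
 have b: "abs (x * y - clip (T^2) (x * y)) <= x^2 * of_bool (T < abs x) + y^2 * of_bool (T < abs y)" for x y
 proof -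
  have "T^2 < abs (x * y) ==> T < abs x \<or> T < abs y"
   using abs_mult_le[of x T y T] by (fastforce simp: power2_eq_square not_less)
  hence "abs (x * y) * of_bool (T^2 < abs (x * y)) <= abs (x * y) * of_bool (T < abs x \<or> T < abs y)"
   by (auto intro!: mult_left_mono)
  thus ?thesis using abs_diff_clip_le[of "T^2" "x * y"] mult_tail_le[of x y T] by (auto intro: order_trans)
 qed
 have "(LINT x|M. abs (Y i x * Y j x - clip (T^2) (Y i x * Y j x))) <=
   (LINT z|M. (Y i z)^2 * of_bool (T < abs (Y i z)) + (Y j z)^2 * of_bool (T < abs (Y j z)))"
  using tail2(1)[OF i j T] T b integrable_mult[OF i j] integrable_clip[of "T^2" "%x. Y i x * Y j x"]
  by (intro integral_mono) auto
 also have "... <= 2 * K * T powr (2 - p)" by (rule tail2(2)[OF i j T])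
 finally have "cmod ((LINT x|M. cpx (Y i x * Y j x) * (g x * h x)) - (LINT x|M. Y i x * Y j x) * (LINT x|M. g x * h x))
  <= 48 * (C * real k powr (- (lam * p))) * T^2 + 2 * (2 * K * T powr (2 - p))"
  using T g h Q integrable_mult[OF i j] measurable_gen_measure[OF ij(1), of Y M] measurable_gen_measure[OF ij(2), of Y M]
  by (intro decorrelation[OF sep]) auto
 moreover have e: "(real k powr lam)^2 = real k powr (lam * 2)" using k by (simp add: powr_powr[symmetric])
 have "48 * (C * real k powr (- (lam * p))) * T^2 + 2 * (2 * K * T powr (2 - p)) = (48 * C + 4 * K) * real k powr (- (lam * (p - 2)))"
  using mixing_powr[OF k, of 2] unfolding T_def e by algebra
 ultimately show ?thesis by simp
qed

lemma covariance_clip: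
 fixes f g :: "'a => real"
 assumes sep: "separated k I J" and f: "f \<in> borel_measurable (G I)" and g: "g \<in> borel_measurable (G J)" and T: "T > 0"
 shows "abs ((LINT x|M. clip T (f x) * clip T (g x)) - (LINT x|M. clip T (f x)) * (LINT x|M. clip T (g x)))
  <= 4 * (C * real k powr (- (lam * p))) * T * T"
 using f g T by (intro covariance_real[OF sep]) (auto intro: abs_clip_le)

text \<open>The clipped variables are no longer centred. As the unclipped means are 0, their means
  are bounded by the tail, and the product of the two contributes only T^(2 - 2p).\<close>

lemma autocovariance_bound:
 assumes k: "k >= 1"
 shows "abs (c k) <= (4 * C + K^2 + 4 * K) * real k powr (- (lam * (p - 2)))"
proof -
 define T where "T = real k powr lam"
 have T: "T > 0" "T >= 1" using k lam by (auto simp: T_def ge_one_powr_ge_zero)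
 let ?f = "%x. clip T (Y 1 x)" and ?g = "%x. clip T (Y (1+k) x)"
 have sep: "separated k {1} {1+k}" using k by (auto simp: separated_def)
 have a: "abs ((LINT x|M. ?f x * ?g x) - expectation ?f * expectation ?g) <= 4 * (C * real k powr (- (lam * p))) * T * T"
  using T by (intro covariance_clip[OF sep] measurable_gen_measure) auto
 have m: "abs (LINT x|M. clip T (Y i x)) <= K * T powr (1 - p)" if i: "i >= 1" for i
 proof -
  have ic: "integrable M (%x. clip T (Y i x))" using abs_clip_le[of T] T by (intro integrable_bounded[of _ T]) auto
  have "abs (LINT x|M. clip T (Y i x)) = abs (LINT x|M. Y i x - clip T (Y i x))"
   using mean[OF i] ic integrable_Y[OF i] by simp
  also have "... <= (LINT x|M. abs (Y i x - clip T (Y i x)))" by (rule integral_abs_bound)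
  also have "... <= (LINT y|M. abs (Y i y) ^ 1 * of_bool (T < abs (Y i y)))"
   using tail(1)[OF i T(1), of 1] T abs_diff_clip_le[of T] integrable_Y[OF i] ic by (intro integral_mono) auto
  also have "... <= K * T powr (1 - p)" using tail(2)[OF i T(1), of 1] by simp
  finally show ?thesis .
 qed
 have ifg: "integrable M (%x. ?f x * ?g x)"
  using T by (intro integrable_bounded[of _ "T * T"]) (auto simp: abs_mult intro!: mult_mono abs_clip_le)
 have "abs (c k - (LINT x|M. ?f x * ?g x)) = abs (LINT x|M. Y 1 x * Y (1+k) x - ?f x * ?g x)"
  using cov[of 1 k] integrable_mult[of 1 "1+k"] ifg by simp
 also have "... <= (LINT x|M. abs (Y 1 x * Y (1+k) x - ?f x * ?g x))" by (rule integral_abs_bound)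
 also have "... <= (LINT y|M. 2 * ((Y 1 y)^2 * of_bool (T < abs (Y 1 y)) + (Y (1+k) y)^2 * of_bool (T < abs (Y (1+k) y))))"
  using tail2(1)[of 1 "1+k" T] T ifg integrable_mult[of 1 "1+k"] by (intro integral_mono integrable_abs int_diff integrable_mult_right clip_mult_diff_le) auto
 also have "... <= 4 * K * T powr (2 - p)"
  using tail2(2)[of 1 "1+k" T] T by (subst integral_mult_right_zero) auto
 finally have b: "abs (c k - (LINT x|M. ?f x * ?g x)) <= 4 * K * T powr (2 - p)" .
 have "abs (expectation ?f * expectation ?g) <= (K * T powr (1 - p)) * (K * T powr (1 - p))"
  using m[of 1] m[of "1+k"] by (intro abs_mult_le) auto
 also have "... = K^2 * T powr (2 - 2 * p)" by (simp add: power2_eq_square powr_add[symmetric])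
 also have "... <= K^2 * T powr (2 - p)" using T p by (intro mult_left_mono powr_mono) auto
 finally have d: "abs (expectation ?f * expectation ?g) <= K^2 * T powr (2 - p)" .
 let ?a = "lam * (p - 2)"
 have "T * T = real k powr (lam * 2)" using k by (simp add: T_def powr_powr[symmetric] power2_eq_square)
 hence "4 * (C * real k powr (- (lam * p))) * T * T = 4 * C * real k powr (- ?a)"
  using mixing_powr(1)[OF k, of 2] by (rule rearrange4)
 note a' = a[unfolded this]
 have "T powr (2 - p) = real k powr (- ?a)" using mixing_powr(2)[OF k, of 2] by (simp add: T_def)
 hence "abs (c k) <= 4 * C * real k powr (- ?a) + K^2 * real k powr (- ?a) + 4 * K * real k powr (- ?a)"
  using a' b d by simp
 thus ?thesis by (simp only: distrib_right)
qed

text \<open>This controls the fluctuation of the local variances. Clipping the squares at T^2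
  amounts to clipping the variables at T; the tail of a product of squares then uses up four of the
  \<open>p\<close> moments.\<close>

lemma sq_covariance_bound:
 assumes k: "k >= 1" and i: "i >= 1"
 shows "abs ((LINT x|M. (Y i x)^2 * (Y (i+k) x)^2) - 1) <= (4 * C + 8 * K) * real k powr (- (lam * (p - 4)))"
proof -
 define T where "T = real k powr lam"
 have T: "T > 0" "T >= 1" "T^2 > 0" using k lam by (auto simp: T_def ge_one_powr_ge_zero)
 let ?f = "%x. clip (T^2) ((Y i x)^2)" and ?g = "%x. clip (T^2) ((Y (i+k) x)^2)"
 have sep: "separated k {i} {i+k}" using k i by (auto simp: separated_def)
 have [measurable]: "Y i \<in> borel_measurable (G {i})" "Y (i+k) \<in> borel_measurable (G {i+k})"
  by (auto intro: measurable_gen_measure)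
 have a: "abs ((LINT x|M. ?f x * ?g x) - expectation ?f * expectation ?g) <= 4 * (C * real k powr (- (lam * p))) * T^2 * T^2"
  by (intro covariance_clip[OF sep _ _ T(3)]) measurable
 have bt: "of_bool (T^2 < abs (y^2)) = (of_bool (T < abs y) :: real)" for y
  using T abs_square_less_1[of "T"] power2_strict_mono[of T "abs y"] power_less_imp_less_base[of T 2 "abs y"]
  by (auto simp: of_bool_def power_strict_mono)
 have ic: "integrable M (%x. clip (T^2) ((Y j x)^2))" for j
  using T by (intro integrable_bounded[of _ "T^2"]) (auto intro!: abs_clip_le)
 have m: "abs (1 - (LINT x|M. clip (T^2) ((Y j x)^2))) <= K * T powr (2 - p)" if j: "j >= 1" for j
 proof -
  have "abs (1 - (LINT x|M. clip (T^2) ((Y j x)^2))) = abs (LINT x|M. (Y j x)^2 - clip (T^2) ((Y j x)^2))"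
   using expectation_sq[OF j] ic integrable_sq[OF j] by simp
  also have "... <= (LINT x|M. abs ((Y j x)^2 - clip (T^2) ((Y j x)^2)))" by (rule integral_abs_bound)
  also have "... <= (LINT z|M. abs (Y j z) ^ 2 * of_bool (T < abs (Y j z)))"
   using tail(1)[OF j T(1), of 2] abs_diff_clip_le[of "T^2"] bt integrable_sq[OF j] ic
   by (intro integral_mono) (auto simp: order_trans[OF abs_diff_clip_le])
  also have "... <= K * T powr (2 - p)" using tail(2)[OF j T(1), of 2] by simp
  finally show ?thesis .
 qed
 have iq: "integrable M (%x. (Y i x)^2 * (Y (i+k) x)^2)"
  by (rule int_bound[OF int_add[OF integrable_power(1)[of i 4] integrable_power(1)[of "i+k" 4]]])
    (use i abs_mult_le_squares[of "(Y i _)^2" "(Y (i+k) _)^2"] in \<open>auto intro!: AE_I2\<close>)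
 have ifg: "integrable M (%x. ?f x * ?g x)"
  using abs_mult_le[OF abs_clip_le(1) abs_clip_le(1), of "T^2" "T^2"]
  by (intro integrable_bounded[of _ "T^2 * T^2"]) auto
 have p4: "(y^2)^2 * of_bool (T^2 < abs (y^2)) = abs y ^ 4 * of_bool (T < abs y)" for y unfolding bt by simp
 let ?a = "LINT x|M. (Y i x)^2 * (Y (i+k) x)^2"
 have "abs (?a - (LINT x|M. ?f x * ?g x)) = abs (LINT x|M. (Y i x)^2 * (Y (i+k) x)^2 - ?f x * ?g x)"
  using iq ifg by simp
 also have "... <= (LINT x|M. abs ((Y i x)^2 * (Y (i+k) x)^2 - ?f x * ?g x))" by (rule integral_abs_bound)
 also have "... <= (LINT z|M. 2 * (abs (Y i z) ^ 4 * of_bool (T < abs (Y i z)) + abs (Y (i+k) z) ^ 4 * of_bool (T < abs (Y (i+k) z))))"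
  using tail(1)[of i T 4] tail(1)[of "i+k" T 4] i T ifg iq clip_mult_diff_le[of "T^2" "(Y i _)^2" "(Y (i+k) _)^2"]
  unfolding p4 by (intro integral_mono) auto
 also have "... <= 4 * K * T powr (4 - p)" using tail[of i T 4] tail[of "i+k" T 4] i T by simp
 finally have b: "abs (?a - (LINT x|M. ?f x * ?g x)) <= 4 * K * T powr (4 - p)" .
 have e01: "0 <= expectation ?g \<and> expectation ?g <= 1"
  using expectation_sq[of "i+k"] integral_mono[OF ic[of "i+k"] integrable_sq[of "i+k"]] i T
  by (auto intro!: integral_nonneg_AE simp: clip_def)
 have "abs (1 - expectation ?f * expectation ?g) = abs ((1 - expectation ?f) * expectation ?g + (1 - expectation ?g))"
  by (simp add: algebra_simps)
 also have "... <= (K * T powr (2 - p)) * 1 + K * T powr (2 - p)"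
  using m[of i] m[of "i+k"] i e01 by (intro order_trans[OF abs_triangle_ineq] add_mono abs_mult_le) auto
 also have "... = 2 * K * T powr (2 - p)" by simp
 also have "... <= 2 * K * T powr (4 - p)" using T p K by (intro mult_left_mono powr_mono) auto
 finally have d: "abs (1 - expectation ?f * expectation ?g) <= 2 * K * T powr (4 - p)" .
 let ?b = "lam * (p - 4)"
 have "T^2 * T^2 = T ^ 4" by (simp add: power2_eq_square power4_eq_xxxx)
 also have "... = real k powr (lam * 4)" using k by (simp add: T_def powr_powr[symmetric])
 finally have "4 * (C * real k powr (- (lam * p))) * T^2 * T^2 = 4 * C * real k powr (- ?b)"
  using mixing_powr(1)[OF k, of 4] by (rule rearrange4)
 note a' = a[unfolded this]
 have "T powr (4 - p) = real k powr (- ?b)" using mixing_powr(2)[OF k, of 4] by (simp add: T_def)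
 note bd = b[unfolded this] d[unfolded this]
 have "0 <= K * real k powr (- ?b)" using K by simp
 hence "abs (?a - 1) <= 4 * C * real k powr (- ?b) + 8 * (K * real k powr (- ?b))"
  using a' bd unfolding mult.assoc[of _ K] by linarith
 thus ?thesis by (simp only: distrib_right mult.assoc)
qed

end

section \<open>Quadratic forms and moments of weighted sums\<close>

lemma sum_distance_le:
 fixes R :: "nat => real"
 assumes I: "finite I" and R: "!!k. 0 <= R k" "summable R"
 shows "(\<Sum>j\<in>I. R (max i j - min i j)) <= 2 * suminf R"
proof -
 let ?a = "\<Sum>j\<in>I \<inter> - {j. i <= j}. R (max i j - min i j)"
  and ?b = "\<Sum>j\<in>I \<inter> {j. i <= j}. R (max i j - min i j)"
 have "(\<Sum>j\<in>I. R (max i j - min i j)) = ?b + ?a"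
  using I by (rule sum.Int_Diff[where B = "{j. i <= j}", unfolded Diff_eq])
 also have "?b = (\<Sum>k\<in>(%j. j - i) ` (I \<inter> {j. i <= j}). R k)"
  by (subst sum.reindex) (auto simp: inj_on_def max_def min_def intro!: sum.cong)
 also have "... <= suminf R" using I R by (intro sum_le_suminf) auto
 also have "?a = (\<Sum>k\<in>(%j. i - j) ` (I \<inter> - {j. i <= j}). R k)"
  by (subst sum.reindex) (auto simp: inj_on_def max_def min_def intro!: sum.cong)
 also have "... <= suminf R" using I R by (intro sum_le_suminf) auto
 finally show ?thesis by simp
qed

text \<open>Schur's test: the weights are separated by 2 |a b| <= a^2 + b^2, and each row of the
  kernel sums to at most twice the series, once for either side of the diagonal.\<close>

lemma double_sum_bound:
 fixes R :: "nat => real" and w :: "nat => real"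
 assumes I: "finite I" and R: "!!k. 0 <= R k" "summable R"
  and r: "!!i j. i \<in> I ==> j \<in> I ==> abs (r i j) <= R (max i j - min i j)"
 shows "abs (\<Sum>i\<in>I. \<Sum>j\<in>I. w i * w j * r i j) <= 2 * suminf R * (\<Sum>i\<in>I. (w i)^2)"
proof -
 let ?R = "%i j. R (max i j - min i j)"
 have "abs (\<Sum>i\<in>I. \<Sum>j\<in>I. w i * w j * r i j) <= (\<Sum>i\<in>I. \<Sum>j\<in>I. ((w i)^2 / 2 + (w j)^2 / 2) * ?R i j)"
 proof (intro order_trans[OF sum_abs] sum_mono)
  fix i j assume "i \<in> I" "j \<in> I"
  have "2 * abs (w i * w j) <= (w i)^2 + (w j)^2"
   using sum_squares_bound[of "abs (w i)" "abs (w j)"] by (simp add: abs_mult)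
  thus "abs (w i * w j * r i j) <= ((w i)^2 / 2 + (w j)^2 / 2) * ?R i j"
   using r[OF \<open>i \<in> I\<close> \<open>j \<in> I\<close>] by (intro abs_mult_le) auto
 qed
 also have "... = (\<Sum>i\<in>I. \<Sum>j\<in>I. (w i)^2 / 2 * ?R i j) + (\<Sum>i\<in>I. \<Sum>j\<in>I. (w j)^2 / 2 * ?R i j)"
  by (simp add: distrib_right sum.distrib)
 also have "(\<Sum>i\<in>I. \<Sum>j\<in>I. (w j)^2 / 2 * ?R i j) = (\<Sum>i\<in>I. \<Sum>j\<in>I. (w i)^2 / 2 * ?R i j)"
  by (subst sum.swap) (simp add: max.commute min.commute)
 also have "(\<Sum>i\<in>I. \<Sum>j\<in>I. (w i)^2 / 2 * ?R i j) = (\<Sum>i\<in>I. (w i)^2 / 2 * (\<Sum>j\<in>I. ?R i j))"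
  by (simp add: sum_distrib_left)
 also have "... <= (\<Sum>i\<in>I. (w i)^2 / 2 * (2 * suminf R))"
  by (intro sum_mono mult_left_mono sum_distance_le I R) auto
 finally show ?thesis by (simp add: sum_distrib_left mult_ac)
qed

lemma abs_mult3_le: "abs x * abs y * abs z <= abs x ^ 3 + abs y ^ 3 + abs z ^ 3" for x y z :: real
proof -
 define t where "t = max (abs x) (max (abs y) (abs z))"
 have "abs x * abs y * abs z <= t * t * t" by (intro mult_mono) (auto simp: t_def)
 also have "... = t ^ 3" by (simp add: power3_eq_cube)
 also have "... <= abs x ^ 3 + abs y ^ 3 + abs z ^ 3" by (auto simp: t_def max_def)
 finally show ?thesis .
qed

context poly_mixing
begin

definition S :: "(nat => real) => nat set => 'a => real" where
 "S w I x = (\<Sum>i\<in>I. w i * Y i x)"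

lemma S_measurable [measurable]: "S w I \<in> borel_measurable M" unfolding S_def by measurable

lemma S_gen_measurable: "I \<subseteq> J ==> S w I \<in> borel_measurable (G J)"
 unfolding S_def by (intro borel_measurable_sum borel_measurable_times measurable_gen_measure) auto

lemma S_Un: "finite I ==> finite J ==> I \<inter> J = {} ==> S w (I \<union> J) x = S w I x + S w J x"
 unfolding S_def by (rule sum.union_disjoint)

lemma integrable_S: "I \<subseteq> {1..} ==> integrable M (S w I)"
 unfolding S_def using integrable_Y by (intro int_sum integrable_mult_right) auto

lemma expectation_S: "I \<subseteq> {1..} ==> expectation (S w I) = 0"
 unfolding S_def using integrable_Y mean by (subst LINT_sum) (auto intro!: sum.neutral)

lemma cov_sym:
 assumes "i >= 1" "j >= 1"
 shows "(LINT x|M. Y i x * Y j x) = c (max i j - min i j)"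
 using cov[of i "j - i"] cov[of j "i - j"] assms by (cases "i <= j") (auto simp: mult.commute)

lemma S_square: "(S w I x)^2 = (\<Sum>i\<in>I. \<Sum>j\<in>I. w i * w j * (Y i x * Y j x))"
 unfolding S_def power2_eq_square sum_product by (simp add: mult_ac)

lemma integrable_S_sq: "I \<subseteq> {1..} ==> integrable M (%x. (S w I x)^2)"
 unfolding S_square using integrable_mult by (intro int_sum integrable_mult_right) (auto simp: subset_iff)

lemma expectation_S_sq:
 assumes "I \<subseteq> {1..}"
 shows "(LINT x|M. (S w I x)^2) = (\<Sum>i\<in>I. \<Sum>j\<in>I. w i * w j * c (max i j - min i j))"
proof -
 have i: "integrable M (%x. w i * w j * (Y i x * Y j x))" if "i \<in> I" "j \<in> I" for i j
  using that assms by (intro integrable_mult_right integrable_mult) auto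
 have "(LINT x|M. (S w I x)^2) = (\<Sum>i\<in>I. \<Sum>j\<in>I. w i * w j * (LINT x|M. Y i x * Y j x))"
  unfolding S_square using i by (simp add: LINT_sum int_sum)
 thus ?thesis using assms by (auto intro!: sum.cong simp: cov_sym subset_iff)
qed

lemma autocovariance_le:
 assumes "k >= 1"
 shows "abs (c k) <= (4 * C + K^2 + 4 * K) * inverse (real k ^ 4)"
proof -
 have "lam * (p - 2) = lam * (p - 4) + 2 * lam" by (simp add: algebra_simps)
 hence "lam * (p - 2) >= 4" using lam by simp
 hence "real k powr (- (lam * (p - 2))) <= real k powr (- 4)" using assms by (intro powr_mono) auto
 also have "... = inverse (real k ^ 4)" using assms by (simp add: powr_minus powr_numeral)
 finally have "(4 * C + K^2 + 4 * K) * real k powr (- (lam * (p - 2))) <= (4 * C + K^2 + 4 * K) * inverse (real k ^ 4)"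
  using C K by (intro mult_left_mono) auto
 thus ?thesis using autocovariance_bound[OF assms] by linarith
qed

lemma summable_abs_c: "summable (%k. abs (c k))"
proof (rule summable_comparison_test')
 show "summable (%k. (4 * C + K^2 + 4 * K) * inverse (real k ^ 4))"
  by (intro summable_mult inverse_power_summable) auto
qed (use autocovariance_le in \<open>auto\<close>)

lemma S_variance_le:
 assumes "finite I" "I \<subseteq> {1..}"
 shows "(LINT x|M. (S w I x)^2) <= 2 * (\<Sum>k. abs (c k)) * (\<Sum>i\<in>I. (w i)^2)"
 unfolding expectation_S_sq[OF assms(2)]
 using double_sum_bound[OF assms(1), of "%k. abs (c k)" "%i j. c (max i j - min i j)" w] summable_abs_c by auto

text \<open>The decay estimate speaks about positive lags only. At lag 0 the kernel is a fourth
  moment minus 1, which is bounded by 2 K + 1.\<close>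

definition sq_cov_sum :: real where
 "sq_cov_sum = (\<Sum>k. if k = 0 then 2 * K + 1 else (4 * C + 8 * K) * inverse (real k ^ 2))"

lemma sum_squares_variance_le:
 assumes "finite I" "I \<subseteq> {1..}"
 shows "integrable M (%y. (\<Sum>i\<in>I. w i * ((Y i y)^2 - 1))^2)"
  "(LINT y|M. (\<Sum>i\<in>I. w i * ((Y i y)^2 - 1))^2) <= 2 * sq_cov_sum * (\<Sum>i\<in>I. (w i)^2)"
proof -
 define R where "R k = (if k = 0 then 2 * K + 1 else (4 * C + 8 * K) * inverse (real k ^ 2))" for k :: nat
 define r where "r i j = (LINT x|M. (Y i x)^2 * (Y j x)^2) - 1" for i j
 have iq: "integrable M (%x. (Y i x)^2 * (Y j x)^2)" if "i >= 1" "j >= 1" for i j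
  by (rule int_bound[OF int_add[OF integrable_power(1)[of i 4] integrable_power(1)[of j 4]]])
    (use that abs_mult_le_squares[of "(Y i _)^2" "(Y j _)^2"] in \<open>auto intro!: AE_I2\<close>)
 have eq: "(\<Sum>i\<in>I. w i * ((Y i y)^2 - 1))^2 =
  (\<Sum>i\<in>I. \<Sum>j\<in>I. w i * w j * ((Y i y)^2 * (Y j y)^2 - (Y i y)^2 - (Y j y)^2 + 1))" for y
  unfolding power2_eq_square[of "sum _ _"] sum_product by (simp add: algebra_simps)
 have i1: "integrable M (%y. w i * w j * ((Y i y)^2 * (Y j y)^2 - (Y i y)^2 - (Y j y)^2 + 1))"
  if "i \<in> I" "j \<in> I" for i j
  using that assms integrable_sq[of i] integrable_sq[of j] iq[of i j] by (auto simp: subset_iff)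
 show "integrable M (%y. (\<Sum>i\<in>I. w i * ((Y i y)^2 - 1))^2)" unfolding eq by (intro int_sum i1)
 let ?a = "LINT y|M. (\<Sum>i\<in>I. w i * ((Y i y)^2 - 1))^2"
 have "?a = (\<Sum>i\<in>I. \<Sum>j\<in>I. (LINT y|M. w i * w j * ((Y i y)^2 * (Y j y)^2 - (Y i y)^2 - (Y j y)^2 + 1)))"
  unfolding eq using i1 by (simp add: LINT_sum int_sum)
 also have "... = (\<Sum>i\<in>I. \<Sum>j\<in>I. w i * w j * r i j)"
 proof (intro sum.cong refl)
  fix i j assume ij: "i \<in> I" "j \<in> I"
  hence "i >= 1" "j >= 1" using assms by auto
  thus "(LINT y|M. w i * w j * ((Y i y)^2 * (Y j y)^2 - (Y i y)^2 - (Y j y)^2 + 1)) = w i * w j * r i j"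
   using integrable_sq[of i] integrable_sq[of j] iq[of i j] expectation_sq[of i] expectation_sq[of j]
   by (simp add: r_def prob_space)
 qed
 also have "... <= 2 * suminf R * (\<Sum>i\<in>I. (w i)^2)"
 proof (rule order_trans[OF abs_ge_self double_sum_bound[OF assms(1)]])
  show "0 <= R k" for k using C K by (auto simp: R_def)
  have "summable (%k. (4 * C + 8 * K) * inverse (real k ^ 2))"
   by (intro summable_mult inverse_power_summable) auto
  thus "summable R"
   by (rule summable_cong[THEN iffD1, rotated]) (auto simp: R_def eventually_at_top_linorder intro!: exI[of _ 1])
  fix i j assume ij: "i \<in> I" "j \<in> I"
  hence ge: "i >= 1" "j >= 1" using assms by auto
  have sb: "abs (r i j) <= R (j - i)" if "i <= j" "i >= 1" for i j
  proof (cases "i = j")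
   case True
   have "0 <= (LINT x|M. (Y i x)^2 * (Y i x)^2)" by simp
   moreover have "(LINT x|M. (Y i x)^2 * (Y i x)^2) <= 2 * K"
    using integrable_power(2)[of i 4] that by (simp add: power4_eq_xxxx power2_eq_square mult.assoc)
   ultimately have "abs ((LINT x|M. (Y i x)^2 * (Y i x)^2) - 1) <= 2 * K + 1" using K by linarith
   thus ?thesis using True by (simp add: r_def R_def)
  next
   case False
   hence k: "j - i >= 1" using that by auto
   have "abs (r i j) <= (4 * C + 8 * K) * real (j - i) powr (- (lam * (p - 4)))"
    using sq_covariance_bound[OF k, of i] that by (simp add: r_def)
   also have "... <= (4 * C + 8 * K) * real (j - i) powr (- 2)"
    using C K k lam by (intro mult_left_mono powr_mono) auto
   also have "real (j - i) powr (- 2) = inverse (real (j - i) ^ 2)"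
    using k by (simp add: powr_minus powr_numeral)
   finally show ?thesis using k by (auto simp: R_def)
  qed
  show "abs (r i j) <= R (max i j - min i j)"
  proof (cases "i <= j")
   case True thus ?thesis using sb ge by auto
  next
   case False thus ?thesis using sb[of j i] ge by (auto simp: r_def mult.commute)
  qed
 qed
 finally show "?a <= 2 * sq_cov_sum * (\<Sum>i\<in>I. (w i)^2)" by (simp add: R_def[abs_def] sq_cov_sum_def)
qed

lemma integrable_triple:
 assumes "i >= 1" "j >= 1" "k >= 1"
 shows "integrable M (%x. abs (Y i x) * abs (Y j x) * abs (Y k x))"
  and "(LINT x|M. abs (Y i x) * abs (Y j x) * abs (Y k x)) <= 6 * K"
proof -
 have i: "integrable M (%x. abs (Y i x) ^ 3 + abs (Y j x) ^ 3 + abs (Y k x) ^ 3)"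
  using assms by (intro int_add integrable_power) auto
 show i3: "integrable M (%x. abs (Y i x) * abs (Y j x) * abs (Y k x))"
  by (rule int_bound[OF i]) (use abs_mult3_le in \<open>auto intro!: AE_I2 simp: abs_mult\<close>)
 let ?a = "LINT x|M. abs (Y i x) * abs (Y j x) * abs (Y k x)"
 have "?a <= (LINT x|M. abs (Y i x) ^ 3 + abs (Y j x) ^ 3 + abs (Y k x) ^ 3)"
  by (intro integral_mono i i3 abs_mult3_le)
 also have "... = (LINT x|M. abs (Y i x) ^ 3) + (LINT x|M. abs (Y j x) ^ 3) + (LINT x|M. abs (Y k x) ^ 3)"
  using integrable_power(1)[of i 3] integrable_power(1)[of j 3] integrable_power(1)[of k 3] assms by simp
 also have "... <= 6 * K"
  using integrable_power(2)[of i 3] integrable_power(2)[of j 3] integrable_power(2)[of k 3] assms by simp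
 finally show "?a <= 6 * K" .
qed

text \<open>Crude moments that ignore the dependence. They serve the Taylor remainders in Stein's
  equation, where the sum runs over a short window only.\<close>

lemma abs_sum_moments:
 assumes J: "finite J" "J \<subseteq> {1..}" and i: "i >= 1"
 defines "Q \<equiv> %x. \<Sum>j\<in>J. abs (Y j x)"
 shows "integrable M Q" "expectation Q <= 2 * K * card J"
  "integrable M (%x. abs (Y i x) * (Q x)^2)" "(LINT x|M. abs (Y i x) * (Q x)^2) <= 6 * K * (real (card J))^2"
proof -
 have J1: "j >= 1" if "j \<in> J" for j using that J by auto
 show "integrable M Q" unfolding Q_def using integrable_Y J1 by (intro int_sum integrable_abs) auto
 have "expectation Q = (\<Sum>j\<in>J. (LINT x|M. abs (Y j x)))"
  unfolding Q_def using integrable_Y J1 by (intro LINT_sum integrable_abs) auto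
 also have "... <= (\<Sum>j\<in>J. 2 * K)" using integrable_power(2)[of _ 1] J1 by (intro sum_mono) auto
 finally show "expectation Q <= 2 * K * card J" by (simp add: mult_ac)
 have eq: "abs (Y i x) * (Q x)^2 = (\<Sum>j\<in>J. \<Sum>k\<in>J. abs (Y i x) * abs (Y j x) * abs (Y k x))" for x
  unfolding Q_def power2_eq_square sum_product by (simp add: sum_distrib_left mult_ac)
 have it: "integrable M (%x. abs (Y i x) * abs (Y j x) * abs (Y k x))" if "j \<in> J" "k \<in> J" for j k
  using that J1 i by (intro integrable_triple) auto
 show "integrable M (%x. abs (Y i x) * (Q x)^2)" unfolding eq using it by (intro int_sum) auto
 have "(LINT x|M. abs (Y i x) * (Q x)^2) = (\<Sum>j\<in>J. \<Sum>k\<in>J. (LINT x|M. abs (Y i x) * abs (Y j x) * abs (Y k x)))"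
  unfolding eq using it by (simp add: LINT_sum int_sum)
 also have "... <= (\<Sum>j\<in>J. \<Sum>k\<in>J. 6 * K)"
  using J1 i by (intro sum_mono integrable_triple) auto
 finally show "(LINT x|M. abs (Y i x) * (Q x)^2) <= 6 * K * (real (card J))^2" by (simp add: power2_eq_square mult_ac)
qed

section \<open>Stein equation for weighted sums\<close>

lemma iexp_1: "cmod (iexp x - 1) <= abs x" using iexp_approx1[of x 0] by simp

lemma iexp_2: "cmod (iexp x - 1 - \<i> * x) <= x^2 / 2"
proof -
 have "(\<Sum>k \<le> 1. (\<i> * x)^k / fact k) = 1 + \<i> * x" by simp
 thus ?thesis using iexp_approx1[of x 1] by (simp add: diff_diff_eq power2_eq_square)
qed

lemma iexp_add: "iexp (x + y) = iexp x * iexp y" by (simp add: exp_add[symmetric] distrib_left)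

text \<open>Covariance of the summand \<open>w i * Y i\<close> with the part of the sum at distance
  at most \<open>m\<close>; it plays the role of the variance in Stein's equation.\<close>

definition near_cov :: "(nat => real) => nat set => nat => nat => real" where
 "near_cov w I m i = (\<Sum>j\<in>{j\<in>I. i <= j + m \<and> j <= i + m}. w i * w j * c (max i j - min i j))"

text \<open>Two nested windows around \<open>i\<close> are left out of the exponent. Expanding over
  the inner one yields the summand alone, which is nearly uncorrelated with the remaining exponent
  because its mean is 0, plus \<open>u\<close> times the summand times the inner sum. That product
  reaches out to distance m, so the window is doubled before it is decorrelated. Finally the full
  exponent is restored. The replacements cost absolute moments of sums over at most 5 m indices,
  whence the term in u^2.\<close>

lemma stein_char_single:
 assumes I: "finite I" "I \<subseteq> {1..}" and i: "i \<in> I" and m: "m >= 1" and W: "!!j. j \<in> I ==> abs (w j) <= W"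
 shows "cmod ((LINT x|M. cpx (w i * Y i x) * iexp (u * S w I x))
   - \<i> * u * near_cov w I m i * (LINT x|M. iexp (u * S w I x)))
  <= W * (48 * C + 2 * K) * real m powr (- (lam * (p - 1)))
   + abs u * (3 * real m * W^2 * (48 * C + 4 * K) * real m powr (- (lam * (p - 2))))
   + u^2 * (1000 * K^2 * (real m)^2 * W ^ 3)"
proof -
 have i1: "i >= 1" using i I by auto
 have W0: "W >= 0" using W[OF i] by (auto intro: order_trans[OF abs_ge_zero])
 \<comment> \<open>\<open>A\<close> is the window of radius m and \<open>B\<close> the ring from m
   to 2 m. \<open>L1\<close>, \<open>R1\<close> and \<open>L2\<close>, \<open>R2\<close> are what is
   left on either side of the window and of the doubled window.\<close>
 define A where "A = {j\<in>I. i <= j + m \<and> j <= i + m}"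
 define B where "B = {j\<in>I. (j + m < i \<or> i + m < j) \<and> i <= j + 2 * m \<and> j <= i + 2 * m}"
 define L1 where "L1 = {j\<in>I. j + m < i}"
 define R1 where "R1 = {j\<in>I. i + m < j}"
 define L2 where "L2 = {j\<in>I. j + 2 * m < i}"
 define R2 where "R2 = {j\<in>I. i + 2 * m < j}"
 have fin [simp]: "finite A" "finite B" "finite L1" "finite R1" "finite L2" "finite R2"
  using I by (auto simp: A_def B_def L1_def R1_def L2_def R2_def)
 define D where "D = S w A"
 define D' where "D' = S w B"
 define X where "X x = w i * Y i x" for x
 define E1 where "E1 x = iexp (u * S w L1 x) * iexp (u * S w R1 x)" for x
 define E2 where "E2 x = iexp (u * S w L2 x) * iexp (u * S w R2 x)" for x
 define E where "E x = iexp (u * S w I x)" for x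
 have meas [measurable]: "D \<in> borel_measurable M" "D' \<in> borel_measurable M" "X \<in> borel_measurable M"
  "E1 \<in> borel_measurable M" "E2 \<in> borel_measurable M" "E \<in> borel_measurable M"
  unfolding D_def D'_def X_def E1_def E2_def E_def by measurable
 let ?i = "L1 \<union> R1"
 have S1: "S w I x = D x + (S w L1 x + S w R1 x)" for x
 proof -
  have "I = A \<union> ?i" by (auto simp: A_def L1_def R1_def)
  hence "S w I x = S w (A \<union> ?i) x" by simp
  also have "... = D x + S w ?i x"
   unfolding D_def by (intro S_Un fin finite_UnI) (auto simp: A_def L1_def R1_def)
  also have "S w ?i x = S w L1 x + S w R1 x" by (intro S_Un fin) (auto simp: L1_def R1_def)
  finally show ?thesis .
 qed
 have S2: "S w L1 x + S w R1 x = D' x + (S w L2 x + S w R2 x)" for x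
 proof -
  have "L1 \<union> R1 = B \<union> (L2 \<union> R2)" by (auto simp: B_def L1_def R1_def L2_def R2_def)
  hence "S w ?i x = S w (B \<union> (L2 \<union> R2)) x" by simp
  also have "... = D' x + S w (L2 \<union> R2) x"
   unfolding D'_def by (intro S_Un fin finite_UnI) (auto simp: B_def L2_def R2_def)
  also have "S w (L2 \<union> R2) x = S w L2 x + S w R2 x" by (intro S_Un fin) (auto simp: L2_def R2_def)
  also have "S w ?i x = S w L1 x + S w R1 x" by (intro S_Un fin) (auto simp: L1_def R1_def)
  finally show ?thesis .
 qed
 have EE1: "E x = iexp (u * D x) * E1 x" for x
  unfolding E_def E1_def S1 by (simp only: iexp_add[symmetric] distrib_left)
 have EE2: "E1 x = iexp (u * D' x) * E2 x" for x
  unfolding E1_def E2_def iexp_add[symmetric] distrib_left[symmetric] S2 ..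
 have n1: "cmod (E1 x) = 1" "cmod (E2 x) = 1" "cmod (E x) = 1" for x
  by (auto simp: E1_def E2_def E_def norm_mult)
 define J where "J = A \<union> B"
 have J: "finite J" "J \<subseteq> {1..}" using I by (auto simp: J_def A_def B_def)
 define Q where "Q x = (\<Sum>j\<in>J. abs (Y j x))" for x
 have [measurable]: "Q \<in> borel_measurable M" unfolding Q_def by measurable
 have cardJ: "card J <= 5 * m"
 proof -
  have "card J <= card {i - 2 * m..i + 2 * m}" by (intro card_mono) (auto simp: J_def A_def B_def)
  also have "... <= 4 * m + 1" by simp
  finally show ?thesis using m by simp
 qed
 have cardA: "card A <= 3 * m"
 proof -
  have "card A <= card {i - m..i + m}" by (intro card_mono) (auto simp: A_def)
  also have "... <= 2 * m + 1" by simp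
  finally show ?thesis using m by simp
 qed
 have SQ: "abs (S w H x) <= W * Q x" if "H \<subseteq> J" for H x
 proof -
  have "abs (S w H x) <= (\<Sum>j\<in>H. W * abs (Y j x))"
   unfolding S_def using W that by (intro order_trans[OF sum_abs] sum_mono) (auto simp: abs_mult J_def A_def B_def intro!: mult_right_mono)
  also have "... <= (\<Sum>j\<in>J. W * abs (Y j x))" using J that W0 by (intro sum_mono2) auto
  finally show ?thesis by (simp add: Q_def sum_distrib_left)
 qed
 have DQ: "abs (D x) <= W * Q x" "abs (D' x) <= W * Q x" "abs (D x + D' x) <= W * Q x" for x
 proof -
  show "abs (D x) <= W * Q x" "abs (D' x) <= W * Q x" unfolding D_def D'_def by (auto intro!: SQ simp: J_def)
  have "D x + D' x = S w J x" unfolding D_def D'_def J_def by (intro S_Un[symmetric] fin) (auto simp: A_def B_def)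
  thus "abs (D x + D' x) <= W * Q x" using SQ by auto
 qed
 have XW: "abs (X x) <= W * abs (Y i x)" for x
  unfolding X_def abs_mult using W[OF i] by (intro mult_right_mono) auto
 let ?l = "LINT x|M. abs (Y i x) * (Q x)^2"
 have iQ: "integrable M Q" and eQ: "expectation Q <= 2 * K * (5 * real m)"
  and iYQ: "integrable M (%x. abs (Y i x) * (Q x)^2)"
  and eYQ: "?l <= 6 * K * (25 * (real m)^2)"
 proof -
  note q = abs_sum_moments[OF J i1, folded Q_def]
  show "integrable M Q" "integrable M (%x. abs (Y i x) * (Q x)^2)" using q by auto
  have c: "real (card J) <= 5 * real m" using cardJ by linarith
  show "expectation Q <= 2 * K * (5 * real m)" using q(2) mult_left_mono[OF c, of "2 * K"] K by linarith
  have "(real (card J))^2 <= (5 * real m)^2" using c by (intro power_mono) auto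
  hence "6 * K * (real (card J))^2 <= 6 * K * (25 * (real m)^2)"
   using K by (intro mult_left_mono) (auto simp: power_mult_distrib)
  thus "?l <= 6 * K * (25 * (real m)^2)" using q(4) by linarith
 qed
 \<comment> \<open>One bound for both Taylor remainders: a summand times the square of the absolute
   sum over the doubled window.\<close>
 define eQ3 where "eQ3 = W ^ 3 * ?l"
 have eQ3: "eQ3 <= 150 * K * (real m)^2 * W ^ 3" "0 <= eQ3"
  unfolding eQ3_def using mult_left_mono[OF eYQ, of "W ^ 3"] W0 by (auto simp: mult_ac)
 have bound3: "cmod (expectation F) <= eQ3 * b"
  if "F \<in> borel_measurable M" "!!x. cmod (F x) <= b * (abs (X x) * (W * Q x)^2)" "b >= 0" for F b
 proof -
  have le: "b * (abs (X x) * (W * Q x)^2) <= b * (W ^ 3 * (abs (Y i x) * (Q x)^2))" for x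
  proof -
   have "abs (X x) * (W * Q x)^2 <= (W * abs (Y i x)) * (W * Q x)^2" using XW by (intro mult_right_mono) auto
   also have "... = W ^ 3 * (abs (Y i x) * (Q x)^2)" by (simp add: power2_eq_square power3_eq_cube mult_ac)
   finally show ?thesis using that(3) by (rule mult_left_mono)
  qed
  have "cmod (expectation F) <= (LINT x|M. cmod (F x))" by (rule integral_norm_bound)
  also have "... <= (LINT x|M. b * (W ^ 3 * (abs (Y i x) * (Q x)^2)))"
   using iYQ that W0 le order_trans[OF that(2) le]
   by (intro integral_mono) (auto intro!: int_bound[OF integrable_mult_right[OF integrable_mult_right[OF iYQ]], of _ b "W^3"] AE_I2)
  also have "... = eQ3 * b" by (simp add: eQ3_def)
  finally show ?thesis .
 qed
 have iX: "integrable M X" unfolding X_def using integrable_Y[OF i1] by simp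
 have iXD: "integrable M (%x. X x * D x)"
 proof -
  have "(%x. X x * D x) = (%x. \<Sum>j\<in>A. w i * w j * (Y i x * Y j x))"
   unfolding X_def D_def S_def sum_distrib_left by (simp add: mult_ac)
  thus ?thesis using i1 I by (auto simp: A_def intro!: int_sum integrable_mult_right integrable_mult)
 qed
 have iB: "integrable M (%x. cpx (F x) * E' x)" if F: "integrable M F" and E': "E' \<in> borel_measurable M" "!!x. cmod (E' x) = 1" for F E'
 proof -
  have [measurable]: "F \<in> borel_measurable M" using F by auto
  note E'(1)[measurable]
  show ?thesis by (rule int_bound[OF F]) (auto simp: norm_mult E' intro!: AE_I2)
 qed
 note ints = iB[OF iX] iB[OF iXD]
 let ?e = "LINT x|M. cpx (X x * D x) * E1 x"
  and ?g = "LINT x|M. cpx (X x) * E1 x"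
 let ?o = "LINT x|M. cpx (X x) * E x"
 \<comment> \<open>Second-order expansion of the exponential of the inner window.\<close>
 have a: "cmod (?o - ?g - \<i> * u * ?e) <= eQ3 * (u^2 / 2)"
 proof -
  have "?o - ?g - \<i> * u * ?e
   = (LINT x|M. cpx (X x) * E x - cpx (X x) * E1 x - \<i> * u * (cpx (X x * D x) * E1 x))"
   using ints n1 meas by (simp del: of_real_mult)
  also have "cmod ... <= eQ3 * (u^2 / 2)"
  proof (rule bound3)
   fix x
   have "cpx (X x) * E x - cpx (X x) * E1 x - \<i> * u * (cpx (X x * D x) * E1 x)
    = cpx (X x) * E1 x * (iexp (u * D x) - 1 - \<i> * (u * D x))" unfolding EE1 by (simp add: algebra_simps)
   also have "cmod ... = abs (X x) * cmod (iexp (u * D x) - 1 - \<i> * (u * D x))" by (simp add: norm_mult n1)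
   also have "... <= abs (X x) * ((u * D x)^2 / 2)" using iexp_2[of "u * D x"] by (intro mult_left_mono) auto
   also have "... = u^2 / 2 * (abs (X x) * (D x)^2)" by (simp add: power_mult_distrib)
   also have "... <= u^2 / 2 * (abs (X x) * (W * Q x)^2)"
    using power_mono[OF DQ(1), of x 2] by (intro mult_left_mono) auto
   finally show "cmod (cpx (X x) * E x - cpx (X x) * E1 x - \<i> * u * (cpx (X x * D x) * E1 x)) <= u^2 / 2 * (abs (X x) * (W * Q x)^2)" .
  qed auto
  finally show ?thesis .
 qed
 let ?c = "(48 * C + 2 * K) * real m powr (- (lam * (p - 1)))"
 have b: "cmod (?g) <= W * ?c"
 proof -
  have sep: "separated m L1 {i}" "separated m {i} R1" "separated m L1 R1"
   using m I i1 by (auto simp: separated_def L1_def R1_def)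
  let ?k = "LINT x|M. cpx (Y i x) * (iexp (u * S w L1 x) * iexp (u * S w R1 x))"
  have "cmod (?k) <= (48 * C + 2 * K) * real m powr (- (lam * (p - 1)))"
   using S_gen_measurable[of L1 L1 w] S_gen_measurable[of R1 R1 w] by (intro decorrelation_single[OF sep]) auto
  hence "cmod (cpx (w i) * ?k) <= W * ?c" using W[OF i] by (intro norm_mult_bound) auto
  thus ?thesis unfolding X_def E1_def by (simp add: mult_ac flip: integral_mult_right_zero)
 qed
 let ?d = "LINT x|M. cpx (X x * D x) * E2 x"
 \<comment> \<open>Doubling the window costs one more factor, the sum over the ring.\<close>
 have cc: "cmod (?e - ?d) <= eQ3 * abs u"
 proof -
  have "?e - ?d = (LINT x|M. cpx (X x * D x) * E1 x - cpx (X x * D x) * E2 x)"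
   using ints n1 meas by (simp del: of_real_mult)
  also have "cmod ... <= eQ3 * abs u"
  proof (rule bound3)
   fix x
   have "cpx (X x * D x) * E1 x - cpx (X x * D x) * E2 x = cpx (X x * D x) * E2 x * (iexp (u * D' x) - 1)"
    unfolding EE2 by (simp add: algebra_simps)
   also have "cmod ... = abs (X x) * abs (D x) * cmod (iexp (u * D' x) - 1)" by (simp add: norm_mult n1 abs_mult)
   also have "... <= abs (X x) * (W * Q x) * (abs u * (W * Q x))"
   proof (intro mult_mono)
    have "cmod (iexp (u * D' x) - 1) <= abs u * abs (D' x)" using iexp_1[of "u * D' x"] by (simp add: abs_mult)
    also have "... <= abs u * (W * Q x)" using DQ by (intro mult_left_mono) auto
    finally show "cmod (iexp (u * D' x) - 1) <= abs u * (W * Q x)" .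
    show "0 <= abs (X x) * (W * Q x)" using W0 by (auto simp: Q_def intro!: mult_nonneg_nonneg sum_nonneg)
   qed (use DQ in auto)
   also have "... = abs u * (abs (X x) * (W * Q x)^2)" by (simp add: power2_eq_square mult_ac)
   finally show "cmod (cpx (X x * D x) * E1 x - cpx (X x * D x) * E2 x) <= abs u * (abs (X x) * (W * Q x)^2)" .
  qed auto
  finally show ?thesis .
 qed
 have XDs: "X x * D x = (\<Sum>j\<in>A. w i * w j * (Y i x * Y j x))" for x
  unfolding X_def D_def S_def sum_distrib_left by (simp add: mult_ac)
 let ?m = "\<Sum>j\<in>A. w i * w j * (LINT x|M. Y i x * Y j x)"
 let ?p = "(48 * C + 4 * K) * real m powr (- (lam * (p - 2)))"
 \<comment> \<open>Summand and inner sum are decorrelated from the outer exponent pair by pair; the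
   surviving expectations add up to \<open>near_cov\<close>.\<close>
 have d: "cmod (?d - near_cov w I m i * expectation E2) <= 3 * real m * W^2 * ?p"
 proof -
  define r where "r = (48 * C + 4 * K) * real m powr (- (lam * (p - 2)))"
  have r0: "r >= 0" using C K by (auto simp: r_def)
  have sep: "separated m L2 A" "separated m A R2" "separated m L2 R2"
   using m I i1 by (auto simp: separated_def L2_def R2_def A_def)
  have iA: "i \<in> A" using i by (auto simp: A_def)
  define g where "g j = (LINT x|M. cpx (Y i x * Y j x) * E2 x) - (LINT x|M. Y i x * Y j x) * expectation E2" for j
  have g: "cmod (g j) <= r" if "j \<in> A" for j unfolding g_def E2_def r_def
   using S_gen_measurable[of L2 L2 w] S_gen_measurable[of R2 R2 w] by (intro decorrelation_pair[OF sep iA that]) auto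
  have ie: "integrable M (%x. cpx (Y i x * Y j x) * E2 x)" if "j \<in> A" for j
   using that i1 I n1 by (intro iB integrable_mult) (auto simp: A_def)
  have "?d - near_cov w I m i * expectation E2 = (\<Sum>j\<in>A. cpx (w i * w j) * g j)"
  proof -
   let ?h = "\<Sum>j\<in>A. cpx (w i * w j) * (LINT x|M. cpx (Y i x * Y j x) * E2 x)"
   have "?d = (LINT x|M. (\<Sum>j\<in>A. cpx (w i * w j) * (cpx (Y i x * Y j x) * E2 x)))"
    unfolding XDs of_real_sum sum_distrib_right by (simp add: mult_ac)
   also have "... = ?h" using ie by (subst LINT_sum) auto
   finally have 1: "?d = ?h" .
   have "near_cov w I m i = ?m"
    unfolding near_cov_def A_def[symmetric] using i1 I by (intro sum.cong refl) (auto simp: A_def cov_sym subset_iff)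
   thus ?thesis unfolding 1 g_def by (simp add: sum_distrib_left right_diff_distrib sum_subtractf mult_ac)
  qed
  also have "cmod ... <= (\<Sum>j\<in>A. W^2 * r)"
  proof (intro sum_norm_le norm_mult_bound g)
   fix j assume "j \<in> A"
   thus "cmod (cpx (w i * w j)) <= W^2"
    using abs_mult_le[OF W[OF i] W[of j]] by (auto simp: A_def power2_eq_square norm_mult abs_mult)
  qed
  also have "... = card A * (W^2 * r)" by simp
  also have "... <= (3 * real m) * (W^2 * r)" using cardA r0 by (intro mult_right_mono mult_nonneg_nonneg) auto
  finally show ?thesis by (simp add: r_def mult_ac)
 qed
 let ?f = "W * (2 * K * (5 * real m))"
 \<comment> \<open>The doubled window returns to the exponent. First moments suffice here, since the
   other factor is nonrandom.\<close>
 have e: "cmod (near_cov w I m i * expectation E2 - near_cov w I m i * expectation E) <= 3 * real m * W^2 * (abs u * ?f)* (2 * K)"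
 proof -
  have "abs (near_cov w I m i) <= (\<Sum>j\<in>A. W^2 * (2 * K))" unfolding near_cov_def A_def[symmetric]
  proof (intro order_trans[OF sum_abs] sum_mono abs_mult_le)
   fix j assume j: "j \<in> A"
   thus "abs (w i * w j) <= W^2" using abs_mult_le[OF W[OF i] W[of j]] by (auto simp: A_def power2_eq_square)
   have j1: "j >= 1" using j I by (auto simp: A_def)
   have "abs (c (max i j - min i j)) = abs (LINT x|M. Y i x * Y j x)" using cov_sym[OF i1 j1] by simp
   also have "... <= (LINT x|M. abs (Y i x * Y j x))" by (rule integral_abs_bound)
   also have "... <= (LINT x|M. (Y i x)^2 + (Y j x)^2)"
    using i1 j1 integrable_sq integrable_mult by (intro integral_mono abs_mult_le_squares) auto
   also have "... = 2" using i1 j1 integrable_sq expectation_sq by simp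
   finally show "abs (c (max i j - min i j)) <= 2 * K" using K by simp
  qed
  also have "... <= (3 * real m) * (W^2 * (2 * K))"
   unfolding sum_constant using cardA K by (intro mult_right_mono mult_nonneg_nonneg) auto
  finally have 1: "cmod (cpx (near_cov w I m i)) <= (3 * real m) * (W^2 * (2 * K))" by simp
  have "expectation E2 - expectation E = (LINT x|M. E2 x - E x)"
   using n1 by (intro LINT_diff[symmetric] integrable_bounded[of _ 1]) auto
  also have "cmod ... <= (LINT x|M. cmod (E2 x - E x))" by (rule integral_norm_bound)
  also have "... <= (LINT x|M. abs u * (W * Q x))"
  proof (intro integral_mono)
   show "integrable M (%x. cmod (E2 x - E x))"
    using n1 by (intro integrable_norm int_diff integrable_bounded[of _ 1]) auto
   fix x
   have "E x = iexp (u * (D x + D' x)) * E2 x" unfolding EE1 EE2 by (simp only: distrib_left iexp_add mult.assoc)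
   hence "E2 x - E x = - (E2 x * (iexp (u * (D x + D' x)) - 1))" by (simp add: algebra_simps)
   hence "cmod (E2 x - E x) = cmod (iexp (u * (D x + D' x)) - 1)" by (simp add: norm_mult n1)
   also have "... <= abs u * abs (D x + D' x)" using iexp_1[of "u * (D x + D' x)"] by (simp add: abs_mult)
   also have "... <= abs u * (W * Q x)" using DQ by (intro mult_left_mono) auto
   finally show "cmod (E2 x - E x) <= abs u * (W * Q x)" .
  qed (use iQ in auto)
  also have "... <= abs u * ?f" using eQ W0 by (auto intro!: mult_left_mono)
  finally have 2: "cmod (expectation E2 - expectation E) <= abs u * ?f" .
  have "cmod (cpx (near_cov w I m i) * (expectation E2 - expectation E)) <= ((3 * real m) * (W^2 * (2 * K))) * (abs u * ?f)"
   by (rule norm_mult_bound[OF 1 2])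
  thus ?thesis by (simp add: algebra_simps)
 qed
 let ?a = "?o" and ?b = "?g"
  and ?c1 = "?e" and ?c2 = "?d"
  and ?n = "cpx (near_cov w I m i)"
 let ?j = "3 * real m * W^2 * (48 * C + 4 * K) * real m powr (- (lam * (p - 2)))"
 have "?a - \<i> * u * ?n * expectation E = (?a - ?b - \<i> * u * ?c1) + ?b + \<i> * u * (?c1 - ?c2 + (?c2 - ?n * expectation E2) + (?n * expectation E2 - ?n * expectation E))"
  by (simp add: algebra_simps)
 also have "cmod ... <= eQ3 * (u^2 / 2) + W * ?c
   + abs u * (eQ3 * abs u + 3 * real m * W^2 * ?p + 3 * real m * W^2 * (abs u * ?f)* (2 * K))"
  using a b cc d e
  by (intro order_trans[OF norm_triangle_ineq] add_mono norm_mult_bound) (auto simp: norm_mult)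
 also have "... = W * ?c + abs u * ?j + u^2 * (3 / 2 * eQ3 + 60 * K^2 * (real m)^2 * W ^ 3)"
  by (simp add: algebra_simps power2_eq_square power3_eq_cube)
 \<comment> \<open>The Taylor remainders contribute 225 and the restored window 60;
   \<open>K <= K^2\<close> merges the powers, and 1000 is a round bound.\<close>
 also have "... <= W * ?c + abs u * ?j + u^2 * (1000 * K^2 * (real m)^2 * W ^ 3)"
 proof (intro add_left_mono mult_left_mono)
  have "K * ((real m)^2 * W ^ 3) <= K^2 * ((real m)^2 * W ^ 3)" using K W0 by (intro mult_right_mono) (auto simp: power2_eq_square)
  moreover have "0 <= K * ((real m)^2 * W ^ 3)" using K W0 by auto
  ultimately show "3 / 2 * eQ3 + 60 * K^2 * (real m)^2 * W ^ 3 <= 1000 * K^2 * (real m)^2 * W ^ 3" using eQ3 unfolding mult.assoc by linarith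
 qed auto
 finally show ?thesis unfolding X_def E_def by (simp add: mult_ac)
qed

end

section \<open>Summation of Stein's equation and its solution\<close>

lemma sum_scaled_of_real:
 fixes n :: "nat => real" and u :: real
 shows "(\<Sum>i\<in>I. \<i> * u * n i * z) = \<i> * u * (\<Sum>i\<in>I. n i) * z"
 by (simp only: sum_distrib_left sum_distrib_right of_real_sum)

context poly_mixing begin

lemma stein_char:
 assumes I: "finite I" "I \<subseteq> {1..}" and m: "m >= 1" and W: "!!j. j \<in> I ==> abs (w j) <= W"
 shows "cmod ((LINT x|M. cpx (S w I x) * iexp (u * S w I x))
   - \<i> * u * (\<Sum>i\<in>I. near_cov w I m i) * (LINT x|M. iexp (u * S w I x)))
  <= card I * (W * (48 * C + 2 * K) * real m powr (- (lam * (p - 1)))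
   + abs u * (3 * real m * W^2 * (48 * C + 4 * K) * real m powr (- (lam * (p - 2))))
   + u^2 * (1000 * K^2 * (real m)^2 * W ^ 3))"
proof -
 define F where "F i = (LINT x|M. cpx (w i * Y i x) * iexp (u * S w I x)) - \<i> * u * near_cov w I m i * (LINT x|M. iexp (u * S w I x))" for i
 define R where "R = W * (48 * C + 2 * K) * real m powr (- (lam * (p - 1)))
   + abs u * (3 * real m * W^2 * (48 * C + 4 * K) * real m powr (- (lam * (p - 2))))
   + u^2 * (1000 * K^2 * (real m)^2 * W ^ 3)"
 let ?E = "%x. iexp (u * S w I x)"
 have i: "integrable M (%x. cpx (w i * Y i x) * ?E x)" if "i \<in> I" for i
 proof (rule int_bound)
  show "integrable M (%x. w i * Y i x)" using that I by (intro integrable_mult_right integrable_Y) auto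
  show "AE x in M. norm (cpx (w i * Y i x) * ?E x) <= norm (w i * Y i x)"
   by (intro AE_I2) (simp add: norm_mult)
 qed auto
 have 1: "(LINT x|M. cpx (S w I x) * ?E x) = (\<Sum>i\<in>I. (LINT x|M. cpx (w i * Y i x) * ?E x))"
 proof -
  have "cpx (S w I x) * ?E x = (\<Sum>i\<in>I. cpx (w i * Y i x) * ?E x)" for x
   unfolding sum_distrib_right[symmetric] by (simp only: S_def of_real_sum)
  thus ?thesis using LINT_sum[OF i] by (simp only:)
 qed
 have "(LINT x|M. cpx (S w I x) * ?E x) - \<i> * u * (\<Sum>i\<in>I. near_cov w I m i) * expectation ?E
  = (\<Sum>i\<in>I. (LINT x|M. cpx (w i * Y i x) * ?E x) - \<i> * u * near_cov w I m i * expectation ?E)"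
  by (subst sum_subtractf, subst 1, subst sum_scaled_of_real, rule refl)
 hence eq: "(LINT x|M. cpx (S w I x) * ?E x) - \<i> * u * (\<Sum>i\<in>I. near_cov w I m i) * expectation ?E = (\<Sum>i\<in>I. F i)"
  unfolding F_def .
 have "cmod (F i) <= R" if "i \<in> I" for i
  unfolding F_def R_def by (rule stein_char_single[OF I that m]) (rule W)
 hence "cmod (\<Sum>i\<in>I. F i) <= card I * R" by (rule sum_norm_bound)
 thus ?thesis unfolding eq R_def .
qed

end

text \<open>The integrating factor exp(v w^2 / 2) turns the approximate equation into a bound on a
  derivative. The aim is an error linear in u on the whole half line: against du / u^2 it costs only
  a logarithm, whereas higher powers of u would ruin the bound for large u.\<close>

lemma char_ode:
 fixes ph ph' :: "real => complex"
 assumes deriv: "!!u. (ph has_vector_derivative ph' u) (at u)" and one: "ph 0 = 1"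
  and v: "v > 0" and e: "e0 >= 0" "e1 >= 0" "e2 >= 0"
  and bound: "!!u. u >= 0 ==> cmod (ph' u + u * v * ph u) <= e0 + e1 * u + e2 * u^2"
  and u: "u > 0"
 shows "cmod (ph u - cpx (exp (- v * u^2 / 2))) <= (1 + 1 / v) * (e0 + e1 + e2) * u"
proof -
 define x where "x = v * u^2 / 2"
 \<comment> \<open>\<open>?B\<close> is the antiderivative of a majorant: in the constant part the
   exponential is replaced by its value at the end point, while w exp(v w^2 / 2) integrates exactly
   and leaves the factor 1/v.\<close>
 let ?G = "%w. ph w * cpx (exp (v * w^2 / 2))"
  and ?B = "%w. e0 * exp x * w + (e1 + e2 * u) * (exp (v * w^2 / 2) / v)"
 have "cmod (?G u - ?G 0) <= ?B u - ?B 0"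
 proof (rule differentiable_bound_general[where f' = "%w. (ph' w + w * v * ph w) * cpx (exp (v * w^2 / 2))"
    and \<phi>' = "%w. e0 * exp x + (e1 + e2 * u) * (w * exp (v * w^2 / 2))"])
  show "0 < u" by fact
  have "continuous_on {0..u} ph"
   by (intro continuous_at_imp_continuous_on ballI has_vector_derivative_continuous[OF deriv])
  thus "continuous_on {0..u} ?G" by (intro continuous_intros) auto
  show "continuous_on {0..u} ?B" using v by (intro continuous_intros) auto
  fix w assume w: "0 < w" "w < u"
  show "(?G has_vector_derivative (ph' w + w * v * ph w) * cpx (exp (v * w^2 / 2))) (at w)"
  proof -
   have "((%w. cpx (exp (v * w^2 / 2))) has_vector_derivative cpx (w * v * exp (v * w^2 / 2))) (at w)"
    by (intro has_vector_derivative_of_real) (auto intro!: derivative_eq_intros simp: has_real_derivative_iff_has_vector_derivative[symmetric])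
   from has_vector_derivative_mult[OF deriv this] show ?thesis
    by (rule has_vector_derivative_eq_rhs) (simp add: algebra_simps)
  qed
  show "(?B has_vector_derivative e0 * exp x + (e1 + e2 * u) * (w * exp (v * w^2 / 2))) (at w)"
   unfolding has_real_derivative_iff_has_vector_derivative[symmetric]
   using v by (auto intro!: derivative_eq_intros)
  have "exp (v * w^2 / 2) <= exp x" using w v unfolding x_def by (auto intro!: mult_left_mono power_mono)
  have "cmod ((ph' w + w * v * ph w) * cpx (exp (v * w^2 / 2))) = cmod (ph' w + w * v * ph w) * exp (v * w^2 / 2)"
   by (simp add: norm_mult)
  also have "... <= (e0 + e1 * w + e2 * w^2) * exp (v * w^2 / 2)"
   using bound[of w] w by (intro mult_right_mono) auto
  also have "... = e0 * exp (v * w^2 / 2) + (e1 + e2 * w) * (w * exp (v * w^2 / 2))"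
   by (simp add: algebra_simps power2_eq_square)
  also have "... <= e0 * exp x + (e1 + e2 * u) * (w * exp (v * w^2 / 2))"
   using \<open>exp (v * w\<^sup>2 / 2) <= exp x\<close> e w
   by (intro add_mono mult_left_mono mult_right_mono add_left_mono) auto
  finally show "cmod ((ph' w + w * v * ph w) * cpx (exp (v * w^2 / 2))) <= e0 * exp x + (e1 + e2 * u) * (w * exp (v * w^2 / 2))" .
 qed
 hence G: "cmod (ph u * cpx (exp x) - 1) <= e0 * exp x * u + (e1 + e2 * u) * ((exp x - 1) / v)"
  by (simp add: one x_def diff_divide_distrib right_diff_distrib)
 let ?a = "1 - exp (- x)"
  and ?b = "1 + 1 / v"
 have "ph u - cpx (exp (- v * u^2 / 2)) = (ph u * cpx (exp x) - 1) * cpx (exp (- x))"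
  by (simp add: x_def algebra_simps exp_minus of_real_exp[symmetric])
 hence "cmod (ph u - cpx (exp (- v * u^2 / 2))) = cmod (ph u * cpx (exp x) - 1) * exp (- x)"
  by (simp add: norm_mult)
 also have "... <= (e0 * exp x * u + (e1 + e2 * u) * ((exp x - 1) / v)) * exp (- x)"
  using G by (intro mult_right_mono) auto
 also have "... = e0 * u + (e1 + e2 * u) * (?a / v)"
 proof -
  have a: "exp x * exp (- x) = 1" by (simp add: exp_minus_inverse)
  hence b: "(exp x - 1) * exp (- x) = 1 - exp (- x)" by (simp only: left_diff_distrib mult_1_left)
  have "(e0 * E * u + (e1 + e2 * u) * ((E - 1) / v)) * F = e0 * u * (E * F) + (e1 + e2 * u) * ((E - 1) * F / v)" for E F
   using v by (simp add: field_simps)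
  from this[of "exp x" "exp (- x)"] show ?thesis unfolding a b by simp
 qed
 also have "... <= e0 * (u * ?b) + (e1 * (u * ?b) + e2 * (u * ?b))"
 proof -
  have 1: "?a / v <= 1 / v" using v by (intro divide_right_mono) auto
  have "1 - exp (- x) <= x" using exp_ge_add_one_self[of "- x"] by simp
  hence "?a / v <= x / v" using v by (intro divide_right_mono) auto
  also have "x / v = u^2 / 2" using v by (simp add: x_def)
  finally have 2: "?a / v <= u^2 / 2" .
  \<comment> \<open>For u <= 1 the bound u^2 / 2 is at most u; for larger u the bound 1 / v is at
    most u / v.\<close>
  have 3: "?a / v <= u * ?b"
  proof (cases "u <= 1")
   case True
   hence "u^2 / 2 <= u" using u by (simp add: power2_eq_square field_simps)
   moreover have "u * (1 / v) >= 0" using u v by simp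
   ultimately show ?thesis using 2 unfolding distrib_left mult_1_right by linarith
  next
   case False
   hence "1 / v <= u * (1 / v)" using v by (simp add: divide_right_mono)
   thus ?thesis using 1 u by (simp add: distrib_left)
  qed
  have 4: "u * (?a / v) <= u * ?b" using 1 u by (intro mult_left_mono) (auto intro: order_trans)
  have 5: "u <= u * ?b" using u v by (simp add: distrib_left)
  have "e0 * u <= e0 * (u * ?b)" using 5 e by (intro mult_left_mono) auto
  moreover have "(e1 + e2 * u) * (?a / v) = e1 * (?a / v) + e2 * (u * (?a / v))"
   by (simp only: distrib_right mult.assoc)
  moreover have "e1 * (?a / v) <= e1 * (u * ?b)" using 3 e by (intro mult_left_mono) auto
  moreover have "e2 * (u * (?a / v)) <= e2 * (u * ?b)" using 4 e by (rule_tac mult_left_mono) auto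
  ultimately show ?thesis by linarith
 qed
 also have "... = ?b * (e0 + e1 + e2) * u" by (simp add: algebra_simps add_divide_distrib)
 finally show ?thesis .
qed

context prob_space
begin

text \<open>The second-order Taylor remainder is at most h^2 X^2 / 2, so two moments give
  differentiability with an explicit error.\<close>

lemma char_has_derivative:
 assumes X: "integrable M X" and X2: "integrable M (%x. (X x)^2)"
 shows "((%u. (LINT x|M. iexp (u * X x))) has_vector_derivative (\<i> * (LINT x|M. cpx (X x) * iexp (u * X x)))) (at u)"
proof -
 let ?ph = "%u. (LINT x|M. iexp (u * X x))" and ?d = "\<i> * (LINT x|M. cpx (X x) * iexp (u * X x))"
 have [measurable]: "X \<in> borel_measurable M" using X by auto
 have i1: "integrable M (%x. iexp (v * X x))" for v by (intro integrable_const_bound[of _ 1]) auto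
 have i2: "integrable M (%x. cpx (X x) * iexp (u * X x))" by (rule int_bound[OF X]) (auto simp: norm_mult)
 define R where "R h x = iexp ((u + h) * X x) - iexp (u * X x) - \<i> * h * (cpx (X x) * iexp (u * X x))" for h x
 note i3 = int_diff[OF i1 i1] integrable_mult_right[OF i2]
 have iR: "integrable M (R h)" for h unfolding R_def[abs_def] by (rule int_diff[OF i3(1) i3(2)])
 have eR: "?ph (u + h) - ?ph u - h *\<^sub>R ?d = expectation (R h)" for h
 proof -
  have "expectation (R h) = ?ph (u + h) - ?ph u - (LINT x|M. \<i> * h * (cpx (X x) * iexp (u * X x)))"
   unfolding R_def[abs_def] LINT_diff[OF i3(1) i3(2)] LINT_diff[OF i1 i1] ..
  also have "(LINT x|M. \<i> * h * (cpx (X x) * iexp (u * X x))) = \<i> * h * (LINT x|M. cpx (X x) * iexp (u * X x))"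
   by (rule integral_mult_right_zero)
  also have "... = h *\<^sub>R ?d" by (simp add: scaleR_conv_of_real)
  finally show ?thesis by simp
 qed
 have R_le: "cmod (R h x) <= h^2 / 2 * (X x)^2" for h x
 proof -
  have "R h x = iexp (u * X x) * (iexp (h * X x) - 1 - \<i> * (h * X x))"
   unfolding R_def by (simp add: algebra_simps exp_add)
  moreover have "(\<Sum>k \<le> 1. (\<i> * cpx y)^k / fact k) = 1 + \<i> * y" for y by simp
  ultimately have "cmod (R h x) <= (h * X x)^2 / 2"
   using iexp_approx1[of "h * X x" 1] by (simp add: diff_diff_eq power2_eq_square norm_mult)
  thus ?thesis by (simp add: power_mult_distrib)
 qed
 let ?a = "LINT x|M. (X x)^2"
 have b: "cmod (?ph (u + h) - ?ph u - h *\<^sub>R ?d) <= h^2 / 2 * ?a" for h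
 proof -
  have "cmod (expectation (R h)) <= (LINT x|M. cmod (R h x))" by (rule integral_norm_bound)
  also have "... <= (LINT x|M. h^2 / 2 * (X x)^2)"
   by (rule integral_mono[OF integrable_norm[OF iR] integrable_mult_right[OF X2] R_le])
  also have "... = h^2 / 2 * ?a" by simp
  finally show ?thesis unfolding eR .
 qed
 show ?thesis unfolding has_vector_derivative_def has_derivative_at
 proof (intro conjI bounded_linear_scaleR_left)
  show "(%h. norm (?ph (u + h) - ?ph u - h *\<^sub>R ?d) / norm h) \<midarrow>0\<rightarrow> 0"
  proof (rule Lim_null_comparison)
   show "((%h. abs h / 2 * ?a) \<longlongrightarrow> 0) (at 0)" by (rule tendsto_eq_intros refl | simp)+
   have "norm (norm (?ph (u + h) - ?ph u - h *\<^sub>R ?d) / norm h) <= abs h / 2 * ?a" if "h ~= 0" for h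
    using b[of h] that by (simp add: divide_le_eq power2_eq_square mult_ac)
   thus "\<forall>\<^sub>F h in at 0. norm (norm (?ph (u + h) - ?ph u - h *\<^sub>R ?d) / norm h) <= abs h / 2 * ?a"
    by (auto simp: eventually_at_filter)
  qed
 qed
qed

end

section \<open>Total variation and the long run variance of weighted sums\<close>

definition tv :: "(nat => real) => nat => real" where
 "tv w n = (\<Sum>i=1..n. (abs (w (Suc i) - w i)))"

text \<open>A shift by k is made of k unit shifts, and as the weights vanish beyond \<open>n\<close>
  the shifted sums meet no increments outside \<open>tv\<close>, whose last term is the jump to 0
  after \<open>n\<close>.\<close>

lemma sum_shift_le_tv:
 assumes z: "!!i. i \<notin> {1..n} ==> w i = 0"
 shows "(\<Sum>i=1..n. (abs (w (i + k) - w i))) <= real k * tv w n"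
proof (induction k)
 case (Suc k)
 have "(\<Sum>i=1..n. (abs (w (Suc (i + k)) - w (i + k)))) = (\<Sum>i\<in>(%i. i + k) ` {1..n}. abs (w (Suc i) - w i))"
  by (subst sum.reindex) (auto simp: inj_on_def)
 also have "... = (\<Sum>i\<in>(%i. i + k) ` {1..n} \<inter> {1..n}. abs (w (Suc i) - w i))"
  using z by (intro sum.mono_neutral_right) auto
 also have "... <= tv w n" unfolding tv_def by (intro sum_mono2) auto
 finally have 1: "(\<Sum>i=1..n. (abs (w (Suc (i + k)) - w (i + k)))) <= tv w n" .
 have "(\<Sum>i=1..n. (abs (w (i + Suc k) - w i))) <= (\<Sum>i=1..n. (abs (w (Suc (i + k)) - w (i + k))) + abs (w (i + k) - w i))"
  by (intro sum_mono) auto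
 thus ?case using 1 Suc by (simp add: sum.distrib algebra_simps)
qed auto

context poly_mixing
begin

definition kappa2 :: real where
 "kappa2 = 1 + 2 * (\<Sum>k. c (Suc k))"

text \<open>The sum over pairs at distance at most m is reorganised by lag; the two sides of the
  diagonal agree by symmetry.\<close>

lemma sum_near_cov:
 assumes I: "I \<subseteq> {1..n}" and z: "!!i. i \<notin> I ==> w i = 0"
 shows "(\<Sum>i\<in>I. near_cov w I m i) = (\<Sum>i\<in>I. (w i)^2) + 2 * (\<Sum>k=1..m. c k * (\<Sum>i\<in>I. w i * w (i + k)))"
proof -
 have fin: "finite I" using I finite_subset by blast
 let ?f = "%i j. w i * w j * c (max i j - min i j)"
 have inner: "(\<Sum>j\<in>I. if i < j \<and> j <= i + m then ?f i j else 0) = (\<Sum>k=1..m. c k * (w i * w (i + k)))" for i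
 proof -
  have "(\<Sum>j\<in>I. if i < j \<and> j <= i + m then ?f i j else 0) = (\<Sum>j\<in>{j\<in>I. i < j \<and> j <= i + m}. ?f i j)"
   using fin by (intro sum.inter_filter[symmetric])
  \<comment> \<open>Outside \<open>I\<close> the weights vanish, so the inner sum may run over the
    full window.\<close>
  also have "... = (\<Sum>j\<in>{i+1..i+m}. ?f i j)" using z by (intro sum.mono_neutral_left) auto
  also have "... = (\<Sum>j\<in>(%k. i + k) ` {1..m}. ?f i j)"
   by (intro sum.cong) (auto simp: image_iff intro: bexI[of _ "_ - i"])
  also have "... = (\<Sum>k=1..m. c k * (w i * w (i + k)))"
   by (subst sum.reindex) (auto simp: inj_on_def mult_ac max_def min_def intro!: sum.cong)
  finally show ?thesis .
 qed
 have "near_cov w I m i = (\<Sum>j\<in>I. if i <= j + m \<and> j <= i + m then ?f i j else 0)" for i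
  unfolding near_cov_def using fin by (intro sum.inter_filter)
 hence "(\<Sum>i\<in>I. near_cov w I m i) = (\<Sum>i\<in>I. \<Sum>j\<in>I. if i <= j + m \<and> j <= i + m then ?f i j else 0)" by simp
 also have "... = (\<Sum>i\<in>I. \<Sum>j\<in>I. (if i = j then (w i)\<^sup>2 else 0) + (if i < j \<and> j <= i + m then ?f i j else 0) + (if j < i \<and> i <= j + m then ?f j i else 0))"
  using c0 by (intro sum.cong refl) (auto simp: power2_eq_square max_def min_def mult.commute)
 also have "... = (\<Sum>i\<in>I. (w i)^2) + (\<Sum>i\<in>I. \<Sum>j\<in>I. if i < j \<and> j <= i + m then ?f i j else 0) + (\<Sum>i\<in>I. \<Sum>j\<in>I. if j < i \<and> i <= j + m then ?f j i else 0)"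
  using fin by (simp add: sum.distrib)
 also have "(\<Sum>i\<in>I. \<Sum>j\<in>I. if j < i \<and> i <= j + m then ?f j i else 0) = (\<Sum>i\<in>I. \<Sum>j\<in>I. if i < j \<and> j <= i + m then ?f i j else 0)"
  by (rule sum.swap)
 also have "(%i. \<Sum>j\<in>I. if i < j \<and> j <= i + m then ?f i j else 0) = (%i. \<Sum>k=1..m. c k * (w i * w (i + k)))"
  using inner by (rule ext)
 also have "(\<Sum>i\<in>I. \<Sum>k=1..m. c k * (w i * w (i + k))) = (\<Sum>k=1..m. c k * (\<Sum>i\<in>I. w i * w (i + k)))"
  by (subst sum.swap) (simp add: sum_distrib_left)
 finally show ?thesis by simp
qed

definition cov_first_moment :: real where
 "cov_first_moment = (\<Sum>k. real k * abs (c k))"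

definition cov_const :: real where
 "cov_const = 4 * C + K^2 + 4 * K"

lemma cov_const_pos: "cov_const > 0" unfolding cov_const_def using C K by (simp add: add_nonneg_pos)

lemma summable_cov_first_moment: "summable (%k. real k * abs (c k))"
proof (rule summable_comparison_test')
 show "summable (%k. cov_const * inverse (real k ^ 3))" by (intro summable_mult inverse_power_summable) auto
 fix k :: nat assume k: "k >= 1"
 have "real k * abs (c k) <= real k * (cov_const * inverse (real k ^ 4))"
  using autocovariance_le[OF k] by (intro mult_left_mono) (auto simp: cov_const_def)
 also have "... = cov_const * inverse (real k ^ 3)"
  using k by (simp add: power4_eq_xxxx power3_eq_cube field_simps)
 finally show "norm (real k * abs (c k)) <= cov_const * inverse (real k ^ 3)" by simp
qed

definition zeta2 :: real where "zeta2 = (\<Sum>k. inverse (real k ^ 2))"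

lemma zeta2: "summable (%k. inverse (real k ^ 2))" "zeta2 >= 0"
proof -
 show "summable (%k. inverse (real k ^ 2))" by (intro inverse_power_summable) auto
 thus "zeta2 >= 0" unfolding zeta2_def by (intro suminf_nonneg) auto
qed

lemma cov_tail:
 assumes m: "m >= 1"
 shows "summable (%k. c (Suc k))" "abs ((\<Sum>k. c (Suc k)) - (\<Sum>k=1..m. c k)) <= cov_const * zeta2 * real m powr (2 - lam * (p - 2))"
proof -
 have "summable (%k. abs (c (Suc k)))" using summable_abs_c by (subst summable_Suc_iff)
 thus s: "summable (%k. c (Suc k))" by (rule summable_rabs_cancel)
 let ?a = "2 - lam * (p - 2)"
 have "(\<Sum>k=1..m. c k) = (\<Sum>k<m. c (Suc k))"
  by (rule sum.reindex_bij_witness[of _ Suc "%k. k - 1"]) auto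
 hence "(\<Sum>k. c (Suc k)) - (\<Sum>k=1..m. c k) = (\<Sum>k. c (Suc (k + m)))"
  using suminf_minus_initial_segment[OF s, of m] by simp
 also have "abs ... <= (\<Sum>k. cov_const * real m powr ?a * inverse (real (Suc (k + m)) ^ 2))"
 proof (rule norm_suminf_le[where 'a=real, unfolded real_norm_def])
  have "summable (%k. inverse (real (k + Suc m) ^ 2))" using zeta2(1) by (rule summable_ignore_initial_segment)
  thus "summable (%k. cov_const * real m powr ?a * inverse (real (Suc (k + m)) ^ 2))"
   by (intro summable_mult) simp
  fix k
  let ?k = "Suc (k + m)"
  have "lam * (p - 2) = lam * (p - 4) + 2 * lam" by (simp add: algebra_simps)
  hence l: "lam * (p - 2) >= 4" using lam by simp
  have "abs (c ?k) <= cov_const * real ?k powr (- (lam * (p - 2)))"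
   using autocovariance_bound[of ?k] by (simp add: cov_const_def)
  \<comment> \<open>Two powers of the decay are kept for summability; the rest is evaluated at
    m.\<close>
  also have "real ?k powr (- (lam * (p - 2))) = real ?k powr ?a * inverse (real ?k ^ 2)"
  proof -
   have "real ?k powr (- (lam * (p - 2))) = real ?k powr (?a + (- 2))" by simp
   also have "... = real ?k powr ?a * real ?k powr (- 2)" by (rule powr_add)
   also have "real ?k powr (- 2) = inverse (real ?k ^ 2)" by (simp add: powr_minus powr_numeral)
   finally show ?thesis .
  qed
  also have "real ?k powr ?a <= real m powr ?a" using m l by (intro powr_mono2') auto
  finally show "abs (c ?k) <= cov_const * real m powr ?a * inverse (real ?k ^ 2)"
   using cov_const_pos by (simp add: mult_left_mono mult_right_mono mult.assoc)
 qed
 also have "... = cov_const * real m powr ?a * (\<Sum>k. inverse (real (k + Suc m) ^ 2))"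
  using summable_ignore_initial_segment[OF zeta2(1), of "Suc m"] by (simp add: suminf_mult)
 also have "... <= cov_const * real m powr ?a * zeta2"
 proof (rule mult_left_mono)
  show "(\<Sum>k. inverse (real (k + Suc m) ^ 2)) <= zeta2"
   unfolding zeta2_def using suminf_minus_initial_segment[OF zeta2(1), of "Suc m"] sum_nonneg[of "{..<Suc m}" "%k. inverse (real k ^ 2)"] by simp
 qed (use cov_const_pos in auto)
 finally show "abs ((\<Sum>k. c (Suc k)) - (\<Sum>k=1..m. c k)) <= cov_const * zeta2 * real m powr ?a"
  using cov_const_pos by (simp add: mult_ac)
qed

text \<open>A product of weights at lag k differs from a square by at most k total variations, so
  the series of k |c k| bounds the error of treating the weights as locally constant; the lags
  beyond m contribute the tail of the covariance series. Only the total variation of the weights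
  enters, which admits scale functions with jumps.\<close>

lemma near_cov_variance:
 assumes I: "I \<subseteq> {1..n}" and z: "!!i. i \<notin> I ==> w i = 0" and m: "m >= 1" and W: "!!i. abs (w i) <= W"
 shows "abs ((\<Sum>i\<in>I. near_cov w I m i) - kappa2 * (\<Sum>i\<in>I. (w i)^2)) <=
  2 * cov_first_moment * W * tv w n + 2 * cov_const * zeta2 * real m powr (2 - lam * (p - 2)) * (\<Sum>i\<in>I. (w i)^2)"
proof -
 let ?V = "\<Sum>i\<in>I. (w i)^2"
 have W0: "W >= 0" using W[of 0] by linarith
 have tv0: "tv w n >= 0" by (auto simp: tv_def intro: sum_nonneg)
 have d: "abs ((\<Sum>i\<in>I. w i * w (i + k)) - ?V) <= real k * (W * tv w n)" for k
 proof -
  have "(\<Sum>i\<in>I. w i * w (i + k)) - ?V = (\<Sum>i\<in>I. w i * (w (i + k) - w i))"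
   by (simp add: sum_subtractf right_diff_distrib power2_eq_square)
  also have "abs ... <= (\<Sum>i\<in>I. W * abs (w (i + k) - w i))"
   by (intro order_trans[OF sum_abs] sum_mono abs_mult_le W) auto
  also have "... <= (\<Sum>i=1..n. W * abs (w (i + k) - w i))" using I W0 by (intro sum_mono2) auto
  also have "... = W * (\<Sum>i=1..n. (abs (w (i + k) - w i)))" by (simp add: sum_distrib_left)
  also have "... <= W * (real k * tv w n)" using I W0 by (intro mult_left_mono sum_shift_le_tv z) auto
  finally show ?thesis by (simp add: mult_ac)
 qed
 let ?a = "(\<Sum>k. c (Suc k)) - (\<Sum>k=1..m. c k)"
  and ?b = "\<Sum>i\<in>I. near_cov w I m i"
 have eq: "?b - kappa2 * ?V = 2 * (\<Sum>k=1..m. c k * ((\<Sum>i\<in>I. w i * w (i + k)) - ?V))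
   - 2 * ?a * ?V"
 proof -
  have e: "?b = ?V + 2 * (\<Sum>k=1..m. c k * (\<Sum>i\<in>I. w i * w (i + k)))"
   by (rule sum_near_cov[OF I]) (rule z)
  show ?thesis
   unfolding e kappa2_def right_diff_distrib sum_subtractf sum_distrib_right[symmetric] by (simp add: algebra_simps)
 qed
 have a: "abs (\<Sum>k=1..m. c k * ((\<Sum>i\<in>I. w i * w (i + k)) - ?V)) <= cov_first_moment * (W * tv w n)"
 proof -
  have "abs (\<Sum>k=1..m. c k * ((\<Sum>i\<in>I. w i * w (i + k)) - ?V)) <= (\<Sum>k=1..m. (abs (c k)) * (real k * (W * tv w n)))"
   by (intro order_trans[OF sum_abs] sum_mono abs_mult_le d) auto
  also have "... = (\<Sum>k=1..m. real k * abs (c k)) * (W * tv w n)"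
   unfolding sum_distrib_right by (intro sum.cong refl) (simp only: mult_ac)
  also have "... <= cov_first_moment * (W * tv w n)" unfolding cov_first_moment_def using W0 tv0
   by (intro mult_right_mono sum_le_suminf summable_cov_first_moment) auto
  finally show ?thesis .
 qed
 have b: "abs (?a * ?V) <= cov_const * zeta2 * real m powr (2 - lam * (p - 2)) * ?V"
  by (intro abs_mult_le cov_tail m) (simp add: sum_nonneg)
 have "abs (2 * A - 2 * B * D) <= 2 * abs A + 2 * abs (B * D)" for A B D :: real
  using abs_triangle_ineq4[of "2 * A" "2 * B * D"] by (simp add: abs_mult mult.assoc)
 hence "abs (?b - kappa2 * ?V) <= 2 * abs (\<Sum>k=1..m. c k * ((\<Sum>i\<in>I. w i * w (i + k)) - ?V)) + 2 * abs (?a * ?V)"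
  unfolding eq by blast
 thus ?thesis using a b by (simp add: mult.assoc)
qed

text \<open>Window \<open>n\<close> covers all pairs, so here the local variances add up to the
  exact variance.\<close>

lemma variance_approx:
 assumes I: "I \<subseteq> {1..n}" and z: "!!i. i \<notin> I ==> w i = 0" and n: "n >= 1" and W: "!!i. abs (w i) <= W"
 shows "abs ((LINT x|M. (S w I x)^2) - kappa2 * (\<Sum>i\<in>I. (w i)^2)) <=
  2 * cov_first_moment * W * tv w n + 2 * cov_const * zeta2 / real n * (\<Sum>i\<in>I. (w i)^2)"
proof -
 have I1: "I \<subseteq> {1..}" using I by auto
 have "near_cov w I n i = (\<Sum>j\<in>I. w i * w j * c (max i j - min i j))" if "i \<in> I" for i
 proof -
  have "{j \<in> I. i <= j + n \<and> j <= i + n} = I" using I that by auto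
  thus ?thesis by (simp add: near_cov_def)
 qed
 hence "(LINT x|M. (S w I x)^2) = (\<Sum>i\<in>I. near_cov w I n i)" unfolding expectation_S_sq[OF I1] by simp
 moreover have "lam * (p - 2) = lam * (p - 4) + 2 * lam" by (simp add: algebra_simps)
 hence "real n powr (2 - lam * (p - 2)) <= real n powr (- 1)" using n lam by (intro powr_mono) auto
 hence "2 * cov_const * zeta2 * real n powr (2 - lam * (p - 2)) * (\<Sum>i\<in>I. (w i)^2) <= 2 * cov_const * zeta2 * (1 / real n) * (\<Sum>i\<in>I. (w i)^2)"
  using n cov_const_pos zeta2 by (intro mult_right_mono mult_left_mono sum_nonneg) (auto simp: powr_minus inverse_eq_divide)
 ultimately show ?thesis using near_cov_variance[of I n w n W, OF I z n W] by simp
qed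

end

text \<open>\<open>l\<close> is the effective block length: weights of size l^(-1/2) on about l
  indices, which keeps the variance of order 1. The class contains the normalised blocks, the
  differences of two blocks and the contrasts of a block with its neighbours, so that one constant
  serves all of them.\<close>

definition admissible :: "real => real => nat => nat => (nat => real) => nat set => bool" where
 "admissible A B l n w I \<longleftrightarrow> 1 <= l \<and> l <= n \<and> I \<subseteq> {1..n} \<and> (\<forall>i. i \<notin> I --> w i = 0) \<and>
   (\<forall>i. abs (w i) <= A / sqrt l) \<and> tv w n <= B / sqrt l \<and> real (card I) <= A * real l"

lemma admissible_sum_sq:
 assumes "admissible A B l n w I"
 shows "(\<Sum>i\<in>I. (w i)^2) <= A ^ 3"
proof -
 have l1: "1 <= l" and w: "!!i. abs (w i) <= A / sqrt l" and card: "real (card I) <= A * real l"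
  using assms unfolding admissible_def by blast+
 have l: "real l > 0" using l1 by simp
 have "(w i)^2 <= A^2 / l" for i using power_mono[OF w[of i], of 2] l by (simp add: power_divide)
 hence "(\<Sum>i\<in>I. (w i)^2) <= (\<Sum>i\<in>I. A^2 / l)" by (intro sum_mono)
 also have "... = card I * (A^2 / l)" by simp
 also have "... <= A * l * (A^2 / l)" using card l by (intro mult_right_mono) auto
 also have "... = A ^ 3" using l by (simp add: power2_eq_square power3_eq_cube)
 finally show ?thesis .
qed

text \<open>The window in Stein's equation is m = l^\<beta>. The third condition makes m^(-lam (p -
  1)) at most 1/l, the fourth makes m^(2 - lam (p - 2)) at most l^(-1/2), and \<beta> < 1/4 lets the
  Taylor remainder of order m^2 l^(-1/2) vanish.\<close>

locale rate_mixing = poly_mixing M Y C lam p K c for M :: "'a measure" and Y C lam p K c +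
 fixes \<beta> :: real
 assumes beta: "0 < \<beta>" "\<beta> < 1/4" "1 <= \<beta> * (lam * (p - 1))" "1/2 <= \<beta> * (lam * (p - 2) - 2)"
  and kappa2_pos: "kappa2 > 0"
begin

definition rate :: "nat => real" where
 "rate l = real l powr (2 * \<beta> - 1/2)"

definition var :: "(nat => real) => nat set => real" where
 "var w I = kappa2 * (\<Sum>i\<in>I. (w i)^2)"

lemma var_nonneg: "var w I >= 0" unfolding var_def using kappa2_pos by (simp add: sum_nonneg)

text \<open>Stein's equation sums about l terms with weights of size l^(-1/2). The coefficients of 1
  and u then are of order l^(-1/2), and the coefficient of u^2 is of order m^2 l^(-1/2), that is
  \<open>rate l\<close>, which dominates.\<close>

lemma char_bound:
 assumes A: "A >= 0" and B: "B >= 0" and v0: "v0 > 0"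
 shows "\<exists>E\<ge>0. \<forall>l n w I u. admissible A B l n w I --> v0 <= var w I --> u > 0 -->
  cmod ((LINT y|M. iexp (u * S w I y)) - cpx (exp (- var w I * u^2 / 2))) <= E * rate l * u"
proof -
 define E0 where "E0 = A^2 * (48 * C + 2 * K)"
 define E1 where "E1 = 3 * A ^ 3 * (48 * C + 4 * K) + 2 * cov_first_moment * A * B + 2 * cov_const * zeta2 * A ^ 3"
 define E2 where "E2 = 4000 * K^2 * A ^ 4"
 define E where "E = (1 + 1 / v0) * (E0 + E1 + E2)"
 have cf: "cov_first_moment >= 0"
  unfolding cov_first_moment_def by (intro suminf_nonneg summable_cov_first_moment) auto
 have E0: "E0 >= 0" and E1: "E1 >= 0" and E2: "E2 >= 0"
  unfolding E0_def E1_def E2_def using A B C K cf cov_const_pos zeta2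
  by (intro add_nonneg_nonneg mult_nonneg_nonneg; simp)+
 show ?thesis
 proof (intro exI[of _ E] conjI allI impI)
  show "E >= 0" unfolding E_def using E0 E1 E2 v0 by simp
  fix l n w I and u :: real
  assume ad: "admissible A B l n w I" and vv: "v0 <= var w I" and u: "u > 0"
  have l: "l >= 1" and n: "l <= n" and I: "I \<subseteq> {1..n}" and z: "!!i. i \<notin> I ==> w i = 0"
   and w: "!!i. abs (w i) <= A / sqrt l" and t: "tv w n <= B / sqrt l" and card: "real (card I) <= A * real l"
   using ad unfolding admissible_def by blast+
  have I1: "finite I" "I \<subseteq> {1..}" using finite_subset[OF I] I by auto
  \<comment> \<open>Rounding up keeps m above l^\<beta> for the negative powers and costs a factor 2
    in the positive ones.\<close>
  define m where "m = nat \<lceil>real l powr \<beta>\<rceil>"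
  have lb: "real l powr \<beta> >= 1" using l beta by (intro ge_one_powr_ge_zero) auto
  have "real m = of_int \<lceil>real l powr \<beta>\<rceil>" using lb by (simp add: m_def)
  hence m1: "real l powr \<beta> <= real m" "real m <= 2 * real l powr \<beta>" "m >= 1"
   using ceiling_correct[of "real l powr \<beta>"] lb by linarith+
  define L where "L = real l powr (- (1/2))"
  have Ld: "L = 1 / sqrt l" unfolding L_def by (simp add: powr_minus_divide powr_half_sqrt)
  have W: "A / sqrt l = A * L" unfolding Ld by simp
  have L0: "L > 0" unfolding Ld using l by simp
  have L2: "L * L = real l powr (- 1)" unfolding Ld using l by (simp add: powr_neg_one)
  have LL: "real l * L * L = 1" unfolding mult.assoc L2 using l by (simp add: powr_neg_one)
  have mp: "real m powr (- x) <= L" if "1/2 <= \<beta> * x" for x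
  proof -
   have "0 < \<beta> * x" using that by linarith
   hence "x >= 0" using beta(1) zero_less_mult_pos[of \<beta> x] by simp
   hence "real m powr (- x) <= (real l powr \<beta>) powr (- x)" using m1 lb l by (intro powr_mono2') auto
   also have "... = real l powr (- (\<beta> * x))" by (simp add: powr_powr)
   also have "... <= L" unfolding L_def using l that by (intro powr_mono) auto
   finally show ?thesis .
  qed
  let ?e = "lam * (p - 1)"
  have mp1: "real m powr (- ?e) <= L * L"
  proof -
   have "lam * (p - 1) >= 0" using lam p by simp
   hence "real m powr (- ?e) <= (real l powr \<beta>) powr (- ?e)" using m1 lb l by (intro powr_mono2') auto
   also have "... = real l powr (- (\<beta> * ?e))" by (simp add: powr_powr)
   also have "... <= real l powr (- 1)" using l beta by (intro powr_mono) auto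
   finally show ?thesis unfolding L2 .
  qed
  have mp2: "real m powr (2 - lam * (p - 2)) <= L" using mp[of "lam * (p - 2) - 2"] beta by simp
  have mp3: "real m * real m powr (- (lam * (p - 2))) <= L"
  proof -
   have "real m * real m powr (- (lam * (p - 2))) = real m powr (1 - lam * (p - 2))"
    using m1 by (simp add: powr_diff powr_minus_divide)
   also have "... <= real m powr (2 - lam * (p - 2))" using m1 by (intro powr_mono) auto
   finally show ?thesis using mp2 by linarith
  qed
  have mp4: "(real m)^2 * L <= 4 * rate l"
  proof -
   have "(real m)^2 <= (2 * real l powr \<beta>)^2" using m1 by (intro power_mono) auto
   also have "... = 4 * real l powr (2 * \<beta>)" using l by (simp add: power_mult_distrib powr_power mult.commute)
   finally have "(real m)^2 * L <= 4 * real l powr (2 * \<beta>) * L" using L0 by (intro mult_right_mono) auto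
   also have "... = 4 * (real l powr (2 * \<beta>) * real l powr (- (1/2)))" unfolding L_def by simp
   also have "real l powr (2 * \<beta>) * real l powr (- (1/2)) = real l powr (2 * \<beta> + - (1/2))" by (rule powr_add[symmetric])
   also have "4 * real l powr (2 * \<beta> + - (1/2)) = 4 * rate l" by (simp add: rate_def)
   finally show ?thesis .
  qed
  have Lr: "L <= rate l" unfolding L_def rate_def using l beta by (intro powr_mono) auto
  let ?phi = "%u. (LINT y|M. iexp (u * S w I y))"
  let ?E = "%u. (LINT y|M. cpx (S w I y) * iexp (u * S w I y))"
  define V where "V = (\<Sum>i\<in>I. near_cov w I m i)"
  let ?c = "2 * cov_first_moment * A * B + 2 * cov_const * zeta2 * A ^ 3"
  have V: "abs (V - var w I) <= ?c * L"
  proof -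
   have "abs (V - var w I) <= 2 * cov_first_moment * (A * L) * tv w n + 2 * cov_const * zeta2 * real m powr (2 - lam * (p - 2)) * (\<Sum>i\<in>I. (w i)^2)"
    unfolding V_def var_def using w W by (intro near_cov_variance I z m1(3)) auto
   also have "... <= 2 * cov_first_moment * (A * L) * B + 2 * cov_const * zeta2 * L * A ^ 3"
   proof (intro add_mono mult_mono mult_left_mono)
    have "sqrt l >= 1" using l by simp
    hence "B / sqrt l <= B" using B divide_left_mono[of 1 "sqrt l" B] by simp
    thus "tv w n <= B" using t by linarith
    show "(\<Sum>i\<in>I. (w i)^2) <= A ^ 3" by (rule admissible_sum_sq[OF ad])
   qed (use cf A L0 mp2 cov_const_pos zeta2 in \<open>auto simp: sum_nonneg tv_def\<close>)
   finally show ?thesis by (simp add: algebra_simps)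
  qed
  have "cmod (?phi u - cpx (exp (- var w I * u^2 / 2))) <= (1 + 1 / var w I) * (E0 * L + E1 * L + E2 * rate l) * u"
  proof (rule char_ode[where ph = ?phi and ph' = "%u. \<i> * ?E u"])
   show "(?phi has_vector_derivative \<i> * ?E u) (at u)" for u
    by (intro char_has_derivative integrable_S integrable_S_sq I1)
   show "?phi 0 = 1" by (simp add: prob_space)
   show "var w I > 0" using vv v0 by linarith
   show "0 <= E0 * L" "0 <= E1 * L" "0 <= E2 * rate l" using E0 E1 E2 L0 by (auto simp: rate_def)
   show "u > 0" by fact
   fix u :: real assume u0: "u >= 0"
   let ?a = "3 * real m * (A * L)^2 * (48 * C + 4 * K) * real m powr (- (lam * (p - 2)))"
    and ?b = "1000 * K^2 * (real m)^2 * (A * L) ^ 3"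
   define R where "R = card I * (A * L * (48 * C + 2 * K) * real m powr (- ?e) + abs u * ?a
    + u^2 * ?b)"
   have "abs (w j) <= A * L" for j using w W by simp
   hence st: "cmod (?E u - \<i> * u * V * ?phi u) <= R"
    unfolding R_def V_def using stein_char[OF I1 m1(3), of w "A * L" u] by blast
   have R: "R <= E0 * L + u * (3 * A ^ 3 * (48 * C + 4 * K) * L) + u^2 * (E2 * rate l)"
   proof -
    let ?d = "A * L * (48 * C + 2 * K) * real m powr (- ?e)"
    have 1: "card I * ?d <= E0 * L"
    proof -
     have "card I * ?d <= (A * real l) * (A * L * (48 * C + 2 * K) * (L * L))"
      using card mp1 A L0 C K by (intro mult_mono mult_left_mono) auto
     also have "... = E0 * L * (real l * L * L)" by (simp add: E0_def power2_eq_square)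
     finally show ?thesis by (simp add: LL)
    qed
    have 2: "card I * ?a <= 3 * A ^ 3 * (48 * C + 4 * K) * L"
    proof -
     have "card I * ?a = card I * (3 * (A * L)^2 * (48 * C + 4 * K) * (real m * real m powr (- (lam * (p - 2)))))"
      by (simp only: mult_ac)
     also have "... <= (A * real l) * (3 * (A * L)^2 * (48 * C + 4 * K) * L)"
      using card mp3 A L0 C K by (intro mult_mono mult_left_mono) auto
     also have "... = 3 * A ^ 3 * (48 * C + 4 * K) * L * (real l * L * L)" by (simp add: power2_eq_square power3_eq_cube)
     finally show ?thesis by (simp add: LL)
    qed
    have 3: "card I * ?b <= E2 * rate l"
    proof -
     have "card I * ?b <= (A * real l) * ?b" using card A L0 by (intro mult_right_mono) auto
     also have "... = 1000 * K^2 * A ^ 4 * ((real m)^2 * L) * (real l * L * L)"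
      by (simp add: power2_eq_square power3_eq_cube power4_eq_xxxx)
     also have "... <= 1000 * K^2 * A ^ 4 * (4 * rate l)" unfolding LL mult_1_right using mp4 A by (intro mult_left_mono) auto
     finally show ?thesis by (simp add: E2_def)
    qed
    have "R = card I * ?d + u * (card I * ?a) + u^2 * (card I * ?b)"
     using u0 by (simp add: R_def distrib_left mult.left_commute)
    thus ?thesis using 1 mult_left_mono[OF 2 u0] mult_left_mono[OF 3 zero_le_power2[of u]] by linarith
   qed
   have p1: "cmod (?phi u) <= 1" by (rule norm_expectation_le) auto
   \<comment> \<open>The exact coefficient \<open>V\<close> is exchanged for \<open>var w I\<close>;
     the difference goes into the linear coefficient \<open>E1\<close>.\<close>
   have "\<i> * ?E u + u * var w I * ?phi u = \<i> * (?E u - \<i> * u * V * ?phi u) + cpx (u * (var w I - V)) * ?phi u"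
    by (simp add: algebra_simps)
   also have "cmod ... <= R + (u * (?c * L)) * 1"
   proof (intro order_trans[OF norm_triangle_ineq] add_mono norm_mult_bound p1)
    show "cmod (\<i> * (?E u - \<i> * u * V * ?phi u)) <= R" using st by (simp add: norm_mult)
    show "cmod (cpx (u * (var w I - V))) <= u * (?c * L)"
     unfolding norm_of_real abs_mult using u0 V by (auto simp: abs_minus_commute intro!: mult_left_mono)
   qed
   also have "... <= E0 * L + E1 * L * u + E2 * rate l * u^2" using R by (simp add: E1_def algebra_simps)
   finally show "cmod (\<i> * ?E u + cpx u * cpx (var w I) * ?phi u) <= E0 * L + E1 * L * u + E2 * rate l * u^2"
    by (simp only: of_real_mult)
  qed
  also have "... <= (1 + 1 / v0) * ((E0 + E1 + E2) * rate l) * u"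
  proof (intro mult_right_mono mult_mono)
   show "1 + 1 / var w I <= 1 + 1 / v0" using vv v0 by (simp add: frac_le)
   show "E0 * L + E1 * L + E2 * rate l <= (E0 + E1 + E2) * rate l"
    using mult_left_mono[OF Lr E0] mult_left_mono[OF Lr E1] by (simp add: distrib_right)
  qed (use u v0 E0 E1 E2 L0 in \<open>auto simp: rate_def\<close>)
  finally show "cmod (?phi u - cpx (exp (- var w I * u^2 / 2))) <= E * rate l * u"
   by (simp add: E_def mult.assoc)
 qed
qed

end

section \<open>First absolute moments\<close>

text \<open>The constant 2/pi normalises the weight on the half line so that 1 - cos(u x) integrates
  to |x|.\<close>

definition nu_weight :: "real => real" where
 "nu_weight u = (if 0 < u then 2 / pi / u^2 else 0)"

definition nu :: "real measure" where
 "nu = density lborel (%u. ennreal (nu_weight u))"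

lemma nu_weight_nonneg [simp]: "0 <= nu_weight u" by (simp add: nu_weight_def)

lemma nu_weight_measurable [measurable]: "nu_weight \<in> borel_measurable borel"
 unfolding nu_weight_def by measurable

lemma sets_nu [measurable_cong, simp]: "sets nu = sets borel" by (simp add: nu_def)

lemma space_nu [simp]: "space nu = UNIV" by (simp add: nu_def)

lemma sigma_finite_nu: "sigma_finite_measure nu"
 unfolding nu_def by (subst sigma_finite_measure.sigma_finite_iff_density_finite[OF sigma_finite_lborel]) auto

lemma AE_nu: "AE u in nu. 0 < u"
 unfolding nu_def by (subst AE_density) (auto simp: nu_weight_def intro!: AE_I2)

text \<open>For nonnegative integrands the fundamental theorem yields integrability together with
  the value, and limits of the antiderivative cover the end points 0 and infinity.\<close>

lemma nu_FTC:
 fixes f F :: "real => real" and a b :: ereal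
 assumes ab: "0 <= a" "a < b"
  and F: "!!x. a < ereal x ==> ereal x < b ==> DERIV F x :> 2 / pi / x^2 * f x"
  and f: "continuous_on UNIV f" and nn: "!!x. 0 <= f x"
  and lim: "((F \<circ> real_of_ereal) \<longlongrightarrow> A) (at_right a)" "((F \<circ> real_of_ereal) \<longlongrightarrow> B) (at_left b)"
 shows "has_bochner_integral nu (%u. indicator (einterval a b) u * f u) (B - A)"
proof -
 let ?h = "%x. 2 / pi / x^2 * f x"
 have cf: "isCont f x" for x using f by (simp add: continuous_on_eq_continuous_at)
 have [measurable]: "f \<in> borel_measurable borel" using f by (rule borel_measurable_continuous_onI)
 have c: "isCont ?h x" if "a < ereal x" "ereal x < b" for x
 proof -
  have "0 < ereal x" using ab that by (meson le_less_trans)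
  thus ?thesis using cf by (intro continuous_intros) auto
 qed
 have p: "AE x in lborel. a < ereal x --> ereal x < b --> 0 <= ?h x" using nn by (intro AE_I2) auto
 note I = interval_integral_FTC_nonneg[OF ab(2) F c p lim]
 have "has_bochner_integral lborel (%x. indicator (einterval a b) x *\<^sub>R ?h x) (B - A)"
  using I less_imp_le[OF ab(2)] unfolding has_bochner_integral_iff interval_lebesgue_integral_def set_integrable_def set_lebesgue_integral_def
  by simp
 also have "(%x. indicator (einterval a b) x *\<^sub>R ?h x) = (%x. nu_weight x *\<^sub>R (indicator (einterval a b) x * f x))"
 proof
  fix x
  have "0 < x" if "x \<in> einterval a b" using that ab by (metis einterval_iff ereal_less(2) le_less_trans)
  thus "indicator (einterval a b) x *\<^sub>R ?h x = nu_weight x *\<^sub>R (indicator (einterval a b) x * f x)"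
   by (auto simp: nu_weight_def indicator_def)
 qed
 finally show ?thesis unfolding nu_def by (intro has_bochner_integral_density) (auto intro!: AE_I2)
qed

text \<open>Integration by parts leads to the sine integral \<open>Si\<close>, whose limit pi/2 at
  infinity gives the normalisation.\<close>

lemma nu_cos: "has_bochner_integral nu (%u. 1 - cos (u * x)) (abs x)"
proof (cases "x = 0")
 case False
 define y where "y = abs x"
 have y: "y > 0" using False by (simp add: y_def)
 define F where "F u = 2 / pi * (y * Si (y * u) - (1 - cos (u * x)) / u)" for u
 have "has_bochner_integral nu (%u. indicator (einterval 0 \<infinity>) u * (1 - cos (u * x))) (y - 0)"
 proof (rule nu_FTC[where F = F])
  fix u :: real assume "0 < ereal u"
  hence u: "u > 0" by simp
  \<comment> \<open>x sin(u x) is even in x, so the absolute value may stand inside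
    \<open>Si\<close>.\<close>
  have s: "y * sin (y * u) = x * sin (u * x)" unfolding y_def by (cases "x >= 0") (auto simp: mult.commute)
  have "(Si has_real_derivative sin (y * u) / (y * u)) (at (y * u))" using DERIV_Si[of "y * u"] u y by simp
  hence "((%u. Si (y * u)) has_real_derivative (sin (y * u) / (y * u)) * y) (at u)"
   by (intro DERIV_chain'[where f = "%u. y * u" and g = Si]) (auto intro!: derivative_eq_intros)
  hence S: "((%u. Si (y * u)) has_real_derivative sin (y * u) / u) (at u)" using y by simp
  have "(F has_real_derivative 2 / pi * (y * (sin (y * u) / u) - (sin (u * x) * x * u - (1 - cos (u * x))) / (u * u))) (at u)"
   unfolding F_def using u by (auto intro!: derivative_eq_intros S) (simp add: mult_ac)
  also have "y * (sin (y * u) / u) - (sin (u * x) * x * u - (1 - cos (u * x))) / (u * u) = (1 - cos (u * x)) / u^2"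
   using u s by (simp add: field_simps power2_eq_square)
  finally show "(F has_real_derivative 2 / pi / u^2 * (1 - cos (u * x))) (at u)" by simp
 next
  show "continuous_on UNIV (%u. 1 - cos (u * x))" by (intro continuous_intros)
  let ?a = "(%u. (1 - cos (u * x)) / u) \<longlongrightarrow> 0"
  have "?a (at_right 0)" by real_asymp
  moreover have "((%u. Si (y * u)) \<longlongrightarrow> Si (y * 0)) (at_right 0)"
   by (intro isCont_tendsto_compose[OF isCont_Si] tendsto_intros)
  ultimately have "(F \<longlongrightarrow> 2 / pi * (y * Si (y * 0) - 0)) (at_right 0)"
   unfolding F_def by (intro tendsto_intros)
  thus "((F \<circ> real_of_ereal) \<longlongrightarrow> 0) (at_right 0)"
   unfolding zero_ereal_def ereal_tendsto_simps by (simp add: Si_def zero_ereal_def[symmetric] flip: ereal_tendsto_simps)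
  have "?a at_top" by real_asymp
  moreover have "((%u. Si (y * u)) \<longlongrightarrow> pi / 2) at_top"
   by (rule filterlim_compose[OF Si_at_top]) (use y in real_asymp)
  ultimately have "(F \<longlongrightarrow> 2 / pi * (y * (pi / 2) - 0)) at_top"
   unfolding F_def by (intro tendsto_intros)
  thus "((F \<circ> real_of_ereal) \<longlongrightarrow> y) (at_left \<infinity>)"
   unfolding ereal_tendsto_simps by simp
 qed auto
 moreover have "AE u in nu. indicator (einterval 0 \<infinity>) u * (1 - cos (u * x)) = 1 - cos (u * x)"
  using AE_nu by eventually_elim (auto simp: einterval_def)
 ultimately show ?thesis
  by (subst has_bochner_integral_cong_AE[symmetric, where f="%u. indicator (einterval 0 \<infinity>) u * (1 - cos (u * x))"]) (auto simp: y_def)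
qed (simp add: has_bochner_integral_zero)

text \<open>The three regimes of the later error bound: quadratic near 0, linear in the middle,
  bounded at infinity.\<close>

lemma nu_pieces:
 assumes h: "0 < h" "h < A"
 shows "has_bochner_integral nu (%u. indicator {0<..<h} u * u^2) (2 / pi * h)"
  and "has_bochner_integral nu (%u. indicator {h<..<A} u * abs u) (2 / pi * ln (A / h))"
  and "has_bochner_integral nu (%u. indicator {A<..} u * 1) (2 / pi / A)"
proof -
 have "has_bochner_integral nu (%u. indicator (einterval 0 h) u * u^2) (2 / pi * h - 0)"
 proof (rule nu_FTC[where F = "%u. 2 / pi * u"])
  show "(((%u. 2 / pi * u) \<circ> real_of_ereal) \<longlongrightarrow> 0) (at_right 0)"
   unfolding zero_ereal_def ereal_tendsto_simps by real_asymp
  show "(((%u. 2 / pi * u) \<circ> real_of_ereal) \<longlongrightarrow> 2 / pi * h) (at_left (ereal h))"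
   unfolding ereal_tendsto_simps by (intro tendsto_intros)
 qed (use h in \<open>auto intro!: derivative_eq_intros continuous_intros\<close>)
 thus "has_bochner_integral nu (%u. indicator {0<..<h} u * u^2) (2 / pi * h)" by (simp add: zero_ereal_def)
 have "has_bochner_integral nu (%u. indicator (einterval h A) u * abs u) (2 / pi * ln A - 2 / pi * ln h)"
 proof (rule nu_FTC[where F = "%u. 2 / pi * ln u"])
  show "(((%u. 2 / pi * ln u) \<circ> real_of_ereal) \<longlongrightarrow> 2 / pi * ln h) (at_right (ereal h))"
   unfolding ereal_tendsto_simps using h by (intro tendsto_intros) auto
  show "(((%u. 2 / pi * ln u) \<circ> real_of_ereal) \<longlongrightarrow> 2 / pi * ln A) (at_left (ereal A))"
   unfolding ereal_tendsto_simps using h by (intro tendsto_intros) auto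
 qed (use h in \<open>auto intro!: derivative_eq_intros continuous_intros simp: power2_eq_square\<close>)
 thus "has_bochner_integral nu (%u. indicator {h<..<A} u * abs u) (2 / pi * ln (A / h))"
  using h by (simp add: ln_div right_diff_distrib)
 have "has_bochner_integral nu (%u. indicator (einterval A \<infinity>) u * 1) (0 - (- (2 / pi / A)))"
 proof (rule nu_FTC[where F = "%u. - (2 / pi / u)"])
  show "(((%u. - (2 / pi / u)) \<circ> real_of_ereal) \<longlongrightarrow> - (2 / pi / A)) (at_right (ereal A))"
   unfolding ereal_tendsto_simps using h by (intro tendsto_intros) auto
  show "(((%u. - (2 / pi / u)) \<circ> real_of_ereal) \<longlongrightarrow> 0) (at_left \<infinity>)"
   unfolding ereal_tendsto_simps by real_asymp
 qed (use h in \<open>auto intro!: derivative_eq_intros continuous_intros simp: power2_eq_square\<close>)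
 thus "has_bochner_integral nu (%u. indicator {A<..} u * 1) (2 / pi / A)" by simp
qed

context prob_space
begin

lemma abs_moment_nu:
 assumes X: "integrable M X"
 shows "has_bochner_integral nu (%u. (LINT x|M. 1 - cos (u * X x))) ((LINT x|M. abs (X x)))"
proof -
 interpret nu: sigma_finite_measure nu by (rule sigma_finite_nu)
 interpret P: pair_sigma_finite M nu ..
 have [measurable]: "X \<in> borel_measurable M" using X by auto
 let ?f = "%(x, u). 1 - cos (u * X x)"
 have c: "(LINT u|nu. norm (1 - cos (u * X x))) = abs (X x)" "integrable nu (%u. 1 - cos (u * X x))"
  "(LINT u|nu. 1 - cos (u * X x)) = abs (X x)" for x
  using nu_cos[of "X x"] by (auto simp: has_bochner_integral_iff)
 have i: "integrable (M \<Otimes>\<^sub>M nu) ?f"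
  using X c by (intro P.Fubini_integrable) (auto simp: split_beta')
 have "integrable nu (%u. (LINT x|M. 1 - cos (u * X x)))" using P.integrable_snd[OF i] by simp
 moreover have "(LINT u|nu. (LINT x|M. 1 - cos (u * X x))) = (LINT x|M. abs (X x))"
  using P.Fubini_integral[OF i] c by simp
 ultimately show ?thesis by (simp add: has_bochner_integral_iff)
qed

end

text \<open>A shift by \<open>a\<close> multiplies both characteristic functions by the same factor
  of modulus 1, so the bound is uniform in \<open>a\<close>. This uniformity is what later gives
  access to second-order functionals.\<close>

lemma abs_moment_diff:
 assumes M: "prob_space M" and N: "prob_space N" and X: "integrable M X" and Z: "integrable N Z"
  and g: "integrable nu g"
  and b: "AE u in nu. cmod ((LINT x|M. iexp (u * X x)) - (LINT x|N. iexp (u * Z x))) <= g u"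
 shows "abs ((LINT x|M. abs (X x - a)) - (LINT x|N. abs (Z x - a))) <= (LINT u|nu. g u)"
proof -
 interpret M: prob_space M by fact
 interpret N: prob_space N by fact
 have [measurable]: "X \<in> borel_measurable M" "Z \<in> borel_measurable N" using X Z by auto
 have iX: "integrable M (%x. X x - a)" and iZ: "integrable N (%x. Z x - a)" using X Z by auto
 note h = M.abs_moment_nu[OF iX] N.abs_moment_nu[OF iZ]
 let ?d = "%u. (LINT x|M. 1 - cos (u * (X x - a))) - (LINT x|N. 1 - cos (u * (Z x - a)))"
 have d: "abs (?d u) <= g u" if "cmod ((LINT x|M. iexp (u * X x)) - (LINT x|N. iexp (u * Z x))) <= g u" for u
 proof -
  have "(LINT x|M. 1 - cos (u * (X x - a))) = 1 - Re (iexp (- u * a) * (LINT x|M. iexp (u * X x)))"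
  proof -
   have "Re (iexp (- u * a) * (LINT x|M. iexp (u * X x))) = Re ((LINT x|M. iexp (- u * a) * iexp (u * X x)))" by simp
   also have "... = (LINT x|M. Re (iexp (- u * a) * iexp (u * X x)))"
    by (intro integral_Re[symmetric] M.integrable_bounded[of _ 1]) (auto simp: norm_mult)
   also have "... = (LINT x|M. cos (u * (X x - a)))"
    unfolding exp_add[symmetric] by (simp add: Re_exp algebra_simps)
   finally show ?thesis using M.integrable_bounded[of "%x. cos (u * (X x - a))" 1] by (simp add: M.prob_space)
  qed
  moreover have "(LINT x|N. 1 - cos (u * (Z x - a))) = 1 - Re (iexp (- u * a) * (LINT x|N. iexp (u * Z x)))"
  proof -
   have "Re (iexp (- u * a) * (LINT x|N. iexp (u * Z x))) = Re ((LINT x|N. iexp (- u * a) * iexp (u * Z x)))" by simp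
   also have "... = (LINT x|N. Re (iexp (- u * a) * iexp (u * Z x)))"
    by (intro integral_Re[symmetric] N.integrable_bounded[of _ 1]) (auto simp: norm_mult)
   also have "... = (LINT x|N. cos (u * (Z x - a)))"
    unfolding exp_add[symmetric] by (simp add: Re_exp algebra_simps)
   finally show ?thesis using N.integrable_bounded[of "%x. cos (u * (Z x - a))" 1] by (simp add: N.prob_space)
  qed
  ultimately have "?d u = - Re (iexp (- u * a) * ((LINT x|M. iexp (u * X x)) - (LINT x|N. iexp (u * Z x))))"
   by (simp add: right_diff_distrib)
  also have "abs ... <= cmod (iexp (- u * a) * ((LINT x|M. iexp (u * X x)) - (LINT x|N. iexp (u * Z x))))"
   unfolding abs_minus_cancel by (rule abs_Re_le_cmod)
  also have "... <= g u" using that by (simp add: norm_mult del: of_real_mult)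
  finally show ?thesis .
 qed
 have i: "integrable nu ?d" using h by (auto simp: has_bochner_integral_iff)
 have "(LINT x|M. abs (X x - a)) - (LINT x|N. abs (Z x - a)) = (LINT u|nu. ?d u)"
  using h by (auto simp: has_bochner_integral_iff)
 also have "abs ... <= (LINT u|nu. abs (?d u))" by (rule integral_abs_bound)
 also have "... <= (LINT u|nu. g u)"
  using b by (intro integral_mono_AE integrable_abs i g) (auto elim!: eventually_mono intro: d)
 finally show ?thesis .
qed

abbreviation "gauss \<equiv> std_normal_distribution"

lemma prob_space_std_normal: "prob_space gauss" using prob_space_normal_density[of 1 0] by simp

lemma std_normal_moments:
 "integrable gauss (%z. z)" "integrable gauss (%z. abs z)" "integrable gauss (%z. z^2)"
 "(LINT z|gauss. abs z) = sqrt (2 / pi)" "(LINT z|gauss. z^2) = 1" "(LINT z|gauss. z) = 0"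
proof -
 show 1: "integrable gauss (%z. z)" using integrable_std_normal_distribution_moment[of 1] by simp
 thus "integrable gauss (%z. abs z)" by (rule integrable_abs)
 show "integrable gauss (%z. z^2)" by (rule integrable_std_normal_distribution_moment)
 show "(LINT z|gauss. abs z) = sqrt (2 / pi)" using std_normal_distribution_odd_moments_abs[of 0] by simp
 show "(LINT z|gauss. z^2) = 1" using std_normal_distribution_even_moments(1)[of 1] by simp
 show "(LINT z|gauss. z) = 0" using integral_std_normal_distribution_moment_odd[of 1] by simp
qed

lemma char_scaled_normal:
 assumes "v >= 0"
 shows "(LINT z|gauss. iexp (u * (sqrt v * z))) = cpx (exp (- v * u^2 / 2))"
proof -
 have "(LINT z|gauss. iexp (u * (sqrt v * z))) = char gauss (u * sqrt v)"
  unfolding char_def by (simp add: mult.assoc)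
 also have "... = cpx (exp (- v * u^2 / 2))"
  unfolding char_std_normal_distribution using assms by (simp add: power_mult_distrib mult.commute)
 finally show ?thesis .
qed

context rate_mixing
begin

text \<open>The logarithm is the integral of u / u^2 over the middle range of frequencies, from 1 /
  sqrt l to 2 sqrt l.\<close>

definition wrate :: "nat => real" where
 "wrate l = rate l * (1 + ln (real l))"

lemma wrate_nonneg: "0 <= wrate l" by (cases "l = 0") (auto simp: wrate_def rate_def)

text \<open>A linear error is not integrable against du / u^2 at 0. There the vanishing mean gives a
  quadratic bound, which carries no rate but is needed only on a short interval.\<close>

lemma char_quadratic_bound:
 assumes "admissible A B l n w I"
 shows "cmod ((LINT x|M. iexp (u * S w I x)) - cpx (exp (- var w I * u^2 / 2)))
  <= (2 * (\<Sum>k. abs (c k)) + kappa2) * A ^ 3 * u^2"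
proof -
 have I0: "I \<subseteq> {1..n}" using assms unfolding admissible_def by blast
 have I: "finite I" "I \<subseteq> {1..}" using finite_subset[OF I0] I0 by auto
 let ?X = "S w I"
 have iX: "integrable M ?X" "integrable M (%x. (?X x)^2)" using integrable_S integrable_S_sq I by auto
 have iE: "integrable M (%x. iexp (u * ?X x))" by (intro integrable_bounded[of _ 1]) auto
 have iR: "integrable M (%x. iexp (u * ?X x) - 1 - \<i> * (u * ?X x))"
  using iE iX(1) by (auto intro!: int_diff)
 let ?a = "\<Sum>k. abs (c k)"
 have "(LINT x|M. iexp (u * ?X x)) - 1 = (LINT x|M. iexp (u * ?X x) - 1 - \<i> * (u * ?X x))"
 proof -
  have "(LINT x|M. \<i> * cpx (u * ?X x)) = \<i> * cpx ((LINT x|M. u * ?X x))" by (simp del: of_real_mult)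
  also have "... = 0" using expectation_S[OF I(2), of w] by simp
  finally have 0: "(LINT x|M. \<i> * cpx (u * ?X x)) = 0" .
  have i1: "integrable M (%x. iexp (u * ?X x) - 1)" using iE by simp
  have i2: "integrable M (%x. \<i> * cpx (u * ?X x))" using iX(1) by simp
  have "(LINT x|M. iexp (u * ?X x) - 1) = (LINT x|M. iexp (u * ?X x)) - 1"
   by (subst LINT_diff[OF iE]) (auto simp: prob_space)
  thus ?thesis unfolding LINT_diff[OF i1 i2] 0 by simp
 qed
 also have "cmod ... <= (LINT x|M. cmod (iexp (u * ?X x) - 1 - \<i> * (u * ?X x)))" by (rule integral_norm_bound)
 also have "... <= (LINT x|M. u^2 / 2 * (?X x)^2)"
 proof -
  have "cmod (iexp (u * ?X x) - 1 - \<i> * (u * ?X x)) <= u^2 / 2 * (?X x)^2" for x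
   using iexp_2[of "u * ?X x"] by (simp add: power_mult_distrib)
  thus ?thesis by (intro integral_mono[OF integrable_norm[OF iR] integrable_mult_right[OF iX(2)]])
 qed
 also have "... = u^2 / 2 * (LINT x|M. (?X x)^2)" by simp
 also have "... <= u^2 / 2 * (2 * ?a * A ^ 3)"
 proof -
  have "2 * ?a * (\<Sum>i\<in>I. (w i)^2) <= 2 * ?a * A ^ 3"
   using suminf_nonneg[OF summable_abs_c] by (intro mult_left_mono admissible_sum_sq[OF assms]) auto
  thus ?thesis using S_variance_le[OF I, of w] by (intro mult_left_mono) auto
 qed
 finally have 1: "cmod ((LINT x|M. iexp (u * ?X x)) - 1) <= u^2 / 2 * (2 * ?a * A ^ 3)" .
 let ?b = "- var w I * u^2 / 2"
 have "cmod (1 - cpx (exp ?b)) = abs (1 - exp ?b)"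
  using norm_of_real[of "1 - exp ?b", where 'a = complex] by (simp only: of_real_diff of_real_1)
 also have "... <= var w I * u^2 / 2"
  using exp_ge_add_one_self[of "- var w I * u^2 / 2"] var_nonneg[of w I] by auto
 also have "... <= kappa2 * A ^ 3 * u^2 / 2"
  unfolding var_def using admissible_sum_sq[OF assms] kappa2_pos by (intro divide_right_mono mult_right_mono mult_left_mono) auto
 finally have 2: "cmod (1 - cpx (exp ?b)) <= kappa2 * A ^ 3 * u^2 / 2" .
 have A3: "0 <= A ^ 3" by (rule order_trans[OF sum_nonneg admissible_sum_sq[OF assms]]) simp
 have "cmod ((LINT x|M. iexp (u * ?X x)) - cpx (exp ?b)) <= u^2 / 2 * (2 * ?a * A ^ 3) + kappa2 * A ^ 3 * u^2 / 2"
  using norm_triangle_ineq[of "(LINT x|M. iexp (u * ?X x)) - 1" "1 - cpx (exp ?b)"] 1 2 by simp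
 also have "... = (2 * ?a + kappa2) * A ^ 3 * u^2 / 2" by (simp add: algebra_simps)
 also have "... <= (2 * ?a + kappa2) * A ^ 3 * u^2"
 proof -
  have "0 <= (2 * ?a + kappa2) * A ^ 3 * u^2"
   using A3 suminf_nonneg[OF summable_abs_c] kappa2_pos by (intro mult_nonneg_nonneg add_nonneg_nonneg) auto
  thus ?thesis by linarith
 qed
 finally show ?thesis .
qed

lemma absolute_moment_bound:
 assumes A: "A >= 0" and B: "B >= 0" and v0: "v0 > 0"
 shows "\<exists>E\<ge>0. \<forall>l n w I a. admissible A B l n w I --> v0 <= var w I -->
  abs ((LINT x|M. abs (S w I x - a)) - (LINT z|gauss. abs (sqrt (var w I) * z - a))) <= E * wrate l"
proof -
 obtain E where E: "E >= 0" "!!l n w I u. admissible A B l n w I ==> v0 <= var w I ==> u > 0 ==>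
  cmod ((LINT x|M. iexp (u * S w I x)) - cpx (exp (- var w I * u^2 / 2))) <= E * rate l * u"
  using char_bound[OF A B v0] by blast
 define V where "V = (2 * (\<Sum>k. abs (c k)) + kappa2) * A ^ 3"
 have V: "V >= 0" unfolding V_def using A suminf_nonneg[OF summable_abs_c] kappa2_pos by simp
 show ?thesis
 proof (intro exI[of _ "V + 1 + E"] conjI allI impI)
  show "V + 1 + E >= 0" using V E by simp
  fix l n w I a assume ad: "admissible A B l n w I" and v: "v0 <= var w I"
  have l: "l >= 1" and I0: "I \<subseteq> {1..n}" using ad unfolding admissible_def by blast+
  have I: "finite I" "I \<subseteq> {1..}" using finite_subset[OF I0] I0 by auto
  \<comment> \<open>Below \<open>h\<close> the quadratic bound costs order h, above \<open>D\<close>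
    the trivial bound 2 costs order 1/D; both are of order l^(-1/2), hence below the rate.\<close>
  define h where "h = 1 / sqrt l"
  define D where "D = 2 * sqrt l"
  have sl: "sqrt l >= 1" using l by simp
  have h: "0 < h" using l by (simp add: h_def)
  have "h <= 1" using sl by (simp add: h_def)
  hence hD: "h < D" unfolding D_def using sl by linarith
  define e where "e = E * rate l"
  have e0: "e >= 0" using E by (simp add: e_def rate_def)
  note P = nu_pieces[OF h hD]
  define g where "g u = V * (indicator {0<..<h} u * u^2) + e * (indicator {h<..<D} u * abs u) + 2 * (indicator {D<..} u * 1)" for u :: real
  have g: "has_bochner_integral nu g (V * (2 / pi * h) + e * (2 / pi * ln (D / h)) + 2 * (2 / pi / D))"
   unfolding g_def[abs_def] by (intro has_bochner_integral_add has_bochner_integral_mult_right P)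
  \<comment> \<open>The three pieces are open intervals; the cut points are null sets.\<close>
  have "AE u in nu. 0 < u \<and> u ~= h \<and> u ~= D"
  proof -
   have "AE u in nu. u ~= y" for y
    unfolding nu_def by (subst AE_density) (auto intro: AE_mp[OF AE_lborel_singleton[of y]])
   thus ?thesis using AE_nu by auto
  qed
  hence b: "AE u in nu. cmod ((LINT x|M. iexp (u * S w I x)) - (LINT z|gauss. iexp (u * (sqrt (var w I) * z)))) <= g u"
  proof (rule eventually_mono)
   fix u assume u: "0 < u \<and> u ~= h \<and> u ~= D"
   let ?d = "cmod ((LINT x|M. iexp (u * S w I x)) - cpx (exp (- var w I * u^2 / 2)))"
   have 1: "?d <= V * u^2" unfolding V_def by (rule char_quadratic_bound[OF ad])
   have 2: "?d <= e * u" unfolding e_def using E(2)[OF ad v] u by auto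
   have "?d <= cmod ((LINT x|M. iexp (u * S w I x))) + cmod (cpx (exp (- var w I * u^2 / 2)))"
    by (rule norm_triangle_ineq4)
   also have "cmod ((LINT x|M. iexp (u * S w I x))) <= 1" by (rule norm_expectation_le) auto
   also have "cmod (cpx (exp (- var w I * u^2 / 2))) <= 1" unfolding norm_of_real using var_nonneg[of w I] by simp
   finally have 3: "?d <= 2" by simp
   have "?d <= g u"
   proof -
    consider "u < h" | "h < u" "u < D" | "D < u" using u by linarith
    thus ?thesis using 1 2 3 u h hD by cases (auto simp: g_def)
   qed
   thus "cmod ((LINT x|M. iexp (u * S w I x)) - (LINT z|gauss. iexp (u * (sqrt (var w I) * z)))) <= g u"
    unfolding char_scaled_normal[OF var_nonneg] .
  qed
  have "abs ((LINT x|M. abs (S w I x - a)) - (LINT z|gauss. abs (sqrt (var w I) * z - a))) <= (LINT u|nu. g u)"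
   using g std_normal_moments(1) integrable_S[OF I(2)]
   by (intro abs_moment_diff[OF prob_space_axioms prob_space_std_normal _ _ _ b]) (auto simp: has_bochner_integral_iff)
  also have "... = V * (2 / pi * h) + e * (2 / pi * ln (D / h)) + 2 * (2 / pi / D)"
   using g by (rule has_bochner_integral_integral_eq)
  also have "... = 2 / pi * (V * h + e * ln (D / h) + h)" using sl by (simp add: h_def D_def algebra_simps)
  also have "D / h = 2 * real l" using l by (simp add: h_def D_def)
  also have "2 / pi * (V * h + e * ln (2 * real l) + h) <= 1 * (V * h + e * ln (2 * real l) + h)"
   using V e0 h l pi_ge_two by (intro mult_right_mono) (auto simp: divide_le_eq)
  also have "... <= V * wrate l + E * wrate l + wrate l"
  proof -
   have "ln (2 * real l) = ln 2 + ln (real l)" using l by (simp add: ln_mult)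
   hence ln2: "ln (2 * real l) <= 1 + ln (real l)" using ln_2_less_1 by simp
   have "h = real l powr (- (1/2))" unfolding h_def by (simp add: powr_minus_divide powr_half_sqrt)
   also have "... <= rate l" unfolding rate_def using l beta by (intro powr_mono) auto
   also have "... <= wrate l" unfolding wrate_def rate_def using l by (simp add: distrib_left)
   finally have hw: "h <= wrate l" .
   have "e * ln (2 * real l) <= e * (1 + ln (real l))" using ln2 e0 by (rule mult_left_mono)
   also have "... = E * wrate l" by (simp add: e_def wrate_def)
   finally show ?thesis using hw mult_left_mono[OF hw V] unfolding mult_1_left by linarith
  qed
  also have "... = (V + 1 + E) * wrate l" by (simp add: algebra_simps)
  finally show "abs ((LINT x|M. abs (S w I x - a)) - (LINT z|gauss. abs (sqrt (var w I) * z - a))) <= (V + 1 + E) * wrate l" .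
 qed
qed

end

section \<open>Expected absolute differences\<close>

text \<open>Kernel of the Hoeffding projection: mean distance of a given block value to an
  independent Gaussian block.\<close>

definition H :: "real => real => real" where
 "H x v = (LINT z|gauss. abs (x - v * z))"

text \<open>Closed form of E|x Z - v Z'| for independent standard normal Z and Z', as shown in
  \<open>H_normal\<close>.\<close>

definition hmean :: "real => real => real" where
 "hmean x v = sqrt (x^2 + v^2) * sqrt (2 / pi)"

lemma sqrt_2_pi_le: "sqrt (2 / pi) <= 1" "0 <= sqrt (2 / pi)" using pi_ge_two by (auto simp: divide_le_eq)

interpretation gauss: prob_space gauss by (rule prob_space_std_normal)

lemma integrable_std_normal_abs: "integrable gauss (%z. abs (x - v * z))" using std_normal_moments(1) by auto

lemma std_normal_reflect:
 fixes f :: "real => real"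
 assumes "f \<in> borel_measurable borel"
 shows "(LINT z|gauss. f (- z)) = (LINT z|gauss. f z)"
proof -
 have "(LINT z|gauss. f z) = (LINT z|lborel. std_normal_density z * f z)"
  using assms by (subst integral_density) auto
 also have "... = (LINT z|lborel. std_normal_density (- z) * f (- z))"
  using lborel_integral_real_affine[of "-1" "%z. std_normal_density z * f z" 0] by simp
 also have "... = (LINT z|gauss. f (- z))"
  using assms by (subst integral_density) (auto simp: std_normal_density_def)
 finally show ?thesis by simp
qed

text \<open>Averaging over z and -z uses |x - y| + |x + y| = 2 max(|x|, |y|). In this form
  \<open>H\<close> is visibly even and monotone in |x|.\<close>

lemma H_max: "H x v = (LINT z|gauss. max (abs x) (abs (v * z)))"
proof -
 have "H x v = (LINT z|gauss. abs (x - v * (- z)))"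
  unfolding H_def by (rule std_normal_reflect[symmetric]) measurable
 hence "2 * H x v = (LINT z|gauss. abs (x - v * z) + abs (x - v * (- z)))"
  using integrable_std_normal_abs[of x v] integrable_std_normal_abs[of x "- v"] by (simp add: H_def)
 also have "... = (LINT z|gauss. 2 * max (abs x) (abs (v * z)))"
  by (intro LINT_cong refl) (auto simp: max_def)
 finally show ?thesis by simp
qed

lemma integrable_max: "integrable gauss (%z. max (abs x) (abs (v * z)))" using std_normal_moments(1) by auto

lemma H_nonneg: "0 <= H x v" unfolding H_def by simp

lemma H_le: "H x v <= abs x + abs v"
proof -
 have "H x v <= (LINT z|gauss. abs x + abs v * abs z)"
  unfolding H_def using integrable_std_normal_abs std_normal_moments(2)
  by (intro integral_mono) (auto simp: abs_mult intro: order_trans[OF abs_triangle_ineq4])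
 also have "... = abs x + abs v * sqrt (2 / pi)"
  using std_normal_moments by (simp add: gauss.prob_space[simplified])
 also have "... <= abs x + abs v * 1" using sqrt_2_pi_le by (intro add_left_mono mult_left_mono) auto
 finally show ?thesis by simp
qed

lemma H_lipschitz: "abs (H x v - H y w) <= abs (x - y) + abs (v - w)"
proof -
 have "abs (H x v - H y w) = abs (\<integral>z. abs (x - v * z) - abs (y - w * z) \<partial>gauss)"
  unfolding H_def using integrable_std_normal_abs by simp
 also have "... <= (LINT z|gauss. abs (abs (x - v * z) - abs (y - w * z)))" by (rule integral_abs_bound)
 also have "... <= (LINT z|gauss. abs ((x - y) - (v - w) * z))"
 proof (intro integral_mono integrable_abs int_diff integrable_std_normal_abs)
  fix z
  have "abs (abs (x - v * z) - abs (y - w * z)) <= abs ((x - v * z) - (y - w * z))" by (rule abs_triangle_ineq3)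
  also have "(x - v * z) - (y - w * z) = (x - y) - (v - w) * z" by (simp add: algebra_simps)
  finally show "abs (abs (x - v * z) - abs (y - w * z)) <= abs ((x - y) - (v - w) * z)" .
 qed (use std_normal_moments(1) in auto)
 also have "... = H (x - y) (v - w)" by (simp add: H_def)
 also have "... <= abs (x - y) + abs (v - w)" by (rule H_le)
 finally show ?thesis .
qed

lemma H_measurable_pair [measurable]: "(%(x, v). H x v) \<in> borel_measurable (borel \<Otimes>\<^sub>M borel)"
 unfolding H_def by measurable

lemma H_measurable [measurable (raw)]:
 "f \<in> borel_measurable N ==> g \<in> borel_measurable N ==> (%x. H (f x) (g x)) \<in> borel_measurable N"
 using measurable_compose[OF measurable_Pair H_measurable_pair, of f N g] by simp

lemma H_mono: "abs x <= abs y ==> H x v <= H y v"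
 unfolding H_max using integrable_max by (intro integral_mono) auto

text \<open>Where |v z| <= x the maximum grows with slope 1, elsewhere it does not decrease. This is
  the source of the lower bound for the limit variance.\<close>

lemma H_increment:
 assumes "0 <= x" "x <= y"
 shows "(y - x) * measure gauss {z. abs (v * z) <= x} <= H y v - H x v"
proof -
 have [measurable]: "{z. abs (v * z) <= x} \<in> sets borel" by measurable
 have "(y - x) * measure gauss {z. abs (v * z) <= x} = (LINT z|gauss. (y - x) * indicator {z. abs (v * z) <= x} z)"
  by (simp add: gauss.emeasure_eq_measure)
 also have "... <= (LINT z|gauss. max (abs y) (abs (v * z)) - max (abs x) (abs (v * z)))"
 proof (intro integral_mono integrable_mult_right int_diff integrable_max)
  show "integrable gauss (indicat_real {z. abs (v * z) <= x})"
   by (intro gauss.integrable_bounded[of _ 1]) auto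
 qed (use assms in \<open>auto simp: indicator_def\<close>)
 also have "... = H y v - H x v" unfolding H_max using integrable_max by simp
 finally show ?thesis .
qed

lemma char_scaled_normal': "(LINT z|gauss. iexp (u * (v * z))) = cpx (exp (- v\<^sup>2 * u^2 / 2))"
proof -
 have "(LINT z|gauss. iexp (u * (v * z))) = char gauss (u * v)" unfolding char_def by (simp add: mult.assoc)
 also have "... = cpx (exp (- v\<^sup>2 * u^2 / 2))"
  unfolding char_std_normal_distribution by (simp add: power_mult_distrib mult.commute)
 finally show ?thesis .
qed

lemma cos_shift_normal: "(LINT z|gauss. 1 - cos (u * (x - v * z))) = 1 - cos (u * x) * exp (- v\<^sup>2 * u^2 / 2)"
proof -
 have i: "integrable gauss (%z. iexp (u * x) * iexp (u * ((- v) * z)))"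
  by (intro gauss.integrable_bounded[of _ 1]) (auto simp: norm_mult)
 have "(LINT z|gauss. cos (u * (x - v * z))) = (LINT z|gauss. Re (iexp (u * x) * iexp (u * ((- v) * z))))"
  unfolding exp_add[symmetric] by (simp add: Re_exp algebra_simps)
 also have "... = Re (LINT z|gauss. iexp (u * x) * iexp (u * ((- v) * z)))" by (rule integral_Re[OF i])
 also have "... = Re (iexp (u * x) * (LINT z|gauss. iexp (u * ((- v) * z))))"
  by (simp only: integral_mult_right_zero)
 also have "... = cos (u * x) * exp (- v\<^sup>2 * u^2 / 2)"
  unfolding char_scaled_normal' by (simp add: Re_exp)
 finally have "(LINT z|gauss. cos (u * (x - v * z))) = cos (u * x) * exp (- v\<^sup>2 * u^2 / 2)" .
 moreover have "integrable gauss (%z. cos (u * (x - v * z)))" by (intro gauss.integrable_bounded[of _ 1]) auto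
 ultimately show ?thesis using gauss.prob_space by simp
qed

lemma H_nu: "has_bochner_integral nu (%u. 1 - cos (u * x) * exp (- v\<^sup>2 * u^2 / 2)) (H x v)"
 using gauss.abs_moment_nu[of "%z. x - v * z"] std_normal_moments(1) unfolding cos_shift_normal H_def by simp

lemma hmean_H: "hmean x v = H 0 (sqrt (x^2 + v^2))"
proof -
 have "H 0 (sqrt (x^2 + v^2)) = (LINT z|gauss. sqrt (x^2 + v^2) * abs z)"
  unfolding H_def by (simp add: abs_mult)
 thus ?thesis using std_normal_moments(4) by (simp add: hmean_def)
qed

lemma hmean_nu: "has_bochner_integral nu (%u. 1 - exp (- x\<^sup>2 * u^2 / 2) * exp (- v\<^sup>2 * u^2 / 2)) (hmean x v)"
proof -
 have "exp (- x\<^sup>2 * u^2 / 2) * exp (- v\<^sup>2 * u^2 / 2) = exp (- (sqrt (x^2 + v^2))\<^sup>2 * u^2 / 2)" for u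
  by (simp add: exp_add[symmetric] field_simps)
 thus ?thesis using H_nu[of 0 "sqrt (x^2 + v^2)"] unfolding hmean_H by simp
qed

lemma integrable_H_normal: "integrable gauss (%z. H (x * z) v)"
 by (rule int_bound[where f = "%z. abs x * abs z + abs v"])
   (use std_normal_moments(2) H_le[of "x * _" v] in \<open>auto intro!: AE_I2 simp: abs_mult abs_of_nonneg[OF H_nonneg] add_nonneg_nonneg\<close>)

text \<open>Fubini against \<open>nu\<close>: the Gaussian average of the cosine turns the integrand
  of \<open>H\<close> into one minus a product of two exponentials, the integrand of
  \<open>hmean\<close>.\<close>

lemma H_normal: "(LINT z|gauss. H (x * z) v) = hmean x v"
proof -
 interpret nu: sigma_finite_measure nu by (rule sigma_finite_nu)
 interpret P: pair_sigma_finite gauss nu ..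
 let ?f = "%z u. 1 - cos (u * (x * z)) * exp (- v\<^sup>2 * u^2 / 2)"
 have nn: "0 <= ?f z u" for z u
  using mult_le_one[of "abs (cos (u * (x * z)))" "exp (- v\<^sup>2 * u^2 / 2)"] abs_le_iff[of "cos (u * (x * z)) * exp (- v\<^sup>2 * u^2 / 2)" 1]
  by (simp add: abs_mult)
 have c: "(LINT u|nu. norm (?f z u)) = H (x * z) v" "integrable nu (?f z)" "(LINT u|nu. ?f z u) = H (x * z) v" for z
  using H_nu[of "x * z" v] nn by (auto simp: has_bochner_integral_iff)
 have i: "integrable (gauss \<Otimes>\<^sub>M nu) (%(z, u). ?f z u)"
  using integrable_H_normal c by (intro P.Fubini_integrable) (auto simp: split_beta')
 have "(LINT z|gauss. H (x * z) v) = (LINT z|gauss. (LINT u|nu. ?f z u))" by (simp only: c)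
 also have "... = (LINT u|nu. (LINT z|gauss. ?f z u))" using P.Fubini_integral[OF i] by simp
 also have "... = (LINT u|nu. 1 - exp (- x\<^sup>2 * u^2 / 2) * exp (- v\<^sup>2 * u^2 / 2))"
 proof (intro LINT_cong refl)
  fix u
  have ic: "integrable gauss (%z. cos (u * (x * z)))" by (intro gauss.integrable_bounded[of _ 1]) auto
  have "(LINT z|gauss. 1 - cos (u * (0 - x * z))) = 1 - exp (- x\<^sup>2 * u^2 / 2)"
   using cos_shift_normal[of u 0 x] by simp
  hence "(LINT z|gauss. cos (u * (x * z))) = exp (- x\<^sup>2 * u^2 / 2)" using ic gauss.prob_space by simp
  thus "(LINT z|gauss. ?f z u) = 1 - exp (- x\<^sup>2 * u^2 / 2) * exp (- v\<^sup>2 * u^2 / 2)"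
   using ic gauss.prob_space by simp
 qed
 also have "... = hmean x v" using hmean_nu by (rule has_bochner_integral_integral_eq)
 finally show ?thesis .
qed

text \<open>Negative type made explicit: after expansion of cos(u (x_j - x_k)) the integrand is a
  sum of two squares, the cosine sum of the data minus its Gaussian counterpart, and the sine sum of
  the data. The Gaussian side has no sine part by symmetry.\<close>

lemma energy_inequality:
 fixes x v :: "nat => real"
 assumes "finite J"
 shows "(\<Sum>j\<in>J. \<Sum>k\<in>J. abs (x j - x k)) + (\<Sum>j\<in>J. \<Sum>k\<in>J. hmean (v j) (v k)) <= 2 * (\<Sum>j\<in>J. \<Sum>k\<in>J. H (x j) (v k))"
proof -
 let ?e = "%k u. exp (- (v k)\<^sup>2 * u^2 / 2)"
 define F where "F j k u = 2 * (1 - cos (u * x j) * ?e k u) - (1 - cos (u * (x j - x k))) - (1 - ?e j u * ?e k u)" for j k u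
 have F: "has_bochner_integral nu (F j k) (2 * H (x j) (v k) - abs (x j - x k) - hmean (v j) (v k))" for j k
  unfolding F_def[abs_def]
  by (intro has_bochner_integral_diff has_bochner_integral_mult_right H_nu hmean_nu nu_cos)
 let ?a = "\<Sum>j\<in>J. \<Sum>k\<in>J. 2 * H (x j) (v k) - abs (x j - x k) - hmean (v j) (v k)"
 have "has_bochner_integral nu (%u. \<Sum>j\<in>J. \<Sum>k\<in>J. F j k u) ?a"
  using F by (intro has_bochner_integral_sum)
 hence "?a = (LINT u|nu. (\<Sum>j\<in>J. \<Sum>k\<in>J. F j k u))"
  by (simp add: has_bochner_integral_integral_eq)
 also have "... >= 0"
 proof (intro integral_nonneg_AE AE_I2)
  fix u
  have "(\<Sum>j\<in>J. \<Sum>k\<in>J. F j k u) = (\<Sum>j\<in>J. \<Sum>k\<in>J. cos (u * x j) * cos (u * x k) + sin (u * x j) * sin (u * x k) - 2 * (cos (u * x j) * ?e k u) + ?e j u * ?e k u)"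
   unfolding F_def by (intro sum.cong refl) (simp add: right_diff_distrib cos_diff)
  also have "... = (\<Sum>j\<in>J. cos (u * x j))^2 + (\<Sum>j\<in>J. sin (u * x j))^2 - 2 * ((\<Sum>j\<in>J. cos (u * x j)) * (\<Sum>k\<in>J. ?e k u)) + (\<Sum>k\<in>J. ?e k u)^2"
   unfolding power2_eq_square[of "sum _ _"] sum_product by (simp add: sum.distrib sum_subtractf sum_distrib_left)
  also have "... = ((\<Sum>j\<in>J. cos (u * x j)) - (\<Sum>k\<in>J. ?e k u))^2 + (\<Sum>j\<in>J. sin (u * x j))^2"
   by (simp add: power2_diff)
  finally show "0 <= (\<Sum>j\<in>J. \<Sum>k\<in>J. F j k u)" by simp
 qed
 finally show ?thesis by (simp add: sum_subtractf sum_distrib_left)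
qed

section \<open>Second-order functionals from shifted first absolute moments\<close>

definition lebesgue_upto :: "real => real measure" where
 "lebesgue_upto t = density lborel (%r. ennreal (indicator {0..t} r))"

lemma max_square_eq:
 fixes y t :: real
 assumes "0 <= y" "0 <= t"
 shows "has_bochner_integral (lebesgue_upto t) (%r. max y r) (if t <= y then t * y else (y^2 + t^2) / 2)"
proof -
 have a: "has_bochner_integral lborel (%r. indicator {0..t} r *\<^sub>R max y r) (if t <= y then t * y else (y^2 + t^2) / 2)"
 proof (cases "t <= y")
  case True
  have "has_bochner_integral lborel (%r. y * indicator {0..t} r) (y * t - y * 0)"
   using assms by (intro has_bochner_integral_FTC_Icc_real[of 0 t "%r. y * r" "%_. y"]) (auto intro!: derivative_eq_intros)
  also have "(%r. y * indicator {0..t} r) = (%r. indicator {0..t} r *\<^sub>R max y r)"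
   using True by (auto simp: indicator_def)
  finally show ?thesis using True by (simp add: mult.commute)
 next
  case False
  hence yt: "y <= t" by simp
  have "has_bochner_integral lborel (%r. y * indicator {0..y} r + r * indicator {y..t} r) ((y * y - y * 0) + (t^2 / 2 - y^2 / 2))"
  proof (rule has_bochner_integral_add)
   show "has_bochner_integral lborel (%r. y * indicator {0..y} r) (y * y - y * 0)"
    using assms by (intro has_bochner_integral_FTC_Icc_real[of 0 y "%r. y * r" "%_. y"]) (auto intro!: derivative_eq_intros)
   show "has_bochner_integral lborel (%r. r * indicator {y..t} r) (t^2 / 2 - y^2 / 2)"
    using yt by (intro has_bochner_integral_FTC_Icc_real[of y t "%r. r^2 / 2" "%r. r"]) (auto intro!: derivative_eq_intros)
  qed
  also have "(y * y - y * 0) + (t^2 / 2 - y^2 / 2) = (y^2 + t^2) / 2"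
   by (simp add: power2_eq_square field_simps)
  finally have 1: "has_bochner_integral lborel (%r. y * indicator {0..y} r + r * indicator {y..t} r) ((y^2 + t^2) / 2)" .
  have "AE r in lborel. indicator {0..t} r *\<^sub>R max y r = y * indicator {0..y} r + r * indicator {y..t} r"
   using AE_lborel_singleton[of y] by eventually_elim (use assms yt in \<open>auto simp: indicator_def max_def\<close>)
  hence "has_bochner_integral lborel (%r. indicator {0..t} r *\<^sub>R max y r) ((y^2 + t^2) / 2)"
   by (subst has_bochner_integral_cong_AE[where g = "%r. y * indicator {0..y} r + r * indicator {y..t} r"]) (auto intro: 1)
  thus ?thesis using False by simp
 qed
 thus ?thesis unfolding lebesgue_upto_def by (intro has_bochner_integral_density) auto
qed

lemma max_abs_eq: "max (abs x) (abs t) = (abs (x - t) + abs (x - (- t))) / 2" for x t :: real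
 by (auto simp: max_def abs_if)

text \<open>Up to y^2, the square of max y t is a superposition of the functions max y r with r <=
  t, and these are averages of |y - r| and |y + r|. Closeness of second moments and of shifted
  absolute moments therefore passes to truncated second moments.\<close>

lemma max_square:
 assumes "0 <= y" "0 <= t"
 shows "(max y t)^2 = y^2 + 2 * t * max y t - 2 * (\<integral>r. max y r \<partial>lebesgue_upto t)"
 using has_bochner_integral_integral_eq[OF max_square_eq[OF assms]] by (auto simp: max_def power2_eq_square algebra_simps)

lemma finite_lebesgue_upto: "finite_measure (lebesgue_upto t)" unfolding lebesgue_upto_def
 by (intro finite_measureI, cases "0 <= t") (auto simp: emeasure_density ennreal_indicator)

lemma sets_lebesgue_upto [measurable_cong, simp]: "sets (lebesgue_upto t) = sets borel"
 by (simp add: lebesgue_upto_def)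

lemma space_lebesgue_upto [simp]: "space (lebesgue_upto t) = UNIV" by (simp add: lebesgue_upto_def)

lemma AE_lebesgue_upto: "AE r in lebesgue_upto t. 0 <= r \<and> r <= t"
 unfolding lebesgue_upto_def by (subst AE_density) (auto simp: indicator_def intro!: AE_I2)

lemma measure_lebesgue_upto: "0 <= t ==> (\<integral>r. 1 \<partial>lebesgue_upto t) = t"
 unfolding lebesgue_upto_def by (subst integral_density) auto

lemma (in prob_space) expectation_max_square:
 assumes X: "integrable M X" and X2: "integrable M (%x. (X x)^2)" and t: "0 <= t"
 shows "(LINT x|M. (max (abs (X x)) t)^2) = (LINT x|M. (X x)^2) + 2 * t * (LINT x|M. max (abs (X x)) t)
   - 2 * (\<integral>r. (LINT x|M. max (abs (X x)) r) \<partial>lebesgue_upto t)"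
  and "integrable (lebesgue_upto t) (%r. (LINT x|M. max (abs (X x)) r))"
proof -
 interpret I: finite_measure "lebesgue_upto t" by (rule finite_lebesgue_upto)
 interpret P: pair_sigma_finite M "lebesgue_upto t" ..
 have [measurable]: "X \<in> borel_measurable M" using X by auto
 have m: "integrable (lebesgue_upto t) (%r. max (abs (X x)) r)" for x
  using max_square_eq[of "abs (X x)" t] t by (auto simp: has_bochner_integral_iff)
 have nm: "(\<integral>r. norm (max (abs (X x)) r) \<partial>lebesgue_upto t) = (\<integral>r. max (abs (X x)) r \<partial>lebesgue_upto t)" for x
  by (intro LINT_cong refl) auto
 have mm: "(\<integral>r. max (abs (X x)) r \<partial>lebesgue_upto t) = ((X x)^2 + 2 * t * max (abs (X x)) t - (max (abs (X x)) t)^2) / 2" for x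
  using max_square[of "abs (X x)" t] t by simp
 have imax: "integrable M (%x. max (abs (X x)) t)" using X by auto
 have imax2: "integrable M (%x. (max (abs (X x)) t)^2)"
  by (rule int_bound[where f = "%x. (X x)^2 + t^2"]) (use X2 in \<open>auto simp: max_def intro!: AE_I2\<close>)
 have i: "integrable (M \<Otimes>\<^sub>M lebesgue_upto t) (%(x, r). max (abs (X x)) r)"
 proof (rule P.Fubini_integrable)
  show "integrable M (%x. \<integral>r. norm (case (x, r) of (x, r) => max (abs (X x)) r) \<partial>lebesgue_upto t)"
   using X2 imax imax2 unfolding prod.case nm mm by auto
 qed (use m in auto)
 show "integrable (lebesgue_upto t) (%r. (LINT x|M. max (abs (X x)) r))" using P.integrable_snd[OF i] by simp
 let ?a = "\<integral>r. (LINT x|M. max (abs (X x)) r) \<partial>lebesgue_upto t"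
 have "?a = (LINT x|M. (\<integral>r. max (abs (X x)) r \<partial>lebesgue_upto t))"
  using P.Fubini_integral[OF i] by simp
 also have "... = ((LINT x|M. (X x)^2) + 2 * t * (LINT x|M. max (abs (X x)) t) - (LINT x|M. (max (abs (X x)) t)^2)) / 2"
  unfolding mm using X2 imax imax2 by simp
 finally show "(LINT x|M. (max (abs (X x)) t)^2) = (LINT x|M. (X x)^2) + 2 * t * (LINT x|M. max (abs (X x)) t)
   - 2 * ?a" by simp
qed

text \<open>Products of two maxima reduce to one square and first-order terms.\<close>

lemma max_mult_max:
 fixes y s t :: real
 assumes "0 <= y" "0 <= s" "s <= t"
 shows "max y s * max y t = t * max y s - t * max y t + (max y t)^2"
 using assms by (auto simp: max_def power2_eq_square algebra_simps)

text \<open>\<open>X\<close> will be a block sum and \<open>Z\<close> its Gaussian counterpart, on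
  unrelated spaces: no coupling is constructed, only integrals are compared.\<close>

locale two_variables = M: prob_space M + N: prob_space N for M :: "'a measure" and N :: "'b measure" +
 fixes X :: "'a => real" and Z :: "'b => real" and w e :: real
 assumes X: "integrable M X" "integrable M (%x. (X x)^2)" and Z: "integrable N Z" "integrable N (%x. (Z x)^2)"
  and first: "!!a. abs ((LINT x|M. abs (X x - a)) - (LINT x|N. abs (Z x - a))) <= w"
  and second: "abs ((LINT x|M. (X x)^2) - (LINT x|N. (Z x)^2)) <= e"
begin

lemma X_measurable [measurable]: "X \<in> borel_measurable M" and Z_measurable [measurable]: "Z \<in> borel_measurable N"
 using X Z by auto

lemma integrable_abs_shift: "integrable M (%x. abs (X x - a))" "integrable N (%x. abs (Z x - a))"
 using X Z by auto

lemma w_nonneg: "0 <= w" using first[of 0] by linarith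

lemma integrable_max_shift: "integrable M (%x. max (abs (X x)) t)" "integrable N (%x. max (abs (Z x)) t)"
 using X Z by auto

lemma integrable_max_prod: "integrable M (%y. max (abs (X y)) s * max (abs (X y)) t)" "integrable N (%y. max (abs (Z y)) s * max (abs (Z y)) t)"
proof -
 have b: "abs (max (abs x) s * max (abs x) t) <= 2 * x^2 + s^2 + t^2" for x :: real
 proof -
  have m: "(max (abs x) r)^2 <= x^2 + r^2" for r by (auto simp: max_def)
  show ?thesis using abs_mult_le_squares[of "max (abs x) s" "max (abs x) t"] m[of s] m[of t] by linarith
 qed
 have i: "integrable M (%y. 2 * (X y)^2 + s^2 + t^2)" "integrable N (%y. 2 * (Z y)^2 + s^2 + t^2)"
  using X Z by auto
 show "integrable M (%y. max (abs (X y)) s * max (abs (X y)) t)"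
  by (rule int_bound[OF i(1)]) (use b in \<open>auto intro!: AE_I2 intro: order_trans\<close>)
 show "integrable N (%y. max (abs (Z y)) s * max (abs (Z y)) t)"
  by (rule int_bound[OF i(2)]) (use b in \<open>auto intro!: AE_I2 intro: order_trans\<close>)
qed

lemma max_close:
 assumes "0 <= t"
 shows "abs ((LINT x|M. max (abs (X x)) t) - (LINT x|N. max (abs (Z x)) t)) <= w"
proof -
 have "(LINT x|M. max (abs (X x)) t) = ((LINT x|M. abs (X x - t)) + (LINT x|M. abs (X x - (- t)))) / 2"
 proof -
  have "max (abs (X x)) t = (abs (X x - t) + abs (X x - (- t))) / 2" for x
   using max_abs_eq[of "X x" t] assms by simp
  thus ?thesis using integrable_abs_shift(1)[of t] integrable_abs_shift(1)[of "- t"]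
   by (simp only: integral_divide_zero Bochner_Integration.integral_add)
 qed
 moreover have "(LINT x|N. max (abs (Z x)) t) = ((LINT x|N. abs (Z x - t)) + (LINT x|N. abs (Z x - (- t)))) / 2"
 proof -
  have "max (abs (Z x)) t = (abs (Z x - t) + abs (Z x - (- t))) / 2" for x
   using max_abs_eq[of "Z x" t] assms by simp
  thus ?thesis using integrable_abs_shift(2)[of t] integrable_abs_shift(2)[of "- t"]
   by (simp only: integral_divide_zero Bochner_Integration.integral_add)
 qed
 ultimately show ?thesis using first[of t] first[of "- t"] by (simp only: abs_le_iff) (simp add: field_simps)
qed

text \<open>The explicit term of \<open>expectation_max_square\<close> contributes 2 t w and the
  integral over r <= t another 2 t w.\<close>

lemma max_square_close:
 assumes t: "0 <= t"
 shows "abs ((LINT x|M. (max (abs (X x)) t)^2) - (LINT x|N. (max (abs (Z x)) t)^2)) <= e + 4 * t * w"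
proof -
 interpret I: finite_measure "lebesgue_upto t" by (rule finite_lebesgue_upto)
 note EM = M.expectation_max_square[OF X t] and EN = N.expectation_max_square[OF Z t]
 let ?m = "%r. (LINT x|M. max (abs (X x)) r)" and ?n = "%r. (LINT x|N. max (abs (Z x)) r)"
 have "abs ((\<integral>r. ?m r \<partial>lebesgue_upto t) - (\<integral>r. ?n r \<partial>lebesgue_upto t)) = abs (\<integral>r. ?m r - ?n r \<partial>lebesgue_upto t)"
  using EM(2) EN(2) by simp
 also have "... <= (\<integral>r. abs (?m r - ?n r) \<partial>lebesgue_upto t)" by (rule integral_abs_bound)
 also have "... <= (\<integral>r. w * 1 \<partial>lebesgue_upto t)"
 proof (intro integral_mono_AE)
  show "AE r in lebesgue_upto t. abs (?m r - ?n r) <= w * 1"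
   using AE_lebesgue_upto[of t] by eventually_elim (auto intro: max_close)
 qed (use EM(2) EN(2) in auto)
 also have "... = w * t" using measure_lebesgue_upto[OF t] by (simp only: integral_mult_right_zero)
 finally have d: "abs ((\<integral>r. ?m r \<partial>lebesgue_upto t) - (\<integral>r. ?n r \<partial>lebesgue_upto t)) <= w * t" .
 have "abs (2 * t * (?m t - ?n t)) <= 2 * t * w"
  using max_close[OF t] t by (simp add: abs_mult mult_left_mono)
 hence "abs (2 * t * ?m t - 2 * t * ?n t) <= 2 * t * w" by (simp only: right_diff_distrib)
 thus ?thesis unfolding EM(1) EN(1) using second d mult.commute[of w t] by linarith
qed

lemma max_mult_close:
 assumes "0 <= s" "0 <= t"
 shows "abs ((LINT x|M. max (abs (X x)) s * max (abs (X x)) t) - (LINT x|N. max (abs (Z x)) s * max (abs (Z x)) t)) <= e + 6 * (s + t) * w"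
proof -
 have main: "abs ((LINT x|M. max (abs (X x)) s * max (abs (X x)) t) - (LINT x|N. max (abs (Z x)) s * max (abs (Z x)) t)) <= e + 6 * (s + t) * w"
  if st: "0 <= s" "s <= t" for s t
 proof -
  have t: "0 <= t" using st by simp
  have iX: "integrable M (%x. (max (abs (X x)) t)^2)" and iZ: "integrable N (%x. (max (abs (Z x)) t)^2)"
   using integrable_max_prod[of t t] by (auto simp: power2_eq_square)
  have 1: "(LINT x|M. max (abs (X x)) s * max (abs (X x)) t) = t * (LINT x|M. max (abs (X x)) s) - t * (LINT x|M. max (abs (X x)) t) + (LINT x|M. (max (abs (X x)) t)^2)"
   using max_mult_max[OF abs_ge_zero st] integrable_max_shift iX by simp
  have 2: "(LINT x|N. max (abs (Z x)) s * max (abs (Z x)) t) = t * (LINT x|N. max (abs (Z x)) s) - t * (LINT x|N. max (abs (Z x)) t) + (LINT x|N. (max (abs (Z x)) t)^2)"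
   using max_mult_max[OF abs_ge_zero st] integrable_max_shift iZ by simp
  have a: "abs (t * (LINT x|M. max (abs (X x)) r) - t * (LINT x|N. max (abs (Z x)) r)) <= t * w" if "0 <= r" for r
   unfolding right_diff_distrib[symmetric] using max_close[OF that] t by (simp add: abs_mult mult_left_mono)
  have "abs ((LINT x|M. max (abs (X x)) s * max (abs (X x)) t) - (LINT x|N. max (abs (Z x)) s * max (abs (Z x)) t)) <= e + 4 * t * w + 2 * (t * w)"
   unfolding 1 2 using a[OF st(1)] a[OF t] max_square_close[OF t] by linarith
  also have "... <= e + 6 * (s + t) * w" using st w_nonneg by (simp add: distrib_right)
  finally show ?thesis .
 qed
 show ?thesis
 proof (cases "s <= t")
  case True thus ?thesis using main assms by blast
 next
  case False thus ?thesis using main[of t s] assms by (simp add: mult.commute add.commute)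
 qed
qed

end

text \<open>The Gaussian integral inside \<open>H\<close> is taken out of the expectation, so that
  facts about maxima pass to \<open>H\<close>. The weight \<open>Q\<close> allows a product to be
  treated one factor at a time.\<close>

lemma (in prob_space) expectation_H:
 assumes X: "X \<in> borel_measurable M" and Q: "integrable M Q" "integrable M (%x. Q x * abs (X x))" and Q0: "!!x. 0 <= Q x"
 shows "integrable M (%x. Q x * H (X x) v)"
  and "(LINT x|M. Q x * H (X x) v) = (LINT z|gauss. (LINT x|M. Q x * max (abs (X x)) (abs (v * z))))"
  and "integrable gauss (%z. (LINT x|M. Q x * max (abs (X x)) (abs (v * z))))"
proof -
 interpret P: pair_sigma_finite M gauss ..
 note X[measurable]
 have [measurable]: "Q \<in> borel_measurable M" using Q by auto
 show iH: "integrable M (%x. Q x * H (X x) v)"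
 proof (rule int_bound)
  show "integrable M (%x. Q x * abs (X x) + abs v * Q x)" using Q by auto
  show "AE x in M. norm (Q x * H (X x) v) <= norm (Q x * abs (X x) + abs v * Q x)"
  proof (intro AE_I2)
   fix x
   have "Q x * H (X x) v <= Q x * (abs (X x) + abs v)" by (intro mult_left_mono H_le Q0)
   moreover have "0 <= Q x * H (X x) v" by (intro mult_nonneg_nonneg H_nonneg Q0)
   ultimately show "norm (Q x * H (X x) v) <= norm (Q x * abs (X x) + abs v * Q x)" by (simp add: algebra_simps)
  qed
 qed measurable
 let ?f = "%x z. Q x * max (abs (X x)) (abs (v * z))"
 have nf: "norm (?f x z) = ?f x z" for x z using Q0[of x] by (simp add: mult_nonneg_nonneg max_def)
 have iz: "(LINT z|gauss. ?f x z) = Q x * H (X x) v" for x unfolding H_max by (rule integral_mult_right_zero)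
 have i: "integrable (M \<Otimes>\<^sub>M gauss) (%(x, z). ?f x z)"
 proof (rule P.Fubini_integrable)
  show "integrable M (%x. \<integral>z. norm (case (x, z) of (x, z) => ?f x z) \<partial>gauss)"
   unfolding prod.case nf iz by (rule iH)
  show "AE x in M. integrable gauss (%z. case (x, z) of (x, z) => ?f x z)"
   unfolding prod.case by (intro AE_I2 integrable_mult_right integrable_max)
 qed measurable
 show "integrable gauss (%z. (LINT x|M. ?f x z))" using P.integrable_snd[OF i] by simp
 show "(LINT x|M. Q x * H (X x) v) = (LINT z|gauss. (LINT x|M. ?f x z))"
  using P.Fubini_integral[OF i] unfolding iz[symmetric] by simp
qed

lemma integral_affine_abs_normal:
 "integrable gauss (%z. a + b * abs (v * z))" "b >= 0 ==> (LINT z|gauss. a + b * abs (v * z)) <= a + b * abs v"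
proof -
 show "integrable gauss (%z. a + b * abs (v * z))" using std_normal_moments(2) by (auto simp: abs_mult)
 assume b: "b >= 0"
 have "(LINT z|gauss. a + b * abs (v * z)) = (LINT z|gauss. a + b * abs v * abs z)" by (simp add: abs_mult mult.assoc)
 also have "... = a + b * abs v * sqrt (2 / pi)" using std_normal_moments(2,4) gauss.prob_space by simp
 also have "... <= a + b * abs v * 1"
  using sqrt_2_pi_le b by (intro add_left_mono mult_left_mono mult_nonneg_nonneg) auto
 finally show "(LINT z|gauss. a + b * abs (v * z)) <= a + b * abs v" by simp
qed

lemma std_normal_integral_diff_le:
 assumes "integrable gauss f" "integrable gauss g" "b >= 0" "!!z. abs (f z - g z) <= a + b * abs (v * z)"
 shows "abs ((LINT z|gauss. f z) - (LINT z|gauss. g z)) <= a + b * abs v"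
proof -
 have "abs ((LINT z|gauss. f z) - (LINT z|gauss. g z)) = abs (\<integral>z. f z - g z \<partial>gauss)" using assms by simp
 also have "... <= (LINT z|gauss. abs (f z - g z))" by (rule integral_abs_bound)
 also have "... <= (LINT z|gauss. a + b * abs (v * z))"
  using assms integral_affine_abs_normal(1) by (intro integral_mono) auto
 also have "... <= a + b * abs v" by (rule integral_affine_abs_normal(2)[OF assms(3)])
 finally show ?thesis .
qed

context two_variables
begin

lemma H_close: "abs ((LINT x|M. H (X x) v) - (LINT x|N. H (Z x) v)) <= w"
proof -
 note EM = M.expectation_H[where Q = "%_. 1" and X = X and v = v]
 note EN = N.expectation_H[where Q = "%_. 1" and X = Z and v = v]
 have "abs ((LINT z|gauss. (LINT x|M. 1 * max (abs (X x)) (abs (v * z)))) - (LINT z|gauss. (LINT x|N. 1 * max (abs (Z x)) (abs (v * z))))) <= w + 0 * abs v"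
  using EM(3) EN(3) X Z by (intro std_normal_integral_diff_le) (auto intro: max_close)
 thus ?thesis using EM(2) EN(2) X Z by simp
qed

lemma H_max_close:
 assumes s: "0 <= s"
 shows "abs ((LINT x|M. max (abs (X x)) s * H (X x) v) - (LINT x|N. max (abs (Z x)) s * H (Z x) v)) <= e + 6 * (s + abs v) * w"
proof -
 have iX: "integrable M (%x. max (abs (X x)) s * abs (X x))" and iZ: "integrable N (%x. max (abs (Z x)) s * abs (Z x))"
  using integrable_max_prod[of s 0] by auto
 note EM = M.expectation_H[where Q = "%x. max (abs (X x)) s" and X = X and v = v, OF X_measurable integrable_max_shift(1) iX]
 note EN = N.expectation_H[where Q = "%x. max (abs (Z x)) s" and X = Z and v = v, OF Z_measurable integrable_max_shift(2) iZ]
 have "abs ((LINT z|gauss. (LINT x|M. max (abs (X x)) s * max (abs (X x)) (abs (v * z)))) - (LINT z|gauss. (LINT x|N. max (abs (Z x)) s * max (abs (Z x)) (abs (v * z)))))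
  <= (e + 6 * s * w) + (6 * w) * abs v"
 proof (rule std_normal_integral_diff_le)
  fix z
  show "abs ((LINT x|M. max (abs (X x)) s * max (abs (X x)) (abs (v * z))) - (LINT x|N. max (abs (Z x)) s * max (abs (Z x)) (abs (v * z))))
   <= (e + 6 * s * w) + (6 * w) * abs (v * z)"
   using max_mult_close[OF s, of "abs (v * z)"] by (simp add: algebra_simps)
 qed (use EM(3) EN(3) w_nonneg in \<open>auto simp: le_max_iff_disj\<close>)
 thus ?thesis using EM(2) EN(2) by (simp add: algebra_simps le_max_iff_disj)
qed

text \<open>One factor is opened into maxima here; the other one was opened in
  \<open>H_max_close\<close>.\<close>

lemma H_mult_close:
 "abs ((LINT x|M. H (X x) v' * H (X x) v) - (LINT x|N. H (Z x) v' * H (Z x) v)) <= e + 6 * (abs v' + abs v) * w"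
proof -
 have iHX: "integrable M (%x. H (X x) v)" and iHZ: "integrable N (%x. H (Z x) v)"
  using M.expectation_H(1)[where Q = "%_. 1" and X = X and v = v] N.expectation_H(1)[where Q = "%_. 1" and X = Z and v = v] X Z by auto
 have "integrable M (%x. abs (X x) * H (X x) v)" "integrable N (%x. abs (Z x) * H (Z x) v)"
  using M.expectation_H(1)[where Q = "%x. abs (X x)" and X = X and v = v] N.expectation_H(1)[where Q = "%x. abs (Z x)" and X = Z and v = v] X Z
  by (auto simp: power2_eq_square)
 hence iX: "integrable M (%x. H (X x) v * abs (X x))" and iZ: "integrable N (%x. H (Z x) v * abs (Z x))"
  by (simp_all add: mult.commute)
 note EM = M.expectation_H[where Q = "%x. H (X x) v" and X = X and v = v', OF X_measurable iHX iX H_nonneg]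
 note EN = N.expectation_H[where Q = "%x. H (Z x) v" and X = Z and v = v', OF Z_measurable iHZ iZ H_nonneg]
 have "abs ((LINT z|gauss. (LINT x|M. H (X x) v * max (abs (X x)) (abs (v' * z)))) - (LINT z|gauss. (LINT x|N. H (Z x) v * max (abs (Z x)) (abs (v' * z)))))
  <= (e + 6 * abs v * w) + (6 * w) * abs v'"
 proof (rule std_normal_integral_diff_le[OF EM(3) EN(3)])
  fix z
  show "abs ((LINT x|M. H (X x) v * max (abs (X x)) (abs (v' * z))) - (LINT x|N. H (Z x) v * max (abs (Z x)) (abs (v' * z))))
   <= (e + 6 * abs v * w) + (6 * w) * abs (v' * z)"
   using H_max_close[of "abs (v' * z)" v] by (simp add: algebra_simps)
 qed (use w_nonneg in auto)
 thus ?thesis unfolding EM(2)[symmetric] EN(2)[symmetric] by (simp add: algebra_simps)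
qed

end

lemma tv_add_le: "tv (%i. w i + w' i) n <= tv w n + tv w' n"
 unfolding tv_def sum.distrib[symmetric] by (intro sum_mono) linarith

lemma tv_scale: "tv (%i. a * w i) n = abs a * tv w n"
 unfolding tv_def sum_distrib_left by (intro sum.cong refl) (simp add: abs_mult[symmetric] right_diff_distrib)

lemma tv_nonneg: "0 <= tv w n" unfolding tv_def by (intro sum_nonneg) auto

text \<open>Cutting a sequence off outside an interval adds two boundary jumps of size at most
  \<open>A\<close>, charged to the indices p - 1 and q.\<close>

lemma tv_interval_le:
 fixes a :: "nat => real"
 assumes a: "!!i. i \<in> {1..n} ==> abs (a i) <= A" and B: "(\<Sum>i=1..<n. abs (a (Suc i) - a i)) <= B"
  and pq: "{p..q} \<subseteq> {1..n}" and A: "0 <= A"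
 shows "tv (%i. if i \<in> {p..q} then a i else 0) n <= B + 2 * A"
proof (cases "p <= q")
 case True
 hence pq': "1 <= p" "q <= n" using pq by auto
 let ?w = "%i. if i \<in> {p..q} then a i else 0"
  and ?a = "\<Sum>i=1..n. if i \<in> {1..<n} then abs (a (Suc i) - a i) else 0"
 have "tv ?w n <= (\<Sum>i=1..n. (if i \<in> {1..<n} then abs (a (Suc i) - a i) else 0) + (if i = p - 1 then A else 0) + (if i = q then A else 0))"
  unfolding tv_def
 proof (intro sum_mono)
  fix i assume i: "i \<in> {1..n}"
  define t1 t2 t3 where "t1 = (if i \<in> {1..<n} then abs (a (Suc i) - a i) else 0)" and "t2 = (if i = p - 1 then A else 0)"
   and "t3 = (if i = q then A else 0)"
  have nn: "0 <= t1" "0 <= t2" "0 <= t3" using A by (auto simp: t1_def t2_def t3_def)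
  consider "p <= i" "i < q" | "i = q" | "Suc i = p" | "Suc i < p \<or> q < i" by linarith
  hence "abs (?w (Suc i) - ?w i) <= t1 + t2 + t3"
  proof cases
   case 1
   hence "abs (?w (Suc i) - ?w i) = t1" using pq' i by (simp add: t1_def)
   thus ?thesis using nn by linarith
  next
   case 2
   hence "abs (?w (Suc i) - ?w i) = abs (a q)" "t3 = A" using True by (simp_all add: t3_def)
   thus ?thesis using a[of q] pq' i 2 nn by simp
  next
   case 3
   hence "abs (?w (Suc i) - ?w i) = abs (a p)" "t2 = A" using True by (simp_all add: t2_def)
   moreover have "p \<in> {1..n}" using pq' True by auto
   ultimately show ?thesis using a[of p] nn by simp
  next
   case 4
   hence "abs (?w (Suc i) - ?w i) = 0" by auto
   thus ?thesis using nn by linarith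
  qed
  thus "abs (?w (Suc i) - ?w i) <= (if i \<in> {1..<n} then abs (a (Suc i) - a i) else 0) + (if i = p - 1 then A else 0) + (if i = q then A else 0)"
   unfolding t1_def t2_def t3_def .
 qed
 also have "... = ?a + (\<Sum>i=1..n. if i = p - 1 then A else 0) + (\<Sum>i=1..n. if i = q then A else 0)"
  by (simp only: sum.distrib)
 also have "?a = (\<Sum>i=1..<n. abs (a (Suc i) - a i))" by (intro sum.mono_neutral_cong_right) auto
 also have "(\<Sum>i=1..n. if i = p - 1 then A else 0) <= A" using A by (simp add: sum.delta)
 also have "(\<Sum>i=1..n. if i = q then A else 0) <= A" using A by (simp add: sum.delta)
 finally show ?thesis using B by simp
next
 case False
 have "0 <= B" by (rule order_trans[OF sum_nonneg B]) simp
 thus ?thesis using False A by (simp add: tv_def)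
qed

section \<open>The Hoeffding decomposition\<close>

text \<open>\<open>sg\<close> is the scale at the design points, with size bounded by
  \<open>A\<close> and variation by \<open>B\<close>. The constant \<open>E\<close> of the absolute
  moment estimate is a parameter, so that one value serves all sample sizes. The arguments of
  \<open>admissible\<close> are large enough for blocks, for their differences and for contrasts
  with up to \<open>c0\<close> neighbours on either side.\<close>

locale block_array = rate_mixing M Y C lam p K c \<beta> for M :: "'a measure" and Y C lam p K c \<beta> +
 fixes sg :: "nat => real" and n l b c0 :: nat and A B s0 E :: real
 assumes n: "n = l * b" and l: "1 <= l" and b: "2 <= b"
  and s0: "0 < s0" and sg: "!!i. i \<in> {1..n} ==> s0 <= sg i" "!!i. i \<in> {1..n} ==> sg i <= A"
  and sg_tv: "(\<Sum>i=1..<n. abs (sg (Suc i) - sg i)) <= B"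
  and E: "0 <= E" "!!w I a. admissible (A + 2 * real c0 + 2) (3 * (B + 2 * A)) l n w I ==> kappa2 * s0^2 <= var w I ==>
   abs ((LINT x|M. abs (S w I x - a)) - (LINT z|gauss. abs (sqrt (var w I) * z - a))) <= E * wrate l"
begin

definition wt :: "nat set => nat => real" where
 "wt J i = (if i \<in> J then sg i else 0) / sqrt l"

definition blk :: "nat => nat set" where
 "blk j = {(j - 1) * l + 1..j * l}"

definition X :: "nat => 'a => real" where
 "X j = S (wt (blk j)) (blk j)"

text \<open>Mean squared scale over the block, because \<open>wt\<close> carries the factor
  l^(-1/2).\<close>

definition tau2 :: "nat => real" where
 "tau2 j = (\<Sum>i\<in>blk j. (wt (blk j) i)^2)"

definition tau :: "nat => real" where
 "tau j = sqrt (tau2 j)"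

lemma blk_subset: "j \<in> {1..b} ==> blk j \<subseteq> {1..n}"
proof
 fix i assume j: "j \<in> {1..b}" and i: "i \<in> blk j"
 have "j * l <= b * l" using j by simp
 moreover have "1 <= i" "i <= j * l" using i by (auto simp: blk_def)
 ultimately show "i \<in> {1..n}" unfolding n atLeastAtMost_iff mult.commute[of l b] by linarith
qed

lemma finite_blk [simp]: "finite (blk j)" and card_blk: "j \<in> {1..b} ==> card (blk j) = l"
 by (auto simp: blk_def diff_mult_distrib)

lemma blk_before: "j < k ==> i \<in> blk j ==> i' \<in> blk k ==> i < i'"
proof -
 assume a: "j < k" "i \<in> blk j" "i' \<in> blk k"
 have "j * l <= (k - 1) * l" using a by (intro mult_right_mono) auto
 moreover have "i <= j * l" "(k - 1) * l < i'" using a by (auto simp: blk_def)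
 ultimately show "i < i'" by linarith
qed

lemma blk_disjoint: "j ~= k ==> blk j \<inter> blk k = {}"
 using blk_before[of j k] blk_before[of k j] by (metis disjoint_iff less_irrefl nat_neq_iff)

lemma A_pos: "0 < A" using sg[of 1] s0 l b n by fastforce

lemma B_nonneg: "0 <= B" by (rule order_trans[OF sum_nonneg sg_tv]) simp

lemma sqrt_l: "1 <= sqrt l" using l by simp

lemma wt_le: "J \<subseteq> {1..n} ==> abs (wt J i) <= A / sqrt l"
 unfolding wt_def using sg[of i] s0 A_pos l by (auto simp: abs_divide intro!: divide_right_mono)

lemma wt_ge: "J \<subseteq> {1..n} ==> i \<in> J ==> s0^2 / l <= (wt J i)^2"
 unfolding wt_def using sg(1)[of i] s0 l by (auto simp: power_divide intro!: divide_right_mono power_mono)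

lemma tv_wt:
 assumes "{r..q} \<subseteq> {1..n}"
 shows "tv (wt {r..q}) n <= (B + 2 * A) / sqrt l"
proof -
 have "tv (%i. if i \<in> {r..q} then sg i else 0) n <= B + 2 * A"
  using sg s0 A_pos by (intro tv_interval_le sg_tv assms) fastforce+
 hence "1 / sqrt l * tv (%i. if i \<in> {r..q} then sg i else 0) n <= 1 / sqrt l * (B + 2 * A)"
  by (rule mult_left_mono) simp
 moreover have "wt {r..q} = (%i. (1 / sqrt l) * (if i \<in> {r..q} then sg i else 0))" by (auto simp: wt_def)
 hence "tv (wt {r..q}) n = 1 / sqrt l * tv (%i. if i \<in> {r..q} then sg i else 0) n"
  by (simp only: tv_scale) simp
 ultimately show ?thesis by simp
qed

lemma ln_pos: "l <= n" using n b by simp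

lemma BA_nonneg: "0 <= (B + 2 * A) / sqrt l" using A_pos B_nonneg by simp

lemma admissible_blk:
 assumes "j \<in> {1..b}"
 shows "admissible (A + 2 * real c0 + 2) (3 * (B + 2 * A)) l n (wt (blk j)) (blk j)" unfolding admissible_def
proof (intro conjI allI impI)
 show "blk j \<subseteq> {1..n}" by (rule blk_subset[OF assms])
 show "abs (wt (blk j) i) <= (A + 2 * real c0 + 2) / sqrt l" for i
  by (rule order_trans[OF wt_le[OF blk_subset[OF assms]]]) (auto intro!: divide_right_mono)
 have "tv (wt (blk j)) n <= (B + 2 * A) / sqrt l" using blk_subset[OF assms] unfolding blk_def by (rule tv_wt)
 also have "... <= 3 * (B + 2 * A) / sqrt l" using A_pos B_nonneg by (intro divide_right_mono) auto
 finally show "tv (wt (blk j)) n <= 3 * (B + 2 * A) / sqrt l" .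
 show "real (card (blk j)) <= (A + 2 * real c0 + 2) * real l"
  using A_pos l unfolding card_blk[OF assms] by (simp add: distrib_right)
qed (use l ln_pos in \<open>auto simp: wt_def\<close>)

lemma tau2_bounds:
 assumes "j \<in> {1..b}"
 shows "s0^2 <= tau2 j" "tau2 j <= A^2"
proof -
 have "(\<Sum>i\<in>blk j. s0^2 / l) <= tau2 j" unfolding tau2_def by (intro sum_mono wt_ge blk_subset assms)
 thus "s0^2 <= tau2 j" using l by (simp add: card_blk[OF assms])
 have "(wt (blk j) i)^2 <= A^2 / l" for i
  using power_mono[OF wt_le[OF blk_subset[OF assms]], of i 2] l by (simp add: power_divide)
 hence "tau2 j <= (\<Sum>i\<in>blk j. A^2 / l)" unfolding tau2_def by (intro sum_mono)
 thus "tau2 j <= A^2" using l by (simp add: card_blk[OF assms])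
qed

lemma tau_bounds:
 assumes "j \<in> {1..b}"
 shows "s0 <= tau j" "tau j <= A"
 using tau2_bounds[OF assms] s0 A_pos unfolding tau_def by (auto intro: real_le_rsqrt real_le_lsqrt)

definition kap :: real where "kap = sqrt kappa2"

lemma kap_pos: "0 < kap" using kappa2_pos by (simp add: kap_def)

lemma sqrt_var_blk: "sqrt (var (wt (blk j)) (blk j)) = kap * tau j"
 by (simp add: var_def kap_def tau_def tau2_def real_sqrt_mult)

lemma X_measurable [measurable]: "X j \<in> borel_measurable M" unfolding X_def by measurable

lemma X_integrable:
 assumes "j \<in> {1..b}"
 shows "integrable M (X j)" "integrable M (%x. (X j x)^2)"
 unfolding X_def using blk_subset[OF assms] by (auto intro!: integrable_S integrable_S_sq)

definition eps :: real where "eps = E * wrate l"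

lemma eps_nonneg: "0 <= eps" unfolding eps_def using E(1) wrate_nonneg by simp

lemma X_first:
 assumes "j \<in> {1..b}"
 shows "abs ((LINT x|M. abs (X j x - a)) - (LINT z|gauss. abs ((kap * tau j) * z - a))) <= eps"
 unfolding X_def eps_def sqrt_var_blk[symmetric] using tau2_bounds[OF assms] kappa2_pos
 by (intro E(2) admissible_blk assms) (auto simp: var_def tau2_def)

definition vconst :: real where
 "vconst = 6 * cov_first_moment * A * (B + 2 * A) + 2 * cov_const * zeta2 * A^2"

lemma X_second:
 assumes "j \<in> {1..b}"
 shows "abs ((LINT z|M. (X j z)^2) - (kap * tau j)^2) <= vconst / l"
proof -
 have n1: "n >= 1" using ln_pos l by simp
 have cf: "cov_first_moment >= 0"
  unfolding cov_first_moment_def by (intro suminf_nonneg summable_cov_first_moment) auto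
 let ?a = "\<Sum>i\<in>blk j. (wt (blk j) i)^2"
 have "abs ((LINT z|M. (S (wt (blk j)) (blk j) z)^2) - kappa2 * ?a)
  <= 2 * cov_first_moment * (A / sqrt l) * tv (wt (blk j)) n + 2 * cov_const * zeta2 / real n * ?a"
  by (intro variance_approx blk_subset assms n1 wt_le) (auto simp: wt_def)
 also have "kappa2 * ?a = (kap * tau j)^2"
  using kappa2_pos tau2_bounds(1)[OF assms] by (simp add: power_mult_distrib kap_def tau_def tau2_def sum_nonneg)
 also have "2 * cov_first_moment * (A / sqrt l) * tv (wt (blk j)) n + 2 * cov_const * zeta2 / real n * ?a
  <= 2 * cov_first_moment * (A / sqrt l) * ((B + 2 * A) / sqrt l) + 2 * cov_const * zeta2 / real l * A^2"
 proof (intro add_mono mult_mono mult_left_mono)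
  show "tv (wt (blk j)) n <= (B + 2 * A) / sqrt l"
   using blk_subset[OF assms] unfolding blk_def by (rule tv_wt)
  show "?a <= A^2" using tau2_bounds(2)[OF assms] by (simp add: tau2_def)
  show "2 * cov_const * zeta2 / real n <= 2 * cov_const * zeta2 / real l"
   using ln_pos l cov_const_pos zeta2 by (intro divide_left_mono) auto
 qed (use cf A_pos cov_const_pos zeta2 tv_nonneg in \<open>auto simp: sum_nonneg\<close>)
 also have "... = (2 * cov_first_moment * A * (B + 2 * A) + 2 * cov_const * zeta2 * A^2) / l"
 proof -
  have "x / sqrt l * (y / sqrt l) = x * y / l" for x y :: real by simp
  hence "2 * cov_first_moment * (A / sqrt l * ((B + 2 * A) / sqrt l)) = 2 * cov_first_moment * (A * (B + 2 * A) / l)"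
   by (simp only:)
  thus ?thesis by (simp only: mult.assoc times_divide_eq_right add_divide_distrib) simp
 qed
 also have "... <= vconst / l"
  unfolding vconst_def using cf A_pos B_nonneg by (intro divide_right_mono add_right_mono mult_right_mono) auto
 finally show ?thesis unfolding X_def .
qed

lemma vconst_nonneg: "0 <= vconst"
proof -
 have "0 <= vconst / l" using X_second[of 1] b by force
 thus ?thesis using l by (simp add: zero_le_divide_iff)
qed

lemma X_two_variables:
 assumes "j \<in> {1..b}"
 shows "two_variables M gauss (X j) (%z. kap * tau j * z) eps (vconst / l)"
proof -
 have "(LINT z|gauss. (kap * tau j * z)^2) = (kap * tau j)^2"
  using std_normal_moments(5) by (simp add: power_mult_distrib)
 thus ?thesis using X_integrable[OF assms] X_first[OF assms] X_second[OF assms] std_normal_moments(1,3)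
  by unfold_locales (auto simp: power_mult_distrib)
qed

text \<open>A difference of two blocks is again an admissible weighted sum, so the moment estimate
  applies to it directly, for adjacent blocks as well; approximate independence of the two is not
  argued for separately. The Gaussian variances add because the supports are disjoint and
  \<open>var\<close> involves only the squared weights.\<close>

lemma X_diff:
 assumes j: "j \<in> {1..b}" and k: "k \<in> {1..b}" and jk: "j ~= k"
 shows "abs ((LINT x|M. abs (X j x - X k x)) - hmean (kap * tau j) (kap * tau k)) <= eps"
proof -
 let ?w = "%i. wt (blk j) i + (- 1) * wt (blk k) i" and ?I = "blk j \<union> blk k"
 have disj: "blk j \<inter> blk k = {}" by (rule blk_disjoint[OF jk])
 have wj: "?w i = wt (blk j) i" if "i \<in> blk j" for i using that disj by (auto simp: wt_def)
 have wk: "?w i = - wt (blk k) i" if "i \<in> blk k" for i using that disj by (auto simp: wt_def)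
 have S: "S ?w ?I x = X j x - X k x" for x
 proof -
  have "S ?w ?I x = (\<Sum>i\<in>blk j. ?w i * Y i x) + (\<Sum>i\<in>blk k. ?w i * Y i x)"
   unfolding S_def by (rule sum.union_disjoint) (use disj in auto)
  also have "(\<Sum>i\<in>blk j. ?w i * Y i x) = X j x" unfolding X_def S_def using wj by (intro sum.cong) auto
  also have "(\<Sum>i\<in>blk k. ?w i * Y i x) = - X k x" unfolding X_def S_def sum_negf[symmetric] using wk by (intro sum.cong) auto
  finally show ?thesis by simp
 qed
 have V: "(\<Sum>i\<in>?I. (?w i)^2) = tau2 j + tau2 k"
 proof -
  have "(\<Sum>i\<in>?I. (?w i)^2) = (\<Sum>i\<in>blk j. (?w i)^2) + (\<Sum>i\<in>blk k. (?w i)^2)"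
   by (rule sum.union_disjoint) (use disj in auto)
  also have "(\<Sum>i\<in>blk j. (?w i)^2) = tau2 j" unfolding tau2_def using wj by (intro sum.cong) auto
  also have "(\<Sum>i\<in>blk k. (?w i)^2) = tau2 k" unfolding tau2_def using wk by (intro sum.cong) auto
  finally show ?thesis .
 qed
 have t0: "0 <= tau2 j" "0 <= tau2 k" by (auto simp: tau2_def sum_nonneg)
 have sv: "sqrt (var ?w ?I) = sqrt ((kap * tau j)^2 + (kap * tau k)^2)"
  unfolding var_def V using kappa2_pos t0 by (simp add: power_mult_distrib kap_def tau_def distrib_left)
 let ?a = "A + 2 * real c0 + 2"
 have ad: "admissible ?a (3 * (B + 2 * A)) l n ?w ?I" unfolding admissible_def
 proof (intro conjI allI impI)
  show "?I \<subseteq> {1..n}" using blk_subset[OF j] blk_subset[OF k] by auto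
  fix i
  have "abs (?w i) <= A / sqrt l"
  proof (cases "i \<in> blk j")
   case True thus ?thesis using wj wt_le[OF blk_subset[OF j]] by simp
  next
   case False thus ?thesis using wt_le[OF blk_subset[OF k], of i] by (simp add: wt_def[of "blk j"])
  qed
  also have "... <= ?a / sqrt l" by (intro divide_right_mono) auto
  finally show "abs (?w i) <= ?a / sqrt l" .
 next
  have "tv ?w n <= tv (wt (blk j)) n + tv (%i. (- 1) * wt (blk k) i) n" by (rule tv_add_le)
  also have "tv (%i. (- 1) * wt (blk k) i) n = tv (wt (blk k)) n" unfolding tv_scale by simp
  also have "tv (wt (blk j)) n <= (B + 2 * A) / sqrt l"
   using blk_subset[OF j] unfolding blk_def by (rule tv_wt)
  also have "tv (wt (blk k)) n <= (B + 2 * A) / sqrt l"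
   using blk_subset[OF k] unfolding blk_def by (rule tv_wt)
  also have "(B + 2 * A) / sqrt l + (B + 2 * A) / sqrt l <= 3 * (B + 2 * A) / sqrt l"
   using BA_nonneg unfolding times_divide_eq_right[symmetric] by linarith
  finally show "tv ?w n <= 3 * (B + 2 * A) / sqrt l" by simp
 next
  have "card ?I <= card (blk j) + card (blk k)" by (rule card_Un_le)
  hence "real (card ?I) <= 2 * real l" unfolding card_blk[OF j] card_blk[OF k] by simp
  also have "... <= ?a * real l" using A_pos by (intro mult_right_mono) auto
  finally show "real (card ?I) <= ?a * real l" .
 qed (use l ln_pos in \<open>auto simp: wt_def\<close>)
 have vg: "kappa2 * s0^2 <= var ?w ?I"
  unfolding var_def V using tau2_bounds(1)[OF j] t0 kappa2_pos by (intro mult_left_mono) auto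
 have "abs ((LINT x|M. abs (S ?w ?I x - 0)) - (LINT z|gauss. abs (sqrt (var ?w ?I) * z - 0))) <= eps"
  unfolding eps_def by (rule E(2)[OF ad vg])
 moreover have "(LINT z|gauss. abs (sqrt (var ?w ?I) * z - 0)) = hmean (kap * tau j) (kap * tau k)"
  unfolding sv hmean_def using std_normal_moments(4) by (simp add: abs_mult)
 ultimately show ?thesis unfolding S by simp
qed

end

lemma hmean_le: "hmean x v <= abs x + abs v"
proof -
 have "sqrt (x^2 + v^2) <= abs x + abs v" by (rule sqrt_sum_squares_le_sum_abs)
 hence "hmean x v <= (abs x + abs v) * 1" unfolding hmean_def using sqrt_2_pi_le by (intro mult_mono) auto
 thus ?thesis by simp
qed

lemma norm_triangle4: "cmod (a + b + c - d) <= cmod a + cmod b + cmod c + cmod d"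
 using norm_triangle_ineq4[of "a + b + c" d] norm_triangle_ineq[of "a + b" c] norm_triangle_ineq[of a b] by linarith

lemma hmean_nonneg: "0 <= hmean x v" by (simp add: hmean_def)

lemma integral_double_sum:
 fixes f :: "'i => 'j => 'a => real"
 assumes f: "!!j k. j \<in> J ==> k \<in> J' ==> integrable N (f j k)"
 shows "(LINT x|N. (\<Sum>j\<in>J. \<Sum>k\<in>J'. f j k x)) = (\<Sum>j\<in>J. \<Sum>k\<in>J'. \<integral>x. f j k x \<partial>N)"
proof -
 have "(LINT x|N. (\<Sum>j\<in>J. \<Sum>k\<in>J'. f j k x)) = (\<Sum>j\<in>J. \<integral>x. (\<Sum>k\<in>J'. f j k x) \<partial>N)"
  using f by (intro LINT_sum int_sum)
 also have "... = (\<Sum>j\<in>J. \<Sum>k\<in>J'. \<integral>x. f j k x \<partial>N)"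
  using f by (intro sum.cong refl LINT_sum)
 finally show ?thesis .
qed

context block_array
begin

definition v :: "nat => real" where "v j = kap * tau j"
definition VB :: real where "VB = kap * A"
text \<open>Projection of the kernel |x - y| with Gaussian blocks as second argument. The average
  includes the block itself and is divided by b, which makes \<open>phi\<close> the same function
  for every block.\<close>

definition phi :: "real => real" where "phi x = (1 / real b) * (\<Sum>k=1..b. H x (v k))"
definition mn :: "nat => real" where "mn j = (1 / real b) * (\<Sum>k=1..b. hmean (v j) (v k))"
text \<open>The centring \<open>mn j\<close> is the Gaussian mean; the true mean is off by at most
  \<open>eps\<close>.\<close>

definition xi :: "nat => 'a => real" where "xi j x = phi (X j x) - mn j"
definition U0 :: "'a => real" where
 "U0 x = 1 / (real b * (real b - 1)) * (\<Sum>j=1..b. \<Sum>k\<in>{1..b} - {j}. abs (X j x - X k x))"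
definition a0 :: real where
 "a0 = 1 / (real b * (real b - 1)) * (\<Sum>j=1..b. \<Sum>k\<in>{1..b} - {j}. hmean (v j) (v k))"

lemma VB_pos: "0 < VB" unfolding VB_def using kap_pos A_pos by simp

lemma v_bounds:
 assumes "j \<in> {1..b}"
 shows "0 < v j" "v j <= VB" "abs (v j) <= VB"
proof -
 show 1: "0 < v j" unfolding v_def using kap_pos tau_bounds(1)[OF assms] s0 by simp
 show 2: "v j <= VB" unfolding v_def VB_def using kap_pos tau_bounds(2)[OF assms] by simp
 show "abs (v j) <= VB" using 1 2 by simp
qed

lemma phi_measurable [measurable]: "phi \<in> borel_measurable borel" unfolding phi_def by measurable

lemma xi_measurable [measurable]: "xi j \<in> borel_measurable M" unfolding xi_def by measurable

lemma average_le:
 assumes "!!k. k \<in> {1..b} ==> f k <= (r::real)"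
 shows "(1 / real b) * (\<Sum>k=1..b. f k) <= r"
proof -
 have "(\<Sum>k=1..b. f k) <= (\<Sum>k=1..b. r)" using assms by (intro sum_mono)
 thus ?thesis using b by (simp add: field_simps)
qed

lemma average_abs_le:
 assumes "!!k. k \<in> {1..b} ==> abs (f k) <= (r::real)"
 shows "abs ((1 / real b) * (\<Sum>k=1..b. f k)) <= r"
proof -
 have "abs ((1 / real b) * (\<Sum>k=1..b. f k)) <= (1 / real b) * (\<Sum>k=1..b. (abs (f k)))"
  by (simp add: abs_mult divide_right_mono)
 also have "... <= r" by (rule average_le[OF assms])
 finally show ?thesis .
qed

lemma average_diff: "(1 / real b) * (\<Sum>k=1..b. f k) - (1 / real b) * (\<Sum>k=1..b. g k) = (1 / real b) * (\<Sum>k=1..b. f k - g k :: real)"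
 by (simp add: sum_subtractf right_diff_distrib)

lemma phi_bounds: "0 <= phi x" "phi x <= abs x + VB"
proof -
 show "0 <= phi x" unfolding phi_def by (intro mult_nonneg_nonneg sum_nonneg H_nonneg) auto
 show "phi x <= abs x + VB" unfolding phi_def
  by (intro average_le order_trans[OF H_le] add_left_mono v_bounds)
qed

lemma phi_lipschitz: "abs (phi x - phi y) <= abs (x - y)" unfolding phi_def average_diff
 by (intro average_abs_le order_trans[OF H_lipschitz]) auto

lemma mn_bounds: "j \<in> {1..b} ==> 0 <= mn j" "j \<in> {1..b} ==> mn j <= 2 * VB"
proof -
 show "0 <= mn j" unfolding mn_def by (intro mult_nonneg_nonneg sum_nonneg hmean_nonneg) auto
 assume j: "j \<in> {1..b}"
 show "mn j <= 2 * VB" unfolding mn_def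
 proof (intro average_le)
  fix k assume "k \<in> {1..b}"
  thus "hmean (v j) (v k) <= 2 * VB" using hmean_le[of "v j" "v k"] v_bounds(3)[OF j] v_bounds(3)[of k] by linarith
 qed
qed

lemma integrable_H_X:
 assumes "j \<in> {1..b}"
 shows "integrable M (%x. H (X j x) r)" by (rule int_bound[where f = "%x. abs (X j x) + abs r"])
   (use X_integrable[OF assms] H_le in \<open>auto intro!: AE_I2 simp: abs_of_nonneg[OF H_nonneg] order_trans[OF H_le]\<close>)

lemma H_X_close:
 assumes "j \<in> {1..b}"
 shows "abs ((LINT x|M. H (X j x) r) - hmean (v j) r) <= eps"
proof -
 interpret two_variables M gauss "X j" "%z. kap * tau j * z" eps "vconst / l"
  by (rule X_two_variables[OF assms])
 show ?thesis using H_close[of r] unfolding H_normal v_def .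
qed

text \<open>Multiplied by b (b - 1) the remainder is \<open>d - D\<close>, where
  \<open>D >= 0\<close> is the energy inequality and \<open>d\<close> collects the diagonal. Its L1
  norm is at most \<open>d\<close> plus the mean of \<open>D\<close>, and that mean involves only
  E|X_j - X_k| and E H(X_j, v_k), both known up to \<open>eps\<close>. No second moment of the
  degenerate part is computed.\<close>

lemma remainder:
 "(LINT y|M. abs (U0 y - a0 - 2 / (real b - 1) * (\<Sum>j=1..b. xi j y))) <= 6 * eps + 8 * VB / b"
 "integrable M (%y. U0 y - a0 - 2 / (real b - 1) * (\<Sum>j=1..b. xi j y))"
proof -
 let ?b = "\<Sum>j=1..b. \<Sum>k=1..b. hmean (v j) (v k)"
 define D where "D y = 2 * (\<Sum>j=1..b. \<Sum>k=1..b. H (X j y) (v k)) - ?b - (\<Sum>j=1..b. \<Sum>k=1..b. (abs (X j y - X k y)))" for y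
 define d where "d = (\<Sum>j=1..b. hmean (v j) (v j))"
 have D0: "0 <= D y" for y unfolding D_def using energy_inequality[of "{1..b}" "%j. X j y" v] by simp
 have d0: "0 <= d" unfolding d_def by (intro sum_nonneg hmean_nonneg)
 have dle: "d <= real b * (2 * VB)"
 proof -
  have "d <= (\<Sum>j=1..b. 2 * VB)" unfolding d_def
  proof (intro sum_mono)
   fix k assume "k \<in> {1..b}"
   thus "hmean (v k) (v k) <= 2 * VB" using hmean_le[of "v k" "v k"] v_bounds(3)[of k] by linarith
  qed
  thus ?thesis by simp
 qed
 have bb: "real b * (real b - 1) > 0" using b by simp
 \<comment> \<open>The statistic omits the diagonal, the energy form includes it.\<close>
 have off: "(\<Sum>j=1..b. \<Sum>k=1..b. f j k) = (\<Sum>j=1..b. \<Sum>k\<in>{1..b} - {j}. f j k) + (\<Sum>j=1..b. f j j)" for f :: "nat => nat => real"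
  unfolding sum.distrib[symmetric] by (intro sum.cong refl) (simp add: sum.remove)
 let ?a = "real b * (real b - 1)"
 have eq: "U0 y - a0 - 2 / (real b - 1) * (\<Sum>j=1..b. xi j y) = (d - D y) / ?a" for y
 proof -
  have x: "(\<Sum>j=1..b. xi j y) = (1 / real b) * ((\<Sum>j=1..b. \<Sum>k=1..b. H (X j y) (v k)) - ?b)"
   unfolding xi_def phi_def mn_def by (simp add: sum_subtractf sum_distrib_left right_diff_distrib)
  define h2 where "h2 = (\<Sum>j=1..b. \<Sum>k=1..b. H (X j y) (v k))"
  define hm where "hm = ?b"
  define xx where "xx = (\<Sum>j=1..b. \<Sum>k=1..b. (abs (X j y - X k y)))"
  have u: "U0 y = xx / ?a" unfolding U0_def xx_def off[of "%j k. abs (X j y - X k y)"] by simp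
  have a: "a0 = (hm - d) / ?a" unfolding a0_def hm_def d_def off[of "%j k. hmean (v j) (v k)"] by simp
  have "2 / (real b - 1) * ((1 / real b) * (h2 - hm)) = 2 * (h2 - hm) / ?a" by (simp add: mult.commute)
  hence "U0 y - a0 - 2 / (real b - 1) * (\<Sum>j=1..b. xi j y) = (xx - (hm - d) - 2 * (h2 - hm)) / ?a"
   unfolding x u a h2_def[symmetric] hm_def[symmetric] by (simp only: diff_divide_distrib)
  also have "xx - (hm - d) - 2 * (h2 - hm) = d - D y"
   unfolding D_def xx_def[symmetric] hm_def[symmetric] h2_def[symmetric] by simp
  finally show ?thesis .
 qed
 have iX: "integrable M (%y. abs (X j y - X k y))" if "j \<in> {1..b}" "k \<in> {1..b}" for j k
  using X_integrable(1)[OF that(1)] X_integrable(1)[OF that(2)] by simp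
 have iD: "integrable M D" unfolding D_def[abs_def]
  by (intro int_diff integrable_mult_right int_sum iX integrable_H_X integrable_const)
 have ED: "expectation D <= real b * real b * (3 * eps) + d"
 proof -
  let ?d = "\<Sum>j=1..b. \<Sum>k=1..b. (LINT y|M. abs (X j y - X k y))"
   and ?e = "\<Sum>j=1..b. \<Sum>k=1..b. (LINT y|M. H (X j y) (v k))"
  have "expectation D = 2 * ?e - ?b - ?d"
  proof -
   have "(LINT y|M. (\<Sum>j=1..b. \<Sum>k=1..b. H (X j y) (v k))) = ?e"
    by (intro integral_double_sum integrable_H_X)
   moreover have "(LINT y|M. (\<Sum>j=1..b. \<Sum>k=1..b. (abs (X j y - X k y)))) = ?d"
    by (intro integral_double_sum iX)
   moreover have "integrable M (%y. \<Sum>j=1..b. \<Sum>k=1..b. H (X j y) (v k))" "integrable M (%y. \<Sum>j=1..b. \<Sum>k=1..b. (abs (X j y - X k y)))"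
    by (intro int_sum iX integrable_H_X; assumption)+
   ultimately show ?thesis unfolding D_def[abs_def] by (simp add: prob_space)
  qed
  also have "... = (\<Sum>j=1..b. \<Sum>k=1..b. 2 * (LINT y|M. H (X j y) (v k)) - hmean (v j) (v k) - (LINT y|M. abs (X j y - X k y)))"
   by (simp add: sum_subtractf sum_distrib_left)
  \<comment> \<open>Each pair costs \<open>eps\<close> three times; on the diagonal the distance is
    0, so one \<open>hmean\<close> is left over.\<close>
  also have "... <= (\<Sum>j=1..b. \<Sum>k=1..b. 3 * eps + (if j = k then hmean (v j) (v j) else 0))"
  proof (intro sum_mono)
   fix j k assume j: "j \<in> {1..b}" and k: "k \<in> {1..b}"
   have 1: "(LINT y|M. H (X j y) (v k)) <= hmean (v j) (v k) + eps" using H_X_close[OF j, of "v k"] by linarith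
   show "2 * (LINT y|M. H (X j y) (v k)) - hmean (v j) (v k) - (LINT y|M. abs (X j y - X k y)) <= 3 * eps + (if j = k then hmean (v j) (v j) else 0)"
   proof (cases "j = k")
    case True
    thus ?thesis using 1 eps_nonneg by simp
   next
    case False
    have "hmean (v j) (v k) - eps <= (LINT y|M. abs (X j y - X k y))" using X_diff[OF j k False] unfolding v_def by linarith
    thus ?thesis using 1 False by simp
   qed
  qed
  also have "... = real b * real b * (3 * eps) + d" by (simp add: sum.distrib d_def)
  finally show ?thesis .
 qed
 show iU: "integrable M (%y. U0 y - a0 - 2 / (real b - 1) * (\<Sum>j=1..b. xi j y))"
  unfolding eq using iD by simp
 let ?c = "LINT y|M. abs (U0 y - a0 - 2 / (real b - 1) * (\<Sum>j=1..b. xi j y))"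
 have "?c <= (LINT y|M. (d + D y) / ?a)"
 proof (rule integral_mono[OF integrable_abs[OF iU]])
  show "integrable M (%y. (d + D y) / ?a)" using iD by simp
  fix y
  have "abs (d - D y) <= d + D y" using d0 D0[of y] by simp
  thus "abs (U0 y - a0 - 2 / (real b - 1) * (\<Sum>j=1..b. xi j y)) <= (d + D y) / ?a"
   unfolding eq using bb by (simp add: abs_divide divide_right_mono)
 qed
 also have "... = (d + expectation D) / ?a" using iD by (simp add: prob_space)
 \<comment> \<open>b - 1 is at least b / 2, since there are at least two blocks.\<close>
 also have "... <= (real b * real b * (3 * eps) + 2 * (real b * (2 * VB))) / (real b * (real b / 2))"
 proof (rule frac_le)
  show "real b * (real b / 2) <= real b * (real b - 1)" using b by (intro mult_left_mono) auto
 qed (use ED dle d0 D0 eps_nonneg VB_pos b in auto)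
 also have "... = 6 * eps + 8 * VB / b" using b by (simp add: field_simps)
 finally show "?c <= 6 * eps + 8 * VB / b" .
qed

text \<open>Variance of the projection for a Gaussian block, as \<open>phi (v j * z)\<close> has
  Gaussian mean \<open>mn j\<close>.\<close>

definition qv :: "nat => real" where
 "qv j = (LINT z|gauss. (phi (v j * z) - mn j)^2)"

lemma integrable_phi_X: "j \<in> {1..b} ==> integrable M (%x. phi (X j x))"
 unfolding phi_def by (intro integrable_mult_right int_sum integrable_H_X)

lemma xi_le: "j \<in> {1..b} ==> abs (xi j x) <= abs (X j x) + 3 * VB"
 using phi_bounds[of "X j x"] mn_bounds[of j] VB_pos unfolding xi_def by auto

lemma integrable_xi:
 assumes j: "j \<in> {1..b}"
 shows "integrable M (xi j)" "integrable M (%x. (xi j x)^2)"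
proof -
 show "integrable M (xi j)" unfolding xi_def[abs_def] using integrable_phi_X[OF j] by simp
 have b: "(xi j x)^2 <= 2 * (X j x)^2 + 18 * VB^2" for x
 proof -
  have "(xi j x)^2 <= (abs (X j x) + 3 * VB)^2" using power_mono[OF xi_le[OF j], of x 2] by simp
  also have "... <= 2 * (X j x)^2 + 18 * VB^2"
   using sum_squares_bound[of "abs (X j x)" "3 * VB"] by (simp add: power2_sum power_mult_distrib)
  finally show ?thesis .
 qed
 have "integrable M (%x. 2 * (X j x)^2 + 18 * VB^2)" using X_integrable(2)[OF j] by simp
 thus "integrable M (%x. (xi j x)^2)" by (rule int_bound) (use b in \<open>auto intro!: AE_I2\<close>)
qed

lemma xi_mean:
 assumes j: "j \<in> {1..b}"
 shows "abs (expectation (xi j)) <= eps"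
proof -
 have "expectation (xi j) = (1 / real b) * (\<Sum>k=1..b. (LINT x|M. H (X j x) (v k))) - mn j"
 proof -
  have "(LINT x|M. phi (X j x)) = (1 / real b) * (\<Sum>k=1..b. (LINT x|M. H (X j x) (v k)))"
   unfolding phi_def using integrable_H_X[OF j] by (simp add: LINT_sum)
  thus ?thesis unfolding xi_def[abs_def] using integrable_phi_X[OF j] by (simp add: prob_space)
 qed
 also have "... = (1 / real b) * (\<Sum>k=1..b. (LINT x|M. H (X j x) (v k)) - hmean (v j) (v k))"
  unfolding mn_def by (rule average_diff)
 also have "abs ... <= eps" by (intro average_abs_le H_X_close j)
 finally show ?thesis .
qed

lemma integrable_H_X_mult:
 assumes j: "j \<in> {1..b}"
 shows "integrable M (%y. H (X j y) r * H (X j y) s)" "integrable gauss (%z. H (v j * z) r * H (v j * z) s)"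
proof -
 have sq: "(abs x + abs r)^2 <= 2 * x^2 + 2 * r^2" for x r :: real
  using sum_squares_bound[of "abs x" "abs r"] by (simp add: power2_sum)
 have b: "abs (H x r * H x s) <= 4 * x^2 + 2 * r^2 + 2 * s^2" for x
 proof -
  have "abs (H x r * H x s) <= (abs x + abs r) * (abs x + abs s)"
   using H_le[of x r] H_le[of x s] H_nonneg[of x r] H_nonneg[of x s] by (intro abs_mult_le) auto
  also have "... <= (abs x + abs r)^2 + (abs x + abs s)^2"
   by (rule order_trans[OF abs_ge_self abs_mult_le_squares])
  finally show ?thesis using sq[of x r] sq[of x s] by linarith
 qed
 have i: "integrable M (%y. 4 * (X j y)^2 + 2 * r^2 + 2 * s^2)" using X_integrable(2)[OF j] by simp
 show "integrable M (%y. H (X j y) r * H (X j y) s)"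
  by (rule int_bound[OF i]) (use b in \<open>auto intro!: AE_I2 intro: order_trans\<close>)
 have i: "integrable gauss (%z. 4 * (v j * z)^2 + 2 * r^2 + 2 * s^2)"
  using std_normal_moments(3) by (simp add: power_mult_distrib)
 show "integrable gauss (%z. H (v j * z) r * H (v j * z) s)"
  by (rule int_bound[OF i]) (use b in \<open>auto intro!: AE_I2 intro: order_trans\<close>)
qed

lemma phi_square: "(phi x)^2 = (1 / real b) * (\<Sum>j=1..b. (1 / real b) * (\<Sum>k=1..b. H x (v j) * H x (v k)))"
 unfolding phi_def power2_eq_square by (simp add: sum_product sum_divide_distrib[symmetric])

text \<open>The square of \<open>phi\<close> is an average of products of two \<open>H\<close>, to
  which the comparison of two variables applies term by term.\<close>

lemma phi_square_mean:
 assumes j: "j \<in> {1..b}"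
 shows "abs ((LINT x|M. (phi (X j x))^2) - (LINT z|gauss. (phi (v j * z))^2)) <= vconst / l + 12 * VB * eps"
  "integrable M (%x. (phi (X j x))^2)" "integrable gauss (%z. (phi (v j * z))^2)"
proof -
 interpret T: two_variables M gauss "X j" "%z. kap * tau j * z" eps "vconst / l"
  by (rule X_two_variables[OF j])
 note i = integrable_H_X_mult[OF j]
 show "integrable M (%x. (phi (X j x))^2)" "integrable gauss (%z. (phi (v j * z))^2)"
  unfolding phi_square by (intro integrable_mult_right int_sum i)+
 have 1: "(LINT x|M. (phi (X j x))^2) = (1 / real b) * (\<Sum>r=1..b. (1 / real b) * (\<Sum>k=1..b. (LINT x|M. H (X j x) (v r) * H (X j x) (v k))))"
  unfolding phi_square using integral_double_sum[OF i(1), where J = "{1..b}" and J' = "{1..b}"]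
  by (simp add: sum_divide_distrib[symmetric])
 have 2: "(LINT z|gauss. (phi (v j * z))^2) = (1 / real b) * (\<Sum>r=1..b. (1 / real b) * (\<Sum>k=1..b. \<integral>z. H (v j * z) (v r) * H (v j * z) (v k) \<partial>gauss))"
  unfolding phi_square using integral_double_sum[OF i(2), where J = "{1..b}" and J' = "{1..b}"]
  by (simp add: sum_divide_distrib[symmetric])
 show "abs ((LINT x|M. (phi (X j x))^2) - (LINT z|gauss. (phi (v j * z))^2)) <= vconst / l + 12 * VB * eps"
  unfolding 1 2 average_diff
 proof (intro average_abs_le)
  fix r k assume r: "r \<in> {1..b}" and k: "k \<in> {1..b}"
  have "abs ((LINT x|M. H (X j x) (v r) * H (X j x) (v k)) - (LINT z|gauss. H (v j * z) (v r) * H (v j * z) (v k))) <= vconst / l + 6 * (abs (v r) + abs (v k)) * eps"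
   using T.H_mult_close[of "v r" "v k"] unfolding v_def[of j] .
  also have "... <= vconst / l + 12 * VB * eps"
   using v_bounds(3)[OF r] v_bounds(3)[OF k] eps_nonneg by (intro add_left_mono mult_right_mono) auto
  finally show "abs ((LINT x|M. H (X j x) (v r) * H (X j x) (v k)) - (LINT z|gauss. H (v j * z) (v r) * H (v j * z) (v k))) <= vconst / l + 12 * VB * eps" .
 qed
qed

lemma phi_normal:
 shows "(LINT z|gauss. phi (v j * z)) = mn j" "integrable gauss (%z. phi (v j * z))"
 unfolding phi_def mn_def using integrable_H_normal H_normal by (auto simp: LINT_sum)

lemma qv_alt:
 assumes j: "j \<in> {1..b}"
 shows "qv j = (LINT z|gauss. (phi (v j * z))^2) - (mn j)^2"
proof -
 have "(phi (v j * z) - mn j)^2 = (phi (v j * z))^2 - 2 * mn j * phi (v j * z) + (mn j)^2" for z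
  by (simp add: power2_diff)
 hence "qv j = (LINT z|gauss. (phi (v j * z))^2 - 2 * mn j * phi (v j * z) + (mn j)^2)"
  unfolding qv_def by simp
 also have "... = (LINT z|gauss. (phi (v j * z))^2) - 2 * mn j * mn j + (mn j)^2"
  using phi_square_mean(3)[OF j] phi_normal[of j] gauss.prob_space by simp
 finally show ?thesis by (simp add: power2_eq_square)
qed

lemma xi_second:
 assumes j: "j \<in> {1..b}"
 shows "abs ((LINT x|M. (xi j x)^2) - qv j) <= vconst / l + 16 * VB * eps"
proof -
 have "(xi j x)^2 = (phi (X j x))^2 - 2 * mn j * xi j x - (mn j)^2" for x
  unfolding xi_def by (simp add: power2_eq_square algebra_simps)
 hence "(LINT x|M. (xi j x)^2) = (LINT x|M. (phi (X j x))^2) - 2 * mn j * expectation (xi j) - (mn j)^2"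
  using phi_square_mean(2)[OF j] integrable_xi[OF j] by (simp add: prob_space)
 moreover have "abs (2 * mn j * expectation (xi j)) <= (4 * VB) * eps"
  by (rule abs_mult_le[OF _ xi_mean[OF j]]) (use mn_bounds[OF j] in auto)
 ultimately show ?thesis using phi_square_mean(1)[OF j] unfolding qv_alt[OF j] by linarith
qed

lemma qv_bounds:
 assumes j: "j \<in> {1..b}"
 shows "0 <= qv j" "qv j <= 20 * VB^2"
proof -
 show "0 <= qv j" unfolding qv_def by simp
 have b: "(phi (v j * z) - mn j)^2 <= 2 * VB^2 * z^2 + 18 * VB^2" for z
 proof -
  have "abs (phi (v j * z) - mn j) <= abs (v j * z) + 3 * VB"
   using phi_bounds[of "v j * z"] mn_bounds[OF j] VB_pos by auto
  also have "... <= VB * abs z + 3 * VB" unfolding abs_mult using v_bounds(3)[OF j] by (intro add_right_mono mult_right_mono) auto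
  finally have "(phi (v j * z) - mn j)^2 <= (VB * abs z + 3 * VB)^2" by (metis abs_ge_zero power2_abs power_mono)
  also have "... <= 2 * VB^2 * z^2 + 18 * VB^2"
   using sum_squares_bound[of "VB * abs z" "3 * VB"] by (simp add: power2_sum power_mult_distrib ac_simps)
  finally show ?thesis .
 qed
 have i: "integrable gauss (%z. 2 * VB^2 * z^2 + 18 * VB^2)" using std_normal_moments(3) by simp
 have i2: "integrable gauss (%z. (phi (v j * z) - mn j)^2)"
  by (rule int_bound[OF i]) (use b in \<open>auto intro!: AE_I2\<close>)
 have "qv j <= (LINT z|gauss. 2 * VB^2 * z^2 + 18 * VB^2)" unfolding qv_def by (intro integral_mono i i2 b)
 also have "... = 20 * VB^2" using std_normal_moments(3,5) gauss.prob_space by simp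
 finally show "qv j <= 20 * VB^2" .
qed

text \<open>A Lindeberg condition without higher moments of block sums: the excess of E max(|X_j|,
  t)^2 over t^2 is close to its Gaussian counterpart, and that one is small by the fourth Gaussian
  moment.\<close>

lemma xi_tail:
 assumes j: "j \<in> {1..b}" and T: "6 * VB <= T"
 shows "(LINT y|M. (xi j y)^2 * of_bool (T < abs (xi j y))) <= 16 / 3 * (48 * VB ^ 4 / T^2 + vconst / l + T * eps)"
proof -
 interpret T: two_variables M gauss "X j" "%z. kap * tau j * z" eps "vconst / l"
  by (rule X_two_variables[OF j])
 \<comment> \<open>As |xi| <= |X| + T/2, the event |xi| > T forces |xi| <= 2 |X| and |X| > 2 t. Then
   X^2 - t^2 >= 3/4 X^2, which explains the factor 16/3.\<close>
 define t where "t = T / 4"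
 have t: "t > 0" using T VB_pos by (simp add: t_def)
 have imax: "integrable M (%y. (max (abs (X j y)) t)^2)" "integrable gauss (%z. (max (abs (v j * z)) t)^2)"
  using T.integrable_max_prod[of t t] by (auto simp: power2_eq_square v_def)
 have pw: "(xi j y)^2 * of_bool (T < abs (xi j y)) <= 16 / 3 * ((max (abs (X j y)) t)^2 - t^2)" for y
 proof (cases "T < abs (xi j y)")
  case True
  have x: "abs (xi j y) <= 2 * abs (X j y)" "2 * t < abs (X j y)"
   using True T xi_le[OF j, of y] by (auto simp: t_def)
  have "(xi j y)^2 <= (2 * abs (X j y))^2" using power_mono[OF x(1), of 2] by simp
  hence 1: "(xi j y)^2 <= 4 * (X j y)^2" by (simp add: power_mult_distrib)
  have "(2 * t)^2 <= (abs (X j y))^2" using x(2) t by (intro power_mono) auto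
  hence "4 * t^2 <= (X j y)^2" by (simp add: power_mult_distrib)
  moreover have "max (abs (X j y)) t = abs (X j y)" using x(2) t by simp
  ultimately show ?thesis using 1 True by simp
 next
  case False
  have "t^2 <= (max (abs (X j y)) t)^2" using t by (intro power_mono) auto
  thus ?thesis using False by simp
 qed
 have n4: "integrable gauss (%z. z ^ 4)" "(LINT z|gauss. z ^ 4) = 3"
  using integrable_std_normal_distribution_moment[of 4] std_normal_distribution_even_moments(1)[of 2] by (auto simp: fact_numeral)
 have nb: "(LINT z|gauss. (max (abs (v j * z)) t)^2) <= t^2 + 3 * VB ^ 4 / t^2"
 proof -
  have p: "(max (abs (v j * z)) t)^2 <= t^2 + VB ^ 4 / t^2 * z ^ 4" for z
  proof (cases "abs (v j * z) <= t")
   case True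
   thus ?thesis using t by (simp add: max_absorb2)
  next
   case False
   have "(abs (v j * z))^2 * t^2 <= (abs (v j * z))^2 * (abs (v j * z))^2"
    using False t by (intro mult_left_mono power_mono) auto
   also have "... = v j ^ 4 * z ^ 4" by (simp add: power_mult_distrib power2_eq_square power4_eq_xxxx)
   also have "... <= VB ^ 4 * z ^ 4" using v_bounds[OF j] by (intro mult_right_mono power_mono) auto
   finally have "(abs (v j * z))^2 <= VB ^ 4 / t^2 * z ^ 4" using t by (simp add: field_simps)
   thus ?thesis using False by (simp add: max_absorb1 add_increasing)
  qed
  have "(LINT z|gauss. (max (abs (v j * z)) t)^2) <= (LINT z|gauss. t^2 + VB ^ 4 / t^2 * z ^ 4)"
   using n4 imax(2) p by (intro integral_mono) auto
  also have "... = t^2 + 3 * VB ^ 4 / t^2" using n4 gauss.prob_space by simp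
  finally show ?thesis .
 qed
 have "(LINT y|M. (xi j y)^2 * of_bool (T < abs (xi j y))) <= (LINT y|M. 16 / 3 * ((max (abs (X j y)) t)^2 - t^2))"
 proof (intro integral_mono pw)
  show "integrable M (%y. (xi j y)^2 * of_bool (T < abs (xi j y)))"
   by (rule int_bound[OF integrable_xi(2)[OF j]]) (auto intro!: AE_I2)
 qed (use imax in auto)
 also have "... = 16 / 3 * ((LINT y|M. (max (abs (X j y)) t)^2) - t^2)" using imax by (simp add: prob_space)
 also have "... <= 16 / 3 * (3 * VB ^ 4 / t^2 + vconst / l + 4 * t * eps)"
  using T.max_square_close[of t] t nb unfolding v_def by simp
 also have "3 * VB ^ 4 / t^2 = 48 * VB ^ 4 / T^2" using t by (simp add: t_def field_simps)
 also have "4 * t = T" by (simp add: t_def)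
 finally show ?thesis .
qed

lemma iexp_3: "cmod (iexp x - 1 - \<i> * x + x^2 / 2) <= min (x^2) (abs x ^ 3 / 6)" for x :: real
proof -
 have "(\<Sum>k \<le> 2. (\<i> * cpx x)^k / fact k) = 1 + \<i> * x - x^2 / 2"
  by (simp add: eval_nat_numeral power_mult_distrib)
 hence e: "iexp x - (\<Sum>k \<le> 2. (\<i> * cpx x)^k / fact k) = iexp x - 1 - \<i> * x + x^2 / 2" by simp
 have "fact 3 = (6 :: real)" by (simp add: fact_numeral)
 thus ?thesis using iexp_approx1[of x 2] iexp_approx2[of x 2] unfolding e by simp
qed

text \<open>The product (1 + y + y^2/2) (1 - y + y^2/2) = 1 + y^4/4 is at least 1, and its first
  factor is at most exp y.\<close>

lemma exp_neg_2: "0 <= y ==> abs (exp (- y) - 1 + y) <= y^2 / 2" for y :: real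
proof -
 assume y: "0 <= y"
 have 1: "0 <= exp (- y) - 1 + y" using exp_ge_add_one_self[of "- y"] by simp
 have "exp (- y) - 1 + y <= y^2 / 2"
 proof -
  have "1 <= exp y * (1 - y + y^2 / 2)"
  proof -
   have "(1 + y + y^2 / 2) * (1 - y + y^2 / 2) = 1 + y ^ 4 / 4"
    by (simp add: algebra_simps power2_eq_square power4_eq_xxxx)
   hence "1 <= (1 + y + y^2 / 2) * (1 - y + y^2 / 2)" by simp
   also have "... <= exp y * (1 - y + y^2 / 2)"
   proof (rule mult_right_mono)
    show "1 + y + y^2 / 2 <= exp y" using exp_lower_Taylor_quadratic[OF y] by simp
    have "0 <= (1 - y)^2 + 1" by (simp add: add_nonneg_nonneg)
    thus "0 <= 1 - y + y^2 / 2" by (simp add: power2_diff)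
   qed
   finally show ?thesis .
  qed
  hence "exp (- y) * 1 <= exp (- y) * (exp y * (1 - y + y^2 / 2))" by (intro mult_left_mono) auto
  thus ?thesis by (simp add: mult.assoc[symmetric] exp_minus_inverse exp_add[symmetric])
 qed
 thus ?thesis using 1 by simp
qed

text \<open>Both sides are expanded to second order, with the cubic remainder below \<open>T\<close>
  and the quadratic one above. The five terms are, in order, the error of the mean, the error of the
  variance, the cubic remainder, the tail, and the expansion of the Gaussian factor.\<close>

lemma xi_char:
 assumes j: "j \<in> {1..b}" and T: "6 * VB <= T"
 shows "cmod ((LINT x|M. iexp (th * xi j x)) - cpx (exp (- th\<^sup>2 * qv j / 2)))
  <= abs th * eps + th^2 / 2 * (vconst / l + 16 * VB * eps) + abs th ^ 3 * T / 6 * (20 * VB^2 + vconst / l + 16 * VB * eps)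
   + th^2 * (16 / 3 * (48 * VB ^ 4 / T^2 + vconst / l + T * eps)) + th ^ 4 * (50 * VB ^ 4)"
proof -
 have T0: "T > 0" using T VB_pos by linarith
 let ?E2 = "(LINT x|M. (xi j x)^2)" and ?m = "expectation (xi j)"
 define R where "R x = iexp (th * xi j x) - 1 - \<i> * (th * xi j x) + (th * xi j x)^2 / 2" for x
 have iE: "integrable M (%x. iexp (th * xi j x))" by (intro integrable_bounded[of _ 1]) auto
 have i1: "integrable M (%x. \<i> * cpx (th * xi j x))" using integrable_xi(1)[OF j] by simp
 have i2: "integrable M (%x. cpx ((th * xi j x)^2 / 2))" using integrable_xi(2)[OF j] by (simp add: power_mult_distrib del: of_real_power)
 have iR: "integrable M R" unfolding R_def[abs_def] using iE i1 i2 by (intro int_add int_diff) auto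
 let ?b = "LINT x|M. iexp (th * xi j x)"
 have ER: "expectation R = ?b - 1 - \<i> * (th * ?m) + th^2 * ?E2 / 2"
 proof -
  have a: "(LINT x|M. \<i> * cpx (th * xi j x)) = \<i> * (th * ?m)"
   unfolding integral_mult_right_zero integral_complex_of_real by simp
  have bq: "(LINT x|M. cpx ((th * xi j x)^2 / 2)) = th^2 * ?E2 / 2"
   unfolding integral_complex_of_real by (simp add: power_mult_distrib)
  have e1: "(LINT x|M. iexp (th * xi j x) - 1) = ?b - 1" by (subst LINT_diff[OF iE]) (auto simp: prob_space)
  have j1: "integrable M (%x. iexp (th * xi j x) - 1)" using iE by simp
  have e2: "(LINT x|M. iexp (th * xi j x) - 1 - \<i> * cpx (th * xi j x)) = ?b - 1 - \<i> * (th * ?m)"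
   unfolding LINT_diff[OF j1 i1] e1 a ..
  have j2: "integrable M (%x. iexp (th * xi j x) - 1 - \<i> * cpx (th * xi j x))" by (rule int_diff[OF j1 i1])
  have "R = (%x. (iexp (th * xi j x) - 1 - \<i> * cpx (th * xi j x)) + cpx ((th * xi j x)^2 / 2))"
   unfolding R_def by simp
  thus ?thesis using Bochner_Integration.integral_add[OF j2 i2] e2 bq by simp
 qed
 have R_le: "cmod (R x) <= abs th ^ 3 * T / 6 * (xi j x)^2 + th^2 * ((xi j x)^2 * of_bool (T < abs (xi j x)))" for x
 proof (cases "T < abs (xi j x)")
  case True
  have "cmod (R x) <= (th * xi j x)^2" using iexp_3[of "th * xi j x"] by (simp add: R_def)
  moreover have "0 <= abs th ^ 3 * T / 6 * (xi j x)^2" using T0 by simp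
  ultimately show ?thesis using True by (simp add: power_mult_distrib)
 next
  case False
  have "cmod (R x) <= abs (th * xi j x) ^ 3 / 6" using iexp_3[of "th * xi j x"] by (simp add: R_def)
  also have "... = abs th ^ 3 / 6 * abs (xi j x) ^ 3" by (simp add: abs_mult power_mult_distrib)
  also have "abs (xi j x) ^ 3 = abs (xi j x) * (xi j x)^2" by (simp add: power3_eq_cube power2_eq_square mult.commute)
  also have "abs th ^ 3 / 6 * (abs (xi j x) * (xi j x)^2) <= abs th ^ 3 / 6 * (T * (xi j x)^2)" using False by (intro mult_left_mono mult_right_mono) auto
  finally show ?thesis using False by simp
 qed
 have it: "integrable M (%x. (xi j x)^2 * of_bool (T < abs (xi j x)))"
  by (rule int_bound[OF integrable_xi(2)[OF j]]) (auto intro!: AE_I2)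
 let ?a = "16 / 3 * (48 * VB ^ 4 / T^2 + vconst / l + T * eps)"
  and ?c = "20 * VB^2 + vconst / l + 16 * VB * eps"
 have "cmod (expectation R) <= (LINT x|M. cmod (R x))" by (rule integral_norm_bound)
 also have "... <= (LINT x|M. abs th ^ 3 * T / 6 * (xi j x)^2 + th^2 * ((xi j x)^2 * of_bool (T < abs (xi j x))))"
  by (intro integral_mono integrable_norm iR int_add integrable_mult_right integrable_xi j it R_le)
 also have "... = abs th ^ 3 * T / 6 * ?E2 + th^2 * (LINT x|M. (xi j x)^2 * of_bool (T < abs (xi j x)))"
  using it integrable_xi(2)[OF j] by simp
 also have "... <= abs th ^ 3 * T / 6 * ?c + th^2 * ?a"
 proof (intro add_mono mult_left_mono xi_tail j T)
  show "?E2 <= 20 * VB^2 + vconst / l + 16 * VB * eps" using xi_second[OF j] qv_bounds(2)[OF j] by linarith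
 qed (use T0 in auto)
 finally have 1: "cmod (expectation R) <= abs th ^ 3 * T / 6 * ?c + th^2 * ?a" .
 have 2: "cmod (\<i> * (th * ?m)) <= abs th * eps" using xi_mean[OF j] by (simp add: norm_mult mult_left_mono)
 have 3: "cmod (cpx (th^2 / 2 * (qv j - ?E2))) <= th^2 / 2 * (vconst / l + 16 * VB * eps)"
  unfolding norm_of_real using xi_second[OF j] by (intro abs_mult_le) (auto simp: abs_minus_commute)
 define y where "y = th^2 * qv j / 2"
 have y: "0 <= y" using qv_bounds[OF j] by (simp add: y_def)
 have "y^2 / 2 <= (th^2 * (20 * VB^2) / 2)^2 / 2"
  unfolding y_def using qv_bounds[OF j] by (intro divide_right_mono power_mono mult_left_mono) auto
 also have "... = th ^ 4 * (50 * VB ^ 4)" by (simp add: power_mult_distrib power_divide)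
 finally have 4: "cmod (cpx (exp (- y) - 1 + y)) <= th ^ 4 * (50 * VB ^ 4)"
  unfolding norm_of_real using exp_neg_2[OF y] by linarith
 define z1 where "z1 = expectation R"
 define z2 where "z2 = \<i> * cpx (th * ?m)"
 define z3 where "z3 = cpx (th^2 / 2 * (qv j - ?E2))"
 define z4 where "z4 = cpx (exp (- y) - 1 + y)"
 have eq: "?b - cpx (exp (- th\<^sup>2 * qv j / 2)) = z1 + z2 + z3 - z4"
  unfolding z1_def z2_def z3_def z4_def ER y_def by (simp add: algebra_simps diff_divide_distrib)
 define r1 where "r1 = abs th ^ 3 * T / 6 * ?c"
 define r2 where "r2 = th^2 * ?a"
 define r3 where "r3 = abs th * eps"
 define r4 where "r4 = th^2 / 2 * (vconst / l + 16 * VB * eps)"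
 define r5 where "r5 = th ^ 4 * (50 * VB ^ 4)"
 note z = 1[folded z1_def r1_def r2_def] 2[folded z2_def r3_def] 3[folded z3_def r4_def] 4[folded z4_def r5_def]
 have "cmod (z1 + z2 + z3 - z4) <= r3 + r4 + r1 + r2 + r5" using norm_triangle4[of z1 z2 z3 z4] z by linarith
 thus ?thesis unfolding eq r1_def r2_def r3_def r4_def r5_def .
qed

end

section \<open>Decoupling the projection by gaps between the blocks\<close>

lemma (in prob_space) expectation_abs_le_sqrt:
 assumes "integrable M f" "integrable M (%x. (f x)^2)" "(LINT x|M. (f x)^2) <= r"
 shows "(LINT x|M. abs (f x)) <= sqrt r"
proof -
 have i: "integrable M (%x. abs (f x))" "integrable M (%x. (abs (f x))^2)" using assms by auto
 have "0 <= (LINT x|M. (abs (f x) - (LINT x|M. abs (f x)))^2)" by simp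
 also have "... = (LINT x|M. (abs (f x))^2) - ((LINT x|M. abs (f x)))^2" by (rule variance_eq[OF i])
 finally have "((LINT x|M. abs (f x)))^2 <= r" using assms(3) by simp
 thus ?thesis by (rule real_le_rsqrt)
qed

text \<open>Induction from the left: the product over the earlier blocks is one bounded variable
  that is separated from the next block.\<close>

lemma (in mixing_process) prod_decorrelation:
 fixes f :: "nat => 'a => complex"
 assumes f: "!!j. j \<in> {1..r} ==> f j \<in> borel_measurable (G (B j))" and f1: "!!j x. j \<in> {1..r} ==> cmod (f j x) <= 1"
  and sep: "!!i j. 1 <= i ==> i < j ==> j <= r ==> separated g (B i) (B j)" and g: "g >= 1"
 shows "cmod ((LINT y|M. (\<Prod>j=1..r. f j y)) - (\<Prod>j=1..r. expectation (f j))) <= real r * (16 * al g)"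
 using f f1 sep
proof (induction r)
 case 0
 thus ?case by (simp add: prob_space)
next
 case (Suc r)
 let ?P = "%y. \<Prod>j=1..r. f j y" and ?Q = "\<Prod>j=1..r. expectation (f j)"
 have a0: "0 <= al g" by (rule al_nonneg[OF g])
 have IH: "cmod (expectation ?P - ?Q) <= real r * (16 * al g)" by (rule Suc.IH) (use Suc.prems in auto)
 have fm: "f j \<in> borel_measurable M" if "j \<in> {1..Suc r}" for j
  using Suc.prems(1)[OF that] gen_measurable_M by auto
 have Ef: "cmod (expectation (f (Suc r))) <= 1"
  using Suc.prems(2)[of "Suc r"] fm[of "Suc r"] by (intro norm_expectation_le) auto
 have split: "(\<Prod>j\<in>{1..Suc r}. h j) = (\<Prod>j=1..r. h j) * h (Suc r)" for h :: "nat => complex" by simp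
 have 1: "cmod ((LINT y|M. ?P y * f (Suc r) y) - expectation ?P * expectation (f (Suc r))) <= 16 * al g"
 proof (cases "r = 0")
  case True
  thus ?thesis using a0 by (simp add: prob_space)
 next
  case False
  have s: "separated g (\<Union>j\<in>{1..r}. B j) (B (Suc r))"
   using Suc.prems(3)[of _ "Suc r"] False g unfolding separated_def by fastforce
  have "cmod ((LINT y|M. ?P y * f (Suc r) y) - expectation ?P * expectation (f (Suc r))) <= 16 * al g * 1 * 1"
  proof (rule covariance_complex[OF s])
   show "?P \<in> borel_measurable (G (\<Union>j\<in>{1..r}. B j))"
   proof (rule borel_measurable_prod)
    fix j assume j: "j \<in> {1..r}"
    show "f j \<in> borel_measurable (G (\<Union>j\<in>{1..r}. B j))"
     by (rule gen_measure_mono[where I = "B j"]) (use j Suc.prems(1)[of j] in auto)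
   qed
   show "cmod (?P x) <= 1" for x unfolding prod_norm[symmetric] by (rule prod_le_1) (use Suc.prems(2) in auto)
   show "f (Suc r) \<in> borel_measurable (G (B (Suc r)))" by (rule Suc.prems(1)) simp
   show "cmod (f (Suc r) x) <= 1" for x by (rule Suc.prems(2)) simp
  qed auto
  thus ?thesis by simp
 qed
 have "(LINT y|M. (\<Prod>j\<in>{1..Suc r}. f j y)) - (\<Prod>j\<in>{1..Suc r}. expectation (f j)) =
  ((LINT y|M. ?P y * f (Suc r) y) - expectation ?P * expectation (f (Suc r))) + (expectation ?P - ?Q) * expectation (f (Suc r))"
  unfolding split by (simp add: algebra_simps)
 also have "cmod ... <= 16 * al g + real r * (16 * al g) * 1"
  by (rule order_trans[OF norm_triangle_ineq add_mono[OF 1 norm_mult_bound[OF IH Ef]]])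
 finally show ?case by (simp add: algebra_simps)
qed

lemma cmod_iexp_diff: "cmod (iexp x - iexp y) <= abs (x - y)"
proof -
 have "iexp x - iexp y = iexp y * (iexp (x - y) - 1)" by (simp add: exp_diff right_diff_distrib)
 hence "cmod (iexp x - iexp y) = cmod (iexp (x - y) - 1)" by (simp add: norm_mult)
 also have "... <= abs (x - y)" using iexp_approx1[of "x - y" 0] by simp
 finally show ?thesis .
qed

lemma (in prob_space) iexp_expectation_diff:
 assumes f: "f \<in> borel_measurable M" and g: "g \<in> borel_measurable M" and i: "integrable M (%x. abs (f x - g x))"
 shows "cmod ((LINT x|M. iexp (th * f x)) - (LINT x|M. iexp (th * g x))) <= abs th * (LINT x|M. abs (f x - g x))"
proof -
 note f[measurable] g[measurable]
 have i1: "integrable M (%x. iexp (th * f x))" "integrable M (%x. iexp (th * g x))"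
  by (intro integrable_bounded[of _ 1]; simp)+
 have "cmod ((LINT x|M. iexp (th * f x)) - (LINT x|M. iexp (th * g x))) = cmod ((LINT x|M. iexp (th * f x) - iexp (th * g x)))"
  unfolding LINT_diff[OF i1] ..
 also have "... <= (LINT x|M. cmod (iexp (th * f x) - iexp (th * g x)))" by (rule integral_norm_bound)
 also have "... <= (LINT x|M. abs th * abs (f x - g x))"
 proof (rule integral_mono[OF integrable_norm[OF int_diff[OF i1]] integrable_mult_right[OF i]])
  show "cmod (iexp (th * f x) - iexp (th * g x)) <= abs th * abs (f x - g x)" for x
   using cmod_iexp_diff[of "th * f x" "th * g x"] by (simp only: abs_mult[symmetric] right_diff_distrib)
 qed
 also have "... = abs th * (LINT x|M. abs (f x - g x))" by simp
 finally show ?thesis .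
qed

context block_array
begin

definition tblk :: "nat => nat => nat set" where
 "tblk g j = {(j - 1) * l + 1..j * l - g}"

text \<open>The weights of the full block are kept; only the last \<open>g\<close> summands are
  dropped. Their cost in L1 is \<open>gam g\<close>, through the variance bound.\<close>

definition TX :: "nat => nat => 'a => real" where
 "TX g j = S (wt (blk j)) (tblk g j)"

definition gam :: "nat => real" where
 "gam g = sqrt (2 * (\<Sum>k. abs (c k)) * A^2 * (real g / real l))"

lemma TX_diff:
 assumes j: "j \<in> {1..b}" and g: "g <= l"
 shows "integrable M (%x. abs (X j x - TX g j x))" "(LINT x|M. abs (X j x - TX g j x)) <= gam g"
proof -
 let ?J = "{j * l - g + 1..j * l}"
 have jl: "(j - 1) * l + l = j * l" using j by (simp add: diff_mult_distrib)
 have un: "blk j = tblk g j \<union> ?J" and disj: "tblk g j \<inter> ?J = {}"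
  using jl g by (auto simp: tblk_def blk_def)
 have "?J \<subseteq> blk j" using un by auto
 hence J: "finite ?J" "?J \<subseteq> {1..}" using blk_subset[OF j] by auto
 have d: "X j x - TX g j x = S (wt (blk j)) ?J x" for x
  unfolding X_def TX_def using S_Un[of "tblk g j" ?J "wt (blk j)" x] disj un by (simp add: tblk_def)
 show "integrable M (%x. abs (X j x - TX g j x))" unfolding d using integrable_S[OF J(2)] by simp
 have "(wt (blk j) i)^2 <= A^2 / l" for i
  using power_mono[OF wt_le[OF blk_subset[OF j]], of i 2] l by (simp add: power_divide)
 hence "(\<Sum>i\<in>?J. (wt (blk j) i)^2) <= (\<Sum>i\<in>?J. A^2 / l)" by (intro sum_mono)
 also have "... = real g * (A^2 / l)"
 proof -
  have "g <= j * l" using jl g by linarith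
  hence "card ?J = g" by simp
  thus ?thesis by simp
 qed
 finally have s: "(\<Sum>i\<in>?J. (wt (blk j) i)^2) <= real g * (A^2 / l)" .
 have "(LINT x|M. (S (wt (blk j)) ?J x)^2) <= 2 * (\<Sum>k. abs (c k)) * (\<Sum>i\<in>?J. (wt (blk j) i)^2)"
  by (rule S_variance_le[OF J])
 also have "... <= 2 * (\<Sum>k. abs (c k)) * (real g * (A^2 / l))"
  using suminf_nonneg[OF summable_abs_c] by (intro mult_left_mono s) auto
 also have "... = 2 * (\<Sum>k. abs (c k)) * A^2 * (real g / real l)" by simp
 finally show "(LINT x|M. abs (X j x - TX g j x)) <= gam g"
  unfolding d gam_def by (rule expectation_abs_le_sqrt[OF integrable_S[OF J(2)] integrable_S_sq[OF J(2)]])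
qed

definition L :: "'a => real" where "L x = (\<Sum>j=1..b. xi j x)"

lemma L_measurable [measurable]: "L \<in> borel_measurable M" unfolding L_def by measurable

definition xi_error :: "real => real => real" where
 "xi_error T th = abs th * eps + th^2 / 2 * (vconst / l + 16 * VB * eps) + abs th ^ 3 * T / 6 * (20 * VB^2 + vconst / l + 16 * VB * eps)
   + th^2 * (16 / 3 * (48 * VB ^ 4 / T^2 + vconst / l + T * eps)) + th ^ 4 * (50 * VB ^ 4)"

lemma L_char:
 assumes T: "6 * VB <= T" and g: "1 <= g" "g <= l"
 shows "cmod ((LINT z|M. iexp (th * L z)) - cpx (exp (- th\<^sup>2 * (\<Sum>j=1..b. qv j) / 2)))
  <= 2 * (abs th * (real b * gam g)) + real b * (16 * (C * real g powr (- (lam * p)))) + real b * xi_error T th"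
proof -
 define x' where "x' j z = phi (TX g j z) - mn j" for j z
 have TXm [measurable]: "TX g j \<in> borel_measurable M" for j unfolding TX_def by measurable
 have x'm [measurable]: "x' j \<in> borel_measurable M" for j unfolding x'_def by measurable
 have dx: "abs (xi j z - x' j z) <= abs (X j z - TX g j z)" for j z
  unfolding xi_def x'_def using phi_lipschitz[of "X j z" "TX g j z"] by simp
 have ix: "integrable M (%z. abs (xi j z - x' j z))" and ex: "(LINT z|M. abs (xi j z - x' j z)) <= gam g" if j: "j \<in> {1..b}" for j
 proof -
  show i: "integrable M (%z. abs (xi j z - x' j z))"
   by (rule int_bound[OF TX_diff(1)[OF j g(2)]]) (use dx in \<open>auto intro!: AE_I2\<close>)
  have "(LINT z|M. abs (xi j z - x' j z)) <= (LINT z|M. abs (X j z - TX g j z))"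
   by (rule integral_mono[OF i TX_diff(1)[OF j g(2)] dx])
  thus "(LINT z|M. abs (xi j z - x' j z)) <= gam g" using TX_diff(2)[OF j g(2)] by linarith
 qed
 define L' where "L' z = (\<Sum>j=1..b. x' j z)" for z
 have [measurable]: "L' \<in> borel_measurable M" unfolding L'_def by measurable
 have dL: "abs (L z - L' z) <= (\<Sum>j=1..b. (abs (xi j z - x' j z)))" for z
  unfolding L_def L'_def sum_subtractf[symmetric] by (rule sum_abs)
 have isum: "integrable M (%z. \<Sum>j=1..b. (abs (xi j z - x' j z)))" by (intro int_sum ix)
 have iL: "integrable M (%z. abs (L z - L' z))"
  by (rule int_bound[OF isum]) (use dL in \<open>auto intro!: AE_I2 order_trans[OF dL]\<close>)
 have eL: "(LINT z|M. abs (L z - L' z)) <= real b * gam g"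
 proof -
  have "(LINT z|M. abs (L z - L' z)) <= (LINT z|M. (\<Sum>j=1..b. (abs (xi j z - x' j z))))"
   by (rule integral_mono[OF iL isum dL])
  also have "... = (\<Sum>j=1..b. (LINT z|M. abs (xi j z - x' j z)))" using ix by (rule LINT_sum)
  also have "... <= (\<Sum>j=1..b. gam g)" by (intro sum_mono ex)
  finally show ?thesis by simp
 qed
 define F where "F j z = iexp (th * x' j z)" for j z
 \<comment> \<open>Chain of replacements: drop the gaps, factorise, restore the gaps inside each
   factor, pass to Gaussian factors.\<close>
 define z1 where "z1 = (LINT z|M. iexp (th * L z))"
 define z2 where "z2 = (LINT z|M. iexp (th * L' z))"
 define z3 where "z3 = (\<Prod>j=1..b. expectation (F j))"
 define z4 where "z4 = (\<Prod>j=1..b. (LINT z|M. iexp (th * xi j z)))"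
 define z5 where "z5 = (\<Prod>j=1..b. cpx (exp (- th\<^sup>2 * qv j / 2)))"
 have z12: "cmod (z1 - z2) <= abs th * (real b * gam g)" unfolding z1_def z2_def
  by (rule order_trans[OF iexp_expectation_diff[OF L_measurable _ iL] mult_left_mono[OF eL]]) auto
 have z23: "cmod (z2 - z3) <= real b * (16 * (C * real g powr (- (lam * p))))"
 proof -
  have "z2 = (LINT z|M. (\<Prod>j=1..b. F j z))"
  proof -
   have "iexp (th * L' z) = (\<Prod>j=1..b. F j z)" for z
    unfolding F_def L'_def by (simp add: exp_sum[symmetric] sum_distrib_left)
   thus ?thesis unfolding z2_def by simp
  qed
  moreover have "cmod ((LINT z|M. (\<Prod>j=1..b. F j z)) - (\<Prod>j=1..b. expectation (F j))) <= real b * (16 * (C * real g powr (- (lam * p))))"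
  proof (rule prod_decorrelation[where B = "tblk g"])
   fix j
   have "TX g j \<in> borel_measurable (G (tblk g j))" unfolding TX_def by (rule S_gen_measurable) simp
   thus "F j \<in> borel_measurable (G (tblk g j))" unfolding F_def[abs_def] x'_def by measurable
   show "cmod (F j x) <= 1" for x by (simp add: F_def)
  next
   fix i j assume ij: "1 <= i" "i < j" "j <= b"
   have "i * l <= (j - 1) * l" using ij by (intro mult_right_mono) auto
   \<comment> \<open>Together with \<open>g <= l\<close> this makes the natural subtraction in i * l
     - g a true one.\<close>
   moreover have "l <= i * l" using ij by simp
   ultimately show "separated g (tblk g i) (tblk g j)" unfolding separated_def
   proof (intro conjI ballI)
    fix x y assume x: "x \<in> tblk g i" and y: "y \<in> tblk g j"
    have "x <= i * l - g" "(j - 1) * l + 1 <= y" using x y by (auto simp: tblk_def)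
    moreover note \<open>i * l <= (j - 1) * l\<close> \<open>l <= i * l\<close> g(2)
    ultimately show "x + g <= y" by linarith
   qed (use g in \<open>auto simp: tblk_def\<close>)
  qed (rule g)
  ultimately show ?thesis unfolding z3_def by simp
 qed
 have z34: "cmod (z3 - z4) <= abs th * (real b * gam g)"
 proof -
  \<comment> \<open>All factors have modulus at most 1, so the products differ by at most the sum of
    the differences.\<close>
  have "cmod (z3 - z4) <= (\<Sum>j=1..b. cmod (expectation (F j) - (LINT z|M. iexp (th * xi j z))))"
   unfolding z3_def z4_def by (intro norm_prod_diff norm_expectation_le) (auto simp: F_def[abs_def])
  also have "... <= (\<Sum>j=1..b. (abs th) * gam g)"
  proof (intro sum_mono)
   fix j assume j: "j \<in> {1..b}"
   have "cmod (expectation (F j) - (LINT z|M. iexp (th * xi j z))) = cmod ((LINT z|M. iexp (th * xi j z)) - (LINT z|M. iexp (th * x' j z)))"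
    unfolding F_def[abs_def] by (rule norm_minus_commute)
   also have "... <= abs th * gam g"
    by (rule order_trans[OF iexp_expectation_diff[OF xi_measurable x'm ix[OF j]] mult_left_mono[OF ex[OF j]]]) auto
   finally show "cmod (expectation (F j) - (LINT z|M. iexp (th * xi j z))) <= abs th * gam g" .
  qed
  also have "... = abs th * (real b * gam g)" by simp
  finally show ?thesis .
 qed
 have z45: "cmod (z4 - z5) <= real b * xi_error T th"
 proof -
  have "cmod (z4 - z5) <= (\<Sum>j=1..b. cmod ((LINT z|M. iexp (th * xi j z)) - cpx (exp (- th\<^sup>2 * qv j / 2))))"
   unfolding z4_def z5_def
  proof (intro norm_prod_diff norm_expectation_le)
   fix j assume j: "j \<in> {1..b}"
   show "cmod (cpx (exp (- th\<^sup>2 * qv j / 2))) <= 1"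
    unfolding norm_of_real using qv_bounds(1)[OF j] by simp
  qed auto
  also have "... <= (\<Sum>j=1..b. xi_error T th)"
   unfolding xi_error_def by (rule sum_mono) (rule xi_char[OF _ T])
  finally show ?thesis by simp
 qed
 have z5: "z5 = cpx (exp (- th\<^sup>2 * (\<Sum>j=1..b. qv j) / 2))"
  unfolding z5_def of_real_prod[symmetric] exp_sum[OF finite_atLeastAtMost, symmetric]
  by (simp add: sum_distrib_left sum_divide_distrib sum_negf)
 have "cmod (z1 - z5) <= cmod (z1 - z2) + cmod (z2 - z3) + cmod (z3 - z4) + cmod (z4 - z5)"
  using norm_triangle_ineq[of "z1 - z2" "z2 - z5"] norm_triangle_ineq[of "z2 - z3" "z3 - z5"] norm_triangle_ineq[of "z3 - z4" "z4 - z5"] by simp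
 thus ?thesis using z12 z23 z34 z45 unfolding z1_def[symmetric] z5[symmetric] by linarith
qed

text \<open>Lower bound for all \<open>qv j\<close>, read off from the proof of
  \<open>qv_lower\<close>. It depends on \<open>kap\<close>, \<open>s0\<close> and \<open>A\<close>
  but not on the sample size.\<close>

definition q0 :: real where
 "q0 = (kap * s0 * measure gauss {z. abs (A * z) <= s0})^2 / 4 * min (measure gauss {z. abs z <= 1}) (measure gauss {z. 2 <= abs z})"

end

section \<open>Non-degeneracy of the projection\<close>

lemma std_normal_pos:
 assumes "a < d" "{a<..<d} \<subseteq> T" "T \<in> sets borel"
 shows "0 < measure gauss T"
proof (rule ccontr)
 assume "\<not> 0 < measure gauss T"
 hence "measure gauss T = 0" by (simp add: zero_less_measure_iff)
 hence "emeasure gauss T = 0" by (simp add: gauss.emeasure_eq_measure)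
 hence "AE z in lborel. z \<in> T --> ennreal (std_normal_density z) = 0"
  using assms(3) by (subst (asm) emeasure_density) (auto simp: nn_integral_0_iff_AE elim!: eventually_mono split: split_indicator_asm)
 hence "AE z in lborel. z \<notin> {a<..<d}"
 proof eventually_elim
  case (elim z)
  thus ?case using assms(2) normal_density_pos[of 1 0 z] by (auto simp: ennreal_eq_0_iff not_le[symmetric])
 qed
 hence "emeasure lborel {a<..<d} = 0" by (subst (asm) AE_iff_measurable[where N = "{a<..<d}"]) auto
 thus False using assms(1) by simp
qed

context block_array
begin

lemma q0_pos: "0 < q0"
proof -
 have "0 < measure gauss {z. abs (A * z) <= s0}" by (rule std_normal_pos[of "- s0 / A" "s0 / A"])
    (use s0 A_pos in \<open>auto simp: abs_le_iff field_simps\<close>)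
 moreover have "0 < measure gauss {z :: real. abs z <= 1}" by (rule std_normal_pos[of "- 1" 1]) auto
 moreover have "0 < measure gauss {z :: real. 2 <= abs z}" by (rule std_normal_pos[of 2 3]) auto
 ultimately show ?thesis unfolding q0_def using kap_pos s0 by simp
qed

lemma phi_mono: "abs x <= abs y ==> phi x <= phi y"
 unfolding phi_def by (intro mult_left_mono sum_mono H_mono) auto

text \<open>\<open>phi\<close> is monotone in |x| and rises by at least d between v_j and 2 v_j, so
  the mean is at least d/2 away from one of these two values. Accordingly the deviation is at least
  d/2 on |z| >= 2 or on |z| <= 1, events of fixed positive probability.\<close>

lemma qv_lower:
 assumes j: "j \<in> {1..b}"
 shows "q0 <= qv j"
proof -
 define d where "d = kap * s0 * measure gauss {z. abs (A * z) <= s0}"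
 have d0: "0 <= d" unfolding d_def using kap_pos s0 by simp
 note vj = v_bounds[OF j]
 have vs: "kap * s0 <= v j" unfolding v_def using kap_pos tau_bounds(1)[OF j] by simp
 have inc: "d <= phi (2 * v j) - phi (v j)"
 proof -
  have "(1 / real b) * (\<Sum>k=1..b. d) <= (1 / real b) * (\<Sum>k=1..b. H (2 * v j) (v k) - H (v j) (v k))"
  proof (intro mult_left_mono sum_mono)
   fix k assume k: "k \<in> {1..b}"
   have "d <= (2 * v j - v j) * measure gauss {z. abs (v k * z) <= v j}" unfolding d_def
   proof (intro mult_mono gauss.finite_measure_mono)
    \<comment> \<open>The long run factor cancels: v k is at most kap * A and v j at least kap *
      s0.\<close>
    show "{z. abs (A * z) <= s0} \<subseteq> {z. abs (v k * z) <= v j}"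
    proof
     fix z assume "z \<in> {z. abs (A * z) <= s0}"
     hence z: "A * abs z <= s0" using A_pos by (simp add: abs_mult)
     have "abs (v k * z) <= VB * abs z" unfolding abs_mult using v_bounds(3)[OF k] by (intro mult_right_mono) auto
     also have "... = kap * (A * abs z)" by (simp add: VB_def)
     also have "... <= kap * s0" using z kap_pos by (intro mult_left_mono) auto
     finally show "z \<in> {z. abs (v k * z) <= v j}" using vs by simp
    qed
   qed (use vs vj kap_pos s0 in auto)
   also have "... <= H (2 * v j) (v k) - H (v j) (v k)" using vj by (intro H_increment) auto
   finally show "d <= H (2 * v j) (v k) - H (v j) (v k)" .
  qed auto
  thus ?thesis using b unfolding phi_def average_diff by simp
 qed
 define lo where "lo = phi (v j)"
 define hi where "hi = phi (2 * v j)"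
 have i: "integrable gauss (%z. (phi (v j * z) - mn j)^2)"
 proof -
  have "(phi (v j * z) - mn j)^2 = (phi (v j * z))^2 - 2 * mn j * phi (v j * z) + (mn j)^2" for z
   by (simp add: power2_diff)
  thus ?thesis using phi_square_mean(3)[OF j] phi_normal(2)[of j] by simp
 qed
 have *: "d^2 / 4 * measure gauss T <= qv j"
  if T: "T \<in> sets borel" "!!z. z \<in> T ==> d / 2 <= abs (phi (v j * z) - mn j)" for T
 proof -
  have "d^2 / 4 * measure gauss T = (LINT z|gauss. d^2 / 4 * indicator T z)" using T by simp
  also have "... <= qv j" unfolding qv_def
  proof (intro integral_mono i integrable_mult_right)
   show "integrable gauss (indicat_real T)" using T by (intro gauss.integrable_bounded[of _ 1]) auto
   fix z
   show "d^2 / 4 * indicator T z <= (phi (v j * z) - mn j)^2"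
   proof (cases "z \<in> T")
    case True
    have "(d / 2)^2 <= (abs (phi (v j * z) - mn j))^2" using T(2)[OF True] d0 by (intro power_mono) auto
    thus ?thesis using True by (simp add: power_divide)
   qed auto
  qed
  finally show ?thesis .
 qed
 have q0: "q0 <= d^2 / 4 * measure gauss {z :: real. abs z <= 1}" "q0 <= d^2 / 4 * measure gauss {z :: real. 2 <= abs z}"
  unfolding q0_def d_def[symmetric] by (intro mult_left_mono; simp)+
 show ?thesis
 proof (cases "mn j <= (lo + hi) / 2")
  case True
  have "d^2 / 4 * measure gauss {z :: real. 2 <= abs z} <= qv j"
  proof (rule *)
   fix z :: real assume "z \<in> {z. 2 <= abs z}"
   hence "abs (2 * v j) <= abs (v j * z)" using vj by (simp add: abs_mult mult.commute)
   hence "hi <= phi (v j * z)" unfolding hi_def by (rule phi_mono)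
   hence "d / 2 <= phi (v j * z) - mn j" using True inc unfolding lo_def[symmetric] hi_def[symmetric] by argo
   thus "d / 2 <= abs (phi (v j * z) - mn j)" by (rule order_trans) simp
  qed simp
  thus ?thesis using q0 by linarith
 next
  case False
  have "d^2 / 4 * measure gauss {z :: real. abs z <= 1} <= qv j"
  proof (rule *)
   fix z :: real assume "z \<in> {z. abs z <= 1}"
   hence "abs (v j * z) <= abs (v j)" using vj by (simp add: abs_mult mult_left_le)
   hence "phi (v j * z) <= lo" unfolding lo_def by (rule phi_mono)
   hence "d / 2 <= mn j - phi (v j * z)" using False inc unfolding lo_def[symmetric] hi_def[symmetric] by argo
   thus "d / 2 <= abs (phi (v j * z) - mn j)" by (rule order_trans) simp
  qed simp
  thus ?thesis using q0 by linarith
 qed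
qed

end

interpretation normal_pair: pair_prob_space gauss gauss ..

lemma space_normal_pair [simp]: "space normal_pair = UNIV" by (simp add: normal_pair_def space_pair_measure)

lemma sets_normal_pair [measurable_cong]: "sets normal_pair = sets (borel \<Otimes>\<^sub>M borel)"
 unfolding normal_pair_def by (rule sets_pair_measure_cong) simp_all

interpretation normal_pair: prob_space normal_pair
 unfolding normal_pair_def by (rule normal_pair.prob_space_axioms)

section \<open>The limit variance\<close>

lemma integral_normal_pair:
 fixes f :: "real \<times> real => real"
 shows "integrable normal_pair f ==> integral\<^sup>L normal_pair f = (LINT z|gauss. (LINT z'|gauss. f (z, z')))"
 unfolding normal_pair_def by (rule normal_pair.integral_fst'[symmetric])

lemma normal_pair_fst:
 fixes f :: "real => real"
 assumes f: "f \<in> borel_measurable borel"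
 shows "(LINT ze|normal_pair. f (fst ze)) = (LINT z|gauss. f z)"
  "integrable normal_pair (%ze. f (fst ze)) \<longleftrightarrow> integrable gauss f"
proof -
 have d: "distr normal_pair gauss fst = gauss" unfolding normal_pair_def by (rule gauss.distr_pair_fst)
 have m: "fst \<in> measurable normal_pair gauss" unfolding normal_pair_def by measurable
 show "(LINT ze|normal_pair. f (fst ze)) = (LINT z|gauss. f z)"
  using integral_distr[OF m, of f] f unfolding d by simp
 show "integrable normal_pair (%ze. f (fst ze)) \<longleftrightarrow> integrable gauss f"
  using integrable_distr_eq[OF m, of f] f unfolding d by simp
qed

lemma normal_pair_snd_integrable: "integrable normal_pair (%ze. abs (snd ze))"
proof -
 let ?a = "gauss \<Otimes>\<^sub>M gauss"
 have d: "distr ?a gauss snd = gauss"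
 proof (rule measure_eqI)
  fix T assume T: "T \<in> sets (distr ?a gauss snd)"
  hence "snd -` T \<inter> space ?a = space gauss \<times> T" by (auto simp: space_pair_measure)
  thus "emeasure (distr ?a gauss snd) T = emeasure gauss T"
   using T gauss.emeasure_space_1 by (simp add: emeasure_distr gauss.emeasure_pair_measure_Times)
 qed simp
 have m: "snd \<in> measurable normal_pair gauss" unfolding normal_pair_def by measurable
 show ?thesis
  using integrable_distr_eq[OF m, of "%z. abs z"] std_normal_moments(2) unfolding normal_pair_def d by simp
qed

lemma integrable_abs_diff: "integrable normal_pair (abs_diff u r)"
proof (rule int_bound)
 show "integrable normal_pair (%ze. abs u * abs (fst ze) + abs r * abs (snd ze))"
  using normal_pair_fst(2)[of "%z. abs z"] std_normal_moments(2) normal_pair_snd_integrable by simp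
 show "abs_diff u r \<in> borel_measurable normal_pair" unfolding abs_diff_def by measurable
 show "AE ze in normal_pair. norm (abs_diff u r ze) <= norm (abs u * abs (fst ze) + abs r * abs (snd ze))"
  by (intro AE_I2) (auto simp: abs_diff_def abs_mult[symmetric] split: prod.split intro: order_trans[OF abs_triangle_ineq4])
qed

lemma integral_abs_diff: "integral\<^sup>L normal_pair (abs_diff u r) = hmean u r"
 using integral_normal_pair[OF integrable_abs_diff, of u r] H_normal[of u r] by (simp add: abs_diff_def H_def)

text \<open>Conditioning on the first coordinate integrates out the second one, which gives
  \<open>H\<close>. The conditional expectation is determined up to null sets only, hence the almost
  sure form.\<close>

lemma cond_exp_abs_diff:
 "AE ze in normal_pair. real_cond_exp normal_pair sigma_Z (abs_diff u r) ze = H (u * fst ze) r"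
proof -
 have sets_Z: "sets sigma_Z = {fst -` T | T. T \<in> sets borel}"
  unfolding sigma_Z_def by (subst sets_vimage_algebra2) auto
 have fstm: "fst \<in> measurable normal_pair borel" by measurable
 have sub: "subalgebra normal_pair sigma_Z" unfolding subalgebra_def
 proof
  show "space sigma_Z = space normal_pair" by (simp add: sigma_Z_def)
  show "sets sigma_Z \<subseteq> sets normal_pair" unfolding sets_Z using measurable_sets[OF fstm] by auto
 qed
 interpret Z: finite_measure_subalgebra normal_pair sigma_Z by standard (rule sub)
 have im: "integrable normal_pair (%ze. H (u * fst ze) r)"
  using integrable_H_normal[of u r] by (subst normal_pair_fst(2)[of "%z. H (u * z) r"]) auto
 show ?thesis
 proof (rule Z.real_cond_exp_charact[OF _ integrable_abs_diff im])
  have "fst \<in> measurable sigma_Z borel" unfolding sigma_Z_def by (rule measurable_vimage_algebra1) auto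
  thus "(%ze. H (u * fst ze) r) \<in> borel_measurable sigma_Z" by measurable
  fix T' assume "T' \<in> sets sigma_Z"
  then obtain T where T: "T \<in> sets borel" "T' = fst -` T" unfolding sets_Z by auto
  note T(1)[measurable]
  have "integrable normal_pair (%ze. indicator T (fst ze) * abs_diff u r ze)"
   using integrable_abs_diff[of u r] by (rule int_bound) (auto intro!: AE_I2 simp: indicator_def abs_diff_def)
  hence "(LINT ze|normal_pair. indicator T (fst ze) * abs_diff u r ze) = (LINT z|gauss. indicator T z * H (u * z) r)"
   by (subst integral_normal_pair) (simp_all add: abs_diff_def H_def)
  also have "... = (LINT ze|normal_pair. indicator T (fst ze) * H (u * fst ze) r)"
   by (rule normal_pair_fst(1)[symmetric]) measurable
  finally show "(\<integral>x\<in>T'. abs_diff u r x \<partial>normal_pair) = (\<integral>x\<in>T'. H (u * fst x) r \<partial>normal_pair)"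
   unfolding set_lebesgue_integral_def T(2) by (simp add: indicator_def)
 qed
qed

definition centred_H :: "real => real => real => real" where
 "centred_H u r z = H (u * z) r - hmean u r"

lemma centred_H_measurable [measurable (raw)]:
 "f \<in> borel_measurable N ==> g \<in> borel_measurable N ==> h \<in> borel_measurable N ==> (%x. centred_H (f x) (g x) (h x)) \<in> borel_measurable N"
 unfolding centred_H_def hmean_def by simp

text \<open>Finitely many conditional expectations are replaced on a common set of full measure,
  after which the integrand depends on the first coordinate alone.\<close>

lemma f_var_alt:
 "f_var b x = 1 / real b * (\<Sum>j=1..b. \<integral>z. (1 / (real b - 1) * (\<Sum>k\<in>{1..b} - {j}. centred_H (x j) (x k) z))^2 \<partial>gauss)"
 unfolding f_var_def
proof (intro arg_cong2[where f = "(*)"] sum.cong refl)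
 fix j assume "j \<in> {1..b}"
 let ?h = "%z. 1 / (real b - 1) * (\<Sum>k\<in>{1..b} - {j}. centred_H (x j) (x k) z)"
 have "AE ze in normal_pair. \<forall>k\<in>{1..b} - {j}. real_cond_exp normal_pair sigma_Z (abs_diff (x j) (x k)) ze = H (x j * fst ze) (x k)"
  by (intro AE_finite_allI cond_exp_abs_diff) auto
 hence "(LINT ze|normal_pair. (abs (1 / (real b - 1) * (\<Sum>k\<in>{1..b} - {j}.
   real_cond_exp normal_pair sigma_Z (abs_diff (x j) (x k)) ze - integral\<^sup>L normal_pair (abs_diff (x j) (x k)))))^2) =
  (LINT ze|normal_pair. (?h (fst ze))^2)" unfolding integral_abs_diff unfolding power2_abs
 proof (intro integral_cong_AE)
  show "AE ze in normal_pair. (1 / (real b - 1) * (\<Sum>k\<in>{1..b} - {j}.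
   real_cond_exp normal_pair sigma_Z (abs_diff (x j) (x k)) ze - hmean (x j) (x k)))^2 = (?h (fst ze))^2"
   if "AE ze in normal_pair. \<forall>k\<in>{1..b} - {j}. real_cond_exp normal_pair sigma_Z (abs_diff (x j) (x k)) ze = H (x j * fst ze) (x k)"
   using that by eventually_elim (simp only: centred_H_def cong: sum.cong)
 qed measurable
 also have "... = (LINT z|gauss. (?h z)^2)" by (rule normal_pair_fst(1)[of "%z. (?h z)^2"]) measurable
 finally show "(LINT ze|normal_pair. (abs (1 / (real b - 1) * (\<Sum>k\<in>{1..b} - {j}.
   real_cond_exp normal_pair sigma_Z (abs_diff (x j) (x k)) ze - integral\<^sup>L normal_pair (abs_diff (x j) (x k)))))^2) = ..." .
qed

text \<open>Reverse triangle inequality for the Euclidean norm in the plane.\<close>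

lemma hmean_lipschitz: "abs (hmean x r - hmean y w) <= abs (x - y) + abs (r - w)"
proof -
 have "abs (sqrt (x^2 + r^2) - sqrt (y^2 + w^2)) <= sqrt ((x - y)^2 + (r - w)^2)"
  using norm_triangle_ineq3[of "Complex x r" "Complex y w"] by (simp add: cmod_def)
 also have "... <= abs (x - y) + abs (r - w)" by (rule sqrt_sum_squares_le_sum_abs)
 finally have "abs (sqrt (x^2 + r^2) - sqrt (y^2 + w^2)) * sqrt (2 / pi) <= (abs (x - y) + abs (r - w)) * 1"
  using sqrt_2_pi_le by (intro mult_mono) auto
 thus ?thesis unfolding hmean_def left_diff_distrib[symmetric] abs_mult using sqrt_2_pi_le by simp
qed

lemma centred_H_bound: "abs (centred_H u r z) <= abs u * (abs z + 1) + 2 * abs r"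
 using H_le[of "u * z" r] H_nonneg[of "u * z" r] hmean_le[of u r] hmean_nonneg[of u r]
 unfolding centred_H_def abs_mult distrib_left by (auto simp: abs_le_iff)

lemma centred_H_lipschitz: "abs (centred_H u r z - centred_H u' r' z) <= abs (u - u') * (abs z + 1) + 2 * abs (r - r')"
proof -
 have "abs (H (u * z) r - H (u' * z) r') <= abs (u - u') * abs z + abs (r - r')"
  using H_lipschitz[of "u * z" r "u' * z" r'] unfolding left_diff_distrib[symmetric] abs_mult .
 thus ?thesis using hmean_lipschitz[of u r u' r'] unfolding centred_H_def distrib_left by argo
qed

lemma std_normal_weight:
 "integrable gauss (%z. (abs z + 1)^2)" "(LINT z|gauss. (abs z + 1)^2) <= 4"
proof -
 have e: "(abs z + 1)^2 = z^2 + 2 * abs z + 1" for z :: real by (simp add: power2_sum)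
 show "integrable gauss (%z. (abs z + 1)^2)" unfolding e using std_normal_moments by simp
 show "(LINT z|gauss. (abs z + 1)^2) <= 4"
  unfolding e using std_normal_moments sqrt_2_pi_le by (simp add: gauss.prob_space[simplified])
qed

text \<open>The weight |z| + 1 reflects the linear growth of \<open>centred_H\<close>; its Gaussian
  second moment is at most 4.\<close>

lemma square_integral_close:
 assumes m: "f \<in> borel_measurable borel" "g \<in> borel_measurable borel"
  and d: "!!z. abs (f z - g z) <= e * (abs z + 1)" and g: "!!z. abs (g z) <= d * (abs z + 1)"
 shows "abs ((LINT z|gauss. (f z)^2) - (LINT z|gauss. (g z)^2)) <= 4 * (e * (e + 2 * d))"
proof -
 note m[measurable]
 have e0: "0 <= e" "0 <= d" using d[of 0] g[of 0] by auto
 have f: "abs (f z) <= (e + d) * (abs z + 1)" for z using d[of z] g[of z] unfolding distrib_right by argo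
 have i: "integrable gauss (%z. (h z)^2)" if "h \<in> borel_measurable borel" "!!z. abs (h z) <= r * (abs z + 1)" for h r
 proof (rule int_bound)
  show "integrable gauss (%z. r^2 * (abs z + 1)^2)" using std_normal_weight(1) by simp
  have "(h z)^2 <= r^2 * (abs z + 1)^2" for z
   using power_mono[OF that(2)[of z], of 2] by (simp add: power_mult_distrib)
  thus "AE z in gauss. norm ((h z)^2) <= norm (r^2 * (abs z + 1)^2)" by (intro AE_I2) simp
 qed (use that in measurable)
 have ifg: "integrable gauss (%z. (f z)^2)" "integrable gauss (%z. (g z)^2)"
  using i[OF m(1) f] i[OF m(2) g] by auto
 have p: "abs ((f z)^2 - (g z)^2) <= e * (e + 2 * d) * (abs z + 1)^2" for z
 proof -
  have "abs (f z + g z) <= (e + 2 * d) * (abs z + 1)" using f[of z] g[of z] unfolding distrib_right by argo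
  hence "abs (f z - g z) * abs (f z + g z) <= (e * (abs z + 1)) * ((e + 2 * d) * (abs z + 1))"
   using e0 by (intro mult_mono d) auto
  thus ?thesis by (simp add: power2_eq_square abs_mult[symmetric] algebra_simps)
 qed
 have "abs ((LINT z|gauss. (f z)^2) - (LINT z|gauss. (g z)^2)) = abs (\<integral>z. (f z)^2 - (g z)^2 \<partial>gauss)"
  using ifg by simp
 also have "... <= (LINT z|gauss. abs ((f z)^2 - (g z)^2))" by (rule integral_abs_bound)
 also have "... <= (LINT z|gauss. e * (e + 2 * d) * (abs z + 1)^2)"
  using ifg std_normal_weight(1) by (intro integral_mono p) auto
 also have "... <= e * (e + 2 * d) * 4" using std_normal_weight e0 by (simp add: mult_left_mono)
 finally show ?thesis by simp
qed

text \<open>Three discrepancies are treated at once: \<open>x\<close> against \<open>t\<close>, the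
  factor 1/(b - 1) against 1/b, and the missing diagonal. \<open>D\<close> and \<open>D2\<close> are
  averages over blocks, since the local scale estimates are controlled on average and not
  uniformly.\<close>

lemma f_var_close:
 fixes x t :: "nat => real"
 assumes b: "2 <= b" and t: "!!j. j \<in> {1..b} ==> abs (t j) <= T"
 defines "D \<equiv> 1 / real b * (\<Sum>j=1..b. (abs (x j - t j)))" and "D2 \<equiv> 1 / real b * (\<Sum>j=1..b. (x j - t j)^2)"
 shows "abs (f_var b x - 1 / real b * (\<Sum>j=1..b. \<integral>z. (1 / real b * (\<Sum>k=1..b. centred_H (t j) (t k) z))^2 \<partial>gauss))
  <= 204 * D2 + 432 * T^2 / (real b)^2 + 120 * T * D + 144 * T^2 / real b"
proof -
 have T0: "0 <= T" using t[of 1] b by auto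
 have D0: "0 <= D" unfolding D_def by (intro mult_nonneg_nonneg sum_nonneg) auto
 have b1: "real b - 1 > 0" "1 / (real b - 1) <= 2 / real b" using b by (auto simp: field_simps)
 \<comment> \<open>Error of row j: its own argument, the average over the other arguments, and the
   change of normalisation together with the diagonal.\<close>
 define e where "e j = abs (x j - t j) + 4 * D + 6 * T / b" for j
 define F where "F j z = 1 / (real b - 1) * (\<Sum>k\<in>{1..b} - {j}. centred_H (x j) (x k) z)" for j z
 define F1 where "F1 j z = 1 / (real b - 1) * (\<Sum>k\<in>{1..b} - {j}. centred_H (t j) (t k) z)" for j z
 define F2 where "F2 j z = 1 / real b * (\<Sum>k=1..b. centred_H (t j) (t k) z)" for j z
 have cb: "abs (centred_H (t j) (t k) z) <= 3 * T * (abs z + 1)" if "j \<in> {1..b}" "k \<in> {1..b}" for j k z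
 proof -
  have "abs (t j) * (abs z + 1) + 2 * abs (t k) <= T * (abs z + 1) + 2 * (T * (abs z + 1))"
   using t[OF that(1)] order_trans[OF t[OF that(2)], of "T * (abs z + 1)"] T0 by (intro add_mono mult_right_mono mult_left_mono) (auto simp: distrib_left)
  thus ?thesis using centred_H_bound[of "t j" "t k" z] by simp
 qed
 have F2b: "abs (F2 j z) <= 3 * T * (abs z + 1)" if j: "j \<in> {1..b}" for j z
 proof -
  have "abs (\<Sum>k=1..b. centred_H (t j) (t k) z) <= (\<Sum>k=1..b. 3 * T * (abs z + 1))"
   by (rule order_trans[OF sum_abs sum_mono]) (rule cb[OF j])
  thus ?thesis unfolding F2_def using b by (simp add: abs_mult field_simps)
 qed
 have d1: "abs (F j z - F1 j z) <= (abs (x j - t j) + 4 * D) * (abs z + 1)" if j: "j \<in> {1..b}" for j z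
 proof -
  have "abs (F j z - F1 j z) = 1 / (real b - 1) * abs (\<Sum>k\<in>{1..b} - {j}. centred_H (x j) (x k) z - centred_H (t j) (t k) z)"
   unfolding F_def F1_def right_diff_distrib[symmetric] sum_subtractf[symmetric] abs_mult using b1 by simp
  also have "... <= 1 / (real b - 1) * (\<Sum>k\<in>{1..b} - {j}. abs (x j - t j) * (abs z + 1) + 2 * abs (x k - t k))"
   using b1 by (intro mult_left_mono order_trans[OF sum_abs sum_mono] centred_H_lipschitz) auto
  also have "... = abs (x j - t j) * (abs z + 1) + 1 / (real b - 1) * (2 * (\<Sum>k\<in>{1..b} - {j}. abs (x k - t k)))"
   using j b b1 by (simp add: sum.distrib sum_distrib_left[symmetric] distrib_left of_nat_diff)
  also have "1 / (real b - 1) * (2 * (\<Sum>k\<in>{1..b} - {j}. abs (x k - t k))) <= 2 / real b * (2 * (\<Sum>k=1..b. (abs (x k - t k))))"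
   using b1 by (intro mult_mono mult_left_mono sum_mono2) (auto intro!: sum_nonneg)
  also have "... = 4 * D" by (simp add: D_def)
  also have "4 * D <= 4 * D * (abs z + 1)" using D0 by (simp add: distrib_left)
  finally show ?thesis by (simp add: distrib_right)
 qed
 have d2: "abs (F1 j z - F2 j z) <= 6 * T / b * (abs z + 1)" if j: "j \<in> {1..b}" for j z
 proof -
  define s where "s = (\<Sum>k\<in>{1..b} - {j}. centred_H (t j) (t k) z)"
  have s: "abs s <= (real b - 1) * (3 * T * (abs z + 1))"
  proof -
   have "abs s <= (\<Sum>k\<in>{1..b} - {j}. 3 * T * (abs z + 1))"
    unfolding s_def by (rule order_trans[OF sum_abs sum_mono]) (use cb[OF j] in auto)
   thus ?thesis using j b by (simp add: of_nat_diff)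
  qed
  have "(\<Sum>k=1..b. centred_H (t j) (t k) z) = centred_H (t j) (t j) z + s"
   unfolding s_def using j by (intro sum.remove) auto
  hence "F1 j z - F2 j z = 1 / (real b - 1) * s - 1 / real b * s - 1 / real b * centred_H (t j) (t j) z"
   unfolding F1_def F2_def s_def[symmetric] by (simp add: distrib_left)
  also have "1 / (real b - 1) * s - 1 / real b * s = 1 / real b * (1 / (real b - 1) * s)"
   using b1 b by (simp add: field_simps)
  finally have "abs (F1 j z - F2 j z) <= 1 / real b * (1 / (real b - 1) * abs s) + 1 / real b * abs (centred_H (t j) (t j) z)"
   using b1 by (auto simp: abs_mult intro: order_trans[OF abs_triangle_ineq4])
  also have "... <= 1 / real b * (3 * T * (abs z + 1)) + 1 / real b * (3 * T * (abs z + 1))"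
   using s b1 by (intro add_mono mult_left_mono cb j) (auto simp: field_simps)
  finally show ?thesis by (simp add: field_simps)
 qed
 have d: "abs (F j z - F2 j z) <= e j * (abs z + 1)" if j: "j \<in> {1..b}" for j z
  using d1[OF j, of z] d2[OF j, of z] unfolding e_def distrib_right[of _ "6 * T / b"] by linarith
 let ?a = "192 * D^2 + 432 * T^2 / (real b)^2 + 96 * T * D + 144 * T^2 / real b"
  and ?b = "f_var b x - 1 / real b * (\<Sum>j=1..b. \<integral>z. (F2 j z)^2 \<partial>gauss)"
 have "abs ?b
  = 1 / real b * abs (\<Sum>j=1..b. (LINT z|gauss. (F j z)^2) - (LINT z|gauss. (F2 j z)^2))"
  unfolding f_var_alt F_def[symmetric] right_diff_distrib[symmetric] sum_subtractf[symmetric] abs_mult by simp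
 also have "... <= 1 / real b * (\<Sum>j=1..b. 4 * (e j * (e j + 2 * (3 * T))))"
 proof (intro mult_left_mono order_trans[OF sum_abs sum_mono] square_integral_close)
  fix j assume j: "j \<in> {1..b}"
  show "F j \<in> borel_measurable borel" "F2 j \<in> borel_measurable borel"
   unfolding F_def[abs_def] F2_def[abs_def] by measurable
 qed (use d F2b in auto)
 also have "... <= 1 / real b * (\<Sum>j=1..b. 12 * (x j - t j)^2 + 24 * T * abs (x j - t j) + ?a)"
 proof (intro mult_left_mono sum_mono)
  fix j
  have "(p + q + r)^2 <= 3 * p^2 + 3 * q^2 + 3 * r^2" for p q r :: real
   using sum_squares_bound[of p q] sum_squares_bound[of p r] sum_squares_bound[of q r] unfolding power2_sum by (simp add: algebra_simps)
  from this[of "abs (x j - t j)" "4 * D" "6 * T / b"]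
  have "(e j)^2 <= 3 * (x j - t j)^2 + 48 * D^2 + 108 * T^2 / (real b)^2"
   unfolding e_def by (simp add: power_mult_distrib power_divide)
  moreover have "e j * (e j + 2 * (3 * T)) = (e j)^2 + 6 * T * abs (x j - t j) + 24 * T * D + 36 * T^2 / b"
   by (simp add: e_def algebra_simps power2_eq_square)
  ultimately show "4 * (e j * (e j + 2 * (3 * T))) <= 12 * (x j - t j)^2 + 24 * T * abs (x j - t j) + ?a"
   by simp
 qed simp
 also have "... = 12 * D2 + 24 * T * D + ?a"
  using b unfolding D2_def D_def by (simp add: sum.distrib sum_distrib_left[symmetric] distrib_left)
 finally have main: "abs ?b <= 12 * D2 + 24 * T * D + ?a" .
 \<comment> \<open>Cauchy-Schwarz absorbs the square of \<open>D\<close>: 12 + 192 = 204, and the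
   terms in T * D give 24 + 96 = 120.\<close>
 have "D^2 <= D2"
 proof -
  have "(\<Sum>j=1..b. (abs (x j - t j)) * 1)^2 <= (\<Sum>j=1..b. (abs (x j - t j))^2) * (\<Sum>j=1..b. 1^2)"
   by (rule Cauchy_Schwarz_ineq_sum)
  thus ?thesis unfolding D_def D2_def using b by (simp add: power_mult_distrib power_divide field_simps power2_eq_square)
 qed
 thus ?thesis using main unfolding F2_def by argo
qed

section \<open>Local standard deviations\<close>

text \<open>\<open>e\<close> is the deviation of the mean at the last design point x = 1. Almost
  everywhere constancy and right continuity settle all earlier points, so only the observation with
  index \<open>n\<close> can be off.\<close>

locale block_sample = block_array M Y C lam p K c \<beta> sg n l b c0 A B s0 E
 for M :: "'a measure" and Y C lam p K c \<beta> sg n l b c0 A B s0 E +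
 fixes mH e :: real and obs :: "'a => int => real"
 assumes obs: "!!x i. i \<in> {1..n} ==> obs x (int i) = mH + sg i * Y i x + (if i = n then e else 0)"
  and obs_out: "!!x i. i < 1 \<or> int n < i ==> obs x i = 0"
begin

lemma block_blk: "j \<in> {1..b} ==> block l j = int ` blk j"
 unfolding block_def blk_def image_int_atLeastAtMost by (simp add: of_nat_diff)

lemma sum_block: "j \<in> {1..b} ==> (\<Sum>i\<in>block l j. f i) = (\<Sum>i\<in>blk j. f (int i))"
 unfolding block_blk by (subst sum.reindex) auto

definition ej :: "nat => real" where "ej j = (if n \<in> blk j then e else 0)"

lemma ej_le: "abs (ej j) <= abs e" by (simp add: ej_def)

lemma sum_spike: "(\<Sum>i\<in>blk j. if i = n then (r :: real) else 0) = (if n \<in> blk j then r else 0)"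
 by (simp add: sum.delta)

lemma X_alt: "X j x = (1 / sqrt l) * (\<Sum>i\<in>blk j. sg i * Y i x)"
 unfolding X_def S_def wt_def by (simp add: sum_distrib_left)

lemma tau2_alt: "tau2 j = (1 / real l) * (\<Sum>i\<in>blk j. (sg i)^2)"
 unfolding tau2_def wt_def by (simp add: sum_distrib_left power_divide)

lemma local_mean_obs:
 assumes j: "j \<in> {1..b}"
 shows "local_mean l (obs x) j = mH + X j x / sqrt l + ej j / l"
proof -
 have "(\<Sum>i\<in>block l j. obs x i) = (\<Sum>i\<in>blk j. mH + sg i * Y i x + (if i = n then e else 0))"
  unfolding sum_block[OF j] using blk_subset[OF j] by (intro sum.cong refl obs) auto
 also have "... = real l * mH + (\<Sum>i\<in>blk j. sg i * Y i x) + ej j"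
  unfolding sum.distrib sum_spike ej_def by (simp add: card_blk[OF j])
 finally show ?thesis unfolding local_mean_def X_alt using l by (simp add: add_divide_distrib)
qed

text \<open>The common mean drops out of differences of local means. The spike enters a local mean
  with the factor 1/l, hence order l^(-1/2) after scaling.\<close>

lemma U_stat_close: "abs (sqrt l * U_stat b l (obs x) - U0 x) <= 2 * abs e / sqrt l"
proof -
 have bb: "real b * (real b - 1) > 0" using b by simp
 have "sqrt l * U_stat b l (obs x) - U0 x = 1 / (real b * (real b - 1)) *
  (\<Sum>j=1..b. \<Sum>k\<in>{1..b} - {j}. sqrt l * abs (local_mean l (obs x) j - local_mean l (obs x) k) - abs (X j x - X k x))"
  unfolding U_stat_def U0_def by (simp add: sum_subtractf sum_distrib_left right_diff_distrib mult.left_commute)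
 also have "abs ... <= 1 / (real b * (real b - 1)) * (\<Sum>j=1..b. \<Sum>k\<in>{1..b} - {j}. 2 * abs e / sqrt l)"
  unfolding abs_mult abs_of_pos[OF divide_pos_pos[OF zero_less_one bb]]
 proof (intro mult_left_mono order_trans[OF sum_abs] sum_mono)
  fix j k assume j: "j \<in> {1..b}" and "k \<in> {1..b} - {j}"
  hence k: "k \<in> {1..b}" by simp
  have sl: "real l / sqrt l = sqrt l" "0 < sqrt l" using l by (simp_all add: real_div_sqrt)
  have "sqrt l * abs (local_mean l (obs x) j - local_mean l (obs x) k) = abs (sqrt l * (local_mean l (obs x) j - local_mean l (obs x) k))"
   by (simp add: abs_mult)
  also have "sqrt l * (local_mean l (obs x) j - local_mean l (obs x) k) = (X j x - X k x) + (ej j - ej k) / sqrt l"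
  proof -
   have q: "sqrt l * (r / l) = r / sqrt l" for r using sl by (metis divide_divide_eq_right mult.commute times_divide_eq_right)
   show ?thesis unfolding local_mean_obs[OF j] local_mean_obs[OF k] using sl(2)
    by (simp only: right_diff_distrib distrib_left q) (simp add: diff_divide_distrib)
  qed
  finally have "abs (sqrt l * abs (local_mean l (obs x) j - local_mean l (obs x) k) - abs (X j x - X k x)) <= abs ((ej j - ej k) / sqrt l)"
   by linarith
  also have "... <= 2 * abs e / sqrt l"
   using ej_le[of j] ej_le[of k] sl(2) by (auto simp: abs_divide intro!: divide_right_mono)
  finally show "abs (sqrt l * abs (local_mean l (obs x) j - local_mean l (obs x) k) - abs (X j x - X k x)) <= 2 * abs e / sqrt l" .
 qed (use bb in auto)
 also have "... = 2 * abs e / sqrt l" using b by (simp add: of_nat_diff)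
 finally show ?thesis .
qed

definition lv :: "nat => 'a => real" where "lv j x = local_variance l (obs x) j"
text \<open>Centred quadratic part of the local variance; its second moment is of order 1/l by the
  covariance bound for squares.\<close>

definition QS :: "nat => 'a => real" where "QS j x = (\<Sum>i\<in>blk j. (wt (blk j) i)^2 * ((Y i x)^2 - 1))"

lemma lv_nonneg: "0 <= lv j x"
 unfolding lv_def local_variance_def by (intro mult_nonneg_nonneg sum_nonneg) auto

lemma mean_variance:
 fixes u :: "'i => real"
 assumes "finite I" "card I = l"
 shows "(1 / real l) * (\<Sum>i\<in>I. (u i - (1 / real l) * (\<Sum>i\<in>I. u i))^2) = (1 / real l) * (\<Sum>i\<in>I. (u i)^2) - ((1 / real l) * (\<Sum>i\<in>I. u i))^2"
proof -
 define m where "m = (1 / real l) * (\<Sum>i\<in>I. u i)"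
 have "(\<Sum>i\<in>I. (u i - m)^2) = (\<Sum>i\<in>I. (u i)^2) - 2 * m * (\<Sum>i\<in>I. u i) + real l * m^2"
  unfolding power2_diff sum.distrib sum_subtractf sum_distrib_left by (simp add: assms(2) ac_simps)
 also have "(\<Sum>i\<in>I. u i) = real l * m" using l by (simp add: m_def)
 finally show ?thesis unfolding m_def[symmetric] using l by (simp add: field_simps power2_eq_square)
qed

text \<open>The local variance is a mean square minus a squared mean. The former differs from
  \<open>tau2 j\<close> by \<open>QS\<close> and the spike, the latter is of order 1/l.\<close>

lemma lv_close:
 assumes j: "j \<in> {1..b}"
 shows "abs (lv j z - tau2 j) <= abs (QS j z) + (2 * abs e * A * abs (Y n z) + 3 * e^2) / l + 2 * (X j z)^2 / l"
proof -
 define u where "u i = sg i * Y i z + (if i = n then e else 0)" for i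
 have n1: "n \<in> {1..n}" using ln_pos l by auto
 have su: "(1 / real l) * (\<Sum>i\<in>blk j. u i) = X j z / sqrt l + ej j / l"
  unfolding u_def sum.distrib sum_spike ej_def X_alt using l by (simp add: add_divide_distrib)
 have lm: "local_mean l (obs z) j = mH + (1 / real l) * (\<Sum>i\<in>blk j. u i)"
  unfolding su local_mean_obs[OF j] by simp
 let ?a = "X j z / sqrt l + ej j / l"
  and ?b = "\<Sum>i\<in>blk j. (u i)^2"
 have "lv j z = (1 / real l) * (\<Sum>i\<in>blk j. (u i - (1 / real l) * (\<Sum>i\<in>blk j. u i))^2)"
  unfolding lv_def local_variance_def sum_block[OF j] lm
 proof (intro arg_cong2[where f = "(*)"] sum.cong refl arg_cong[where f = "%x. x^2"])
  fix i assume "i \<in> blk j"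
  hence "i \<in> {1..n}" using blk_subset[OF j] by auto
  thus "obs z (int i) - (mH + 1 / real l * sum u (blk j)) = u i - 1 / real l * sum u (blk j)"
   by (simp add: obs u_def)
 qed
 also have "... = (1 / real l) * ?b - ?a^2"
  unfolding su[symmetric] by (rule mean_variance) (simp_all add: card_blk[OF j])
 finally have 1: "lv j z = (1 / real l) * ?b - ?a^2" .
 define r where "r = (if n \<in> blk j then 2 * e * sg n * Y n z + e^2 else 0)"
 let ?c = "\<Sum>i\<in>blk j. (sg i * Y i z)^2"
 have "?b = (\<Sum>i\<in>blk j. (sg i * Y i z)^2 + (if i = n then 2 * e * sg n * Y n z + e^2 else 0))"
  unfolding u_def by (intro sum.cong refl) (auto simp: power2_sum)
 also have "... = ?c + r" unfolding sum.distrib sum_spike r_def ..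
 finally have 2: "(1 / real l) * ?b = (1 / real l) * ?c + r / l" by (simp add: add_divide_distrib)
 have 3: "QS j z = (1 / real l) * ?c - tau2 j"
  unfolding QS_def tau2_alt wt_def by (simp add: sum_distrib_left power_divide power_mult_distrib right_diff_distrib sum_subtractf diff_divide_distrib)
 have 4: "abs r <= 2 * abs e * A * abs (Y n z) + e^2"
 proof -
  have "abs (2 * e * sg n * Y n z) <= 2 * abs e * A * abs (Y n z)"
   unfolding abs_mult using sg[OF n1] s0 by (intro mult_right_mono mult_mono) auto
  thus ?thesis using A_pos by (auto simp: r_def intro: order_trans[OF abs_triangle_ineq])
 qed
 have 5: "?a^2 <= 2 * (X j z)^2 / l + 2 * e^2 / l"
 proof -
  have "(ej j / l)^2 <= e^2 / l"
  proof -
   have "(ej j)^2 / (real l * real l) <= e^2 / (real l * 1)"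
    using l power_mono[OF ej_le[of j], of 2] by (intro frac_le mult_left_mono) auto
   thus ?thesis by (simp add: power_divide power2_eq_square[of "real l"])
  qed
  moreover have "(x + y)^2 <= 2 * x^2 + 2 * y^2" for x y :: real
   using sum_squares_bound[of x y] by (simp add: power2_sum)
  from this[of "X j z / sqrt l" "ej j / l"]
  have "?a^2 <= 2 * ((X j z)^2 / l) + 2 * (ej j / l)^2" by (simp add: power_divide)
  ultimately show ?thesis unfolding times_divide_eq_right[symmetric] by linarith
 qed
 have "lv j z - tau2 j = QS j z + r / l - ?a^2" unfolding 1 2 3 by simp
 hence "abs (lv j z - tau2 j) <= abs (QS j z) + abs r / l + (2 * (X j z)^2 / l + 2 * e^2 / l)"
  using 5 zero_le_power2[of "X j z / sqrt l + ej j / l"] l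
  by (auto simp: abs_divide intro!: order_trans[OF abs_triangle_ineq4] add_mono order_trans[OF abs_triangle_ineq])
 also have "abs r / l <= (2 * abs e * A * abs (Y n z) + e^2) / l" using 4 by (intro divide_right_mono) auto
 finally show ?thesis by (simp add: add_divide_distrib)
qed

lemma obs_measurable [measurable]: "(%x. obs x i) \<in> borel_measurable M"
proof (cases "1 <= i \<and> i <= int n")
 case True
 hence "nat i \<in> {1..n}" "int (nat i) = i" by auto
 hence "(%x. obs x i) = (%x. mH + sg (nat i) * Y (nat i) x + (if nat i = n then e else 0))"
  using obs[of "nat i"] by auto
 thus ?thesis by simp
next
 case False
 hence "(%x. obs x i) = (%x. 0)" using obs_out[of i] by auto
 thus ?thesis by simp
qed

lemma lv_measurable [measurable]: "lv j \<in> borel_measurable M"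
 unfolding lv_def[abs_def] local_variance_def local_mean_def by measurable

definition sdc :: real where
 "sdc = sqrt (2 * sq_cov_sum) * A^2 + 2 * abs e * A + 3 * e^2 + 2 * (VB^2 + vconst)"

lemma sq_cov_sum_nonneg: "0 <= sq_cov_sum"
proof -
 have "0 <= 2 * sq_cov_sum * (\<Sum>i\<in>{1::nat}. (1::real)^2)"
  by (rule order_trans[OF _ sum_squares_variance_le(2)[of "{1}" "%_. 1"]]) auto
 thus ?thesis by simp
qed

lemma lv_L1:
 assumes j: "j \<in> {1..b}"
 shows "integrable M (%x. abs (lv j x - tau2 j))" "(LINT x|M. abs (lv j x - tau2 j)) <= sdc / sqrt l"
proof -
 have J: "finite (blk j)" "blk j \<subseteq> {1..}" using blk_subset[OF j] by auto
 have n1: "1 <= n" using ln_pos l by simp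
 have iQ: "integrable M (QS j)" unfolding QS_def[abs_def] using integrable_sq J(2)
  by (intro int_sum integrable_mult_right int_diff) auto
 have EQ: "(LINT x|M. abs (QS j x)) <= sqrt (2 * sq_cov_sum * (A ^ 4 / l))"
 proof (rule expectation_abs_le_sqrt[OF iQ])
  show "integrable M (%x. (QS j x)^2)" unfolding QS_def by (rule sum_squares_variance_le(1)[OF J])
  have "(LINT x|M. (QS j x)^2) <= 2 * sq_cov_sum * (\<Sum>i\<in>blk j. ((wt (blk j) i)^2)^2)"
   unfolding QS_def by (rule sum_squares_variance_le(2)[OF J])
  also have "(\<Sum>i\<in>blk j. ((wt (blk j) i)^2)^2) <= (\<Sum>i\<in>blk j. A ^ 4 / (real l)^2)"
  proof (intro sum_mono)
   fix i assume "i \<in> blk j"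
   have "abs (wt (blk j) i) ^ 4 <= (A / sqrt l) ^ 4" by (intro power_mono wt_le blk_subset j) auto
   also have "(A / sqrt l) ^ 4 = A ^ 4 / (real l)^2"
    using power_mult[of "sqrt l" 2 2] by (simp add: power_divide)
   finally show "((wt (blk j) i)^2)^2 <= A ^ 4 / (real l)^2" by (simp add: power_even_abs)
  qed
  also have "... = A ^ 4 / l" using l by (simp add: card_blk[OF j] power2_eq_square)
  finally show "(LINT x|M. (QS j x)^2) <= 2 * sq_cov_sum * (A ^ 4 / l)"
   using sq_cov_sum_nonneg by (simp add: mult_left_mono)
 qed
 have EQ': "(LINT x|M. abs (QS j x)) <= sqrt (2 * sq_cov_sum) * A^2 / sqrt l"
 proof -
  have "sqrt (A ^ 4) = A^2" using power_mult[of A 2 2] by (simp add: real_sqrt_unique)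
  hence "sqrt (2 * sq_cov_sum * (A ^ 4 / l)) = sqrt (2 * sq_cov_sum) * A^2 / sqrt l"
   by (simp only: real_sqrt_mult real_sqrt_divide) simp
  thus ?thesis using EQ by (simp only:)
 qed
 have EY: "(LINT x|M. abs (Y n x)) <= 1"
  using expectation_abs_le_sqrt[OF integrable_Y[OF n1] integrable_sq[OF n1], of 1] expectation_sq[OF n1] by simp
 have EX: "(LINT x|M. (X j x)^2) <= VB^2 + vconst"
 proof -
  have "vconst / l <= vconst / 1" using l vconst_nonneg by (intro divide_left_mono) auto
  moreover have "(kap * tau j)^2 <= VB^2" using v_bounds(2)[OF j] v_bounds(1)[OF j] unfolding v_def by (intro power_mono) auto
  ultimately show ?thesis using X_second[OF j] by linarith
 qed
 define R where "R x = abs (QS j x) + (2 * abs e * A * abs (Y n x) + 3 * e^2) / l + 2 * (X j x)^2 / l" for x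
 have iR: "integrable M R" unfolding R_def[abs_def] using iQ integrable_Y[OF n1] X_integrable(2)[OF j] by simp
 have le: "abs (lv j x - tau2 j) <= R x" for x unfolding R_def by (rule lv_close[OF j])
 show i: "integrable M (%x. abs (lv j x - tau2 j))"
  by (rule int_bound[OF iR]) (auto intro!: AE_I2 order_trans[OF le])
 have "(LINT x|M. abs (lv j x - tau2 j)) <= expectation R" by (rule integral_mono[OF i iR le])
 also have "expectation R = (LINT x|M. abs (QS j x)) + (2 * abs e * A * (LINT x|M. abs (Y n x)) + 3 * e^2) / l + 2 * (LINT x|M. (X j x)^2) / l"
  unfolding R_def[abs_def] using iQ integrable_Y[OF n1] X_integrable(2)[OF j] by (simp add: prob_space)
 also have "... <= sqrt (2 * sq_cov_sum) * A^2 / sqrt l + (2 * abs e * A * 1 + 3 * e^2) / sqrt l + 2 * (VB^2 + vconst) / sqrt l"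
  using mult_right_mono[OF sqrt_l, of "sqrt l"] A_pos vconst_nonneg l
  by (intro add_mono EQ' frac_le mult_left_mono EX EY) auto
 also have "... = sdc / sqrt l" unfolding sdc_def by (simp add: add_divide_distrib)
 finally show "(LINT x|M. abs (lv j x - tau2 j)) <= sdc / sqrt l" .
qed

text \<open>The one random quantity that dominates all errors stemming from the local
  variances.\<close>

definition Dv :: "'a => real" where "Dv x = 1 / real b * (\<Sum>j=1..b. (abs (lv j x - tau2 j)))"

lemma Dv_measurable [measurable]: "Dv \<in> borel_measurable M" unfolding Dv_def[abs_def] by measurable

lemma Dv_L1: "integrable M Dv" "expectation Dv <= sdc / sqrt l"
proof -
 show "integrable M Dv" unfolding Dv_def[abs_def] by (intro integrable_mult_right int_sum lv_L1)
 have "expectation Dv = 1 / real b * (\<Sum>j=1..b. (LINT x|M. abs (lv j x - tau2 j)))"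
  unfolding Dv_def[abs_def] integral_mult_right_zero using lv_L1(1) by (simp add: LINT_sum)
 also have "... <= sdc / sqrt l" by (rule average_le) (rule lv_L1)
 finally show "expectation Dv <= sdc / sqrt l" .
qed

definition sd :: "nat => 'a => real" where "sd j x = local_sd l (obs x) j"

lemma sd_sqrt: "sd j x = sqrt (lv j x)" by (simp add: sd_def local_sd_def lv_def)

text \<open>Factor the difference of squares: the sum of the two roots is at least
  \<open>s0\<close>, and also at least their distance. The same L1 control of variances thus gives
  an L1 and an L2 bound for standard deviations.\<close>

lemma sd_close:
 assumes j: "j \<in> {1..b}"
 shows "abs (sd j x - tau j) <= abs (lv j x - tau2 j) / s0" "(sd j x - tau j)^2 <= abs (lv j x - tau2 j)"
proof -
 have t: "s0 <= tau j" "tau2 j = (tau j)^2" using tau_bounds[OF j] order_trans[OF zero_le_power2 tau2_bounds(1)[OF j]] by (auto simp: tau_def)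
 have s: "0 <= sd j x" "lv j x = (sd j x)^2" using lv_nonneg by (auto simp: sd_sqrt)
 let ?a = "sd j x - tau j"
  and ?b = "lv j x - tau2 j"
 have e: "abs ?b = abs ?a * (sd j x + tau j)"
 proof -
  have "abs (sd j x + tau j) = sd j x + tau j" using s(1) t(1) s0 by simp
  moreover have "(sd j x)^2 - (tau j)^2 = ?a * (sd j x + tau j)" by (simp add: power2_eq_square algebra_simps)
  ultimately show ?thesis unfolding s(2) t(2) by (simp only: abs_mult)
 qed
 have "abs ?a * s0 <= abs ?b" unfolding e using s t by (intro mult_left_mono) auto
 thus "abs ?a <= abs ?b / s0" using s0 by (simp add: field_simps)
 have "abs ?a * abs ?a <= abs ?b" unfolding e using s t s0 by (intro mult_left_mono) auto
 thus "?a^2 <= abs ?b" by (simp add: power2_eq_square)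
qed

lemma avg_sd_close: "1 / real b * (\<Sum>j=1..b. (abs (sd j x - tau j))) <= Dv x / s0" "1 / real b * (\<Sum>j=1..b. (sd j x - tau j)^2) <= Dv x"
proof -
 have "1 / real b * (\<Sum>j=1..b. (abs (sd j x - tau j))) <= 1 / real b * (\<Sum>j=1..b. (abs (lv j x - tau2 j)) / s0)"
  by (intro mult_left_mono sum_mono sd_close) auto
 thus "1 / real b * (\<Sum>j=1..b. (abs (sd j x - tau j))) <= Dv x / s0"
  unfolding Dv_def sum_divide_distrib[symmetric] by simp
 show "1 / real b * (\<Sum>j=1..b. (sd j x - tau j)^2) <= Dv x"
  unfolding Dv_def by (intro mult_left_mono sum_mono sd_close) auto
qed

definition qbar :: real where "qbar = 1 / real b * (\<Sum>j=1..b. qv j)"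

text \<open>\<open>H\<close> and \<open>hmean\<close> are homogeneous, so the long run factor comes
  out as kap^2: evaluated at the local scales, \<open>f_var\<close> estimates the projection
  variance divided by kap^2.\<close>

lemma qv_scale: "(LINT z|gauss. (1 / real b * (\<Sum>k=1..b. centred_H (tau j) (tau k) z))^2) = qv j / kap^2"
proof -
 have H: "H (kap * x) (kap * y) = kap * H x y" for x y
 proof -
  have "H (kap * x) (kap * y) = (LINT z|gauss. kap * abs (x - y * z))" unfolding H_def
  proof (intro LINT_cong refl)
   fix z
   have "kap * x - kap * y * z = kap * (x - y * z)" by (simp add: algebra_simps)
   thus "abs (kap * x - kap * y * z) = kap * abs (x - y * z)" using kap_pos by (simp add: abs_mult)
  qed
  thus ?thesis by (simp add: H_def)
 qed
 have m: "hmean (kap * x) (kap * y) = kap * hmean x y" for x y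
  unfolding hmean_def power_mult_distrib distrib_left[symmetric] real_sqrt_mult using kap_pos by simp
 have "phi (v j * z) - mn j = kap * (1 / real b * (\<Sum>k=1..b. centred_H (tau j) (tau k) z))" for z
 proof -
  have "H (v j * z) (v k) - hmean (v j) (v k) = kap * centred_H (tau j) (tau k) z" for k
   using H[of "tau j * z" "tau k"] m[of "tau j" "tau k"] unfolding centred_H_def v_def by (simp add: mult.assoc right_diff_distrib)
  thus ?thesis unfolding phi_def mn_def average_diff by (simp add: sum_distrib_left[symmetric])
 qed
 hence "qv j = kap^2 * (LINT z|gauss. (1 / real b * (\<Sum>k=1..b. centred_H (tau j) (tau k) z))^2)"
  unfolding qv_def by (simp only: power_mult_distrib[of kap] integral_mult_right_zero)
 thus ?thesis using kap_pos by simp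
qed

lemma f_var_sample: "abs (f_var b (local_sd l (obs y)) - qbar / kap^2) <= (204 + 120 * A / s0) * Dv y + 576 * A^2 / b"
proof -
 have t: "abs (tau j) <= A" if "j \<in> {1..b}" for j using tau_bounds[OF that] s0 by simp
 note f_var_close[OF b t, where x = "local_sd l (obs y)"]
 also have "1 / real b * (\<Sum>j=1..b. \<integral>z. (1 / real b * (\<Sum>k=1..b. centred_H (tau j) (tau k) z))^2 \<partial>gauss) = qbar / kap^2"
  unfolding qv_scale qbar_def sum_divide_distrib[symmetric] by simp
 finally have "abs (f_var b (local_sd l (obs y)) - qbar / kap^2)
  <= 204 * (1 / real b * (\<Sum>j=1..b. (sd j y - tau j)^2)) + 432 * A^2 / (real b)^2
   + 120 * A * (1 / real b * (\<Sum>j=1..b. (abs (sd j y - tau j)))) + 144 * A^2 / real b"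
  unfolding sd_def by simp
 also have "... <= 204 * Dv y + 432 * A^2 / real b + 120 * A * (Dv y / s0) + 144 * A^2 / real b"
 proof (intro add_mono mult_left_mono avg_sd_close order_refl)
  have "real b <= (real b)^2" using b by (simp add: power2_eq_square)
  thus "432 * A^2 / (real b)^2 <= 432 * A^2 / real b" using b by (intro divide_left_mono) auto
 qed (use A_pos in auto)
 also have "... = (204 + 120 * A / s0) * Dv y + 576 * A^2 / b" by (simp add: distrib_right)
 finally show ?thesis .
qed

definition Ahat :: "'a => real" where
 "Ahat x = 1 / (real b * (real b - 1)) * (\<Sum>j=1..b. \<Sum>k\<in>{1..b} - {j}. sqrt (lv j x + lv k x) * sqrt (2 / pi))"

text \<open>Homogeneity removes \<open>kap\<close> from the centring, \<open>hmean\<close> is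
  Lipschitz, and every block occurs in 2 (b - 1) ordered pairs.\<close>

lemma Ahat_close: "abs (Ahat z - a0 / kap) <= 2 * Dv z / s0"
proof -
 have bb: "real b * (real b - 1) > 0" using b by simp
 have m: "hmean (kap * x) (kap * y) = kap * hmean x y" for x y
  unfolding hmean_def power_mult_distrib distrib_left[symmetric] real_sqrt_mult using kap_pos by simp
 let ?a = "real b * (real b - 1)"
  and ?b = "\<Sum>j=1..b. \<Sum>k\<in>{1..b} - {j}. abs (sd j z - tau j) + abs (sd k z - tau k)"
 let ?c = "\<Sum>j=1..b. (abs (sd j z - tau j))"
  and ?d = "\<Sum>j=1..b. \<Sum>k\<in>{1..b} - {j}. hmean (tau j) (tau k)"
 have "a0 = kap * (1 / ?a * ?d)" unfolding a0_def v_def m sum_distrib_left[symmetric] by simp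
 hence "a0 / kap = 1 / ?a * ?d" using kap_pos by simp
 moreover have "Ahat z = 1 / ?a * (\<Sum>j=1..b. \<Sum>k\<in>{1..b} - {j}. hmean (sd j z) (sd k z))"
  unfolding Ahat_def hmean_def sd_sqrt using lv_nonneg by simp
 ultimately have "abs (Ahat z - a0 / kap) = 1 / ?a * abs (\<Sum>j=1..b. \<Sum>k\<in>{1..b} - {j}. hmean (sd j z) (sd k z) - hmean (tau j) (tau k))"
  using bb by (simp only: right_diff_distrib[symmetric] sum_subtractf[symmetric] abs_mult) simp
 also have "... <= 1 / ?a * ?b"
  using bb by (intro mult_left_mono order_trans[OF sum_abs] sum_mono hmean_lipschitz) auto
 also have "?b = (real b - 1) * (2 * ?c)"
 proof -
  define d where "d j = abs (sd j z - tau j)" for j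
  have "(\<Sum>k\<in>{1..b} - {j}. d j + d k) = (real b - 2) * d j + (\<Sum>k=1..b. d k)" if "j \<in> {1..b}" for j
   using that b by (simp add: sum.distrib sum_diff1 of_nat_diff algebra_simps)
  hence "(\<Sum>j=1..b. \<Sum>k\<in>{1..b} - {j}. d j + d k) = (\<Sum>j=1..b. (real b - 2) * d j + (\<Sum>k=1..b. d k))"
   by (intro sum.cong refl)
  also have "... = (real b - 2) * (\<Sum>j=1..b. d j) + real b * (\<Sum>k=1..b. d k)"
   unfolding sum.distrib sum_distrib_left[symmetric] by simp
  finally show ?thesis unfolding d_def by (simp add: algebra_simps)
 qed
 also have "1 / ?a * ((real b - 1) * (2 * ?c)) = 2 * (1 / real b * ?c)" using b by simp
 also have "... <= 2 * (Dv z / s0)" by (intro mult_left_mono avg_sd_close) auto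
 finally show ?thesis by simp
qed

end

text \<open>Compare with the constants r - d and r + d. It serves to replace a root mean square of
  the scale over a block by its mean.\<close>

lemma weighted_l2_close:
 fixes u x :: "nat => real"
 assumes u: "!!i. i \<in> I ==> 0 <= u i" and x: "!!i. i \<in> I ==> 0 <= x i" "!!i. i \<in> I ==> abs (x i - r) <= d" and r: "0 <= r" "0 <= d"
 shows "abs (sqrt (\<Sum>i\<in>I. u i * (x i)^2) - r * sqrt (\<Sum>i\<in>I. u i)) <= d * sqrt (\<Sum>i\<in>I. u i)"
proof -
 define U where "U = (\<Sum>i\<in>I. u i)"
 have U: "0 <= U" unfolding U_def using u by (intro sum_nonneg)
 let ?a = "\<Sum>i\<in>I. u i * (x i)^2"
 have "?a <= (\<Sum>i\<in>I. u i * (r + d)^2)"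
 proof (intro sum_mono mult_left_mono power_mono u x)
  fix i assume "i \<in> I"
  thus "x i <= r + d" using x(2)[of i] by linarith
 qed auto
 also have "... = (r + d)^2 * U" by (simp add: U_def sum_distrib_right[symmetric])
 finally have "sqrt ?a <= sqrt ((r + d)^2 * U)" by simp
 also have "... = (r + d) * sqrt U" using r by (simp add: real_sqrt_mult)
 finally have 1: "sqrt ?a <= (r + d) * sqrt U" .
 have 2: "(r - d) * sqrt U <= sqrt ?a"
 proof (cases "r <= d")
  case True
  hence "(r - d) * sqrt U <= 0" using U by (simp add: mult_nonpos_nonneg)
  also have "0 <= sqrt ?a" using u by (intro real_sqrt_ge_zero sum_nonneg) auto
  finally show ?thesis .
 next
  case False
  have "(\<Sum>i\<in>I. u i * (r - d)^2) <= ?a"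
  proof (intro sum_mono mult_left_mono power_mono u)
   fix i assume "i \<in> I"
   thus "r - d <= x i" using x(2)[of i] by linarith
  qed (use False in auto)
  also have "(\<Sum>i\<in>I. u i * (r - d)^2) = (r - d)^2 * U" by (simp add: U_def sum_distrib_right[symmetric])
  finally have "sqrt ((r - d)^2 * U) <= sqrt ?a" by simp
  thus ?thesis using False by (simp add: real_sqrt_mult)
 qed
 show ?thesis using 1 2 unfolding U_def[symmetric] abs_le_iff left_diff_distrib distrib_right by linarith
qed

lemma telescope_le:
 fixes f :: "nat => real"
 assumes "x <= y" "{x..<y} \<subseteq> I" "finite I"
 shows "abs (f y - f x) <= (\<Sum>i\<in>I. abs (f (Suc i) - f i))"
proof -
 have "f y - f x = (\<Sum>i\<in>{x..<y}. f (Suc i) - f i)" using assms(1) by (simp add: sum_Suc_diff')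
 also have "abs ... <= (\<Sum>i\<in>{x..<y}. abs (f (Suc i) - f i))" by (rule sum_abs)
 also have "... <= (\<Sum>i\<in>I. abs (f (Suc i) - f i))" using assms by (intro sum_mono2) auto
 finally show ?thesis .
qed

section \<open>Block averages of a scale function of bounded variation\<close>

context block_sample
begin

definition sbar :: real where "sbar = (1 / real n) * (\<Sum>i=1..n. sg i)"
definition bmean :: "nat => real" where "bmean j = (1 / real l) * (\<Sum>i\<in>blk j. sg i)"
text \<open>Indices of the increments inside the blocks j - r, ..., j + r; natural subtraction and
  \<open>min\<close> cut the range off at the ends of the sample.\<close>

definition erange :: "nat => nat => nat set" where "erange r j = {(j - 1 - r) * l + 1..<min (j + r) b * l}"
definition osc :: "nat => nat => real" where "osc r j = (\<Sum>i\<in>erange r j. abs (sg (Suc i) - sg i))"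

lemma osc_nonneg: "0 <= osc r j" unfolding osc_def by (intro sum_nonneg) auto

lemma osc_diff:
 assumes "x \<in> {(j - 1 - r) * l + 1..min (j + r) b * l}" "y \<in> {(j - 1 - r) * l + 1..min (j + r) b * l}"
 shows "abs (sg x - sg y) <= osc r j"
proof (cases "x <= y")
 case True
 have "abs (sg y - sg x) <= osc r j" unfolding osc_def
  by (rule telescope_le[OF True]) (use assms in \<open>auto simp: erange_def\<close>)
 thus ?thesis by linarith
next
 case False
 thus ?thesis unfolding osc_def by (intro telescope_le) (use assms in \<open>auto simp: erange_def\<close>)
qed

lemma blk_range:
 assumes "j \<in> {1..b}"
 shows "blk j \<subseteq> {(j - 1 - r) * l + 1..min (j + r) b * l}"
proof
 fix i assume "i \<in> blk j"
 hence i: "(j - 1) * l + 1 <= i" "i <= j * l" by (auto simp: blk_def)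
 have "(j - 1 - r) * l <= (j - 1) * l" by (intro mult_right_mono) auto
 moreover have "j * l <= min (j + r) b * l" using assms by (intro mult_right_mono) auto
 ultimately show "i \<in> {(j - 1 - r) * l + 1..min (j + r) b * l}" using i unfolding atLeastAtMost_iff by linarith
qed

lemma bmean_close:
 assumes j: "j \<in> {1..b}" and i: "i \<in> {(j - 1 - r) * l + 1..min (j + r) b * l}"
 shows "abs (sg i - bmean j) <= osc r j"
proof -
 have "sg i - bmean j = (1 / real l) * (\<Sum>k\<in>blk j. sg i - sg k)"
  unfolding bmean_def using l by (simp add: sum_subtractf card_blk[OF j] right_diff_distrib)
 also have "abs ... <= (1 / real l) * (\<Sum>k\<in>blk j. osc r j)"
  unfolding abs_mult using blk_range[OF j, of r] i
  by (intro mult_mono order_trans[OF sum_abs] sum_mono osc_diff) auto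
 also have "... = osc r j" using l by (simp add: card_blk[OF j])
 finally show ?thesis .
qed

lemma bmean_bounds: "j \<in> {1..b} ==> 0 <= bmean j" "j \<in> {1..b} ==> bmean j <= A"
proof -
 assume j: "j \<in> {1..b}"
 have s: "0 <= sg i" "sg i <= A" if "i \<in> blk j" for i using sg[of i] s0 that blk_subset[OF j] by force+
 show "0 <= bmean j" unfolding bmean_def using s by (intro mult_nonneg_nonneg sum_nonneg) auto
 have "(\<Sum>i\<in>blk j. sg i) <= (\<Sum>i\<in>blk j. A)" by (intro sum_mono s)
 thus "bmean j <= A" unfolding bmean_def using l by (simp add: card_blk[OF j] field_simps)
qed

lemma blk_Union: "(\<Union>j\<in>{1..b}. blk j) = {1..n}"
proof
 let ?a = "\<Union>j\<in>{1..b}. blk j"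
 show "?a \<subseteq> {1..n}" using blk_subset by (rule UN_least)
 show "{1..n} \<subseteq> ?a"
 proof
  fix i assume i: "i \<in> {1..n}"
  define q where "q = (i - 1) div l"
  have "q * l + (i - 1) mod l = i - 1" unfolding q_def by (rule div_mult_mod_eq)
  moreover have "(i - 1) mod l < l" using l by simp
  ultimately have "q * l <= i - 1" "i - 1 < (q + 1) * l" unfolding add_mult_distrib by linarith+
  moreover have "i - 1 < b * l" using i n by (simp add: mult.commute less_eq_Suc_le Suc_le_lessD Suc_pred')
  hence "q < b" unfolding q_def by (rule less_mult_imp_div_less)
  ultimately have "q + 1 \<in> {1..b}" "i \<in> blk (q + 1)" using i by (auto simp: blk_def)
  thus "i \<in> ?a" by blast
 qed
qed

lemma avg_bmean: "1 / real b * (\<Sum>j=1..b. bmean j) = sbar"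
proof -
 have "(\<Sum>i\<in>(\<Union>j\<in>{1..b}. blk j). sg i) = (\<Sum>j=1..b. \<Sum>i\<in>blk j. sg i)"
  by (rule sum.UNION_disjoint) (use blk_disjoint in auto)
 thus ?thesis unfolding blk_Union sbar_def bmean_def sum_distrib_left[symmetric] by (simp add: n)
qed

text \<open>Each increment lies in the ranges of at most 2 r + 1 blocks, so the total oscillation is
  bounded whatever the number of blocks. Averages over blocks then have errors of order 1/b, jumps
  included.\<close>

lemma sum_osc: "(\<Sum>j=1..b. osc r j) <= real (2 * r + 1) * B"
proof -
 have sub: "erange r j \<subseteq> {1..<n}" for j
 proof
  fix i assume "i \<in> erange r j"
  moreover have "min (j + r) b * l <= b * l" by (intro mult_right_mono) auto
  ultimately show "i \<in> {1..<n}" unfolding n mult.commute[of l b] erange_def atLeastLessThan_iff by linarith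
 qed
 have "(\<Sum>j=1..b. osc r j) = (\<Sum>j=1..b. \<Sum>i=1..<n. if i \<in> erange r j then abs (sg (Suc i) - sg i) else 0)"
  unfolding osc_def using sub by (intro sum.cong refl sum.mono_neutral_cong_left) auto
 also have "... = (\<Sum>i=1..<n. \<Sum>j=1..b. if i \<in> erange r j then abs (sg (Suc i) - sg i) else 0)" by (rule sum.swap)
 also have "... <= (\<Sum>i=1..<n. real (2 * r + 1) * abs (sg (Suc i) - sg i))"
 proof (intro sum_mono)
  fix i assume i: "i \<in> {1..<n}"
  hence "i \<in> (\<Union>j\<in>{1..b}. blk j)" unfolding blk_Union by simp
  then obtain q where q: "i \<in> blk q" "q \<in> {1..b}" by blast
  have "{j \<in> {1..b}. i \<in> erange r j} \<subseteq> {q - r..q + r}"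
  proof
   fix j assume "j \<in> {j \<in> {1..b}. i \<in> erange r j}"
   hence j: "(j - 1 - r) * l + 1 <= i" "i < min (j + r) b * l" "1 <= j"
    unfolding erange_def mem_Collect_eq atLeastLessThan_iff atLeastAtMost_iff by blast+
   have i': "(q - 1) * l < i" "i <= q * l" using q(1) unfolding blk_def atLeastAtMost_iff by linarith+
   have "(j - 1 - r) * l < q * l" using j i' by linarith
   hence "j - 1 - r < q" by simp
   moreover have "min (j + r) b * l <= (j + r) * l" by (intro mult_right_mono) auto
   hence "(q - 1) * l < (j + r) * l" using j i' by linarith
   hence "q - 1 < j + r" by simp
   ultimately show "j \<in> {q - r..q + r}" unfolding atLeastAtMost_iff by linarith
  qed
  hence "card {j \<in> {1..b}. i \<in> erange r j} <= card {q - r..q + r}" by (intro card_mono) auto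
  also have "... <= 2 * r + 1" by simp
  finally have c: "card {j \<in> {1..b}. i \<in> erange r j} <= 2 * r + 1" .
  have "(\<Sum>j=1..b. if i \<in> erange r j then abs (sg (Suc i) - sg i) else 0) = real (card {j \<in> {1..b}. i \<in> erange r j}) * abs (sg (Suc i) - sg i)"
   by (subst sum.inter_filter[symmetric]) auto
  also have "... <= real (2 * r + 1) * abs (sg (Suc i) - sg i)" using c by (intro mult_right_mono) (auto simp only: of_nat_le_iff abs_ge_zero)
  finally show "(\<Sum>j=1..b. if i \<in> erange r j then abs (sg (Suc i) - sg i) else 0) <= real (2 * r + 1) * abs (sg (Suc i) - sg i)" .
 qed
 also have "... <= real (2 * r + 1) * B" unfolding sum_distrib_left[symmetric] by (intro mult_left_mono sg_tv) auto
 finally show ?thesis .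
qed

lemma sbar_bounds: "s0 <= sbar" "sbar <= A"
proof -
 have n0: "0 < real n" using ln_pos l by simp
 have "(\<Sum>i=1..n. s0) <= (\<Sum>i=1..n. sg i)" "(\<Sum>i=1..n. sg i) <= (\<Sum>i=1..n. A)"
  by (intro sum_mono sg; simp)+
 thus "s0 <= sbar" "sbar <= A" unfolding sbar_def using n0 by (auto simp: field_simps)
qed

lemma avg_tau_close: "abs (1 / real b * (\<Sum>j=1..b. tau j) - sbar) <= B / b"
proof -
 have t: "abs (tau j - bmean j) <= osc 0 j" if j: "j \<in> {1..b}" for j
 proof -
  have 1: "(\<Sum>i\<in>blk j. 1 / real l) = 1" using l by (simp add: card_blk[OF j])
  have s: "0 <= sg i" if "i \<in> blk j" for i using sg[of i] s0 that blk_subset[OF j] by force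
  have "abs (sqrt (\<Sum>i\<in>blk j. 1 / real l * (sg i)^2) - bmean j * sqrt (\<Sum>i\<in>blk j. 1 / real l)) <= osc 0 j * sqrt (\<Sum>i\<in>blk j. 1 / real l)"
  proof (rule weighted_l2_close)
   fix i assume i: "i \<in> blk j"
   show "0 <= sg i" by (rule s[OF i])
   show "abs (sg i - bmean j) <= osc 0 j" by (rule bmean_close[OF j subsetD[OF blk_range[OF j] i]])
  qed (use bmean_bounds[OF j] osc_nonneg in auto)
  thus ?thesis unfolding 1 tau_def tau2_alt by (simp add: sum_distrib_left)
 qed
 have "abs (1 / real b * (\<Sum>j=1..b. tau j) - sbar) = 1 / real b * abs (\<Sum>j=1..b. tau j - bmean j)"
  unfolding avg_bmean[symmetric] right_diff_distrib[symmetric] sum_subtractf[symmetric] abs_mult by simp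
 also have "... <= 1 / real b * (\<Sum>j=1..b. osc 0 j)"
  by (intro mult_left_mono order_trans[OF sum_abs] sum_mono t) auto
 also have "... <= 1 / real b * (real (2 * 0 + 1) * B)" by (intro mult_left_mono sum_osc) auto
 finally show ?thesis by simp
qed

lemma avg_sd_sbar: "abs (1 / real b * (\<Sum>j=1..b. sd j x) - sbar) <= Dv x / s0 + B / b"
proof -
 have "abs (1 / real b * (\<Sum>j=1..b. sd j x) - 1 / real b * (\<Sum>j=1..b. tau j)) <= 1 / real b * (\<Sum>j=1..b. (abs (sd j x - tau j)))"
  unfolding average_diff abs_mult by (auto intro!: divide_right_mono)
 thus ?thesis using avg_sd_close(1)[of x] avg_tau_close by linarith
qed

end

section \<open>Contrasts of a block with its neighbours\<close>

context block_sample
begin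

definition nl :: "nat => nat set" where "nl j = {(j - 1 - c0) * l + 1..(j - 1) * l}"
definition nr :: "nat => nat set" where "nr j = {j * l + 1..min (j + c0) b * l}"
text \<open>Number of neighbouring blocks inside the sample.\<close>

definition nu_count :: "nat => nat" where "nu_count j = min c0 (j - 1) + min c0 (b - j)"
definition nw :: "nat => real" where "nw j = 1 / real (nu_count j)"

lemma card_nl: "card (nl j) = min c0 (j - 1) * l"
proof -
 have "card (nl j) = (j - 1) * l - (j - 1 - c0) * l" by (simp add: nl_def)
 also have "... = (j - 1 - (j - 1 - c0)) * l" by (rule diff_mult_distrib[symmetric])
 also have "j - 1 - (j - 1 - c0) = min c0 (j - 1)" by linarith
 finally show ?thesis .
qed

lemma card_nr: "j \<in> {1..b} ==> card (nr j) = min c0 (b - j) * l"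
proof -
 assume j: "j \<in> {1..b}"
 have "card (nr j) = min (j + c0) b * l - j * l" by (simp add: nr_def)
 also have "... = (min (j + c0) b - j) * l" by (rule diff_mult_distrib[symmetric])
 also have "min (j + c0) b - j = min c0 (b - j)" using j unfolding atLeastAtMost_iff by linarith
 finally show ?thesis .
qed

lemma nl_range: "j \<in> {1..b} ==> nl j \<subseteq> {(j - 1 - c0) * l + 1..min (j + c0) b * l}"
proof
 fix i assume j: "j \<in> {1..b}" and "i \<in> nl j"
 hence i: "(j - 1 - c0) * l + 1 <= i" "i <= (j - 1) * l" by (auto simp: nl_def)
 moreover have "(j - 1) * l <= min (j + c0) b * l" using j by (intro mult_right_mono) auto
 ultimately show "i \<in> {(j - 1 - c0) * l + 1..min (j + c0) b * l}" unfolding atLeastAtMost_iff by linarith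
qed

lemma nr_range: "j \<in> {1..b} ==> nr j \<subseteq> {(j - 1 - c0) * l + 1..min (j + c0) b * l}"
proof
 fix i assume j: "j \<in> {1..b}" and "i \<in> nr j"
 hence i: "j * l + 1 <= i" "i <= min (j + c0) b * l" by (auto simp: nr_def)
 moreover have "(j - 1 - c0) * l <= j * l" by (intro mult_right_mono) auto
 ultimately show "i \<in> {(j - 1 - c0) * l + 1..min (j + c0) b * l}" unfolding atLeastAtMost_iff by linarith
qed

lemma range_subset: "{(j - 1 - r) * l + 1..min (j + r) b * l} \<subseteq> {1..n}"
proof
 fix i assume i: "i \<in> {(j - 1 - r) * l + 1..min (j + r) b * l}"
 have "min (j + r) b * l <= b * l" by (intro mult_right_mono) auto
 thus "i \<in> {1..n}" using i unfolding n mult.commute[of l b] atLeastAtMost_iff by linarith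
qed

lemma nbr_disjoint: "j \<in> {1..b} ==> nl j \<inter> blk j = {}" "nr j \<inter> blk j = {}" "nl j \<inter> nr j = {}"
proof -
 show "j \<in> {1..b} ==> nl j \<inter> blk j = {}" by (auto simp: nl_def blk_def)
 show "nr j \<inter> blk j = {}" by (auto simp: nr_def blk_def)
 have "(j - 1) * l <= j * l" by (intro mult_right_mono) auto
 thus "nl j \<inter> nr j = {}" unfolding nl_def nr_def disjoint_iff atLeastAtMost_iff by (metis Suc_eq_plus1 le_trans not_less_eq_eq)
qed

lemma finite_nbr [simp]: "finite (nl j)" "finite (nr j)" by (auto simp: nl_def nr_def)

lemma left_blocks_window: "j \<in> {1..b} ==> left_blocks c0 l j \<inter> {1..int n} = int ` nl j"
proof -
 assume j: "j \<in> {1..b}"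
 have u: "(int j - 1) * int l <= int n"
 proof -
  have "(j - 1) * l <= b * l" using j by (intro mult_right_mono) auto
  hence "int ((j - 1) * l) <= int (b * l)" by (simp only: of_nat_le_iff)
  thus ?thesis using j by (simp add: n of_nat_diff mult.commute)
 qed
 have "left_blocks c0 l j \<inter> {1..int n} = {max 1 ((int j - 1 - int c0) * int l + 1)..(int j - 1) * int l}"
  unfolding left_blocks_def using u by auto
 \<comment> \<open>Natural subtraction truncates at 0 exactly where the integer interval is cut off
   at 1.\<close>
 also have "max 1 ((int j - 1 - int c0) * int l + 1) = int ((j - 1 - c0) * l + 1)"
 proof (cases "c0 <= j - 1")
  case True
  hence "int (j - 1 - c0) = int j - 1 - int c0" using j by auto
  moreover have "0 <= int (j - 1 - c0) * int l" by simp
  ultimately show ?thesis by simp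
 next
  case False
  hence "(int j - 1 - int c0) * int l <= 0" by (intro mult_nonpos_nonneg) auto
  thus ?thesis using False by simp
 qed
 also have "(int j - 1) * int l = int ((j - 1) * l)" using j by (simp add: of_nat_diff)
 finally show ?thesis unfolding nl_def image_int_atLeastAtMost .
qed

lemma right_blocks_window: "j \<in> {1..b} ==> right_blocks c0 l j \<inter> {1..int n} = int ` nr j"
proof -
 assume j: "j \<in> {1..b}"
 have "1 <= int j * int l + 1" by simp
 hence "right_blocks c0 l j \<inter> {1..int n} = {int j * int l + 1..min ((int j + int c0) * int l) (int n)}"
  unfolding right_blocks_def by auto
 also have "min ((int j + int c0) * int l) (int n) = int (min (j + c0) b * l)"
 proof -
  have "min ((j + c0) * l) (b * l) = min (j + c0) b * l" by (simp only: min_mult_distrib_left nat_mult_min_left)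
  hence "int (min ((j + c0) * l) (b * l)) = int (min (j + c0) b * l)" by (simp only:)
  thus ?thesis unfolding n mult.commute[of l b] by (simp only: of_nat_min of_nat_mult of_nat_add)
 qed
 also have "int j * int l + 1 = int (j * l + 1)" by simp
 finally show ?thesis unfolding nr_def image_int_atLeastAtMost .
qed

lemma sum_window:
 assumes "finite D" "D \<inter> {1..int n} = int ` I"
 shows "(\<Sum>i\<in>D. obs x i) = (\<Sum>i\<in>I. obs x (int i))"
proof -
 have "(\<Sum>i\<in>D. obs x i) = (\<Sum>i\<in>D \<inter> {1..int n}. obs x i)"
 proof (intro sum.mono_neutral_right assms(1) ballI)
  show "obs x i = 0" if "i \<in> D - D \<inter> {1..int n}" for i using that by (intro obs_out) auto
 qed auto
 also have "... = (\<Sum>i\<in>I. obs x (int i))" unfolding assms(2) by (subst sum.reindex) auto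
 finally show ?thesis .
qed

lemma blocks_disjoint: "left_blocks c0 l j \<inter> right_blocks c0 l j = {}"
proof -
 have "(int j - 1) * int l <= int j * int l" by (intro mult_right_mono) auto
 thus ?thesis by (auto simp: left_blocks_def right_blocks_def)
qed

text \<open>Both branches amount to one over the number of neighbouring blocks: when both sides fit
  into the sample there are 2 c0 of them, and otherwise the index count is that number times
  l.\<close>

lemma neighbour_weight_nw:
 assumes j: "j \<in> {1..b}"
 shows "neighbour_weight n c0 l j = nw j"
proof -
 let ?D = "left_blocks c0 l j \<union> right_blocks c0 l j"
 have c: "card (?D \<inter> {1..int n}) = nu_count j * l"
 proof -
  have "?D \<inter> {1..int n} = int ` (nl j \<union> nr j)"
   using left_blocks_window[OF j] right_blocks_window[OF j] by blast
  hence "card (?D \<inter> {1..int n}) = card (nl j \<union> nr j)" by (simp add: card_image)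
  also have "... = nu_count j * l"
   using nbr_disjoint(3)[of j] by (simp add: card_Un_disjoint card_nl card_nr[OF j] nu_count_def distrib_right)
  finally show ?thesis .
 qed
 show ?thesis
 proof (cases "?D \<subseteq> {1..int n}")
  case True
  have "card ?D = c0 * l + c0 * l"
   using blocks_disjoint[of j] by (subst card_Un_disjoint) (auto simp: left_blocks_def right_blocks_def left_diff_distrib distrib_right nat_mult_distrib)
  moreover have "?D \<inter> {1..int n} = ?D" using True by blast
  ultimately have "nu_count j = 2 * c0" using c l by (simp flip: distrib_right)
  thus ?thesis using True by (simp add: neighbour_weight_def nw_def)
 next
  case False
  thus ?thesis using l unfolding neighbour_weight_def nw_def c if_not_P[OF False] by simp
 qed
qed

text \<open>Split into the block and two neighbour parts, so that its variation is bounded by three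
  interval terms; this is the 3 in the constant of \<open>admissible\<close>.\<close>

definition ww :: "nat => nat => real" where
 "ww j i = wt (blk j) i + (- nw j * wt (nl j) i + - nw j * wt (nr j) i)"
definition ext :: "nat => nat set" where "ext j = blk j \<union> (nl j \<union> nr j)"
definition W :: "nat => 'a => real" where "W j = S (ww j) (ext j)"
definition tw :: "nat => real" where "tw j = sqrt (\<Sum>i\<in>ext j. (ww j i)^2)"

lemma ext_range: "j \<in> {1..b} ==> ext j \<subseteq> {(j - 1 - c0) * l + 1..min (j + c0) b * l}"
 unfolding ext_def using blk_range nl_range nr_range by blast

lemma ext_subset: "j \<in> {1..b} ==> ext j \<subseteq> {1..n}" using ext_range range_subset by blast

lemma finite_ext [simp]: "finite (ext j)" by (simp add: ext_def)

lemma ww_blk: "j \<in> {1..b} ==> i \<in> blk j ==> ww j i = wt (blk j) i"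
 unfolding ww_def using nbr_disjoint[of j] by (auto simp: wt_def)

lemma ww_nbr: "j \<in> {1..b} ==> i \<in> nl j \<union> nr j ==> ww j i = - nw j * wt (nl j \<union> nr j) i"
 unfolding ww_def using nbr_disjoint[of j] by (auto simp: wt_def)

lemma ww_out: "i \<notin> ext j ==> ww j i = 0" unfolding ww_def ext_def by (auto simp: wt_def)

lemma sum_ext: "j \<in> {1..b} ==> (\<Sum>i\<in>ext j. f i) = (\<Sum>i\<in>blk j. f i) + (\<Sum>i\<in>nl j \<union> nr j. f i :: real)"
 unfolding ext_def using nbr_disjoint[of j] by (intro sum.union_disjoint) auto

lemma W_alt:
 assumes j: "j \<in> {1..b}"
 shows "W j x = (1 / sqrt l) * ((\<Sum>i\<in>blk j. sg i * Y i x) - nw j * (\<Sum>i\<in>nl j \<union> nr j. sg i * Y i x))"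
proof -
 have "(\<Sum>i\<in>blk j. ww j i * Y i x) = (1 / sqrt l) * (\<Sum>i\<in>blk j. sg i * Y i x)"
  unfolding sum_distrib_left by (intro sum.cong refl) (simp add: ww_blk[OF j] wt_def)
 moreover have "(\<Sum>i\<in>nl j \<union> nr j. ww j i * Y i x) = (1 / sqrt l) * (- nw j * (\<Sum>i\<in>nl j \<union> nr j. sg i * Y i x))"
  unfolding sum_distrib_left
 proof (intro sum.cong refl)
  fix i assume i: "i \<in> nl j \<union> nr j"
  hence "wt (nl j \<union> nr j) i = sg i / sqrt l" by (simp only: wt_def if_True)
  thus "ww j i * Y i x = 1 / sqrt l * (- nw j * (sg i * Y i x))" unfolding ww_nbr[OF j i] by simp
 qed
 ultimately show ?thesis unfolding W_def S_def sum_ext[OF j] by (simp add: algebra_simps)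
qed

text \<open>Removes the bias of the contrast away from the boundary, where its variance weights add
  up to 1 + 1/(2 c0), the inverse of fc^2.\<close>

definition fc :: real where "fc = sqrt (2 * real c0 / (1 + 2 * real c0))"

lemma fc_bounds: "0 <= fc" "fc <= 1" unfolding fc_def by (auto simp: divide_le_eq)

end

section \<open>The long run variance estimator\<close>

locale kappa_sample = block_sample M Y C lam p K c \<beta> sg n l b c0 A B s0 E mH e obs
 for M :: "'a measure" and Y C lam p K c \<beta> sg n l b c0 A B s0 E mH e obs +
 assumes c0_pos: "1 <= c0" and c0_less: "c0 < b"
begin

lemma nu_count_pos: "j \<in> {1..b} ==> 1 <= nu_count j" unfolding nu_count_def using b c0_pos by auto

lemma nw_bounds: "j \<in> {1..b} ==> 0 <= nw j" "j \<in> {1..b} ==> nw j <= 1" "j \<in> {1..b} ==> nw j * nu_count j = 1"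
 unfolding nw_def using nu_count_pos[of j] by (auto simp: divide_le_eq)

lemma card_nbr: "j \<in> {1..b} ==> card (nl j \<union> nr j) = nu_count j * l"
 using nbr_disjoint(3)[of j] by (simp add: card_Un_disjoint card_nl card_nr nu_count_def distrib_right)

text \<open>The neighbour weights add up to those of one block, so the constant mean cancels. Only
  the spike remains, at most \<open>abs e\<close> from the block and \<open>abs e\<close> from its
  neighbours.\<close>

lemma kappa_term:
 assumes j: "j \<in> {1..b}"
 shows "abs (1 / sqrt l * abs ((\<Sum>i\<in>block l j. obs x i) - neighbour_weight n c0 l j * ((\<Sum>i\<in>left_blocks c0 l j. obs x i) + (\<Sum>i\<in>right_blocks c0 l j. obs x i))) - abs (W j x))
  <= 2 * abs e / sqrt l"
proof -
 define I where "I = nl j \<union> nr j"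
 define eI where "eI = (if n \<in> I then e else 0)"
 have I: "I \<subseteq> {1..n}" "finite I" using ext_subset[OF j] by (auto simp: I_def ext_def)
 let ?d = "\<Sum>i\<in>block l j. obs x i"
 have s1: "?d = real l * mH + (\<Sum>i\<in>blk j. sg i * Y i x) + ej j"
 proof -
  have "?d = (\<Sum>i\<in>blk j. mH + sg i * Y i x + (if i = n then e else 0))"
   unfolding sum_block[OF j] using blk_subset[OF j] by (intro sum.cong refl obs) auto
  thus ?thesis unfolding sum.distrib sum_spike ej_def by (simp add: card_blk[OF j])
 qed
 let ?a = "\<Sum>i\<in>right_blocks c0 l j. obs x i"
  and ?c = "\<Sum>i\<in>left_blocks c0 l j. obs x i"
 let ?e = "\<Sum>i\<in>I. sg i * Y i x"
 have "?c + ?a = (\<Sum>i\<in>nl j. obs x (int i)) + (\<Sum>i\<in>nr j. obs x (int i))"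
  using sum_window[OF _ left_blocks_window[OF j]] sum_window[OF _ right_blocks_window[OF j]] by (simp add: left_blocks_def right_blocks_def)
 also have "... = (\<Sum>i\<in>I. obs x (int i))"
  unfolding I_def using nbr_disjoint(3)[of j] by (simp add: sum.union_disjoint)
 also have "... = (\<Sum>i\<in>I. mH + sg i * Y i x + (if i = n then e else 0))"
  using I by (intro sum.cong refl obs) auto
 also have "... = real (nu_count j) * real l * mH + ?e + eI"
  unfolding sum.distrib using I(2) card_nbr[OF j] by (simp add: I_def[symmetric] sum.delta eI_def)
 finally have s2: "?c + ?a = real (nu_count j) * real l * mH + ?e + eI" .
 define q where "q = ?d - neighbour_weight n c0 l j * (?c + ?a)"
 let ?b = "ej j - nw j * eI"
 have "nw j * (real (nu_count j) * real l * mH) = real l * mH"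
  using nw_bounds(3)[OF j] by (metis mult.assoc mult_1)
 hence q: "q = ((\<Sum>i\<in>blk j. sg i * Y i x) - nw j * ?e) + ?b"
  unfolding q_def neighbour_weight_nw[OF j] s1 s2 by (simp add: algebra_simps)
 have "1 / sqrt l * abs q = abs (1 / sqrt l * q)" by (simp add: abs_mult)
 also have "1 / sqrt l * q = W j x + 1 / sqrt l * ?b"
  unfolding q W_alt[OF j] I_def[symmetric] by (rule distrib_left)
 finally have "abs (1 / sqrt l * abs q - abs (W j x)) <= abs (1 / sqrt l * ?b)"
  using abs_triangle_ineq3[of "W j x + 1 / sqrt l * ?b" "W j x"] by (simp only: add_diff_cancel_left')
 also have "... = abs ?b / sqrt l" by (simp add: abs_mult)
 also have "... <= 2 * abs e / sqrt l"
 proof (intro divide_right_mono)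
  have "abs (nw j * eI) <= 1 * abs e" unfolding abs_mult using nw_bounds[OF j] by (intro mult_mono) (auto simp: eI_def)
  thus "abs ?b <= 2 * abs e" using ej_le[of j] by linarith
 qed simp
 finally show ?thesis unfolding q_def .
qed

lemma ww_le: "j \<in> {1..b} ==> abs (ww j i) <= A / sqrt l"
proof -
 assume j: "j \<in> {1..b}"
 have As: "0 <= A / sqrt l" using A_pos by simp
 consider "i \<in> blk j" | "i \<in> nl j \<union> nr j" | "i \<notin> ext j" unfolding ext_def by blast
 thus ?thesis
 proof cases
  case 1
  show ?thesis unfolding ww_blk[OF j 1] by (rule wt_le[OF blk_subset[OF j]])
 next
  case 2
  have "nl j \<union> nr j \<subseteq> {1..n}" using ext_subset[OF j] by (auto simp: ext_def)
  hence "nw j * abs (wt (nl j \<union> nr j) i) <= 1 * (A / sqrt l)" using nw_bounds[OF j] by (intro mult_mono wt_le) auto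
  thus ?thesis unfolding ww_nbr[OF j 2] abs_mult using nw_bounds[OF j] by simp
 next
  case 3
  show ?thesis unfolding ww_out[OF 3] using As by simp
 qed
qed

lemma card_ext: "j \<in> {1..b} ==> real (card (ext j)) <= (2 * real c0 + 1) * real l"
proof -
 assume j: "j \<in> {1..b}"
 have "card (ext j) <= card (blk j) + card (nl j \<union> nr j)" unfolding ext_def by (rule card_Un_le)
 also have "... = (1 + nu_count j) * l" unfolding card_blk[OF j] card_nbr[OF j] by simp
 also have "... <= (2 * c0 + 1) * l" by (intro mult_right_mono) (auto simp: nu_count_def)
 finally have "real (card (ext j)) <= real ((2 * c0 + 1) * l)" by (simp only: of_nat_le_iff)
 thus ?thesis by (simp add: distrib_right)
qed

lemma admissible_ww:
 assumes j: "j \<in> {1..b}"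
 shows "admissible (A + 2 * real c0 + 2) (3 * (B + 2 * A)) l n (ww j) (ext j)" unfolding admissible_def
proof (intro conjI allI impI)
 show "ext j \<subseteq> {1..n}" by (rule ext_subset[OF j])
 show "ww j i = 0" if "i \<notin> ext j" for i using that by (rule ww_out)
 show "abs (ww j i) <= (A + 2 * real c0 + 2) / sqrt l" for i
  by (rule order_trans[OF ww_le[OF j]]) (auto intro!: divide_right_mono)
 have sc: "tv (%i. - nw j * wt J i) n <= (B + 2 * A) / sqrt l" if "tv (wt J) n <= (B + 2 * A) / sqrt l" for J
 proof -
  have "abs (- nw j) * tv (wt J) n <= 1 * ((B + 2 * A) / sqrt l)"
   using nw_bounds[OF j] that tv_nonneg BA_nonneg by (intro mult_mono) auto
  thus ?thesis unfolding tv_scale by simp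
 qed
 have sub: "nl j \<subseteq> {1..n}" "nr j \<subseteq> {1..n}" using ext_subset[OF j] by (auto simp: ext_def)
 have "tv (ww j) n <= tv (wt (blk j)) n + tv (%i. - nw j * wt (nl j) i + - nw j * wt (nr j) i) n"
  unfolding ww_def[abs_def] by (rule tv_add_le)
 also have "... <= tv (wt (blk j)) n + (tv (%i. - nw j * wt (nl j) i) n + tv (%i. - nw j * wt (nr j) i) n)"
  by (intro add_left_mono tv_add_le)
 also have "... <= (B + 2 * A) / sqrt l + ((B + 2 * A) / sqrt l + (B + 2 * A) / sqrt l)"
 proof (intro add_mono sc)
  show "tv (wt (blk j)) n <= (B + 2 * A) / sqrt l" using blk_subset[OF j] unfolding blk_def by (rule tv_wt)
  show "tv (wt (nl j)) n <= (B + 2 * A) / sqrt l" using sub(1) unfolding nl_def by (rule tv_wt)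
  show "tv (wt (nr j)) n <= (B + 2 * A) / sqrt l" using sub(2) unfolding nr_def by (rule tv_wt)
 qed
 also have "... = 3 * (B + 2 * A) / sqrt l" by (simp add: add_divide_distrib[symmetric])
 finally show "tv (ww j) n <= 3 * (B + 2 * A) / sqrt l" .
 have "(2 * real c0 + 1) * real l <= (A + 2 * real c0 + 2) * real l" using A_pos by (intro mult_right_mono) auto
 thus "real (card (ext j)) <= (A + 2 * real c0 + 2) * real l" using card_ext[OF j] by linarith
qed (use l ln_pos in auto)

lemma sum_ww:
 assumes j: "j \<in> {1..b}"
 shows "(\<Sum>i\<in>ext j. (ww j i)^2) = (\<Sum>i\<in>ext j. (if i \<in> blk j then 1 / real l else (nw j)\<^sup>2 / real l) * (sg i)^2)"
proof (intro sum.cong refl)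
 fix i assume i: "i \<in> ext j"
 show "(ww j i)^2 = (if i \<in> blk j then 1 / real l else (nw j)\<^sup>2 / real l) * (sg i)^2"
 proof (cases "i \<in> blk j")
  case True
  thus ?thesis unfolding ww_blk[OF j True] by (simp add: wt_def power_divide)
 next
  case False
  hence n: "i \<in> nl j \<union> nr j" using i by (simp add: ext_def)
  have "wt (nl j \<union> nr j) i = sg i / sqrt l" using n by (simp only: wt_def if_True)
  thus ?thesis unfolding ww_nbr[OF j n] using False by (simp add: power_divide power_mult_distrib)
 qed
qed

lemma sum_weights:
 assumes j: "j \<in> {1..b}"
 shows "(\<Sum>i\<in>ext j. (if i \<in> blk j then 1 / real l else (nw j)\<^sup>2 / real l)) = 1 + nw j"
proof -
 have "(\<Sum>i\<in>nl j \<union> nr j. if i \<in> blk j then 1 / real l else (nw j)\<^sup>2 / real l) = (\<Sum>i\<in>nl j \<union> nr j. (nw j)^2 / real l)"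
  using nbr_disjoint[of j] j by (intro sum.cong refl) auto
 also have "... = real (nu_count j) * (nw j)^2" using l unfolding sum_constant card_nbr[OF j] by simp
 also have "... = nw j" using nw_bounds(3)[OF j] by (simp add: power2_eq_square mult.commute mult.left_commute)
 finally show ?thesis unfolding sum_ext[OF j] using l by (simp add: card_blk[OF j])
qed

lemma tw_close:
 assumes j: "j \<in> {1..b}" and int: "nu_count j = 2 * c0"
 shows "abs (fc * tw j - bmean j) <= osc c0 j"
proof -
 have s: "0 <= sg i" if "i \<in> ext j" for i using sg[of i] s0 that ext_subset[OF j] by force
 let ?a = "tw j - bmean j * sqrt (1 + nw j)"
 have "abs ?a <= osc c0 j * sqrt (1 + nw j)" unfolding tw_def sum_ww[OF j] sum_weights[OF j, symmetric]
 proof (rule weighted_l2_close)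
  fix i assume i: "i \<in> ext j"
  show "0 <= sg i" by (rule s[OF i])
  show "abs (sg i - bmean j) <= osc c0 j" by (rule bmean_close[OF j subsetD[OF ext_range[OF j] i]])
 qed (use bmean_bounds[OF j] osc_nonneg in auto)
 hence "fc * abs ?a <= fc * (osc c0 j * sqrt (1 + nw j))" using fc_bounds by (intro mult_left_mono)
 moreover have f: "fc * sqrt (1 + nw j) = 1"
 proof -
  have "2 * real c0 / (1 + 2 * real c0) * (1 + nw j) = 1"
  proof -
   have "1 + nw j = (1 + 2 * real c0) / (2 * real c0)" unfolding nw_def int using c0_pos by (simp add: field_simps)
   moreover have "2 * real c0 > 0" using c0_pos by simp
   moreover have "x / y * (y / x) = 1" if "0 < x" "0 < y" for x y :: real using that by simp
   from this[of "2 * real c0" "1 + 2 * real c0"] have "2 * real c0 / (1 + 2 * real c0) * ((1 + 2 * real c0) / (2 * real c0)) = 1" using c0_pos by simp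
   ultimately show ?thesis by (simp only:)
  qed
  thus ?thesis unfolding fc_def real_sqrt_mult[symmetric] by (simp only: real_sqrt_one)
 qed
 moreover have "fc * abs ?a = abs (fc * tw j - bmean j)"
 proof -
  have "fc * ?a = fc * tw j - bmean j * (fc * sqrt (1 + nw j))" by (simp add: algebra_simps)
  thus ?thesis unfolding f using fc_bounds(1) by (metis abs_mult abs_of_nonneg mult_1_right)
 qed
 moreover have "fc * (osc c0 j * sqrt (1 + nw j)) = osc c0 j * (fc * sqrt (1 + nw j))" by simp
 ultimately show ?thesis by simp
qed

lemma tw_le: "j \<in> {1..b} ==> 0 <= tw j" "j \<in> {1..b} ==> tw j <= 2 * A"
proof -
 assume j: "j \<in> {1..b}"
 show "0 <= tw j" unfolding tw_def by (intro real_sqrt_ge_zero sum_nonneg) auto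
 have "(\<Sum>i\<in>ext j. (ww j i)^2) <= (\<Sum>i\<in>ext j. (if i \<in> blk j then 1 / real l else (nw j)\<^sup>2 / real l) * A^2)"
  unfolding sum_ww[OF j]
 proof (intro sum_mono mult_left_mono power_mono)
  fix i assume "i \<in> ext j"
  hence "i \<in> {1..n}" using ext_subset[OF j] by blast
  thus "sg i <= A" "0 <= sg i" using sg[of i] s0 by auto
 qed auto
 also have "... = (1 + nw j) * A^2" unfolding sum_distrib_right[symmetric] sum_weights[OF j] ..
 also have "... <= 4 * A^2" using nw_bounds[OF j] by (intro mult_right_mono) auto
 finally have "(\<Sum>i\<in>ext j. (ww j i)^2) <= (2 * A)^2" by (simp add: power_mult_distrib)
 thus "tw j <= 2 * A" unfolding tw_def using A_pos by (intro real_le_lsqrt) auto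
qed

text \<open>With 2 c0 neighbours the error is the local oscillation of the scale. The at most 2 c0
  boundary blocks, for which \<open>fc\<close> is the wrong factor, are bounded by 3 A each.\<close>

lemma avg_tw_close: "abs (fc * (1 / real b * (\<Sum>j=1..b. tw j)) - sbar) <= ((2 * real c0 + 1) * B + 6 * real c0 * A) / b"
proof -
 have t: "abs (fc * tw j - bmean j) <= osc c0 j + (if j \<in> {1..c0} \<union> {b + 1 - c0..b} then 3 * A else 0)" if j: "j \<in> {1..b}" for j
 proof (cases "j \<in> {1..c0} \<union> {b + 1 - c0..b}")
  case True
  have "fc * tw j <= 1 * (2 * A)" using fc_bounds tw_le[OF j] by (intro mult_mono) auto
  moreover have "0 <= fc * tw j" using fc_bounds tw_le[OF j] by simp
  ultimately have "abs (fc * tw j - bmean j) <= 3 * A" using bmean_bounds[OF j] A_pos by (auto simp: abs_le_iff)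
  thus ?thesis using True osc_nonneg[of c0 j] by simp
 next
  case False
  hence "nu_count j = 2 * c0" using j by (auto simp: nu_count_def)
  thus ?thesis using tw_close[OF j] unfolding if_not_P[OF False] by simp
 qed
 let ?a = "\<Sum>j=1..b. osc c0 j + (if j \<in> {1..c0} \<union> {b + 1 - c0..b} then 3 * A else 0)"
 have "abs (fc * (1 / real b * (\<Sum>j=1..b. tw j)) - sbar) = 1 / real b * abs (\<Sum>j=1..b. fc * tw j - bmean j)"
 proof -
  have "fc * (1 / real b * (\<Sum>j=1..b. tw j)) - sbar = 1 / real b * (\<Sum>j=1..b. fc * tw j - bmean j)"
   unfolding avg_bmean[symmetric] sum_subtractf sum_distrib_left[symmetric] by (simp add: right_diff_distrib)
  thus ?thesis by (simp add: abs_mult)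
 qed
 also have "... <= 1 / real b * ?a" by (intro mult_left_mono order_trans[OF sum_abs] sum_mono t) auto
 also have "... <= 1 / real b * ((2 * real c0 + 1) * B + 6 * real c0 * A)"
 proof (intro mult_left_mono)
  let ?b = "\<Sum>j=1..b. if j \<in> {1..c0} \<union> {b + 1 - c0..b} then 3 * A else 0"
  have "?b <= (\<Sum>j\<in>{1..c0} \<union> {b + 1 - c0..b}. 3 * A)"
   using A_pos by (subst sum.inter_restrict[symmetric], simp, intro sum_mono2) auto
  also have "... <= real (c0 + c0) * (3 * A)"
  proof -
   have "card ({1..c0} \<union> {b + 1 - c0..b}) <= card {1..c0} + card {b + 1 - c0..b}" by (rule card_Un_le)
   also have "... <= c0 + c0" using c0_less by auto
   finally have "real (card ({1..c0} \<union> {b + 1 - c0..b})) <= real (c0 + c0)" by (simp only: of_nat_le_iff)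
   thus ?thesis unfolding sum_constant using A_pos by (intro mult_right_mono) simp_all
  qed
  finally have x: "?b <= real (c0 + c0) * (3 * A)" .
  show "?a <= (2 * real c0 + 1) * B + 6 * real c0 * A"
   unfolding sum.distrib by (rule order_trans[OF add_mono[OF sum_osc x]]) (simp add: algebra_simps)
 qed simp
 finally show ?thesis by simp
qed

end

text \<open>Only upper bounds on covariances are needed for a variance. For near pairs the mixed
  second moment is enough, since the variables are nonnegative; far pairs cost \<open>a\<close>, and
  each index has at most 2 r + 1 near partners.\<close>

lemma (in prob_space) average_deviation:
 fixes V :: "nat => 'a => real"
 assumes b: "1 <= b" and V: "!!j. j \<in> {1..b} ==> V j \<in> borel_measurable M" "!!j x. j \<in> {1..b} ==> 0 <= V j x" "!!j x. j \<in> {1..b} ==> V j x <= T"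
  and w: "!!j. j \<in> {1..b} ==> (LINT x|M. (V j x)^2) <= w"
  and far: "!!j k. j \<in> {1..b} ==> k \<in> {1..b} ==> j + r < k ==> (LINT x|M. V j x * V k x) - expectation (V j) * expectation (V k) <= a"
  and a: "0 <= a"
 shows "(LINT x|M. abs (1 / real b * (\<Sum>j=1..b. V j x - expectation (V j)))) <= sqrt (real (2 * r + 1) * w / b + a)"
proof -
 note V(1)[measurable]
 have bnd: "abs (V j x) <= T" if "j \<in> {1..b}" for j x using V(2)[OF that, of x] V(3)[OF that, of x] by simp
 have iV: "integrable M (V j)" if j: "j \<in> {1..b}" for j
  by (rule integrable_bounded[of _ T]) (use V(1)[OF j] bnd[OF j] in auto)
 have iVV: "integrable M (%x. V j x * V k x)" if j: "j \<in> {1..b}" and k: "k \<in> {1..b}" for j k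
  by (rule integrable_bounded[of _ "T * T"]) (use V(1)[OF j] V(1)[OF k] abs_mult_le[OF bnd[OF j] bnd[OF k]] in auto)
 have w0: "0 <= w" by (rule order_trans[OF _ w[of 1]]) (use b in auto)
 define cv where "cv j k = (LINT x|M. V j x * V k x) - expectation (V j) * expectation (V k)" for j k
 have cv_sym: "cv j k = cv k j" for j k unfolding cv_def by (simp add: mult.commute)
 have near: "cv j k <= w" if j: "j \<in> {1..b}" and k: "k \<in> {1..b}" for j k
 proof -
  have "(LINT x|M. V j x * V k x) <= (LINT x|M. ((V j x)^2 + (V k x)^2) / 2)"
  proof (rule integral_mono[OF iVV[OF j k]])
   show "integrable M (%x. ((V j x)^2 + (V k x)^2) / 2)" using iVV[OF j j] iVV[OF k k] by (simp add: power2_eq_square)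
   show "V j x * V k x <= ((V j x)^2 + (V k x)^2) / 2" for x using sum_squares_bound[of "V j x" "V k x"] by simp
  qed
  also have "... <= w" using w[OF j] w[OF k] iVV[OF j j] iVV[OF k k] by (simp add: power2_eq_square)
  finally have "(LINT x|M. V j x * V k x) <= w" .
  moreover have "0 <= expectation (V j) * expectation (V k)"
   using V(2)[OF j] V(2)[OF k] by (intro mult_nonneg_nonneg integral_nonneg) auto
  ultimately show ?thesis unfolding cv_def by linarith
 qed
 have cv: "cv j k <= (if k \<in> {j - r..j + r} then w else 0) + a" if j: "j \<in> {1..b}" and k: "k \<in> {1..b}" for j k
 proof -
  consider "k \<in> {j - r..j + r}" | "k \<notin> {j - r..j + r}" "j + r < k" | "k \<notin> {j - r..j + r}" "k + r < j" by fastforce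
  thus ?thesis
  proof cases
   case 1 thus ?thesis using near[OF j k] a by simp
  next
   case 2 thus ?thesis using far[OF j k] unfolding cv_def by simp
  next
   case 3 thus ?thesis using far[OF k j] unfolding cv_sym[of j k] by (simp add: cv_def)
  qed
 qed
 define Z where "Z x = (\<Sum>j=1..b. V j x - expectation (V j))" for x
 have sq: "(Z x)^2 = (\<Sum>j=1..b. \<Sum>k=1..b. (V j x - expectation (V j)) * (V k x - expectation (V k)))" for x
  unfolding Z_def power2_eq_square sum_product ..
 have ip: "integrable M (%x. (V j x - expectation (V j)) * (V k x - expectation (V k)))"
  and ep: "(LINT x|M. (V j x - expectation (V j)) * (V k x - expectation (V k))) = cv j k" if j: "j \<in> {1..b}" and k: "k \<in> {1..b}" for j k
 proof -
  have e: "(V j x - expectation (V j)) * (V k x - expectation (V k)) = V j x * V k x - expectation (V k) * V j x - expectation (V j) * V k x + expectation (V j) * expectation (V k)" for x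
   by (simp add: algebra_simps)
  show "integrable M (%x. (V j x - expectation (V j)) * (V k x - expectation (V k)))"
   unfolding e using iV[OF j] iV[OF k] iVV[OF j k] by simp
  show "(LINT x|M. (V j x - expectation (V j)) * (V k x - expectation (V k))) = cv j k"
   unfolding e cv_def using iV[OF j] iV[OF k] iVV[OF j k] by (simp add: prob_space algebra_simps)
 qed
 have iZ: "integrable M Z" unfolding Z_def[abs_def] using iV by (intro int_sum int_diff) auto
 have iZ2: "integrable M (%x. (Z x)^2)" unfolding sq by (intro int_sum ip)
 let ?a = "real (2 * r + 1) * w + real b * a"
 have "(LINT x|M. (Z x)^2) = (\<Sum>j=1..b. \<Sum>k=1..b. cv j k)"
  unfolding sq by (subst integral_double_sum) (auto simp: ip ep)
 also have "... <= (\<Sum>j=1..b. \<Sum>k=1..b. (if k \<in> {j - r..j + r} then w else 0) + a)"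
  by (intro sum_mono cv)
 also have "... <= (\<Sum>j=1..b. real (2 * r + 1) * w + real b * a)"
 proof (intro sum_mono)
  fix j
  have "(\<Sum>k=1..b. if k \<in> {j - r..j + r} then w else 0) = (\<Sum>k\<in>{1..b} \<inter> {j - r..j + r}. w)" by (rule sum.inter_restrict[symmetric]) simp
  also have "... = real (card ({1..b} \<inter> {j - r..j + r})) * w" by simp
  also have "... <= real (2 * r + 1) * w"
  proof (intro mult_right_mono w0)
   have "card ({1..b} \<inter> {j - r..j + r}) <= card {j - r..j + r}" by (intro card_mono) auto
   also have "... <= 2 * r + 1" by simp
   finally show "real (card ({1..b} \<inter> {j - r..j + r})) <= real (2 * r + 1)" by (simp only: of_nat_le_iff)
  qed
  finally show "(\<Sum>k=1..b. (if k \<in> {j - r..j + r} then w else 0) + a) <= real (2 * r + 1) * w + real b * a"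
   unfolding sum.distrib by simp
 qed
 also have "... = real b * ?a" by simp
 finally have E: "(LINT x|M. (Z x)^2) <= real b * ?a" .
 show ?thesis unfolding Z_def[symmetric]
 proof (rule expectation_abs_le_sqrt)
  show "integrable M (%x. 1 / real b * Z x)" "integrable M (%x. (1 / real b * Z x)^2)"
   unfolding power_mult_distrib using iZ iZ2 by simp_all
  have "(LINT x|M. (1 / real b * Z x)^2) = (1 / real b)^2 * (LINT x|M. (Z x)^2)"
   unfolding power_mult_distrib by simp
  also have "... <= (1 / real b)^2 * (real b * ?a)" by (intro mult_left_mono E) simp
  also have "... = real (2 * r + 1) * w / b + a" using b by (simp add: power2_eq_square distrib_left add_divide_distrib)
  finally show "(LINT x|M. (1 / real b * Z x)^2) <= real (2 * r + 1) * w / b + a" .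
 qed
qed

context kappa_sample
begin

definition wconst :: real where "wconst = 2 * (\<Sum>k. abs (c k)) * ((2 * real c0 + 1) * A^2)"

lemma W_measurable [measurable]: "W j \<in> borel_measurable M" unfolding W_def by measurable

lemma ext_pos: "j \<in> {1..b} ==> ext j \<subseteq> {1..}" using ext_subset[of j] by auto

lemma W_integrable: "j \<in> {1..b} ==> integrable M (W j)" "j \<in> {1..b} ==> integrable M (%x. (W j x)^2)"
 unfolding W_def using ext_pos[of j] by (auto intro!: integrable_S integrable_S_sq)

lemma W_second:
 assumes j: "j \<in> {1..b}"
 shows "(LINT x|M. (W j x)^2) <= wconst"
proof -
 let ?a = "\<Sum>i\<in>ext j. (ww j i)^2"
 have "(LINT x|M. (W j x)^2) <= 2 * (\<Sum>k. abs (c k)) * ?a"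
  unfolding W_def by (rule S_variance_le[OF finite_ext ext_pos[OF j]])
 also have "... <= wconst" unfolding wconst_def
 proof (rule mult_left_mono)
  have "(ww j i)^2 <= A^2 / l" for i using power_mono[OF ww_le[OF j], of i 2] l by (simp add: power_divide)
  hence "?a <= (\<Sum>i\<in>ext j. A^2 / l)" by (intro sum_mono)
  also have "... = real (card (ext j)) * (A^2 / l)" by simp
  also have "... <= (2 * real c0 + 1) * real l * (A^2 / l)" by (intro mult_right_mono card_ext j) auto
  also have "... = (2 * real c0 + 1) * A^2" using l by simp
  finally show "?a <= (2 * real c0 + 1) * A^2" .
 qed (use suminf_nonneg[OF summable_abs_c] in auto)
 finally show ?thesis .
qed

lemma W_mean:
 assumes j: "j \<in> {1..b}"
 shows "abs ((LINT x|M. abs (W j x)) - kap * tw j * sqrt (2 / pi)) <= eps"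
proof -
 have sv: "sqrt (var (ww j) (ext j)) = kap * tw j" by (simp add: var_def kap_def tw_def real_sqrt_mult)
 have "s0^2 <= tau2 j" by (rule tau2_bounds[OF j])
 also have "tau2 j = (\<Sum>i\<in>blk j. (ww j i)^2)" unfolding tau2_def using ww_blk[OF j] by (intro sum.cong) auto
 also have "... <= (\<Sum>i\<in>ext j. (ww j i)^2)" by (intro sum_mono2) (auto simp: ext_def)
 finally have "kappa2 * s0^2 <= var (ww j) (ext j)" unfolding var_def using kappa2_pos by (intro mult_left_mono) auto
 hence "abs ((LINT x|M. abs (S (ww j) (ext j) x - 0)) - (LINT z|gauss. abs (sqrt (var (ww j) (ext j)) * z - 0))) <= eps"
  unfolding eps_def by (rule E(2)[OF admissible_ww[OF j]])
 moreover have "(LINT z|gauss. abs (kap * tw j * z)) = kap * tw j * sqrt (2 / pi)"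
  using std_normal_moments(4) kap_pos tw_le[OF j] by (simp add: abs_mult)
 ultimately show ?thesis unfolding sv W_def by simp
qed

text \<open>Each contrast reaches \<open>c0\<close> blocks to either side; two further blocks of
  distance leave one full block between the supports.\<close>

lemma ext_separated:
 assumes j: "j \<in> {1..b}" and k: "k \<in> {1..b}" and jk: "j + (2 * c0 + 1) < k"
 shows "separated l (ext j) (ext k)" unfolding separated_def
proof (intro conjI ballI ext_pos j k l)
 fix x y assume "x \<in> ext j" "y \<in> ext k"
 hence "x <= min (j + c0) b * l" "(k - 1 - c0) * l + 1 <= y"
  using ext_range[OF j] ext_range[OF k] by (meson atLeastAtMost_iff subsetD)+
 moreover have "min (j + c0) b * l <= (j + c0) * l" by (intro mult_right_mono) auto
 moreover have "(j + c0 + 1) * l <= (k - 1 - c0) * l" using jk by (intro mult_right_mono) auto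
 ultimately show "x + l <= y" by (simp add: add_mult_distrib)
qed

text \<open>Mixing controls covariances of bounded variables, so |W| is capped at \<open>T\<close>;
  the part above the cap is at most W^2 / T. The level \<open>T\<close> stays free until it can be
  matched with the number of blocks of the other grid.\<close>

lemma W_average:
 assumes T: "0 < T"
 shows "integrable M (%y. abs (1 / real b * (\<Sum>j=1..b. (abs (W j y)) - (LINT y|M. abs (W j y)))))"
  "(LINT y|M. abs (1 / real b * (\<Sum>j=1..b. (abs (W j y)) - (LINT y|M. abs (W j y)))))
   <= sqrt (real (4 * c0 + 3) * wconst / b + 4 * (C * real l powr (- (lam * p))) * T^2) + 2 * wconst / T"
proof -
 define V where "V j y = min (abs (W j y)) T" for j y
 let ?p = "%y. 1 / real b * (\<Sum>j=1..b. (abs (W j y)) - (LINT y|M. abs (W j y)))"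
  and ?q = "%y. 1 / real b * (\<Sum>j=1..b. V j y - expectation (V j))"
 have Vm [measurable]: "V j \<in> borel_measurable M" for j unfolding V_def by measurable
 have V: "0 <= V j y" "V j y <= T" "abs (V j y) <= T" for j y unfolding V_def using T by auto
 have iV: "integrable M (V j)" for j by (rule integrable_bounded[of _ T]) (use V in auto)
 have iW: "integrable M (%y. abs (W j y))" if "j \<in> {1..b}" for j using W_integrable[OF that] by simp
 show i: "integrable M (%y. abs (?p y))"
  by (intro integrable_abs integrable_mult_right int_sum int_diff iW integrable_const)
 let ?b = "C * real l powr (- (lam * p))"
 let ?c = "LINT y|M. abs (?q y)"
 have dev: "?c <= sqrt (real (2 * (2 * c0 + 1) + 1) * wconst / b + 4 * ?b * T * T)"
 proof (rule average_deviation[where T = T])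
  show "1 <= b" using b by simp
  fix j assume j: "j \<in> {1..b}"
  have "(LINT y|M. (V j y)^2) <= (LINT y|M. (W j y)^2)"
  proof (rule integral_mono[OF _ W_integrable(2)[OF j]])
   have "abs ((V j y)^2) <= T^2" for y using power_mono[OF V(2)[of j y] V(1), of 2] by simp
   thus "integrable M (%y. (V j y)^2)" by (intro integrable_bounded[of _ "T^2"]) auto
   show "(V j y)^2 <= (W j y)^2" for y
    using power_mono[of "V j y" "abs (W j y)" 2] V(1)[of j y] by (simp add: V_def)
  qed
  thus "(LINT y|M. (V j y)^2) <= wconst" using W_second[OF j] by linarith
  fix k assume k: "k \<in> {1..b}" and jk: "j + (2 * c0 + 1) < k"
  have g: "V i \<in> borel_measurable (G (ext i))" for i
  proof -
   have "W i \<in> borel_measurable (G (ext i))" unfolding W_def by (rule S_gen_measurable) simp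
   thus ?thesis unfolding V_def[abs_def] by measurable
  qed
  have "abs ((LINT x|M. V j x * V k x) - expectation (V j) * expectation (V k)) <= 4 * ?b * T * T"
   by (rule covariance_real[OF ext_separated[OF j k jk] g g T V(3) T V(3)])
  thus "(LINT x|M. V j x * V k x) - expectation (V j) * expectation (V k) <= 4 * ?b * T * T" by linarith
 qed (use V C T in auto)
 define R where "R j y = abs (W j y) - V j y" for j y
 let ?r = "%y. 1 / real b * (\<Sum>j=1..b. R j y + expectation (R j))"
  and ?s = "%y. 1 / real b * (\<Sum>j=1..b. R j y - expectation (R j))"
 have iR: "integrable M (R j)" if "j \<in> {1..b}" for j unfolding R_def[abs_def] using iW[OF that] iV by simp
 have R0: "0 <= R j y" for j y by (simp add: R_def V_def)
 have ER: "expectation (R j) <= wconst / T" if j: "j \<in> {1..b}" for j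
 proof -
  have "expectation (R j) <= (LINT y|M. (W j y)^2 / T)"
  proof (rule integral_mono[OF iR[OF j]])
   show "integrable M (%y. (W j y)^2 / T)" using W_integrable[OF j] by simp
   show "R j y <= (W j y)^2 / T" for y
   proof (cases "abs (W j y) <= T")
    case True thus ?thesis using T by (simp add: R_def V_def)
   next
    case False
    hence "T * abs (W j y) <= abs (W j y) * abs (W j y)" by (intro mult_right_mono) auto
    thus ?thesis using T False by (simp add: R_def V_def field_simps power2_eq_square add_nonneg_nonneg add_increasing)
   qed
  qed
  also have "... <= wconst / T" using W_second[OF j] T by (simp add: divide_right_mono)
  finally show ?thesis .
 qed
 have EV: "(LINT y|M. abs (W j y)) = expectation (V j) + expectation (R j)" if j: "j \<in> {1..b}" for j
  using iR[OF j] iV[of j] unfolding R_def[abs_def] using iW[OF j] by simp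
 have pw: "abs (?p y) <= abs (?q y) + ?r y" for y
 proof -
  have "(\<Sum>j=1..b. (abs (W j y)) - (LINT y|M. abs (W j y))) = (\<Sum>j=1..b. V j y - expectation (V j)) + (\<Sum>j=1..b. R j y - expectation (R j))"
   unfolding sum.distrib[symmetric] by (intro sum.cong refl) (simp only: EV, simp add: R_def)
  hence "?p y = ?q y + ?s y" by (simp only: distrib_left)
  moreover have "abs (?s y) <= ?r y"
  proof -
   have "abs (R j y - expectation (R j)) <= R j y + expectation (R j)" for j
    using R0[of j y] Bochner_Integration.integral_nonneg[of M "R j", OF R0] by (auto simp: abs_le_iff)
   hence "abs (\<Sum>j=1..b. R j y - expectation (R j)) <= (\<Sum>j=1..b. R j y + expectation (R j))"
    by (intro order_trans[OF sum_abs sum_mono])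
   thus ?thesis by (simp add: abs_mult divide_right_mono)
  qed
  ultimately show ?thesis using abs_triangle_ineq[of "?q y" "?s y"] by linarith
 qed
 have i1: "integrable M (%y. abs (?q y))"
  by (intro integrable_abs integrable_mult_right int_sum int_diff iV integrable_const)
 have i2: "integrable M (%y. ?r y)" by (intro integrable_mult_right int_sum int_add iR integrable_const)
 let ?a = "LINT y|M. abs (?p y)"
 let ?d = "LINT y|M. ?r y"
 have "?a <= (LINT y|M. abs (?q y) + ?r y)" by (rule integral_mono[OF i int_add[OF i1 i2] pw])
 also have "... = ?c + ?d" by (rule Bochner_Integration.integral_add[OF i1 i2])
 also have "?d = 1 / real b * (\<Sum>j=1..b. 2 * expectation (R j))"
 proof -
  have "(LINT y|M. (\<Sum>j=1..b. R j y + expectation (R j))) = (\<Sum>j=1..b. (LINT y|M. R j y + expectation (R j)))"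
   using iR by (intro LINT_sum int_add integrable_const)
  also have "... = (\<Sum>j=1..b. 2 * expectation (R j))"
   using iR by (intro sum.cong refl) (simp add: prob_space)
  finally show ?thesis by simp
 qed
 also have "... <= 2 * (wconst / T)" by (intro average_le mult_left_mono ER) auto
 finally have fin: "?a <= ?c + 2 * (wconst / T)" by simp
 show "?a <= sqrt (real (4 * c0 + 3) * wconst / b + 4 * ?b * T^2) + 2 * wconst / T"
 proof -
  have "real (2 * (2 * c0 + 1) + 1) = real (4 * c0 + 3)" by simp
  hence "sqrt (real (2 * (2 * c0 + 1) + 1) * wconst / b + 4 * ?b * T * T)
   = sqrt (real (4 * c0 + 3) * wconst / b + 4 * ?b * T^2)" by (simp only: power2_eq_square mult.assoc)
  thus ?thesis using dev fin by argo
 qed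
qed

definition kr :: "'a => real" where "kr x = kappa_raw n c0 b l (obs x)"

lemma kr_measurable [measurable]: "kr \<in> borel_measurable M"
 unfolding kr_def[abs_def] kappa_raw_def by measurable

text \<open>The sources of error are the spike \<open>a1\<close>, the fluctuation \<open>Z\<close>,
  the first absolute moments \<open>a2\<close> and the average of the scale \<open>a3\<close>. The
  target contains the mean scale \<open>sbar\<close>, which the denominator of
  \<open>kappa_hat\<close> is there to remove.\<close>

lemma kr_L1:
 assumes T: "0 < T"
 shows "integrable M (%y. abs (kr y - kap * sbar))"
  "(LINT y|M. abs (kr y - kap * sbar)) <= 2 * (2 * abs e / sqrt l + eps
   + (sqrt (real (4 * c0 + 3) * wconst / b + 4 * (C * real l powr (- (lam * p))) * T^2) + 2 * wconst / T))
   + kap * (((2 * real c0 + 1) * B + 6 * real c0 * A) / b)"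
proof -
 define t where "t j y = 1 / sqrt l * abs ((\<Sum>i\<in>block l j. obs y i) - neighbour_weight n c0 l j * ((\<Sum>i\<in>left_blocks c0 l j. obs y i) + (\<Sum>i\<in>right_blocks c0 l j. obs y i)))" for j y
 define Z where "Z y = 1 / real b * (\<Sum>j=1..b. (abs (W j y)) - (LINT y|M. abs (W j y)))" for y
 define a1 where "a1 y = 1 / real b * (\<Sum>j=1..b. t j y - abs (W j y))" for y
 define a2 where "a2 = 1 / real b * (\<Sum>j=1..b. (LINT y|M. abs (W j y)) - kap * tw j * sqrt (2 / pi))"
 define a3 where "a3 = fc * (1 / real b * (\<Sum>j=1..b. tw j)) - sbar"
 define f where "f = fc * sqrt (pi / 2)"
 have f: "0 <= f" "f <= 2"
 proof -
  have "sqrt (pi / 2) <= sqrt (2^2)" using pi_less_4 by (intro real_sqrt_le_mono) simp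
  hence "fc * sqrt (pi / 2) <= 1 * 2" using fc_bounds by (intro mult_mono) auto
  thus "f <= 2" unfolding f_def by simp
  show "0 <= f" unfolding f_def using fc_bounds by simp
 qed
 have fs: "f * (kap * x * sqrt (2 / pi)) = kap * (fc * x)" for x
 proof -
  have "sqrt (pi / 2) * sqrt (2 / pi) = 1" unfolding real_sqrt_mult[symmetric] by simp
  thus ?thesis unfolding f_def by (metis mult.assoc mult.commute mult_1)
 qed
 have dec: "kr y - kap * sbar = f * (a1 y + Z y + a2) + kap * a3" for y
 proof -
  have "kr y = f * (1 / real b * (\<Sum>j=1..b. t j y))"
   unfolding kr_def kappa_raw_def t_def f_def fc_def by (simp add: mult_ac)
  also have "1 / real b * (\<Sum>j=1..b. t j y) = a1 y + Z y + a2 + 1 / real b * (\<Sum>j=1..b. kap * tw j * sqrt (2 / pi))"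
   unfolding a1_def Z_def a2_def distrib_left[symmetric] sum.distrib[symmetric] by simp
  also have "f * ... = f * (a1 y + Z y + a2) + 1 / real b * (\<Sum>j=1..b. f * (kap * tw j * sqrt (2 / pi)))"
   by (simp add: distrib_left sum_distrib_left)
  also have "1 / real b * (\<Sum>j=1..b. f * (kap * tw j * sqrt (2 / pi))) = kap * (fc * (1 / real b * (\<Sum>j=1..b. tw j)))"
   unfolding fs sum_distrib_left[symmetric] by simp
  finally show ?thesis unfolding a3_def by (simp add: right_diff_distrib)
 qed
 have a1: "abs (a1 y) <= 2 * abs e / sqrt l" for y unfolding a1_def t_def by (intro average_abs_le kappa_term)
 have a2: "abs a2 <= eps" unfolding a2_def by (intro average_abs_le W_mean)
 let ?a = "((2 * real c0 + 1) * B + 6 * real c0 * A) / b"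
 have pw: "abs (kr y - kap * sbar) <= 2 * (2 * abs e / sqrt l + abs (Z y) + eps) + kap * ?a" for y
 proof -
  have "abs (a1 y + Z y + a2) <= 2 * abs e / sqrt l + abs (Z y) + eps" using a1[of y] a2 by linarith
  hence "abs (f * (a1 y + Z y + a2)) <= 2 * (2 * abs e / sqrt l + abs (Z y) + eps)"
   unfolding abs_mult using f by (intro mult_mono) auto
  moreover have "abs (kap * a3) <= kap * ?a"
   unfolding abs_mult a3_def using kap_pos avg_tw_close by (intro mult_mono) auto
  ultimately show ?thesis unfolding dec by linarith
 qed
 have iZ: "integrable M (%y. abs (Z y))" unfolding Z_def by (rule W_average(1)[OF T])
 let ?b = "real (4 * c0 + 3) * wconst / b + 4 * (C * real l powr (- (lam * p))) * T^2"
 have EZ: "(LINT y|M. abs (Z y)) <= sqrt ?b + 2 * wconst / T" unfolding Z_def by (rule W_average(2)[OF T])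
 have iB: "integrable M (%y. 2 * (2 * abs e / sqrt l + abs (Z y) + eps) + kap * ?a)" using iZ by simp
 show i: "integrable M (%y. abs (kr y - kap * sbar))"
  by (rule int_bound[OF iB]) (simp, simp only: real_norm_def abs_abs, intro AE_I2 order_trans[OF pw abs_ge_self])
 have "(LINT y|M. abs (kr y - kap * sbar)) <= (LINT y|M. 2 * (2 * abs e / sqrt l + abs (Z y) + eps) + kap * ?a)"
  by (rule integral_mono[OF i iB pw])
 also have "... = 2 * (2 * abs e / sqrt l + (LINT y|M. abs (Z y)) + eps) + kap * ?a"
  using iZ by (simp add: prob_space)
 finally show "(LINT y|M. abs (kr y - kap * sbar)) <= 2 * (2 * abs e / sqrt l + eps
   + (sqrt ?b + 2 * wconst / T)) + kap * ?a" using EZ by argo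
qed

end

section \<open>From the studentised statistic to its linear part\<close>

lemma statistic_close:
 fixes sb :: real
 assumes ps: "0 < \<psi>0" "\<psi>0 <= \<psi>" "0 <= \<psi>h" "abs (\<psi>h\<^sup>2 - \<psi>^2) <= \<psi>0\<^sup>2 / 2"
  and k: "0 < ka" "0 < r0" "r0 <= r" "abs (kh - ka * r) <= ka * r0 / 2"
  and sb: "0 <= sb" and R: "abs u <= R" "abs (sb * g / \<psi>) <= R"
 shows "abs (sb * (1 / \<psi>h) * (u * w / kh - a) - sb * g / \<psi>)
  <= 2 / \<psi>0 * (sb * abs (u / ka - a - g) + R * (2 / (ka^2 * r0)) * (ka * (sb * abs (w - r)) + sb * abs (kh - ka * r))) + R * (2 / \<psi>0\<^sup>2) * abs (\<psi>h\<^sup>2 - \<psi>^2)"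
proof -
 have R0: "0 <= R" using R(1) by linarith
 have "ka * r0 <= ka * r" using k by simp
 hence kh: "ka * r0 / 2 <= kh" using k(4) unfolding abs_le_iff by linarith
 have kh0: "0 < ka * r0 / 2" using k by simp
 have khp: "0 < kh" "0 < ka" using kh kh0 k by linarith+
 have "\<psi>0\<^sup>2 <= \<psi>^2" using ps by (intro power_mono) auto
 hence "(\<psi>0 / 2)^2 <= \<psi>h\<^sup>2" using ps(4) zero_le_power2[of \<psi>0] unfolding abs_le_iff power_divide by (simp add: field_simps)
 hence ph: "\<psi>0 / 2 <= \<psi>h" using ps by (auto intro: power2_le_imp_le)
 have ph0: "0 < \<psi>h" "0 < \<psi>" using ph ps by auto
 have ip: "1 / \<psi>h <= 2 / \<psi>0" using ph ps ph0 by (simp add: field_simps)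
 let ?a = "ka * abs (w - r) + abs (kh - ka * r)"
  and ?d = "2 / (ka^2 * r0)"
 \<comment> \<open>The mean scale \<open>r\<close> cancels, as \<open>w\<close> estimates r and
   \<open>kh\<close> estimates ka * r.\<close>
 have w1: "abs (u * w / kh - u / ka) <= R * ?d * ?a"
 proof -
  let ?e = "ka * (w - r) - (kh - ka * r)"
  have "u * w / kh - u / ka = u * (1 / (ka * kh)) * ?e"
  proof -
   have "kh ~= 0" "ka ~= 0" using k kh kh0 by auto
   thus ?thesis by (simp add: field_simps)
  qed
  also have "abs ... = abs u * (1 / (ka * kh)) * abs ?e" using khp by (simp add: abs_mult)
  also have "... <= R * ?d * ?a"
  proof (intro mult_mono R)
   have "1 / (ka * kh) <= 1 / (ka * (ka * r0 / 2))" using kh kh0 khp k by (intro divide_left_mono mult_left_mono mult_pos_pos) auto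
   thus "1 / (ka * kh) <= 2 / (ka^2 * r0)" by (simp add: power2_eq_square mult.assoc)
   show "abs ?e <= ka * abs (w - r) + abs (kh - ka * r)"
    using abs_triangle_ineq4[of "ka * (w - r)" "kh - ka * r"] k(1) by (simp add: abs_mult)
  qed (use khp R0 k in auto)
  finally show ?thesis .
 qed
 let ?b = "u * w / kh - a - g"
  and ?f = "u / ka - a - g"
 have d1: "abs (1 / \<psi>h * (sb * ?b)) <= 2 / \<psi>0 * (sb * abs ?f + R * ?d * (ka * (sb * abs (w - r)) + sb * abs (kh - ka * r)))"
 proof -
  have "abs ?b <= abs ?f + R * ?d * ?a"
  proof -
   have e: "u * w / kh - a - g = ?f + (u * w / kh - u / ka)" by simp
   show ?thesis unfolding e by (rule order_trans[OF abs_triangle_ineq add_left_mono[OF w1]])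
  qed
  hence "sb * abs ?b <= sb * (abs ?f + R * ?d * ?a)" using sb by (rule mult_left_mono)
  from mult_mono[OF ip this] have "1 / \<psi>h * (sb * abs ?b) <= 2 / \<psi>0 * (sb * (abs ?f + R * ?d * ?a))"
   using ps sb by simp
  moreover have "abs (1 / \<psi>h * (sb * ?b)) = 1 / \<psi>h * (sb * abs ?b)"
   using ph0 sb by (simp add: abs_mult)
  moreover have "p1 * (sb * (d + R * p2 * (ka * x + y))) = p1 * (sb * d + R * p2 * (ka * (sb * x) + sb * y))" for p1 p2 d x y
   by (simp add: algebra_simps)
  ultimately show ?thesis by (simp only:)
 qed
 let ?c = "\<psi>h\<^sup>2 - \<psi>^2"
 \<comment> \<open>Roots are compared through their squares, the sum of the roots being at least
   \<open>\<psi>0\<close>.\<close>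
 have d2: "abs (sb * g / \<psi> * ((\<psi> - \<psi>h) / \<psi>h)) <= R * (2 / \<psi>0\<^sup>2) * abs ?c"
 proof -
  have "\<psi>0 * abs (\<psi>h - \<psi>) <= (\<psi>h + \<psi>) * abs (\<psi>h - \<psi>)" using ps by (intro mult_right_mono) auto
  also have "... = abs ?c"
  proof -
   have "\<psi>h\<^sup>2 - \<psi>^2 = (\<psi>h + \<psi>) * (\<psi>h - \<psi>)" by (simp add: power2_eq_square algebra_simps)
   moreover have "abs (\<psi>h + \<psi>) = \<psi>h + \<psi>" using ps by simp
   ultimately show ?thesis by (simp only: abs_mult)
  qed
  finally have "abs (\<psi> - \<psi>h) <= abs ?c / \<psi>0" using ps by (simp add: field_simps abs_minus_commute)
  hence "abs (\<psi> - \<psi>h) * (1 / \<psi>h) <= abs ?c / \<psi>0 * (2 / \<psi>0)" by (rule mult_mono) (use ip ps in auto)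
  hence "abs (sb * g / \<psi>) * (abs (\<psi> - \<psi>h) * (1 / \<psi>h)) <= R * (abs ?c / \<psi>0 * (2 / \<psi>0))"
   by (intro mult_mono[OF R(2)]) (use R0 ph0 in auto)
  moreover have "abs (sb * g / \<psi> * ((\<psi> - \<psi>h) / \<psi>h)) = abs (sb * g / \<psi>) * (abs (\<psi> - \<psi>h) * (1 / \<psi>h))"
   using ph0 by (simp add: abs_mult)
  moreover have "R * (x / \<psi>0 * (2 / \<psi>0)) = R * (2 / \<psi>0\<^sup>2) * x" for x by (simp add: power2_eq_square)
  ultimately show ?thesis by (simp only:)
 qed
 have e: "sb * (1 / \<psi>h) * (u * w / kh - a) - sb * g / \<psi> = 1 / \<psi>h * (sb * ?b) + sb * g / \<psi> * ((\<psi> - \<psi>h) / \<psi>h)"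
 proof -
  define z where "z = u * w / kh - a"
  show ?thesis unfolding z_def[symmetric] using ph0 by (simp add: field_simps)
 qed
 show ?thesis unfolding e by (rule order_trans[OF abs_triangle_ineq add_mono[OF d1 d2]])
qed

text \<open>One sample with two grids: \<open>l\<close>, \<open>b\<close> for the statistic and the
  local variances, \<open>l2\<close>, \<open>b2\<close> for the long run variance. \<open>Q\<close>
  is the second grid, with the same scale, mean and spike.\<close>

locale paired_samples = block_sample M Y C lam p K c \<beta> sg n l b c0 A B s0 E mH e obs +
 Q: kappa_sample M Y C lam p K c \<beta> sg n l2 b2 c0 A B s0 E mH e obs
 for M :: "'a measure" and Y C lam p K c \<beta> sg n l b c0 A B s0 E mH e obs l2 b2
begin

definition stat :: "'a => real" where
 "stat x = sqrt (real b) * (1 / psi_hat b l (obs x)) *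
   (sqrt (real l) / kappa_hat n c0 b l b2 l2 (obs x) * U_stat b l (obs x) -
   1 / (real b * (real b - 1)) * (\<Sum>j=1..b. \<Sum>k\<in>{1..b} - {j}. sqrt (local_variance l (obs x) j + local_variance l (obs x) k) * sqrt (2 / pi)))"

definition psi :: real where "psi = sqrt (4 * qbar / kap^2)"
definition psi0 :: real where "psi0 = sqrt (4 * q0 / kap^2)"
definition gs :: "'a => real" where "gs x = 2 / (kap * (real b - 1)) * L x"
text \<open>The projection with nonrandom studentisation; its Gaussian limit is the limit of
  \<open>stat\<close>.\<close>

definition GL :: "'a => real" where "GL x = sqrt b * gs x / psi"
definition us :: "'a => real" where "us x = sqrt l * U_stat b l (obs x)"
definition ws :: "'a => real" where "ws x = 1 / real b * (\<Sum>j=1..b. sd j x)"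
definition fv :: "'a => real" where "fv x = 4 * f_var b (local_sd l (obs x))"

lemma fv_nonneg: "0 <= fv x"
 unfolding fv_def f_var_alt by (intro mult_nonneg_nonneg sum_nonneg Bochner_Integration.integral_nonneg) auto

lemma qbar_bounds: "q0 <= qbar" "qbar <= 20 * VB^2"
proof -
 have "(\<Sum>j=1..b. q0) <= (\<Sum>j=1..b. qv j)" by (intro sum_mono qv_lower)
 thus "q0 <= qbar" unfolding qbar_def using b by (simp add: field_simps)
 show "qbar <= 20 * VB^2" unfolding qbar_def by (intro average_le qv_bounds)
qed

lemma psi_bounds: "0 < psi0" "psi0 <= psi" "psi^2 = 4 * qbar / kap^2"
proof -
 show "0 < psi0" unfolding psi0_def using q0_pos kap_pos by simp
 show "psi0 <= psi" unfolding psi0_def psi_def using qbar_bounds kap_pos by (simp add: divide_right_mono)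
 show "psi^2 = 4 * qbar / kap^2" unfolding psi_def using qbar_bounds(1) q0_pos by simp
qed

text \<open>The mean local scale \<open>ws\<close> moves from the denominator of
  \<open>kappa_hat\<close> into the numerator.\<close>

lemma stat_alt: "stat x = sqrt b * (1 / sqrt (fv x)) * (us x * ws x / Q.kr x - Ahat x)"
 unfolding stat_def psi_hat_def fv_def kappa_hat_def Q.kr_def us_def ws_def sd_def Ahat_def lv_def
 by (simp add: mult_ac)

lemma ws_measurable [measurable]: "ws \<in> borel_measurable M"
 unfolding ws_def[abs_def] sd_sqrt by measurable

lemma us_measurable [measurable]: "us \<in> borel_measurable M"
 unfolding us_def[abs_def] U_stat_def local_mean_def by measurable

lemma Ahat_measurable [measurable]: "Ahat \<in> borel_measurable M" unfolding Ahat_def[abs_def] by measurable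

lemma gs_measurable [measurable]: "gs \<in> borel_measurable M" unfolding gs_def[abs_def] by measurable

lemma GL_measurable [measurable]: "GL \<in> borel_measurable M" unfolding GL_def[abs_def] by measurable

lemma fv_measurable [measurable]: "fv \<in> borel_measurable M"
proof -
 have sdm [measurable]: "(%x. local_sd l (obs x) j) \<in> borel_measurable M" for j
  using lv_measurable[of j] unfolding local_sd_def lv_def[abs_def] by measurable
 show ?thesis unfolding fv_def[abs_def] f_var_alt by measurable
qed

lemma stat_measurable [measurable]: "stat \<in> borel_measurable M" unfolding stat_alt[abs_def] by measurable

definition e2 :: real where "e2 = sdc / sqrt l / s0 + B / b"
definition e3 :: real where "e3 = 2 * abs e / sqrt l / kap + (6 * eps + 8 * VB / b) / kap + 2 * (sdc / sqrt l) / s0"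
definition e4 :: real where "e4 = 4 * ((204 + 120 * A / s0) * (sdc / sqrt l) + 576 * A^2 / b)"
definition eU :: real where "eU = 2 * abs e + (2 * VB + eps)"

lemma L1_bound:
 fixes f g :: "'a => real"
 assumes m: "f \<in> borel_measurable M" and g: "integrable M g" "expectation g <= r" and fg: "!!x. abs (f x) <= g x"
 shows "integrable M (%x. abs (f x))" "(LINT x|M. abs (f x)) <= r"
proof -
 note m[measurable]
 show i: "integrable M (%x. abs (f x))"
  by (rule int_bound[OF g(1)]) (simp, simp only: real_norm_def abs_abs, intro AE_I2 order_trans[OF fg abs_ge_self])
 show "(LINT x|M. abs (f x)) <= r" using integral_mono[OF i g(1) fg] g(2) by linarith
qed

lemma ws_L1: "integrable M (%x. abs (ws x - sbar))" "(LINT x|M. abs (ws x - sbar)) <= e2"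
proof -
 have "(LINT x|M. Dv x / s0 + B / b) <= e2"
  unfolding e2_def using Dv_L1(1) divide_right_mono[OF Dv_L1(2), of s0] s0 by (simp add: prob_space)
 note * = L1_bound[of "%x. ws x - sbar" "%x. Dv x / s0 + B / b", OF _ _ this]
 show "integrable M (%x. abs (ws x - sbar))" "(LINT x|M. abs (ws x - sbar)) <= e2"
  using * Dv_L1(1) avg_sd_sbar unfolding ws_def[symmetric] by auto
qed

text \<open>Divided by \<open>kap\<close>, the statistic minus its estimated centring is the
  projection up to the spike, the Hoeffding remainder and the error of the centring.\<close>

lemma linear_L1: "integrable M (%x. abs (us x / kap - Ahat x - gs x))" "(LINT x|M. abs (us x / kap - Ahat x - gs x)) <= e3"
proof -
 define Rm where "Rm x = abs (U0 x - a0 - 2 / (real b - 1) * L x)" for x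
 have Rm: "integrable M Rm" "expectation Rm <= 6 * eps + 8 * VB / b"
  unfolding Rm_def[abs_def] L_def using remainder by auto
 have le: "abs (us x / kap - Ahat x - gs x) <= 2 * abs e / sqrt l / kap + Rm x / kap + 2 * Dv x / s0" for x
 proof -
  have e: "us x / kap - Ahat x - gs x = (us x - U0 x) / kap + (U0 x - a0 - 2 / (real b - 1) * L x) / kap - (Ahat x - a0 / kap)"
   unfolding gs_def using kap_pos b by (simp add: field_simps)
  have "abs (us x / kap - Ahat x - gs x) <= abs ((us x - U0 x) / kap) + abs ((U0 x - a0 - 2 / (real b - 1) * L x) / kap) + abs (Ahat x - a0 / kap)"
   unfolding e by (intro order_trans[OF abs_triangle_ineq4] add_right_mono abs_triangle_ineq)
  also have "... <= 2 * abs e / sqrt l / kap + Rm x / kap + 2 * Dv x / s0"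
  proof -
   have "abs (us x - U0 x) / kap <= 2 * abs e / sqrt l / kap"
    unfolding us_def by (rule divide_right_mono[OF U_stat_close less_imp_le[OF kap_pos]])
   hence 1: "abs ((us x - U0 x) / kap) <= 2 * abs e / sqrt l / kap" by (simp only: abs_divide_pos[OF kap_pos])
   have 2: "abs ((U0 x - a0 - 2 / (real b - 1) * L x) / kap) = Rm x / kap"
    unfolding Rm_def by (rule abs_divide_pos[OF kap_pos])
   show ?thesis unfolding 2 by (rule add_mono[OF add_mono[OF 1 order_refl] Ahat_close])
  qed
  finally show ?thesis .
 qed
 have i: "integrable M (%x. 2 * abs e / sqrt l / kap + Rm x / kap + 2 * Dv x / s0)"
  using Rm(1) Dv_L1(1) by simp
 let ?a = "LINT x|M. 2 * abs e / sqrt l / kap + Rm x / kap + 2 * Dv x / s0"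
 have "?a = 2 * abs e / sqrt l / kap + expectation Rm / kap + 2 * expectation Dv / s0"
  using Rm(1) Dv_L1(1) by (simp add: prob_space)
 also have "... <= e3"
  unfolding e3_def using Rm(2) Dv_L1(2) kap_pos s0 by (intro add_mono divide_right_mono mult_left_mono) auto
 finally have E: "?a <= e3" .
 show "integrable M (%x. abs (us x / kap - Ahat x - gs x))" "(LINT x|M. abs (us x / kap - Ahat x - gs x)) <= e3"
  using L1_bound[OF _ i E le] by auto
qed

lemma fv_L1: "integrable M (%x. abs (fv x - psi^2))" "(LINT x|M. abs (fv x - psi^2)) <= e4"
proof -
 let ?a = "204 + 120 * A / s0"
 have le: "abs (fv x - psi^2) <= 4 * (?a * Dv x + 576 * A^2 / b)" for x
 proof -
  have "fv x - psi^2 = 4 * (f_var b (local_sd l (obs x)) - qbar / kap^2)" unfolding fv_def psi_bounds by simp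
  thus ?thesis using f_var_sample[of x] by (simp add: abs_mult)
 qed
 have i: "integrable M (%x. 4 * (?a * Dv x + 576 * A^2 / b))" using Dv_L1(1) by simp
 have "(LINT x|M. 4 * (?a * Dv x + 576 * A^2 / b)) = 4 * (?a * expectation Dv + 576 * A^2 / b)"
  using Dv_L1(1) by (simp add: prob_space)
 also have "... <= e4" unfolding e4_def using Dv_L1(2) A_pos s0 by (intro mult_left_mono add_right_mono) auto
 finally have E: "(LINT x|M. 4 * (?a * Dv x + 576 * A^2 / b)) <= e4" .
 show "integrable M (%x. abs (fv x - psi^2))" "(LINT x|M. abs (fv x - psi^2)) <= e4"
  using L1_bound[OF _ i E le] by auto
qed

lemma us_L1: "integrable M (%x. abs (us x))" "(LINT x|M. abs (us x)) <= eU"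
proof -
 have bb: "real b * (real b - 1) > 0" using b by simp
 have iX: "integrable M (%x. abs (X j x - X k x))" if "j \<in> {1..b}" "k \<in> {1..b}" for j k
  using X_integrable(1)[OF that(1)] X_integrable(1)[OF that(2)] by simp
 have U0nn: "0 <= U0 x" for x unfolding U0_def using bb by (intro mult_nonneg_nonneg sum_nonneg) auto
 have iU: "integrable M U0" unfolding U0_def[abs_def] by (intro integrable_mult_right int_sum iX) auto
 let ?a = "\<Sum>j=1..b. \<Sum>k\<in>{1..b} - {j}. (LINT x|M. abs (X j x - X k x))"
 have "expectation U0 = 1 / (real b * (real b - 1)) * ?a"
 proof -
  have "(LINT x|M. (\<Sum>j=1..b. \<Sum>k\<in>{1..b} - {j}. abs (X j x - X k x))) = (\<Sum>j=1..b. (LINT x|M. (\<Sum>k\<in>{1..b} - {j}. abs (X j x - X k x))))"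
   by (intro LINT_sum int_sum iX) auto
  also have "... = ?a" by (intro sum.cong refl LINT_sum iX) auto
  finally show ?thesis unfolding U0_def[abs_def] by simp
 qed
 also have "... <= 1 / (real b * (real b - 1)) * (\<Sum>j=1..b. \<Sum>k\<in>{1..b} - {j}. 2 * VB + eps)"
 proof (intro mult_left_mono sum_mono)
  fix j k assume j: "j \<in> {1..b}" and "k \<in> {1..b} - {j}"
  hence k: "k \<in> {1..b}" "j ~= k" by auto
  have "hmean (v j) (v k) <= 2 * VB" using hmean_le[of "v j" "v k"] v_bounds(3)[OF j] v_bounds(3)[OF k(1)] by linarith
  thus "(LINT x|M. abs (X j x - X k x)) <= 2 * VB + eps" using X_diff[OF j k] unfolding v_def by linarith
 qed (use bb in auto)
 also have "... = 2 * VB + eps" using b by (simp add: of_nat_diff)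
 finally have EU: "expectation U0 <= 2 * VB + eps" .
 have le: "abs (us x) <= 2 * abs e + U0 x" for x
 proof -
  have "2 * abs e / sqrt l <= 2 * abs e / 1" using sqrt_l by (intro divide_left_mono) auto
  thus ?thesis using U_stat_close[of x] U0nn[of x] unfolding us_def by linarith
 qed
 have i: "integrable M (%x. 2 * abs e + U0 x)" using iU by simp
 have E: "(LINT x|M. 2 * abs e + U0 x) <= eU" unfolding eU_def using iU EU by (simp add: prob_space)
 show "integrable M (%x. abs (us x))" "(LINT x|M. abs (us x)) <= eU" using L1_bound[OF _ i E le] by auto
qed

text \<open>The deterministic comparison applies on the event where the estimators are close to
  their targets and both \<open>us\<close> and \<open>GL\<close> are at most \<open>R\<close>. Off
  that event the exponentials differ by at most 2. \<open>R\<close> stays free because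
  \<open>us\<close> is bounded in mean but does not tend to 0.\<close>

lemma stat_char:
 assumes R: "0 < R" and e1: "(LINT x|M. abs (Q.kr x - kap * sbar)) <= e1" "integrable M (%x. abs (Q.kr x - kap * sbar))"
 shows "cmod ((LINT x|M. iexp (t * stat x)) - (LINT x|M. iexp (t * GL x)))
  <= abs t * (2 / psi0 * (sqrt b * e3 + R * (2 / (kap^2 * s0)) * (kap * (sqrt b * e2) + sqrt b * e1)) + R * (2 / psi0^2) * e4)
   + 2 * (2 / (kap * s0) * e1 + 2 / psi0^2 * e4 + eU / R + prob {x \<in> space M. R < abs (GL x)})"
proof -
 note kap_pos s0 psi_bounds
 define D where "D x = 2 / psi0 * (sqrt b * abs (us x / kap - Ahat x - gs x) + R * (2 / (kap^2 * s0)) * (kap * (sqrt b * abs (ws x - sbar)) + sqrt b * abs (Q.kr x - kap * sbar)))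
  + R * (2 / psi0^2) * abs (fv x - psi^2)" for x
 \<comment> \<open>\<open>P\<close> is at least 1 off the good event: Markov quotients for the first
   three conditions and an indicator for the last.\<close>
 define P where "P x = 2 / (kap * s0) * abs (Q.kr x - kap * sbar) + 2 / psi0^2 * abs (fv x - psi^2) + 1 / R * abs (us x) + of_bool (R < abs (GL x))" for x
 have D0: "0 <= D x" for x
  unfolding D_def using kap_pos s0 psi_bounds R by (intro add_nonneg_nonneg mult_nonneg_nonneg) auto
 have terms: "0 <= 2 / (kap * s0) * abs (Q.kr x - kap * sbar)" "0 <= 2 / psi0^2 * abs (fv x - psi^2)" "0 <= 1 / R * abs (us x)" "0 <= (of_bool (R < abs (GL x)) :: real)" for x
  using kap_pos s0 R by auto
 have P0: "0 <= P x" for x unfolding P_def using terms[of x] by linarith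
 have pw: "cmod (iexp (t * stat x) - iexp (t * GL x)) <= abs t * D x + 2 * P x" for x
 proof (cases "abs (Q.kr x - kap * sbar) <= kap * s0 / 2 \<and> abs (fv x - psi^2) <= psi0^2 / 2 \<and> abs (us x) <= R \<and> abs (GL x) <= R")
  case True
  have sq: "(sqrt (fv x))^2 = fv x" using fv_nonneg by simp
  have "abs (stat x - GL x) <= D x"
   using statistic_close[of psi0 psi "sqrt (fv x)" kap s0 sbar "Q.kr x" "sqrt b" "us x" R "gs x" "ws x" "Ahat x"] True psi_bounds kap_pos s0 sbar_bounds fv_nonneg
   unfolding sq stat_alt GL_def D_def by simp
  hence "abs (t * stat x - t * GL x) <= abs t * D x"
   unfolding right_diff_distrib[symmetric] abs_mult by (intro mult_left_mono) auto
  thus ?thesis using cmod_iexp_diff[of "t * stat x" "t * GL x"] P0[of x] by linarith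
 next
  case False
  have "1 <= P x"
  proof -
   consider "kap * s0 / 2 < abs (Q.kr x - kap * sbar)" | "psi0^2 / 2 < abs (fv x - psi^2)" | "R < abs (us x)" | "R < abs (GL x)"
    using False by linarith
   thus ?thesis
   proof cases
    case 1
    hence "1 <= 2 / (kap * s0) * abs (Q.kr x - kap * sbar)" using kap_pos s0 by (simp add: field_simps)
    thus ?thesis unfolding P_def using terms[of x] by linarith
   next
    case 2
    hence "1 <= 2 / psi0^2 * abs (fv x - psi^2)" using psi_bounds(1) by (simp add: field_simps)
    thus ?thesis unfolding P_def using terms[of x] by linarith
   next
    case 3
    hence "1 <= 1 / R * abs (us x)" using R by (simp add: field_simps)
    thus ?thesis unfolding P_def using terms[of x] by linarith
   next
    case 4
    hence "(of_bool (R < abs (GL x)) :: real) = 1" by simp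
    thus ?thesis unfolding P_def using terms[of x] by linarith
   qed
  qed
  moreover have "cmod (iexp (t * stat x) - iexp (t * GL x)) <= 2"
   using norm_triangle_ineq4[of "iexp (t * stat x)" "iexp (t * GL x)"] by simp
  moreover have "0 <= abs t * D x" using D0 by simp
  ultimately show ?thesis by linarith
 qed
 have iD: "integrable M D" unfolding D_def[abs_def] using linear_L1(1) ws_L1(1) fv_L1(1) e1(2) by simp
 have iB: "integrable M (%x. of_bool (R < abs (GL x)) :: real)" by (intro integrable_bounded[of _ 1]) auto
 have iP: "integrable M P" unfolding P_def[abs_def] using fv_L1(1) e1(2) us_L1(1) iB by simp
 have EB: "(LINT x|M. of_bool (R < abs (GL x)) :: real) = prob {x \<in> space M. R < abs (GL x)}"
 proof -
  have "(LINT x|M. of_bool (R < abs (GL x)) :: real) = expectation (indicator {x \<in> space M. R < abs (GL x)})"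
   by (intro LINT_cong refl) (auto simp: indicator_def)
  also have "... = prob {x \<in> space M. R < abs (GL x)}" by simp
  finally show ?thesis .
 qed
 let ?a = "sqrt b * e3 + R * (2 / (kap^2 * s0)) * (kap * (sqrt b * e2) + sqrt b * e1)"
 have ED: "expectation D <= 2 / psi0 * ?a + R * (2 / psi0^2) * e4"
 proof -
  have "expectation D = 2 / psi0 * (sqrt b * (LINT x|M. abs (us x / kap - Ahat x - gs x)) + R * (2 / (kap^2 * s0)) * (kap * (sqrt b * (LINT x|M. abs (ws x - sbar))) + sqrt b * (LINT x|M. abs (Q.kr x - kap * sbar))))
  + R * (2 / psi0^2) * (LINT x|M. abs (fv x - psi^2))"
   unfolding D_def[abs_def] using linear_L1(1) ws_L1(1) fv_L1(1) e1(2) by simp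
  also have "... <= 2 / psi0 * ?a + R * (2 / psi0^2) * e4"
   using linear_L1(2) ws_L1(2) fv_L1(2) e1(1) kap_pos s0 psi_bounds(1) R
   by (intro add_mono mult_left_mono) auto
  finally show ?thesis .
 qed
 have EP: "expectation P <= 2 / (kap * s0) * e1 + 2 / psi0^2 * e4 + eU / R + prob {x \<in> space M. R < abs (GL x)}"
 proof -
  have "expectation P = 2 / (kap * s0) * (LINT x|M. abs (Q.kr x - kap * sbar)) + 2 / psi0^2 * (LINT x|M. abs (fv x - psi^2)) + 1 / R * (LINT x|M. abs (us x)) + prob {x \<in> space M. R < abs (GL x)}"
   unfolding P_def[abs_def] EB[symmetric] using fv_L1(1) e1(2) us_L1(1) iB by simp
  also have "... <= 2 / (kap * s0) * e1 + 2 / psi0^2 * e4 + 1 / R * eU + prob {x \<in> space M. R < abs (GL x)}"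
   using fv_L1(2) e1(1) us_L1(2) kap_pos s0 R by (intro add_mono mult_left_mono order_refl) auto
  finally show ?thesis by simp
 qed
 have i1: "integrable M (%x. iexp (t * stat x))" "integrable M (%x. iexp (t * GL x))"
  by (intro integrable_bounded[of _ 1]; simp)+
 have "cmod ((LINT x|M. iexp (t * stat x)) - (LINT x|M. iexp (t * GL x))) = cmod ((LINT x|M. iexp (t * stat x) - iexp (t * GL x)))"
  unfolding LINT_diff[OF i1] ..
 also have "... <= (LINT x|M. cmod (iexp (t * stat x) - iexp (t * GL x)))" by (rule integral_norm_bound)
 also have "... <= (LINT x|M. abs t * D x + 2 * P x)"
  by (rule integral_mono[OF integrable_norm[OF int_diff[OF i1]] _ pw]) (use iD iP in simp)
 also have "... = abs t * expectation D + 2 * expectation P" using iD iP by simp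
 also have "... <= abs t * (2 / psi0 * ?a + R * (2 / psi0^2) * e4)
   + 2 * (2 / (kap * s0) * e1 + 2 / psi0^2 * e4 + eU / R + prob {x \<in> space M. R < abs (GL x)})"
  by (intro add_mono mult_left_mono ED EP) auto
 finally show ?thesis .
qed

end

context paired_samples
begin

text \<open>The characteristic function of the projection is evaluated at an argument of order
  b^(-1/2). The factor b / (b - 1) stems from the 2 / (b - 1) in the Hoeffding
  decomposition.\<close>

lemma GL_char:
 fixes t :: real
 assumes T: "6 * VB <= T" and g: "1 <= g" "g <= l"
 defines "a \<equiv> 4 * abs t / (kap * psi0)"
 shows "cmod ((LINT y|M. iexp (t * GL y)) - cpx (exp (- (t * (b / (real b - 1)))\<^sup>2 / 2)))
  <= 2 * (a * (sqrt b * gam g)) + 16 * (C * (real b * real g powr (- (lam * p))))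
   + (a * (sqrt b * eps) + a^2 / 2 * (vconst * (1 / l) + 16 * VB * eps) + a ^ 3 / 6 * (T / sqrt b) * (20 * VB^2 + vconst * (1 / l) + 16 * VB * eps)
    + a^2 * (16 / 3 * (48 * VB ^ 4 * (1 / T)^2 + vconst * (1 / l) + T * eps)) + a ^ 4 * (50 * VB ^ 4) * (1 / b))"
proof -
 define \<theta> where "\<theta> = t * sqrt b * 2 / (kap * (real b - 1) * psi)"
 have b1: "real b / 2 <= real b - 1" "0 < real b - 1" "0 < real b" using b by auto
 have ps: "0 < psi" using psi_bounds by linarith
 have T0: "0 < T" using T VB_pos by linarith
 have a0: "0 <= a" unfolding a_def using kap_pos psi_bounds by simp
 have GL: "t * GL y = \<theta> * L y" for y unfolding GL_def gs_def \<theta>_def by simp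
 have q: "- \<theta>\<^sup>2 * (\<Sum>j=1..b. qv j) / 2 = - (t * (b / (real b - 1)))\<^sup>2 / 2"
 proof -
  have s: "(\<Sum>j=1..b. qv j) = real b * (psi^2 * kap^2 / 4)"
   unfolding psi_bounds qbar_def using b1 kap_pos by simp
  have "\<theta>^2 = t^2 * real b * 4 / (kap^2 * (real b - 1)^2 * psi^2)"
   unfolding \<theta>_def by (simp add: power_mult_distrib power_divide)
  moreover have "- (t^2 * x * 4 / (k^2 * d^2 * w^2)) * (x * (w^2 * k^2 / 4)) / 2 = - (t * (x / d))\<^sup>2 / 2"
   if "0 < k" "0 < d" "0 < w" for x k d w :: real
   using that by (simp add: power_mult_distrib power_divide power2_eq_square)
  ultimately show ?thesis unfolding s using b1 kap_pos ps by simp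
 qed
 have th: "abs \<theta> <= a / sqrt b"
 proof -
  have "abs \<theta> = abs t * sqrt b * 2 / (kap * (real b - 1) * psi)"
   unfolding \<theta>_def using kap_pos ps b1 by (simp add: abs_mult)
  also have "... <= abs t * sqrt b * 2 / (kap * (real b / 2) * psi0)"
   using kap_pos psi_bounds b1 ps by (intro divide_left_mono mult_mono mult_nonneg_nonneg mult_pos_pos) auto
  also have "... = a * (sqrt b / real b)" unfolding a_def by (simp add: field_simps)
  also have "sqrt b / real b = 1 / sqrt b" using b1 by (simp add: real_div_sqrt field_simps)
  finally show ?thesis by simp
 qed
 have vc: "0 <= vconst" "0 <= eps" "0 <= VB" "0 < real l" using vconst_nonneg eps_nonneg VB_pos l by auto
 let ?a = "16 / 3 * (48 * VB ^ 4 * (1 / T)^2 + vconst * (1 / l) + T * eps)"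
  and ?b = "a / sqrt b"
 have xe: "real b * xi_error T \<theta> <= real b * xi_error T ?b"
 proof (rule mult_left_mono)
  have "abs ?b = a / sqrt b" using a0 by simp
  hence m: "abs \<theta> ^ k <= abs ?b ^ k" for k using th by (intro power_mono) auto
  have "\<theta>^2 <= ?b^2" using m[of 2] by (simp only: power2_abs)
  moreover have "\<theta> ^ 4 <= ?b ^ 4" using m[of 4] a0 by (simp add: power_even_abs)
  ultimately show "xi_error T \<theta> <= xi_error T ?b" unfolding xi_error_def using m[of 1] m[of 3] vc T0
   by (intro add_mono mult_right_mono divide_right_mono) auto
 qed simp
 also have "... = a * (sqrt b * eps) + a^2 / 2 * (vconst * (1 / l) + 16 * VB * eps) + a ^ 3 / 6 * (T / sqrt b) * (20 * VB^2 + vconst * (1 / l) + 16 * VB * eps)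
    + a^2 * ?a + a ^ 4 * (50 * VB ^ 4) * (1 / b)"
 proof -
  define r where "r = sqrt b"
  have r: "r > 0" "real b = r^2" unfolding r_def using b1 by auto
  have e: "r^2 * abs (a / r) = a * r" "r^2 * (a / r)^2 = a^2" "r^2 * abs (a / r) ^ 3 = a ^ 3 / r" "r^2 * (a / r) ^ 4 = a ^ 4 / r^2"
   using r(1) a0 by (simp_all add: power_divide power2_eq_square power3_eq_cube power4_eq_xxxx)
  have "r^2 * xi_error T (a / r) = (r^2 * abs (a / r)) * eps + (r^2 * (a / r)^2) / 2 * (vconst / l + 16 * VB * eps) + (r^2 * abs (a / r) ^ 3) * T / 6 * (20 * VB^2 + vconst / l + 16 * VB * eps)
   + (r^2 * (a / r)^2) * (16 / 3 * (48 * VB ^ 4 / T^2 + vconst / l + T * eps)) + (r^2 * (a / r) ^ 4) * (50 * VB ^ 4)"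
   unfolding xi_error_def by (simp only: distrib_left times_divide_eq_right times_divide_eq_left mult.assoc)
  thus ?thesis unfolding r_def[symmetric] unfolding r(2) e by (simp add: power_divide)
 qed
 finally have xe: "real b * xi_error T \<theta> <= a * (sqrt b * eps) + a^2 / 2 * (vconst * (1 / l) + 16 * VB * eps) + a ^ 3 / 6 * (T / sqrt b) * (20 * VB^2 + vconst * (1 / l) + 16 * VB * eps)
    + a^2 * ?a + a ^ 4 * (50 * VB ^ 4) * (1 / b)" .
 have gg: "abs \<theta> * (real b * gam g) <= a * (sqrt b * gam g)"
 proof -
  have "0 <= gam g" unfolding gam_def using suminf_nonneg[OF summable_abs_c] l by (intro real_sqrt_ge_zero mult_nonneg_nonneg divide_nonneg_nonneg) auto
  hence "abs \<theta> * (real b * gam g) <= a / sqrt b * (real b * gam g)" using th by (intro mult_right_mono) auto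
  also have "... = a * (real b / sqrt b * gam g)" by simp
  also have "real b / sqrt b = sqrt b" by (simp add: real_div_sqrt)
  finally show ?thesis .
 qed
 have "cmod ((LINT y|M. iexp (t * GL y)) - cpx (exp (- (t * (b / (real b - 1)))\<^sup>2 / 2)))
  <= 2 * (abs \<theta> * (real b * gam g)) + real b * (16 * (C * real g powr (- (lam * p)))) + real b * xi_error T \<theta>"
  using L_char[OF T g, of \<theta>] unfolding GL q .
 thus ?thesis using gg xe by (simp add: mult_ac)
qed

lemma kr_bound:
 "(LINT om|M. abs (Q.kr om - kap * sbar)) <= (2 * (2 * abs e * (sqrt b / sqrt l2) + sqrt b * Q.eps
   + (sqrt (real (4 * c0 + 3) * Q.wconst * (b / b2) + 4 * (C * (real b ^ 3 * real l2 powr (- (lam * p))))) + 2 * Q.wconst * (1 / sqrt b)))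
   + kap * ((2 * real c0 + 1) * B + 6 * real c0 * A) * (sqrt b / b2)) / sqrt b"
 "integrable M (%om. abs (Q.kr om - kap * sbar))"
proof -
 have b0: "0 < real b" using b by simp
 \<comment> \<open>The cap is the number of blocks of the first grid: after multiplication by
   \<open>sqrt b\<close> the part above the cap is of order 1 / sqrt b, and under the root the
   mixing rate meets b^3.\<close>
 have T: "0 < real b" by (rule b0)
 show "integrable M (%om. abs (Q.kr om - kap * sbar))" by (rule Q.kr_L1(1)[OF T])
 let ?a = "real (4 * c0 + 3) * Q.wconst * (b / b2) + 4 * (C * (real b ^ 3 * real l2 powr (- (lam * p))))"
  and ?b = "real (4 * c0 + 3) * Q.wconst / b2 + 4 * (C * real l2 powr (- (lam * p))) * (real b)^2"
 have sq: "sqrt ?b = sqrt ?a / sqrt b"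
  unfolding real_sqrt_divide[symmetric] using b0 by (simp add: add_divide_distrib power2_eq_square power3_eq_cube)
 let ?c = "(2 * real c0 + 1) * B + 6 * real c0 * A"
 have "(LINT om|M. abs (Q.kr om - kap * sbar)) <= 2 * (2 * abs e / sqrt l2 + Q.eps
   + (sqrt ?b + 2 * Q.wconst / b)) + kap * (?c / b2)" by (rule Q.kr_L1(2)[OF T])
 also have "... = (2 * (2 * abs e * (sqrt b / sqrt l2) + sqrt b * Q.eps
   + (sqrt ?a + 2 * Q.wconst * (1 / sqrt b))) + kap * ?c * (sqrt b / b2)) / sqrt b"
 proof -
  define r where "r = sqrt b"
  have r: "r > 0" "real b = r * r" unfolding r_def using b0 by auto
  define z where "z = sqrt ?a"
  define u where "u = (2 * real c0 + 1) * B + 6 * real c0 * A"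
  have "2 * (2 * x / y + w + (z / r + 2 * k / (r * r))) + kap * (u / b2) = (2 * (2 * x * (r / y) + r * w + (z + 2 * k * (1 / r))) + kap * u * (r / b2)) / r" for x y w k
   using r(1) by (simp add: add_divide_distrib distrib_left)
  from this[of "abs e" "sqrt l2" Q.eps Q.wconst] show ?thesis unfolding sq z_def[symmetric] u_def[symmetric] r_def[symmetric] unfolding r(2) .
 qed
 finally show "(LINT om|M. abs (Q.kr om - kap * sbar)) <= (2 * (2 * abs e * (sqrt b / sqrt l2) + sqrt b * Q.eps
   + (sqrt ?a + 2 * Q.wconst * (1 / sqrt b))) + kap * ?c * (sqrt b / b2)) / sqrt b" .
qed

end

section \<open>Limits along the sequence of sample sizes\<close>

lemma std_normal_tail: "0 < R ==> measure gauss {z. R < abs z} <= 1 / R"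
proof -
 assume R: "0 < R"
 have "measure gauss {z. R < abs z} = (LINT z|gauss. indicator {z. R < abs z} z)" by simp
 also have "... <= (LINT z|gauss. abs z / R)"
 proof (rule integral_mono)
  show "integrable gauss (indicat_real {z. R < abs z})" by (intro gauss.integrable_bounded[of _ 1]) auto
  show "integrable gauss (%z. abs z / R)" using std_normal_moments(2) by simp
  show "indicator {z. R < abs z} z <= abs z / R" for z using R by (auto simp: indicator_def field_simps)
 qed
 also have "... <= 1 / R" using std_normal_moments(4) sqrt_2_pi_le R by (simp add: divide_right_mono)
 finally show ?thesis .
qed

lemma std_normal_two_points: "emeasure gauss {- R, R} = 0"
proof -
 have "AE z in lborel. z ~= R" "AE z in lborel. z ~= - R" by (rule AE_lborel_singleton)+
 hence "AE z in lborel. ennreal (std_normal_density z) * indicator {- R, R} z = 0" by eventually_elim auto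
 thus ?thesis by (simp add: emeasure_density nn_integral_0_iff_AE)
qed

lemma powr_neg_tendsto: "a < 0 ==> filterlim x at_top F ==> ((%m. x m powr a) \<longlongrightarrow> (0::real)) F"
 by (rule filterlim_compose[OF tendsto_neg_powr, of a "%x. x", simplified]) (auto simp: filterlim_ident)

lemma powr_ln_tendsto:
 assumes "a < 0" "k > 0" "filterlim x at_top F"
 shows "((%m. x m powr a * (1 + ln (x m powr k))) \<longlongrightarrow> (0::real)) F"
proof -
 have "((%x::real. x powr a * (1 + ln (x powr k))) \<longlongrightarrow> 0) at_top" using assms(1,2) by real_asymp
 thus ?thesis by (rule filterlim_compose[OF _ assms(3)])
qed

lemma char_distr_iexp:
 "f \<in> borel_measurable N ==> char (distr N borel f) t = (LINT x|N. iexp (t * f x))"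
 unfolding char_def by (subst integral_distr) auto

text \<open>\<open>x\<close> is the sample size as a real. The conditions with 1 - 4 \<beta> make
  \<open>sqrt b\<close> times the moment error vanish on the first and on the second grid.\<close>

locale sample_sequence = rate_mixing M Y C lam p K c \<beta> for M :: "'a measure" and Y C lam p K c \<beta> +
 fixes sg :: "nat => nat => real" and n l b l2 b2 :: "nat => nat" and c0 :: nat and A B s0 E mH e :: real
  and obs :: "nat => 'a => int => real" and x :: "nat => real" and s q :: real
 assumes samples: "!!m. paired_samples M Y C lam p K c \<beta> (sg m) (n m) (l m) (b m) c0 A B s0 E mH e (obs m) (l2 m) (b2 m)"
  and x: "!!m. 1 <= x m" "filterlim x at_top sequentially"
  and lengths: "!!m. real (l m) = x m powr s" "!!m. real (b m) = x m powr (1 - s)" "!!m. real (l2 m) = x m powr q" "!!m. real (b2 m) = x m powr (1 - q)"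
  and s: "1 / 2 < s" "s < 1" "1 - s < s * (1 - 4 * \<beta>)" and q: "0 < q" "q < 1" "q < s" "1 - s < q * (1 - 4 * \<beta>)"
begin

lemma s_q: "1 - s < q"
proof -
 have "q * (1 - 4 * \<beta>) <= q * 1" using q beta by (intro mult_left_mono) auto
 thus ?thesis using q by linarith
qed

lemma lam_p: "6 <= lam * p"
proof -
 have "lam * p = lam * (p - 4) + 4 * lam" by (simp add: algebra_simps)
 thus ?thesis using lam by linarith
qed

definition eps1 :: "nat => real" where "eps1 m = E * wrate (l m)"
definition eps2 :: "nat => real" where "eps2 m = E * wrate (l2 m)"
text \<open>The exponent 4 \<beta> serves two needs: b * gap / l vanishes, which is once more 1 - s
  < s (1 - 4 \<beta>), and so does b times the mixing rate at distance \<open>gap\<close>.\<close>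

definition gap :: "nat => nat" where "gap m = nat \<lceil>real (l m) powr (4 * \<beta>)\<rceil>"
text \<open>Lindeberg level b^(1/4): it tends to infinity, while TT / sqrt b and TT * eps1
  vanish.\<close>

definition TT :: "nat => real" where "TT m = x m powr ((1 - s) / 4)"

lemma x_pos: "0 < x m" using x(1)[of m] by linarith

lemma sqrt_powr: "sqrt (x m powr a) = x m powr (a / 2)" using x_pos[of m] by (simp add: powr_half_sqrt_powr)

lemmas xlim = powr_neg_tendsto[OF _ x(2)]

lemma wrate_lim:
 assumes L: "!!m. real (L m) = x m powr k" and k: "0 < k" "1 - s < k * (1 - 4 * \<beta>)"
 shows "(%m. sqrt (b m) * (E * wrate (L m))) ----> 0"
proof -
 have "sqrt (b m) * (E * wrate (L m)) = E * (x m powr ((1 - s) / 2 + k * (2 * \<beta> - 1 / 2)) * (1 + ln (x m powr k)))" for m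
  unfolding wrate_def rate_def L lengths sqrt_powr by (simp add: powr_powr powr_add mult_ac)
 moreover have e: "(1 - s) / 2 + k * (2 * \<beta> - 1 / 2) = ((1 - s) - k * (1 - 4 * \<beta>)) / 2" by (simp add: field_simps)
 have "(1 - s) / 2 + k * (2 * \<beta> - 1 / 2) < 0" unfolding e using k by simp
 hence "(%m. E * (x m powr ((1 - s) / 2 + k * (2 * \<beta> - 1 / 2)) * (1 + ln (x m powr k)))) ----> E * 0"
  by (intro tendsto_mult_left powr_ln_tendsto k x)
 ultimately show ?thesis by (simp only: mult_zero_right)
qed

lemma lim_eps1: "(%m. sqrt (b m) * eps1 m) ----> 0"
 unfolding eps1_def using s by (intro wrate_lim[of l s] lengths) auto

lemma lim_eps2: "(%m. sqrt (b m) * eps2 m) ----> 0"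
 unfolding eps2_def using q by (intro wrate_lim[of l2 q] lengths) auto

lemma lim_b: "(%m. 1 / real (b m)) ----> 0" "(%m. 1 / sqrt (b m)) ----> 0" "(%m. sqrt (b m) / b m) ----> 0"
proof -
 have "1 / real (b m) = x m powr - (1 - s)" for m unfolding lengths by (rule powr_minus_divide[symmetric])
 thus "(%m. 1 / real (b m)) ----> 0" using xlim[of "- (1 - s)"] s by simp
 have 1: "1 / sqrt (b m) = x m powr - ((1 - s) / 2)" for m unfolding lengths sqrt_powr by (rule powr_minus_divide[symmetric])
 thus "(%m. 1 / sqrt (b m)) ----> 0" using xlim[of "- ((1 - s) / 2)"] s by simp
 moreover have "sqrt (b m) / b m = 1 / sqrt (b m)" for m
  unfolding lengths sqrt_powr powr_diff[symmetric] powr_minus_divide[symmetric] by (rule arg_cong[where f = "%a. x m powr a"]) (simp add: field_simps)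
 ultimately show "(%m. sqrt (b m) / b m) ----> 0" by simp
qed

lemma lim_eps1': "eps1 ----> 0"
proof -
 have "eps1 m = (1 / sqrt (b m)) * (sqrt (b m) * eps1 m)" for m unfolding lengths using x_pos[of m] by simp
 thus ?thesis using tendsto_mult[OF lim_b(2) lim_eps1] by simp
qed

lemma lim_l: "(%m. 1 / real (l m)) ----> 0" "(%m. 1 / sqrt (l m)) ----> 0" "(%m. sqrt (b m) / sqrt (l m)) ----> 0"
 "(%m. sqrt (b m) / sqrt (l2 m)) ----> 0"
proof -
 have "1 / real (l m) = x m powr - s" for m unfolding lengths by (rule powr_minus_divide[symmetric])
 thus "(%m. 1 / real (l m)) ----> 0" using xlim[of "- s"] s by simp
 have 1: "1 / sqrt (l m) = x m powr - (s / 2)" for m unfolding lengths sqrt_powr by (rule powr_minus_divide[symmetric])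
 thus "(%m. 1 / sqrt (l m)) ----> 0" using xlim[of "- (s / 2)"] s by simp
 have 2: "sqrt (b m) / sqrt (l m) = x m powr ((1 - s) / 2 - s / 2)" for m unfolding lengths sqrt_powr powr_diff[symmetric] ..
 show "(%m. sqrt (b m) / sqrt (l m)) ----> 0" unfolding 2 using s by (intro xlim) simp
 have 3: "sqrt (b m) / sqrt (l2 m) = x m powr ((1 - s) / 2 - q / 2)" for m unfolding lengths sqrt_powr powr_diff[symmetric] ..
 show "(%m. sqrt (b m) / sqrt (l2 m)) ----> 0" unfolding 3 using s_q by (intro xlim) simp
qed

lemma lim_b2: "(%m. real (b m) / real (b2 m)) ----> 0" "(%m. sqrt (b m) / real (b2 m)) ----> 0"
 "(%m. real (b m) ^ 3 * real (l2 m) powr (- (lam * p))) ----> 0"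
proof -
 have 1: "real (b m) / real (b2 m) = x m powr ((1 - s) - (1 - q))" for m unfolding lengths powr_diff[symmetric] ..
 show "(%m. real (b m) / real (b2 m)) ----> 0" unfolding 1 using q by (intro xlim) simp
 have 2: "sqrt (b m) / real (b2 m) = x m powr ((1 - s) / 2 - (1 - q))" for m unfolding lengths sqrt_powr powr_diff[symmetric] ..
 show "(%m. sqrt (b m) / real (b2 m)) ----> 0" unfolding 2 using q s by (intro xlim) (simp add: field_simps)
 have 3: "real (b m) ^ 3 * real (l2 m) powr (- (lam * p)) = x m powr (3 * (1 - s) - q * (lam * p))" for m
 proof -
  have "(x m powr (1 - s)) ^ 3 = x m powr (3 * (1 - s))" using x_pos[of m] by (subst powr_power) auto
  thus ?thesis unfolding lengths powr_powr by (simp only: powr_add[symmetric]) (simp add: mult.commute)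
 qed
 have "q * 6 <= q * (lam * p)" using q lam_p by (intro mult_left_mono) auto
 thus "(%m. real (b m) ^ 3 * real (l2 m) powr (- (lam * p))) ----> 0" unfolding 3
 proof (intro xlim)
  assume "q * 6 <= q * (lam * p)"
  moreover have "3 * (1 - s) < 3 * q" using s_q by simp
  moreover have "3 * q <= q * 6" using q by simp
  ultimately show "3 * (1 - s) - q * (lam * p) < 0" by argo
 qed
qed

lemma lim_TT: "(%m. TT m / sqrt (b m)) ----> 0" "(%m. 1 / TT m) ----> 0" "(%m. TT m * eps1 m) ----> 0" "filterlim TT at_top sequentially"
proof -
 have 1: "TT m / sqrt (b m) = x m powr ((1 - s) / 4 - (1 - s) / 2)" for m unfolding lengths sqrt_powr TT_def powr_diff[symmetric] ..
 show t: "(%m. TT m / sqrt (b m)) ----> 0" unfolding 1 using s by (intro xlim) simp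
 have 2: "1 / TT m = x m powr - ((1 - s) / 4)" for m unfolding TT_def by (rule powr_minus_divide[symmetric])
 show "(%m. 1 / TT m) ----> 0" unfolding 2 using s by (intro xlim) simp
 have 3: "TT m * eps1 m = (TT m / sqrt (b m)) * (sqrt (b m) * eps1 m)" for m unfolding lengths using x_pos[of m] by simp
 show "(%m. TT m * eps1 m) ----> 0" unfolding 3 using tendsto_mult[OF t lim_eps1] by simp
 have "filterlim (%x::real. x powr ((1 - s) / 4)) at_top at_top" using s by real_asymp
 thus "filterlim TT at_top sequentially" unfolding TT_def[abs_def] by (rule filterlim_compose[OF _ x(2)])
qed

lemma gap_bounds: "1 <= gap m" "gap m <= l m" "real (gap m) <= 2 * real (l m) powr (4 * \<beta>)" "real (l m) powr (4 * \<beta>) <= real (gap m)"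
proof -
 have l1: "1 <= real (l m)" unfolding lengths using x(1)[of m] s by (intro ge_one_powr_ge_zero) auto
 have p1: "1 <= real (l m) powr (4 * \<beta>)" using l1 beta by (intro ge_one_powr_ge_zero) auto
 have "real (l m) powr (4 * \<beta>) <= real (l m) powr 1" using l1 beta by (intro powr_mono) auto
 hence pl: "real (l m) powr (4 * \<beta>) <= real (l m)" using l1 by simp
 show "1 <= gap m" unfolding gap_def using p1 by linarith
 show "gap m <= l m" unfolding gap_def using pl by (simp add: ceiling_le_iff)
 show "real (gap m) <= 2 * real (l m) powr (4 * \<beta>)" "real (l m) powr (4 * \<beta>) <= real (gap m)" unfolding gap_def using p1 by linarith+
qed

lemma lim_gap: "(%m. real (b m) * real (gap m) / real (l m)) ----> 0" "(%m. real (b m) * real (gap m) powr (- (lam * p))) ----> 0"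
proof -
 have l0: "0 < real (l m)" for m unfolding lengths using x_pos[of m] by simp
 have 1: "real (b m) * (2 * real (l m) powr (4 * \<beta>)) / real (l m) = 2 * x m powr ((1 - s) + s * (4 * \<beta>) - s)" for m
  unfolding lengths powr_powr powr_diff[symmetric] mult.left_commute[of _ 2] times_divide_eq_right[symmetric] powr_add[symmetric]
  by (simp only: add_diff_eq)
 have "(1 - s) + s * (4 * \<beta>) - s < 0" using s(3) by (simp add: algebra_simps)
 hence "(%m. 2 * x m powr ((1 - s) + s * (4 * \<beta>) - s)) ----> 2 * 0" by (intro tendsto_mult_left xlim)
 hence u: "(%m. real (b m) * (2 * real (l m) powr (4 * \<beta>)) / real (l m)) ----> 0" unfolding 1 by simp
 show "(%m. real (b m) * real (gap m) / real (l m)) ----> 0"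
  by (rule tendsto_sandwich[OF _ _ tendsto_const u]) (use gap_bounds in \<open>auto intro!: always_eventually divide_right_mono mult_left_mono\<close>)
 \<comment> \<open>\<beta> lam (p - 1) >= 1 makes the subtracted exponent at least 4 s, which
   exceeds 1 - s since s > 1/2.\<close>
 have e: "1 - s - s * (4 * \<beta>) * (lam * p) < 0"
 proof -
  have "4 * 1 <= 4 * (\<beta> * (lam * (p - 1)))" using beta by simp
  moreover have "\<beta> * (lam * (p - 1)) <= \<beta> * (lam * p)" using beta lam by (intro mult_left_mono) auto
  ultimately have "s * 4 <= s * (4 * \<beta> * (lam * p))" using s by (intro mult_left_mono) auto
  moreover have "s * (4 * \<beta> * (lam * p)) = s * (4 * \<beta>) * (lam * p)" by simp
  ultimately show ?thesis using s(1,2) by linarith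
 qed
 have 2: "real (b m) * (real (l m) powr (4 * \<beta>)) powr (- (lam * p)) = x m powr (1 - s - s * (4 * \<beta>) * (lam * p))" for m
  unfolding lengths powr_powr powr_add[symmetric] by (simp add: mult.assoc)
 have v: "(%m. real (b m) * (real (l m) powr (4 * \<beta>)) powr (- (lam * p))) ----> 0" unfolding 2 using e by (rule xlim)
 show "(%m. real (b m) * real (gap m) powr (- (lam * p))) ----> 0"
 proof (rule tendsto_sandwich[OF _ _ tendsto_const v])
  show "\<forall>\<^sub>F m in sequentially. real (b m) * real (gap m) powr (- (lam * p)) <= real (b m) * (real (l m) powr (4 * \<beta>)) powr (- (lam * p))"
   using gap_bounds l0 lam_p by (intro always_eventually allI mult_left_mono powr_mono2') auto
 qed auto
qed

definition GG :: "nat => 'a => real" where "GG m = paired_samples.GL Y c (sg m) (l m) (b m)"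
definition TS :: "nat => 'a => real" where "TS m = paired_samples.stat (n m) (l m) (b m) c0 (obs m) (l2 m) (b2 m)"

lemma GG_measurable [measurable]: "GG m \<in> borel_measurable M" and TS_measurable [measurable]: "TS m \<in> borel_measurable M"
proof -
 interpret P: paired_samples M Y C lam p K c \<beta> "sg m" "n m" "l m" "b m" c0 A B s0 E mH e "obs m" "l2 m" "b2 m" by (rule samples)
 show "GG m \<in> borel_measurable M" "TS m \<in> borel_measurable M" unfolding GG_def TS_def by (rule P.GL_measurable P.stat_measurable)+
qed

abbreviation "kp \<equiv> block_array.kap c"
abbreviation "ps0 \<equiv> paired_samples.psi0 c A s0"
abbreviation "vb \<equiv> block_array.VB c A"
abbreviation "vc \<equiv> block_array.vconst C K c A B"

lemma kp_ps0: "0 < kp" "0 < ps0" "0 < s0" "0 <= vb"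
proof -
 interpret P: paired_samples M Y C lam p K c \<beta> "sg 0" "n 0" "l 0" "b 0" c0 A B s0 E mH e "obs 0" "l2 0" "b2 0" by (rule samples)
 show "0 < kp" "0 < ps0" "0 < s0" "0 <= vb" using P.kap_pos P.psi_bounds P.s0 P.VB_pos by auto
qed

definition ga :: "nat => real" where
 "ga m = sqrt (2 * (\<Sum>k. abs (c k)) * A^2 * (real (b m) * real (gap m) / real (l m)))"

lemma lim_ga: "ga ----> 0"
proof -
 have "(%m. sqrt (2 * (\<Sum>k. abs (c k)) * A^2 * (real (b m) * real (gap m) / real (l m)))) ----> sqrt (2 * (\<Sum>k. abs (c k)) * A^2 * 0)"
  by (intro tendsto_intros lim_gap)
 thus ?thesis unfolding ga_def[abs_def] by simp
qed

text \<open>The bound of \<open>GL_char\<close> with every vanishing quantity as a separate factor,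
  so that its limit is arithmetic of limits.\<close>

definition G_err :: "real => nat => real" where
 "G_err a m = 2 * (a * ga m) + 16 * (C * (real (b m) * real (gap m) powr (- (lam * p))))
   + (a * (sqrt (b m) * eps1 m) + a^2 / 2 * (vc * (1 / l m) + 16 * vb * eps1 m) + a ^ 3 / 6 * (TT m / sqrt (b m)) * (20 * vb^2 + vc * (1 / l m) + 16 * vb * eps1 m)
    + a^2 * (16 / 3 * (48 * vb ^ 4 * (1 / TT m)^2 + vc * (1 / l m) + TT m * eps1 m)) + a ^ 4 * (50 * vb ^ 4) * (1 / b m))"

lemma lim_G_err: "G_err a ----> 0"
proof -
 have "G_err a ----> 2 * (a * 0) + 16 * (C * 0)
   + (a * 0 + a^2 / 2 * (vc * 0 + 16 * vb * 0) + a ^ 3 / 6 * 0 * (20 * vb^2 + vc * 0 + 16 * vb * 0)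
    + a^2 * (16 / 3 * (48 * vb ^ 4 * 0^2 + vc * 0 + 0)) + a ^ 4 * (50 * vb ^ 4) * 0)"
  unfolding G_err_def[abs_def]
  by (intro tendsto_add tendsto_mult tendsto_const tendsto_power lim_ga lim_gap lim_eps1 lim_l lim_eps1' lim_TT lim_b)
 thus ?thesis by simp
qed

lemma GG_char:
 assumes "6 * vb <= TT m"
 shows "cmod ((LINT y|M. iexp (t * GG m y)) - cpx (exp (- (t * (b m / (real (b m) - 1)))\<^sup>2 / 2))) <= G_err (4 * abs t / (kp * ps0)) m"
proof -
 interpret P: paired_samples M Y C lam p K c \<beta> "sg m" "n m" "l m" "b m" c0 A B s0 E mH e "obs m" "l2 m" "b2 m" by (rule samples)
 have e: "P.eps = eps1 m" by (simp add: P.eps_def eps1_def)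
 have g: "sqrt (b m) * P.gam (gap m) = ga m"
  unfolding P.gam_def ga_def real_sqrt_mult[symmetric] by (simp add: mult_ac)
 show ?thesis using P.GL_char[OF assms gap_bounds(1,2)[of m], of t] unfolding e g G_err_def GG_def .
qed

lemma exp_lim: "(%m. cpx (exp (- (t * (b m / (real (b m) - 1)))\<^sup>2 / 2))) ----> cpx (exp (- t\<^sup>2 / 2))"
proof -
 have b0: "real (b m) ~= 0" for m unfolding lengths using x_pos[of m] by simp
 have e: "real (b m) / (real (b m) - 1) = 1 / (1 - 1 / real (b m))" for m
 proof -
  have "1 - 1 / real (b m) = (real (b m) - 1) / real (b m)" using b0[of m] by (simp add: field_simps)
  thus ?thesis by simp
 qed
 have "(%m. cpx (exp (- (t * (1 / (1 - 1 / real (b m))))\<^sup>2 / 2))) ----> cpx (exp (- (t * (1 / (1 - 0)))\<^sup>2 / 2))"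
  by (intro tendsto_intros lim_b) auto
 thus ?thesis unfolding e by simp
qed

lemma GG_limit: "(%m. (LINT y|M. iexp (t * GG m y))) ----> cpx (exp (- t\<^sup>2 / 2))"
proof -
 have "\<forall>\<^sub>F m in sequentially. 6 * vb <= TT m" using lim_TT(4) by (simp add: filterlim_at_top)
 hence "\<forall>\<^sub>F m in sequentially. cmod ((LINT y|M. iexp (t * GG m y)) - cpx (exp (- (t * (b m / (real (b m) - 1)))\<^sup>2 / 2))) <= G_err (4 * abs t / (kp * ps0)) m"
  by eventually_elim (rule GG_char)
 hence "(%m. (LINT y|M. iexp (t * GG m y)) - cpx (exp (- (t * (b m / (real (b m) - 1)))\<^sup>2 / 2))) ----> 0"
  by (rule Lim_null_comparison[OF _ lim_G_err])
 from tendsto_add[OF this exp_lim[of t]] show ?thesis by simp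
qed

lemma weak_conv_iexp:
 fixes f :: "nat => 'a => real"
 assumes m: "!!m. f m \<in> borel_measurable M" and l: "!!t. (%m. (LINT y|M. iexp (t * f m y))) ----> cpx (exp (- t\<^sup>2 / 2))"
 shows "weak_conv_m (%m. distr M borel (f m)) gauss"
proof (rule levy_continuity)
 show "real_distribution (distr M borel (f m))" for m by (rule real_distribution_distr[OF m])
 show "real_distribution gauss" by (rule real_dist_normal_dist)
 show "(%m. char (distr M borel (f m)) t) ----> char gauss t" for t
  unfolding char_distr_iexp[OF m] char_std_normal_distribution using l[of t] by simp
qed

text \<open>Tightness of the linear part by the portmanteau theorem: the boundary of the event
  consists of two points, which have Gaussian measure 0.\<close>

lemma GG_tail: "0 < R ==> (%m. prob {y \<in> space M. R < abs (GG m y)}) ----> measure gauss {z. R < abs z}"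
proof -
 have sub: "frontier {z. R < abs z} \<subseteq> {- R, R}"
 proof
  fix z assume z: "z \<in> frontier {z. R < abs z}"
  have "closure {z. R < abs z} \<subseteq> {z. R <= abs z}"
   by (rule closure_minimal) (auto intro!: closed_Collect_le continuous_intros)
  moreover have "open {z. R < abs z}" by (intro open_Collect_less continuous_intros)
  hence "interior {z. R < abs z} = {z. R < abs z}" by (rule interior_open)
  ultimately have "R <= abs z" "\<not> R < abs z" using z unfolding frontier_def by blast+
  thus "z \<in> {- R, R}" by auto
 qed
 have "emeasure gauss (frontier {z. R < abs z}) <= emeasure gauss {- R, R}"
  by (rule emeasure_mono[OF sub]) simp
 hence fr: "emeasure gauss (frontier {z. R < abs z}) = 0" unfolding std_normal_two_points le_zero_eq .
 have "(%m. measure (distr M borel (GG m)) {z. R < abs z}) ----> measure gauss {z. R < abs z}"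
  by (rule weak_conv_imp_continuity_set_conv[OF _ real_dist_normal_dist weak_conv_iexp[OF GG_measurable GG_limit] _ fr])
    (simp_all add: real_distribution_distr)
 moreover have "measure (distr M borel (GG m)) {z. R < abs z} = prob {y \<in> space M. R < abs (GG m y)}" for m
  by (subst measure_distr) (auto intro!: arg_cong[where f = prob])
 ultimately show ?thesis by simp
qed

abbreviation "sc \<equiv> block_sample.sdc C K c A B e"
abbreviation "wc \<equiv> kappa_sample.wconst c c0 A"

text \<open>\<open>d1\<close>, \<open>d2\<close> and \<open>d3\<close> are errors multiplied by
  \<open>sqrt b\<close>. \<open>d4\<close> is not multiplied: the variance estimator has to be
  consistent only.\<close>

definition d1 :: "nat => real" where
 "d1 m = 2 * (2 * abs e * (sqrt (b m) / sqrt (l2 m)) + sqrt (b m) * eps2 m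
   + (sqrt (real (4 * c0 + 3) * wc * (b m / b2 m) + 4 * (C * (real (b m) ^ 3 * real (l2 m) powr (- (lam * p))))) + 2 * wc * (1 / sqrt (b m))))
   + kp * ((2 * real c0 + 1) * B + 6 * real c0 * A) * (sqrt (b m) / b2 m)"
definition d2 :: "nat => real" where "d2 m = sc / s0 * (sqrt (b m) / sqrt (l m)) + B * (sqrt (b m) / b m)"
definition d3 :: "nat => real" where
 "d3 m = 2 * abs e / kp * (sqrt (b m) / sqrt (l m)) + (6 * (sqrt (b m) * eps1 m) + 8 * vb * (sqrt (b m) / b m)) / kp + 2 * sc / s0 * (sqrt (b m) / sqrt (l m))"
definition d4 :: "nat => real" where "d4 m = 4 * ((204 + 120 * A / s0) * (sc * (1 / sqrt (l m))) + 576 * A^2 * (1 / b m))"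
definition T_err :: "real => real => nat => real" where
 "T_err t R m = abs t * (2 / ps0 * (d3 m + R * (2 / (kp^2 * s0)) * (kp * d2 m + d1 m)) + R * (2 / ps0^2) * d4 m)
   + 2 * (2 / (kp * s0) * (d1 m * (1 / sqrt (b m))) + 2 / ps0^2 * d4 m + (2 * abs e + (2 * vb + eps1 m)) / R + prob {y \<in> space M. R < abs (GG m y)})"

lemma lim_d: "d1 ----> 0" "d2 ----> 0" "d3 ----> 0" "d4 ----> 0"
proof -
 have "d1 ----> 2 * (2 * abs e * 0 + 0 + (sqrt (real (4 * c0 + 3) * wc * 0 + 4 * (C * 0)) + 2 * wc * 0)) + kp * ((2 * real c0 + 1) * B + 6 * real c0 * A) * 0"
  unfolding d1_def[abs_def] by (intro tendsto_add tendsto_mult tendsto_const tendsto_real_sqrt lim_l lim_b lim_b2 lim_eps2)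
 thus "d1 ----> 0" by simp
 have "d2 ----> sc / s0 * 0 + B * 0" unfolding d2_def[abs_def] by (intro tendsto_add tendsto_mult tendsto_const lim_l lim_b)
 thus "d2 ----> 0" by simp
 have "d3 ----> 2 * abs e / kp * 0 + (6 * 0 + 8 * vb * 0) / kp + 2 * sc / s0 * 0"
  unfolding d3_def[abs_def] using kp_ps0 by (intro tendsto_add tendsto_mult tendsto_const tendsto_divide lim_l lim_b lim_eps1) auto
 thus "d3 ----> 0" by simp
 have "d4 ----> 4 * ((204 + 120 * A / s0) * (sc * 0) + 576 * A^2 * 0)"
  unfolding d4_def[abs_def] by (intro tendsto_add tendsto_mult tendsto_const lim_l lim_b)
 thus "d4 ----> 0" by simp
qed

lemma TS_char:
 assumes R: "0 < R"
 shows "cmod ((LINT y|M. iexp (t * TS m y)) - (LINT y|M. iexp (t * GG m y))) <= T_err t R m"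
proof -
 interpret P: paired_samples M Y C lam p K c \<beta> "sg m" "n m" "l m" "b m" c0 A B s0 E mH e "obs m" "l2 m" "b2 m" by (rule samples)
 have e1: "P.eps = eps1 m" "P.Q.eps = eps2 m" by (simp_all add: P.eps_def eps1_def P.Q.eps_def eps2_def)
 have b0: "0 < sqrt (b m)" unfolding lengths using x_pos[of m] by simp
 have "sqrt (b m) * P.e2 = d2 m" unfolding P.e2_def d2_def by (simp add: distrib_left mult_ac)
 moreover have "sqrt (b m) * P.e3 = d3 m"
  unfolding P.e3_def d3_def e1 by (simp add: distrib_left add_divide_distrib mult_ac)
 moreover have "P.e4 = d4 m" unfolding P.e4_def d4_def by simp
 moreover have "P.eU = 2 * abs e + (2 * vb + eps1 m)" unfolding P.eU_def e1 ..
 moreover have kr: "(LINT y|M. abs (P.Q.kr y - kp * P.sbar)) <= d1 m * (1 / sqrt (b m))"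
  using P.kr_bound(1) unfolding e1 d1_def by simp
 moreover have "sqrt (b m) * (d1 m * (1 / sqrt (b m))) = d1 m" using b0 by simp
 ultimately show ?thesis
  using P.stat_char[OF R kr P.kr_bound(2), of t] unfolding T_err_def GG_def TS_def by simp
qed

text \<open>\<open>R\<close> is fixed first, according to the wanted accuracy, which makes the mean
  of \<open>us\<close> over \<open>R\<close> and the Gaussian tail small; all other terms then
  vanish as m grows.\<close>

lemma TS_limit: "(%m. (LINT y|M. iexp (t * TS m y))) ----> cpx (exp (- t\<^sup>2 / 2))"
proof -
 have "(%m. (LINT y|M. iexp (t * TS m y)) - (LINT y|M. iexp (t * GG m y))) ----> 0"
 proof (rule LIMSEQ_I)
  fix r :: real assume r: "0 < r"
  \<comment> \<open>The summand 1 pays for the Gaussian tail, which is at most 1 / R.\<close>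
  define cU where "cU = 2 * abs e + 2 * vb + 1"
  have cU: "1 <= cU" unfolding cU_def using kp_ps0 by simp
  define R where "R = 4 * cU / r"
  have R: "0 < R" unfolding R_def using cU r by simp
  let ?a = "2 * abs e + 2 * vb"
  have "T_err t R ----> abs t * (2 / ps0 * (0 + R * (2 / (kp^2 * s0)) * (kp * 0 + 0)) + R * (2 / ps0^2) * 0)
   + 2 * (2 / (kp * s0) * (0 * 0) + 2 / ps0^2 * 0 + (2 * abs e + (2 * vb + 0)) / R + measure gauss {z. R < abs z})"
   unfolding T_err_def[abs_def] using R
   by (intro tendsto_add tendsto_mult tendsto_const tendsto_divide lim_d lim_b lim_eps1' GG_tail) auto
  hence "T_err t R ----> 2 * (?a / R + measure gauss {z. R < abs z})" by simp
  moreover have "2 * (?a / R + measure gauss {z. R < abs z}) < r"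
  proof -
   have "2 * (?a / R + measure gauss {z. R < abs z}) <= 2 * (?a / R + 1 / R)"
    using std_normal_tail[OF R] by simp
   also have "... = 2 * cU / R" unfolding cU_def by (simp add: add_divide_distrib)
   also have "... = r / 2" unfolding R_def using cU r by simp
   also have "... < r" using r by simp
   finally show ?thesis .
  qed
  ultimately have "\<forall>\<^sub>F m in sequentially. T_err t R m < r" by (rule order_tendstoD(2))
  then obtain m0 where "!!m. m0 <= m ==> T_err t R m < r" unfolding eventually_sequentially by blast
  thus "\<exists>no. \<forall>m\<ge>no. norm ((LINT y|M. iexp (t * TS m y)) - (LINT y|M. iexp (t * GG m y)) - 0) < r"
   using TS_char[OF R, of t] by (intro exI[of _ m0] allI impI) (simp only: diff_0_right, rule le_less_trans)
 qed
 from tendsto_add[OF this GG_limit[of t]] show ?thesis by simp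
qed

lemma TS_weak: "weak_conv_m (%m. distr M borel (TS m)) gauss"
 by (rule weak_conv_iexp[OF TS_measurable TS_limit])

end

section \<open>Regularity of the scale and mean functions\<close>

lemma piecewise_constant_finite_image:
 assumes "piecewise_constant_unit h"
 obtains D where "finite D" "finite (h ` {0..1})"
  "!!x y. x \<in> {0..1} ==> y \<in> {0..1} ==> x <= y ==> h x ~= h y ==> {x..y} \<inter> D ~= {}"
proof -
 obtain D where D: "finite D" "!!x y. x \<in> {0..1} ==> y \<in> {0..1} ==> x <= y ==> {x..y} \<inter> D = {} ==> h x = h y"
  using assms unfolding piecewise_constant_unit_def by blast
 \<comment> \<open>The points of \<open>D\<close> on either side, with x itself counted on both:
   equal traces mean that the closed interval between two arguments misses \<open>D\<close>, and
   there are finitely many traces.\<close>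
 define f where "f x = (D \<inter> {..x}, D \<inter> {x..})" for x
 have eq: "h x = h y" if "x \<in> {0..1}" "y \<in> {0..1}" "x < y" "f x = f y" for x y
 proof -
  have "{x..y} \<inter> D = {}"
  proof (rule ccontr)
   assume "{x..y} \<inter> D ~= {}"
   then obtain d where d: "d \<in> D" "x <= d" "d <= y" by auto
   have e: "D \<inter> {..x} = D \<inter> {..y}" "D \<inter> {x..} = D \<inter> {y..}" using that(4) unfolding f_def by simp_all
   have "d \<in> D \<inter> {..x}" unfolding e using d by simp
   moreover have "d \<in> D \<inter> {y..}" unfolding e(2)[symmetric] using d by simp
   ultimately show False using that(3) by auto
  qed
  thus ?thesis using D(2)[OF that(1,2)] that(3) by simp
 qed
 define k where "k z = h (SOME x. x \<in> {0..1} \<and> f x = z)" for z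
 have "h ` {0..1} \<subseteq> k ` (Pow D \<times> Pow D)"
 proof
  fix w assume "w \<in> h ` {0..1}"
  then obtain x where x: "x \<in> {0..1}" "w = h x" by blast
  define y where "y = (SOME y. y \<in> {0..1} \<and> f y = f x)"
  have y: "y \<in> {0..1} \<and> f y = f x" unfolding y_def by (rule someI[of _ x]) (use x in simp)
  have "h y = h x"
  proof (cases x y rule: linorder_cases)
   case less
   show ?thesis by (rule eq[OF x(1) _ less, symmetric]) (use y in simp_all)
  next
   case greater
   show ?thesis by (rule eq[OF _ x(1) greater]) (use y in simp_all)
  qed simp
  hence "w = k (f x)" unfolding k_def y_def[symmetric] using x by simp
  moreover have "f x \<in> Pow D \<times> Pow D" by (auto simp: f_def)
  ultimately show "w \<in> k ` (Pow D \<times> Pow D)" by (rule image_eqI)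
 qed
 hence "finite (h ` {0..1})" by (rule finite_subset) (use D in simp)
 thus ?thesis using D by (intro that[of D]) auto
qed

text \<open>Jumps are charged to a bounded increasing counting function of the points of
  \<open>D\<close>, so the bound on the variation is the same for all grids.\<close>

lemma piecewise_lipschitz_bounds:
 assumes "piecewise_lipschitz_unit f"
 obtains A B :: real where "!!x. x \<in> {0..1} ==> f x <= A"
  "!!n. 1 <= n ==> (\<Sum>i=1..<n. abs (f (real (Suc i) / real n) - f (real i / real n))) <= B"
proof -
 obtain g h L where L: "L-lipschitz_on {0..1} g" and h: "piecewise_constant_unit h" and f: "!!x. x \<in> {0..1} ==> f x = g x + h x"
  using assms unfolding piecewise_lipschitz_unit_def by blast
 obtain D where D: "finite D" "finite (h ` {0..1})" "!!x y. x \<in> {0..1} ==> y \<in> {0..1} ==> x <= y ==> h x ~= h y ==> {x..y} \<inter> D ~= {}"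
  using piecewise_constant_finite_image[OF h] by blast
 have L0: "0 <= L" by (rule lipschitz_on_nonneg[OF L])
 have gl: "abs (g x - g y) <= L * abs (x - y)" if "x \<in> {0..1}" "y \<in> {0..1}" for x y
  using lipschitz_onD[OF L that] by (simp add: dist_real_def)
 obtain Q where Q: "!!z. z \<in> h ` {0..1} ==> abs z <= Q"
  using bounded_real finite_imp_bounded[OF D(2)] by metis
 have hQ: "abs (h x) <= Q" if "x \<in> {0..1}" for x using Q that by blast
 have Q0: "0 <= Q" using hQ[of 0] by simp
 \<comment> \<open>The values on \<open>D\<close> are arbitrary, so a grid step that starts or ends
   at a point of \<open>D\<close> may jump too. With both counts \<open>\<Phi>\<close> grows by at
   least 1 in each such step.\<close>
 define \<Phi> where "\<Phi> x = real (card (D \<inter> {..x})) - real (card (D \<inter> {x..}))" for x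
 have hd: "abs (h y - h x) <= 2 * Q * (\<Phi> y - \<Phi> x)" if x: "x \<in> {0..1}" and y: "y \<in> {0..1}" and xy: "x < y" for x y
 proof -
  have c: "card (D \<inter> {..x}) <= card (D \<inter> {..y})" "card (D \<inter> {y..}) <= card (D \<inter> {x..})"
   using D(1) xy by (auto intro!: card_mono)
  show ?thesis
  proof (cases "h x = h y")
   case True
   thus ?thesis using c Q0 by (simp add: \<Phi>_def)
  next
   case False
   then obtain d where d: "d \<in> D" "x <= d" "d <= y" using D(3)[OF x y] xy by fastforce
   have "card (D \<inter> {..x}) < card (D \<inter> {..y}) \<or> card (D \<inter> {y..}) < card (D \<inter> {x..})"
   proof (cases "d = x")
    case True
    have "D \<inter> {y..} \<subseteq> D \<inter> {x..}" "d \<in> D \<inter> {x..}" "d \<notin> D \<inter> {y..}" using True d xy by auto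
    hence "D \<inter> {y..} \<subset> D \<inter> {x..}" by blast
    thus ?thesis using D(1) by (auto intro!: psubset_card_mono)
   next
    case False
    have "D \<inter> {..x} \<subseteq> D \<inter> {..y}" "d \<in> D \<inter> {..y}" "d \<notin> D \<inter> {..x}" using False d xy by auto
    hence "D \<inter> {..x} \<subset> D \<inter> {..y}" by blast
    thus ?thesis using D(1) by (auto intro!: psubset_card_mono)
   qed
   hence "1 <= \<Phi> y - \<Phi> x" using c unfolding \<Phi>_def by linarith
   hence "2 * Q * 1 <= 2 * Q * (\<Phi> y - \<Phi> x)" using Q0 by (intro mult_left_mono) auto
   thus ?thesis using hQ[OF x] hQ[OF y] by linarith
  qed
 qed
 have \<Phi>_bound: "abs (\<Phi> x) <= card D" for x
 proof -
  have "card (D \<inter> {..x}) <= card D" "card (D \<inter> {x..}) <= card D" using D(1) by (auto intro!: card_mono)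
  thus ?thesis unfolding \<Phi>_def by linarith
 qed
 show ?thesis
 proof (rule that)
  fix x :: real assume x: "x \<in> {0..1}"
  have "abs (g x - g 0) <= L * 1" using gl[OF x, of 0] x L0 mult_left_mono[of x 1 L] by simp
  thus "f x <= abs (g 0) + L + Q" using hQ[OF x] unfolding f[OF x] by linarith
 next
  fix n :: nat assume n: "1 <= n"
  have u: "real i / real n \<in> {0..1}" if "i <= n" for i using that n by (auto simp: divide_le_eq)
  have "(\<Sum>i=1..<n. abs (f (real (Suc i) / real n) - f (real i / real n)))
   <= (\<Sum>i=1..<n. L * (1 / n) + 2 * Q * (\<Phi> (real (Suc i) / real n) - \<Phi> (real i / real n)))"
  proof (intro sum_mono)
   fix i assume i: "i \<in> {1..<n}"
   hence a: "real (Suc i) / real n \<in> {0..1}" "real i / real n \<in> {0..1}" by (intro u; simp)+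
   have lt: "real i / real n < real (Suc i) / real n" using n by (simp add: divide_strict_right_mono)
   have "real (Suc i) / real n - real i / real n = 1 / n" by (simp add: diff_divide_distrib[symmetric])
   hence "abs (g (real (Suc i) / real n) - g (real i / real n)) <= L * (1 / n)" using gl[OF a] by simp
   thus "abs (f (real (Suc i) / real n) - f (real i / real n)) <= L * (1 / n) + 2 * Q * (\<Phi> (real (Suc i) / real n) - \<Phi> (real i / real n))"
    using hd[OF a(2,1) lt] unfolding f[OF a(1)] f[OF a(2)] by linarith
  qed
  also have "... = real (n - 1) * (L * (1 / n)) + 2 * Q * (\<Phi> (real n / real n) - \<Phi> (real 1 / real n))"
   using sum_Suc_diff'[of 1 n "%i. \<Phi> (real i / real n)"] n by (simp add: sum.distrib sum_distrib_left[symmetric])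
  also have "... <= real n * (L * (1 / n)) + 2 * Q * (card D + card D)"
   using L0 Q0 \<Phi>_bound[of "real n / real n"] \<Phi>_bound[of "real 1 / real n"] by (intro add_mono mult_right_mono mult_left_mono) auto
  also have "... = L + 4 * Q * card D" using n by simp
  finally show "(\<Sum>i=1..<n. abs (f (real (Suc i) / real n) - f (real i / real n))) <= L + 4 * Q * card D" .
 qed
qed

text \<open>A value other than \<open>r\<close> would persist on an interval of positive length to
  the right. This requires room to the right of x, hence x < 1.\<close>

lemma right_continuous_AE_const:
 assumes \<mu>: "cadlag_unit \<mu>" and ae: "AE x in lborel. x \<in> {0..1} --> \<mu> x = r" and x: "0 <= x" "x < 1"
 shows "\<mu> x = r"
proof (rule ccontr)
 assume ne: "\<mu> x ~= r"
 have "(\<mu> \<longlongrightarrow> \<mu> x) (at_right x)" using \<mu> x unfolding cadlag_unit_def by auto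
 hence "\<forall>\<^sub>F y in at_right x. \<mu> y ~= r" using ne by (rule tendsto_imp_eventually_ne)
 then obtain d where d: "x < d" "!!y. x < y ==> y < d ==> \<mu> y ~= r"
  unfolding eventually_at_right_field by blast
 have "AE y in lborel. y \<notin> {x<..<min d 1}" using ae by eventually_elim (use d x in auto)
 hence "emeasure lborel {x<..<min d 1} = 0"
  by (subst (asm) AE_iff_measurable[where N = "{x<..<min d 1}"]) auto
 thus False using d x by (simp add: min_def split: if_splits)
qed

section \<open>Transfer from the hypotheses on the process\<close>

lemma stationary_pair:
 assumes st: "strictly_stationary M Y" and m: "!!i. i >= 1 ==> Y i \<in> borel_measurable M" and i: "1 <= i"
  and f: "(%(x, y). f x y) \<in> borel_measurable (borel \<Otimes>\<^sub>M borel)"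
 shows "(LINT om|M. f (Y i om) (Y (i + k) om)) = (\<integral>om. f (Y 1 om) (Y (1 + k) om) \<partial>M :: real)"
  "integrable M (%om. f (Y i om) (Y (i + k) om)) \<longleftrightarrow> integrable M (%om. f (Y 1 om) (Y (1 + k) om))"
proof -
 let ?J = "{1, 1 + k}" and ?P = "Pi\<^sub>M {1, 1 + k} (%_. borel) :: (nat => real) measure"
 define F where "F z = f (z 1) (z (1 + k))" for z :: "nat => real"
 have F: "F \<in> borel_measurable ?P"
 proof -
  have "(%z. (z 1, z (1 + k))) \<in> measurable ?P (borel \<Otimes>\<^sub>M borel)"
   by (intro measurable_Pair measurable_component_singleton) auto
  from measurable_compose[OF this f] show ?thesis unfolding F_def[abs_def] by simp
 qed
 have t: "(%om. \<lambda>j\<in>?J. Y (j + h) om) \<in> measurable M ?P" for h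
  by (intro measurable_restrict m) auto
 have d: "distr M ?P (%om. \<lambda>j\<in>?J. Y (j + (i - 1)) om) = distr M ?P (%om. \<lambda>j\<in>?J. Y (j + 0) om)"
  using st unfolding strictly_stationary_def by simp
 have e: "F (\<lambda>j\<in>?J. Y (j + (i - 1)) om) = f (Y i om) (Y (i + k) om)" "F (\<lambda>j\<in>?J. Y (j + 0) om) = f (Y 1 om) (Y (1 + k) om)" for om
  unfolding F_def using i by (auto simp: add.commute)
 show "(LINT om|M. f (Y i om) (Y (i + k) om)) = (LINT om|M. f (Y 1 om) (Y (1 + k) om))"
  using integral_distr[OF t F, of "i - 1"] integral_distr[OF t F, of 0] unfolding d e by simp
 show "integrable M (%om. f (Y i om) (Y (i + k) om)) \<longleftrightarrow> integrable M (%om. f (Y 1 om) (Y (1 + k) om))"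
  using integrable_distr_eq[OF t F, of "i - 1"] integrable_distr_eq[OF t F, of 0] unfolding d e by simp
qed

lemma sigma_gen_mono: "I \<subseteq> J ==> sigma_gen M Y I \<subseteq> sigma_gen M Y J"
 unfolding sigma_gen_def by (intro sigma_sets_mono') auto

lemma sigma_gen_empty: "sigma_gen M Y {} = {{}, space M}"
 unfolding sigma_gen_def by (simp add: sigma_sets_empty_eq)

text \<open>With m0 the largest index of \<open>I\<close>, the pair is covered by the term of the
  supremum at m0. The suprema are taken over reals, so the trivial bound 1 is used to see that they
  are upper bounds at all.\<close>

lemma (in prob_space) alpha_mix_bound:
 assumes m: "!!i. i >= 1 ==> Y i \<in> borel_measurable M" and sep: "separated k I J" and al: "alpha_mix M Y k <= r" "0 <= r"
  and A: "A \<in> sigma_gen M Y I" and B: "B \<in> sigma_gen M Y J"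
 shows "abs (prob A * prob B - prob (A \<inter> B)) <= r"
proof (cases "I = {} \<or> J = {}")
 \<comment> \<open>An empty index set generates the trivial \<sigma>-algebra, for which the
   difference is 0. Here a largest index of \<open>I\<close> need not exist.\<close>
 case True
 have sub: "sigma_gen M Y I \<subseteq> events" if "I \<subseteq> {1..}" for I
  unfolding sigma_gen_def using that m by (intro sets.sigma_sets_subset) (auto intro: measurable_sets)
 have "A \<in> events" "B \<in> events" using A B sub[of I] sub[of J] sep by (auto simp: separated_def)
 hence "A \<subseteq> space M" "B \<subseteq> space M" by (auto dest: sets.sets_into_space)
 moreover have "A \<in> {{}, space M} \<or> B \<in> {{}, space M}" using True A B sigma_gen_empty[of M Y] by auto
 ultimately have "prob A * prob B = prob (A \<inter> B)" by (auto simp: prob_space Int_absorb1 Int_absorb2)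
 thus ?thesis using al by simp
next
 case False
 then obtain j0 where j0: "j0 \<in> J" by blast
 have I: "I \<subseteq> {..j0}" "I \<subseteq> {1..}" using sep j0 by (force simp: separated_def)+
 hence fin: "finite I" by (meson finite_atMost finite_subset)
 define m0 where "m0 = Max I"
 have m0: "m0 \<in> I" unfolding m0_def using fin False by (intro Max_in) auto
 have m1: "1 <= m0" using m0 I by auto
 have "I \<subseteq> {1..m0}" using I fin unfolding m0_def by auto
 moreover have "J \<subseteq> {k + m0..}" using sep m0 by (auto simp: separated_def add.commute)
 ultimately have AB: "A \<in> sigma_gen M Y {1..m0}" "B \<in> sigma_gen M Y {k + m0..}" using A B sigma_gen_mono by blast+
 have le1: "abs (prob A * prob B - prob (A \<inter> B)) <= 1" for A B
 proof -
  have "prob A * prob B <= 1 * 1" by (intro mult_mono prob_le_1) auto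
  moreover have "0 <= prob A * prob B" by simp
  ultimately show ?thesis using prob_le_1[of "A \<inter> B"] measure_nonneg[of M "A \<inter> B"] unfolding abs_le_iff by linarith
 qed
 let ?S = "%m. {abs (prob A * prob B - prob (A \<inter> B)) | A B. A \<in> sigma_gen M Y {1..m} \<and> B \<in> sigma_gen M Y {k + m..}}"
 have bdd: "bdd_above (?S m)" for m by (rule bdd_aboveI[of _ 1]) (use le1 in auto)
 have ne: "?S m ~= {}" for m unfolding sigma_gen_def using sigma_sets.Empty by blast
 have "abs (prob A * prob B - prob (A \<inter> B)) <= alpha_coeff M (sigma_gen M Y {1..m0}) (sigma_gen M Y {k + m0..})"
  unfolding alpha_coeff_def by (rule cSup_upper[OF _ bdd]) (use AB in blast)
 also have "... <= alpha_mix M Y k" unfolding alpha_mix_def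
 proof (rule cSUP_upper)
  have "alpha_coeff M (sigma_gen M Y {1..m}) (sigma_gen M Y {k + m..}) <= 1" for m
   unfolding alpha_coeff_def by (rule cSup_least[OF ne]) (use le1 in auto)
  thus "bdd_above ((%m. alpha_coeff M (sigma_gen M Y {1..m}) (sigma_gen M Y {k + m..})) ` {1..})"
   by (intro bdd_aboveI[of _ 1]) auto
 qed (use m1 in simp)
 finally show ?thesis using al by linarith
qed

text \<open>\<open>lam\<close> is chosen so that lam * p is the assumed mixing exponent, and
  \<open>\<beta>\<close> so that 1 - 4 \<beta> is the quantity \<open>\<eta>\<close> in the lower
  bounds for \<open>s\<close> and \<open>q\<close>. From
  \<open>\<eta> <= (rh - 1) / (rh + 1)\<close> follows that \<beta> is at least 1 / (2 (rh + 1)),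
  hence \<beta> * lam is at least (1 + de) / (8 de^2), which settles the two conditions on the
  window.\<close>

lemma exponent_conditions:
 fixes de rh :: real
 assumes de: "0 < de" "de <= 1" and rh: "1 < rh"
 defines "p \<equiv> 4 + 2 * de" and "lam \<equiv> rh * (1 + de) / (2 * de^2)" and "\<eta> \<equiv> de * ((rh - 1) / (rh + 1))"
 defines "\<beta> \<equiv> (1 - \<eta>) / 4"
 shows "4 < p" "1 <= lam" "2 <= lam * (p - 4)" "lam * p = rh * (2 + de) * (1 + de) / de^2"
  "0 < \<beta>" "\<beta> < 1 / 4" "1 <= \<beta> * (lam * (p - 1))" "1 / 2 <= \<beta> * (lam * (p - 2) - 2)" "1 - 4 * \<beta> = \<eta>" "0 < \<eta>"
proof -
 have d2: "de^2 <= de" "0 < de^2" using de by (auto simp: power2_eq_square mult_left_le)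
 show "4 < p" using de by (simp add: p_def)
 let ?a = "1 + de"
 have r: "1 * ?a <= rh * ?a" using de rh by (intro mult_right_mono) auto
 have "2 * de^2 <= 1 * ?a" using d2 de by simp
 from order_trans[OF this r] have "2 * de^2 <= rh * ?a" .
 thus lam1: "1 <= lam" unfolding lam_def using d2 by (simp add: le_divide_eq)
 have "lam * (p - 4) = rh * ?a / de" unfolding lam_def p_def using de by (simp add: power2_eq_square)
 moreover have "2 * de <= 1 * ?a" using de by simp
 from order_trans[OF this r] have "2 <= rh * ?a / de" using de by (simp only: le_divide_eq if_True)
 ultimately show "2 <= lam * (p - 4)" by simp
 show "lam * p = rh * (2 + de) * ?a / de^2" unfolding lam_def p_def using de by (simp add: field_simps)
 let ?b = "rh + 1"
 have u: "0 < (rh - 1) / ?b" "(rh - 1) / ?b < 1" using rh by auto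
 show "0 < \<eta>" unfolding \<eta>_def by (rule mult_pos_pos[OF de(1) u(1)])
 have eta: "\<eta> <= (rh - 1) / ?b" unfolding \<eta>_def using mult_right_mono[OF de(2), of "(rh - 1) / ?b"] u by simp
 show b0: "0 < \<beta>" and b4: "\<beta> < 1 / 4" unfolding \<beta>_def using eta u \<open>0 < \<eta>\<close> by auto
 show "1 - 4 * \<beta> = \<eta>" by (simp add: \<beta>_def field_simps)
 have e: "2 / ?b = 1 - (rh - 1) / ?b" using rh by (simp add: field_simps)
 have "2 / ?b <= 1 - \<eta>" unfolding e using eta by (rule diff_left_mono)
 hence "2 / ?b / 4 <= \<beta>" unfolding \<beta>_def by (rule divide_right_mono) simp
 moreover have "1 / (2 * ?b) = 2 / ?b / 4" using rh by (simp add: divide_simps)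
 ultimately have bb: "1 / (2 * ?b) <= \<beta>" by (simp only:)
 have "?a / (8 * de^2) <= rh / ?b * (?a / (4 * de^2))"
 proof -
  have "1 / 2 <= rh / ?b" using rh by (simp add: field_simps)
  hence "1 / 2 * (?a / (4 * de^2)) <= rh / ?b * (?a / (4 * de^2))" using de by (intro mult_right_mono) auto
  thus ?thesis by simp
 qed
 also have "... = 1 / (2 * ?b) * lam" unfolding lam_def by simp
 also have "... <= \<beta> * lam" using bb lam1 by (intro mult_right_mono) auto
 finally have bl: "?a / (8 * de^2) <= \<beta> * lam" .
 have "1 <= ?a / (8 * de^2) * (3 + 2 * de)"
 proof -
  have e: "?a * (3 + 2 * de) = 3 + 5 * de + 2 * de^2" by (simp add: algebra_simps power2_eq_square)
  have "8 * de^2 <= ?a * (3 + 2 * de)" unfolding e using d2 de by simp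
  thus ?thesis using d2 by (simp add: le_divide_eq)
 qed
 also have "... <= \<beta> * lam * (3 + 2 * de)" using bl de by (intro mult_right_mono) auto
 also have "... = \<beta> * (lam * (p - 1))" by (simp add: p_def)
 finally show "1 <= \<beta> * (lam * (p - 1))" .
 have "1 <= ?a / (8 * de^2) * (2 + 2 * de)"
 proof -
  have e: "?a * (2 + 2 * de) = 2 + 4 * de + 2 * de^2" by (simp add: algebra_simps power2_eq_square)
  have "8 * de^2 <= ?a * (2 + 2 * de)" unfolding e using d2 de by simp
  thus ?thesis using d2 by (simp add: le_divide_eq)
 qed
 also have "... <= \<beta> * lam * (2 + 2 * de)" using bl de by (intro mult_right_mono) auto
 also have "... = \<beta> * (lam * (p - 2))" by (simp add: p_def)
 finally have "1 <= \<beta> * (lam * (p - 2))" .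
 thus "1 / 2 <= \<beta> * (lam * (p - 2) - 2)" using b4 by (simp add: right_diff_distrib)
qed

theorem theorem2p12:
  fixes M :: "'a measure"
    and Y :: "nat \<Rightarrow> 'a \<Rightarrow> real"
    and \<mu> \<sigma> :: "real \<Rightarrow> real"
    and \<sigma>\<^sub>0 \<mu>\<^sub>H \<delta> \<rho> C s q :: real
    and c\<^sub>0 :: nat
    and N l b l' b' :: "nat \<Rightarrow> nat"
  assumes "prob_space M"
    and "\<And>i. i \<ge> 1 \<Longrightarrow> Y i \<in> borel_measurable M"
    and "strictly_stationary M Y"
    and "prob_space.expectation M (Y 1) = 0"
    and "prob_space.variance M (Y 1) = 1"
    and "alpha_mix M Y \<longlonglongrightarrow> 0"
    and "long_run_variance M Y > 0"
    and "cadlag_unit \<mu>"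
    and "cadlag_unit \<sigma>"
    and "piecewise_lipschitz_unit \<sigma>"
    and "\<sigma>\<^sub>0 > 0"
    and "\<And>x. x \<in> {0..1} \<Longrightarrow> \<sigma> x \<ge> \<sigma>\<^sub>0"
    and "1 / 2 < s" and "s < 1"
    and "0 < q" and "q < 1"
    and "0 < \<delta>" and "\<delta> \<le> 1"
    and "\<rho> > max ((\<delta>\<^sup>2 + 4 * \<delta>) / (2 + 2 * \<delta>)) 1"
    and "integrable M (\<lambda>\<omega>. \<bar>Y 1 \<omega>\<bar> powr (4 + 2 * \<delta>))"
    and "\<And>k. k \<ge> 1 \<Longrightarrow>
           alpha_mix M Y k \<le> C * real k powr (- (\<rho> * (2 + \<delta>) * (1 + \<delta>) / \<delta>\<^sup>2))"
    and "s > max (1 / (1 + \<delta> * ((\<rho> - 1) / (\<rho> + 1))))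
                 ((1 + \<delta>\<^sup>2 / (\<rho> * (2 + \<delta>) * (1 + \<delta>))) /
                  (2 + \<delta>\<^sup>2 / (\<rho> * (2 + \<delta>) * (1 + \<delta>))))"
    and "s > q"
    and "q > (1 - s) * max (1 / \<delta> * ((\<rho> + 1) / (\<rho> - 1)))
                           (1 + \<delta>\<^sup>2 / (\<rho> * (1 + \<delta>) * (2 + \<delta>)))"
    and "AE x in lborel. x \<in> {0..1} \<longrightarrow> \<mu> x = \<mu>\<^sub>H"
    \<comment> \<open>\<open>N\<close> runs through sample sizes for which all block lengths and block numbers are integers\<close>
    and "strict_mono N"
    and "\<And>m. real (l m) = real (N m) powr s"
    and "\<And>m. real (b m) = real (N m) powr (1 - s)"
    and "\<And>m. real (l' m) = real (N m) powr q"
    and "\<And>m. real (b' m) = real (N m) powr (1 - q)"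
    and "1 \<le> c\<^sub>0"
    and "\<And>m. c\<^sub>0 < b' m"
  shows "weak_conv_m
    (\<lambda>m. distr M borel (\<lambda>\<omega>.
       let x = observation \<mu> \<sigma> Y (N m) \<omega>
       in sqrt (real (b m)) * (1 / psi_hat (b m) (l m) x) *
          (sqrt (real (l m)) / kappa_hat (N m) c\<^sub>0 (b m) (l m) (b' m) (l' m) x * U_stat (b m) (l m) x -
           1 / (real (b m) * (real (b m) - 1)) *
           (\<Sum>j\<in>{1..b m}. \<Sum>k\<in>{1..b m} - {j}.
              sqrt (local_variance (l m) x j + local_variance (l m) x k) * sqrt (2 / pi)))))
    std_normal_distribution"
proof -
 interpret prob_space M by fact
 note Ym = assms(2)
 have \<rho>1: "1 < \<rho>" using assms(19) by simp
 have \<delta>: "0 < \<delta>" "\<delta> <= 1" by fact+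
 define p where "p = 4 + 2 * \<delta>"
 define lam where "lam = \<rho> * (1 + \<delta>) / (2 * \<delta>^2)"
 define \<eta> where "\<eta> = \<delta> * ((\<rho> - 1) / (\<rho> + 1))"
 define \<beta> where "\<beta> = (1 - \<eta>) / 4"
 note ex = exponent_conditions[OF \<delta> \<rho>1, folded p_def lam_def \<eta>_def, folded \<beta>_def]
 \<comment> \<open>The hypotheses say nothing about index 0, where \<open>Y\<close> may fail to be
   measurable; the copy is 0 there.\<close>
 define Y' where "Y' i = (if i = 0 then (%_. 0) else Y i)" for i
 have Y': "Y' i = Y i" if "1 <= i" for i using that by (simp add: Y'_def)
 define c where "c k = (LINT \<omega>|M. Y 1 \<omega> * Y (1 + k) \<omega>)" for k
 \<comment> \<open>The maxima here and in \<open>C'\<close> meet the sign conditions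
   \<open>1 <= K\<close> and \<open>0 <= C\<close> of the locale.\<close>
 define K where "K = max 1 ((LINT \<omega>|M. abs (Y 1 \<omega>) powr p))"
 define C' where "C' = max C 0"
 let ?a = "borel \<Otimes>\<^sub>M borel :: (real \<times> real) measure"
 have m2: "(%(x, y). x * y) \<in> borel_measurable ?a"
  "(%(x, y). abs x powr p) \<in> borel_measurable ?a"
  "(%(x, y). x) \<in> borel_measurable ?a" by measurable
 have meanY: "expectation (Y i) = 0" if "1 <= i" for i
  using stationary_pair(1)[OF assms(3) Ym that m2(3)] assms(4) by simp
 have mom: "integrable M (%\<omega>. abs (Y i \<omega>) powr p)" "(LINT \<omega>|M. abs (Y i \<omega>) powr p) <= K" if "1 <= i" for i
  using stationary_pair[OF assms(3) Ym that m2(2)] assms(20) by (simp_all add: K_def p_def)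
 have c0: "c 0 = 1" using assms(4,5) by (simp add: c_def power2_eq_square)
 interpret poly_mixing M Y' C' lam p K c
 proof
  show "Y' i \<in> borel_measurable M" for i using Ym[of i] by (simp add: Y'_def)
  fix k I J A B assume sep: "separated k I J" and A: "A \<in> sigma_gen M Y' I" and B: "B \<in> sigma_gen M Y' J"
  \<comment> \<open>Separated sets avoid index 0, so the copy generates the same
    \<sigma>-algebras.\<close>
  have sg: "sigma_gen M Y' I = sigma_gen M Y I" if "I \<subseteq> {1..}" for I unfolding sigma_gen_def
  proof (intro arg_cong[where f = "sigma_sets (space M)"] SUP_cong refl)
   fix i assume "i \<in> I"
   hence "Y' i = Y i" using that by (intro Y') auto
   thus "{Y' i -` B \<inter> space M |B. B \<in> sets borel} = {Y i -` B \<inter> space M |B. B \<in> sets borel}" by simp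
  qed
  have k1: "1 <= k" using sep by (simp add: separated_def)
  have "alpha_mix M Y k <= C * real k powr (- (lam * p))" using assms(21)[OF k1] unfolding ex(4) .
  also have "... <= C' * real k powr (- (lam * p))" by (intro mult_right_mono) (auto simp: C'_def)
  finally have al: "alpha_mix M Y k <= C' * real k powr (- (lam * p))" .
  have al0: "0 <= C' * real k powr (- (lam * p))" by (auto simp: C'_def)
  have IJ: "I \<subseteq> {1..}" "J \<subseteq> {1..}" using sep by (auto simp: separated_def)
  show "abs (prob A * prob B - prob (A \<inter> B)) <= C' * real k powr (- (lam * p))"
   by (rule alpha_mix_bound[OF Ym sep al al0 A[unfolded sg[OF IJ(1)]] B[unfolded sg[OF IJ(2)]]])
 next
  fix i k :: nat assume i: "1 <= i"
  show "integrable M (%\<omega>. abs (Y' i \<omega>) powr p)" "(LINT \<omega>|M. abs (Y' i \<omega>) powr p) <= K" "expectation (Y' i) = 0"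
   using mom[OF i] meanY[OF i] by (simp_all add: Y'[OF i])
  show "(LINT \<omega>|M. Y' i \<omega> * Y' (i + k) \<omega>) = c k" using stationary_pair(1)[OF assms(3) Ym i m2(1), of k] i by (simp add: Y' c_def)
 qed (use ex c0 in \<open>auto simp: C'_def K_def\<close>)
 interpret rate_mixing M Y' C' lam p K c \<beta>
 proof
  have "covariance M (Y 1) (Y (Suc k + 1)) = c (Suc k)" for k
   unfolding covariance_def c_def using assms(4) meanY[of "Suc k + 1"] by simp
  hence "kappa2 = long_run_variance M Y" unfolding kappa2_def long_run_variance_def using assms(5) by simp
  thus "0 < kappa2" using assms(7) by simp
 qed (use ex in auto)
 obtain A B where A: "!!x. x \<in> {0..1} ==> \<sigma> x <= A" and B: "!!n. 1 <= n ==> (\<Sum>i=1..<n. abs (\<sigma> (real (Suc i) / real n) - \<sigma> (real i / real n))) <= B"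
  using piecewise_lipschitz_bounds[OF assms(10)] by blast
 have A0: "0 <= A" using A[of 0] assms(12)[of 0] assms(11) by simp
 have B0: "0 <= B" using B[of 1] by simp
 have v0: "0 < kappa2 * \<sigma>\<^sub>0\<^sup>2" using kappa2_pos assms(11) by simp
 \<comment> \<open>One constant for both grids and all sample sizes.\<close>
 obtain E where E: "0 <= E" "!!l n w I a. admissible (A + 2 * real c\<^sub>0 + 2) (3 * (B + 2 * A)) l n w I ==> kappa2 * \<sigma>\<^sub>0\<^sup>2 <= var w I ==>
   abs ((LINT \<omega>|M. abs (S w I \<omega> - a)) - (LINT z|gauss. abs (sqrt (var w I) * z - a))) <= E * wrate l"
  using absolute_moment_bound[of "A + 2 * real c\<^sub>0 + 2" "3 * (B + 2 * A)" "kappa2 * \<sigma>\<^sub>0\<^sup>2"] A0 B0 v0 by (auto simp: add_nonneg_nonneg)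
 have N_top: "filterlim (%m. real (N m)) at_top sequentially"
  using filterlim_subseq[OF assms(26)] by (rule filterlim_compose[OF filterlim_real_sequentially])
 \<comment> \<open>Sample size 0 would give \<open>b' m = 0\<close>, as 0 powr (1 - q) = 0, against
   \<open>c\<^sub>0 < b' m\<close>.\<close>
 have N1: "1 <= N m" for m
 proof (rule ccontr)
  assume "\<not> 1 <= N m"
  hence "real (b' m) = 0" using assms(30)[of m] by simp
  thus False using assms(32)[of m] by simp
 qed
 have "filterlim (%m. real (N m) powr (1 - s)) at_top sequentially"
 proof -
  have "filterlim (%x::real. x powr (1 - s)) at_top at_top" using assms(14) by real_asymp
  thus ?thesis by (rule filterlim_compose[OF _ N_top])
 qed
 hence "\<forall>\<^sub>F m in sequentially. 2 <= real (N m) powr (1 - s)" by (simp add: filterlim_at_top)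
 \<comment> \<open>The first grid needs at least two blocks, which holds from some sample size on;
   the earlier terms are removed by an index shift. The second grid has two blocks because
   \<open>1 \<le> c\<^sub>0 < b' m\<close>.\<close>
 then obtain m0 where m0: "!!m. m0 <= m ==> 2 <= real (N m) powr (1 - s)" unfolding eventually_sequentially by blast
 have n_eq: "N m = l m * b m" "N m = l' m * b' m" for m
 proof -
  have "real (l m) * real (b m) = real (N m)" "real (l' m) * real (b' m) = real (N m)"
   unfolding assms(27-30) powr_add[symmetric] using N1[of m] by simp_all
  thus "N m = l m * b m" "N m = l' m * b' m" by (simp_all only: of_nat_mult[symmetric] of_nat_eq_iff)
 qed
 have l1: "1 <= l m" "1 <= l' m" for m
 proof -
  have "l m ~= 0" using N1[of m] n_eq(1)[of m] by (intro notI) simp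
  thus "1 <= l m" by simp
  have "l' m ~= 0" using N1[of m] n_eq(2)[of m] by (intro notI) simp
  thus "1 <= l' m" by simp
 qed
 define sg where "sg m i = \<sigma> (real i / real (N m))" for m i
 have unit: "real i / real (N m) \<in> {0..1}" if "i \<in> {1..N m}" for i m using that by (auto simp: divide_le_eq)
 have array: "block_array M Y' C' lam p K c \<beta> (sg m) (N m) L W c\<^sub>0 A B \<sigma>\<^sub>0 E" if "N m = L * W" "1 <= L" "2 <= W" for m L W
 proof (unfold_locales)
  show "\<sigma>\<^sub>0 <= sg m i" "sg m i <= A" if "i \<in> {1..N m}" for i unfolding sg_def using A assms(12) unit[OF that] by auto
  show "(\<Sum>i\<in>{1..<N m}. abs (sg m (Suc i) - sg m i)) <= B" unfolding sg_def by (rule B[OF N1])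
 qed (use that assms(11) E in auto)
 \<comment> \<open>All design points but the last lie in [0,1), where the mean has the value of the
   hypothesis; the last one is 1 and carries \<open>\<mu> 1\<close>.\<close>
 have obs: "observation \<mu> \<sigma> Y (N m) \<omega> (int i) = \<mu>\<^sub>H + sg m i * Y' i \<omega> + (if i = N m then \<mu> 1 - \<mu>\<^sub>H else 0)" if i: "i \<in> {1..N m}" for m \<omega> i
 proof -
  have "\<mu> (real i / real (N m)) = \<mu>\<^sub>H" if "i ~= N m"
   by (rule right_continuous_AE_const[OF assms(8,25)]) (use i that in \<open>auto simp: divide_less_eq\<close>)
  moreover have "real (N m) / real (N m) = 1" using N1[of m] by simp
  ultimately show ?thesis using i by (auto simp: observation_def sg_def Y')
 qed
 have obs_out: "observation \<mu> \<sigma> Y (N m) \<omega> i = 0" if "i < 1 \<or> int (N m) < i" for m \<omega> i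
  using that by (auto simp: observation_def)
 have samples: "paired_samples M Y' C' lam p K c \<beta> (sg m) (N m) (l m) (b m) c\<^sub>0 A B \<sigma>\<^sub>0 E \<mu>\<^sub>H (\<mu> 1 - \<mu>\<^sub>H) (observation \<mu> \<sigma> Y (N m)) (l' m) (b' m)" if m: "m0 <= m" for m
 proof -
  have b2: "2 <= b m" "2 <= b' m" using m0[OF m] assms(28)[of m] assms(31) assms(32)[of m] by auto
  show ?thesis
   unfolding paired_samples_def block_sample_def kappa_sample_def block_sample_axioms_def kappa_sample_axioms_def
   using array[OF n_eq(1) l1(1) b2(1)] array[OF n_eq(2) l1(2) b2(2)] obs obs_out assms(31,32) by auto
 qed
 \<comment> \<open>The first alternatives of the two maxima in the lower bounds for \<open>s\<close>
   and \<open>q\<close>, solved for 1 - s.\<close>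
 have dom: "1 - s < s * \<eta>" "1 - s < q * \<eta>"
 proof -
  have "1 / (1 + \<eta>) < s" using assms(22) unfolding \<eta>_def by simp
  thus "1 - s < s * \<eta>" using ex(10) by (simp add: divide_less_eq algebra_simps)
  have le: "(1 - s) * (1 / \<delta> * ((\<rho> + 1) / (\<rho> - 1))) <= (1 - s) * max (1 / \<delta> * ((\<rho> + 1) / (\<rho> - 1))) (1 + \<delta>^2 / (\<rho> * (1 + \<delta>) * (2 + \<delta>)))"
   using assms(14) by (intro mult_left_mono) auto
  have e: "1 / \<delta> * ((\<rho> + 1) / (\<rho> - 1)) = 1 / \<eta>" unfolding \<eta>_def by simp
  have "(1 - s) * (1 / \<eta>) < q" using le_less_trans[OF le assms(24)] unfolding e .
  thus "1 - s < q * \<eta>" using ex(10) by (simp add: divide_less_eq)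
 qed
 have N_shift: "filterlim (%m. real (N (m + m0))) at_top sequentially"
  using N_top filterlim_add_const_nat_at_top[of m0] by (rule filterlim_compose)
 interpret S: sample_sequence M Y' C' lam p K c \<beta> "%m. sg (m + m0)" "%m. N (m + m0)" "%m. l (m + m0)" "%m. b (m + m0)" "%m. l' (m + m0)" "%m. b' (m + m0)"
  c\<^sub>0 A B \<sigma>\<^sub>0 E \<mu>\<^sub>H "\<mu> 1 - \<mu>\<^sub>H" "%m. observation \<mu> \<sigma> Y (N (m + m0))" "%m. real (N (m + m0))" s q
 proof (intro sample_sequence.intro sample_sequence_axioms.intro)
  show "paired_samples M Y' C' lam p K c \<beta> (sg (m + m0)) (N (m + m0)) (l (m + m0)) (b (m + m0)) c\<^sub>0 A B \<sigma>\<^sub>0 E \<mu>\<^sub>H (\<mu> 1 - \<mu>\<^sub>H)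
   (observation \<mu> \<sigma> Y (N (m + m0))) (l' (m + m0)) (b' (m + m0))" for m by (rule samples) simp
 qed (use assms(13-16,23,27-30) dom ex(9) N_shift N1 rate_mixing_axioms in auto)
 define F where "F m = distr M borel (%\<omega>. let x = observation \<mu> \<sigma> Y (N m) \<omega>
    in sqrt (real (b m)) * (1 / psi_hat (b m) (l m) x) *
     (sqrt (real (l m)) / kappa_hat (N m) c\<^sub>0 (b m) (l m) (b' m) (l' m) x * U_stat (b m) (l m) x -
      1 / (real (b m) * (real (b m) - 1)) * (\<Sum>j\<in>{1..b m}. \<Sum>k\<in>{1..b m} - {j}.
       sqrt (local_variance (l m) x j + local_variance (l m) x k) * sqrt (2 / pi))))" for m
 have "distr M borel (S.TS m) = F (m + m0)" for m
  unfolding F_def S.TS_def Let_def paired_samples.stat_def[OF samples[of "m + m0", OF le_add2]] ..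
 hence "weak_conv_m (%m. F (m + m0)) gauss" using S.TS_weak by simp
 \<comment> \<open>Weak convergence is convergence of distribution functions at continuity points,
   which an index shift does not affect.\<close>
 hence "weak_conv_m F gauss"
  unfolding weak_conv_m_def weak_conv_def using LIMSEQ_offset[of "%m. cdf (F m) _" m0] by blast
 thus ?thesis unfolding F_def[abs_def] .
qed

end
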